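(* Let $n\ge 3$. There is a one-to-one (injective) map $$\{(\xi_1,\xi_2): 0\le \xi_1<\xi_2\le \pi\}\ \to\ \{(d,M): 2^{2-n}\le d<1<M\le \infty\},\qquad (\xi_1,\xi_2)\mapsto (d,M)=(d(\xi_1,\xi_2),M(\xi_1,\xi_2)),$$ such that for each $(\xi_1,\xi_2)$ in the domain, with $(d,M)$ its image, there exists a potential $P=P(\cdot,d,M)\in\mathcal{F}$ satisfying: (a) $P\equiv M$ on $E_1=\{x\in\mathbb{S}^{n-1}: \cos\xi_1\le x_1\le 1\}$; (b) $P\equiv d$ on $E_2=\{x\in\mathbb{S}^{n-1}: -1\le x_1\le \cos\xi_2\}$; (c) $P\ge d$ in $\bar B(0,1)$ and $P\le M$ in $\mathbb{R}^n$; (d) $P(0)=1$ and $P$ is harmonic in $\mathbb{R}^n\setminus(E_1\cup E_2)$.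
   Context: Points of $\mathbb{R}^n$ are written $x=(x_1,\dots,x_n)$, $|x|$ is the Euclidean norm, $\mathbb{S}^{n-1}=\{x\in\mathbb{R}^n:|x|=1\}$, $B(0,1)=\{x:|x|<1\}$ and $\bar B(0,1)$ is its closure. For $n\ge3$, $\mathcal{F}$ denotes the family of potentials $$p(x)=\int_{\mathbb{S}^{n-1}}|x-y|^{2-n}\,d\mu(y),\qquad x\in\mathbb{R}^n,$$ where $\mu$ ranges over the positive Borel measures on $\mathbb{S}^{n-1}$ with $\mu(\mathbb{S}^{n-1})=1$. Potentials may take the value $+\infty$; when $M=\infty$, "$P\equiv M$ on $E_1$" means $P=+\infty$ on $E_1$ and "$P\le M$" is no restriction. *)

theory Defs
  imports "HOL-Analysis.Analysis"
begin

text \<open>In \<^typ>\<open>ennreal\<close> one has \<open>inverse 0 = \<infinity>\<close>, so for \<open>n \<ge> 3\<close> the kernel \<open>|x - y|\<close> to the power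
  \<open>2 - n\<close> takes the value \<open>\<infinity>\<close> on the diagonal and potentials may be infinite.\<close>

definition riesz_kernel :: "real ^ 'n \<Rightarrow> real ^ 'n \<Rightarrow> ennreal" where
  "riesz_kernel x y = inverse (ennreal (norm (x - y))) ^ (CARD('n) - 2)"

definition sphere_potentials :: "(real ^ 'n \<Rightarrow> ennreal) set" where
  "sphere_potentials =
     {p. \<exists>\<mu> :: (real ^ 'n) measure.
           sets \<mu> = sets (restrict_space borel (sphere 0 1)) \<and>
           emeasure \<mu> (sphere 0 1) = 1 \<and>
           p = (\<lambda>x. \<integral>\<^sup>+ y. riesz_kernel x y \<partial>\<mu>)}"

text \<open>Twice continuously differentiable with vanishing Laplacian: \<open>g\<close> is the gradient and \<open>H\<close>
  the Hessian matrix of \<open>u\<close>, whose trace is the Laplacian of \<open>u\<close>.\<close>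

definition harmonic_on :: "(real ^ 'n \<Rightarrow> real) \<Rightarrow> (real ^ 'n) set \<Rightarrow> bool" where
  "harmonic_on u U \<longleftrightarrow> open U \<and>
     (\<exists>(g :: real ^ 'n \<Rightarrow> real ^ 'n) (H :: real ^ 'n \<Rightarrow> real ^ 'n ^ 'n).
        (\<forall>x\<in>U. (u has_derivative (\<lambda>h. g x \<bullet> h)) (at x)) \<and>
        (\<forall>x\<in>U. (g has_derivative (\<lambda>h. H x *v h)) (at x)) \<and>
        continuous_on U H \<and>
        (\<forall>x\<in>U. trace (H x) = 0))"

text \<open>The index \<open>k\<close> names the coordinate written \<open>x\<^sub>1\<close> in the informal text; index types carry no
  distinguished first element.\<close>

definition cap1 :: "'n \<Rightarrow> real \<Rightarrow> (real ^ 'n) set" where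
  "cap1 k \<xi> = {x \<in> sphere 0 1. cos \<xi> \<le> x $ k \<and> x $ k \<le> 1}"

definition cap2 :: "'n \<Rightarrow> real \<Rightarrow> (real ^ 'n) set" where
  "cap2 k \<xi> = {x \<in> sphere 0 1. - 1 \<le> x $ k \<and> x $ k \<le> cos \<xi>}"

end

theory Submission
  imports Defs "HOL-Probability.Probability"
begin

text \<open>Let \<open>e\<close> be the centre of the first cap.  Among all positive measures on the sphere the energy minimizer of
  an obstacle problem has a continuous potential which is at least \<open>1 + \<tau>\<close> on the first cap and at least \<open>1\<close> on
  the rest of the sphere, with equality on the support (if the first cap is the point \<open>e\<close>, one adds a charge \<open>\<tau>\<close>
  at \<open>e\<close> and keeps the obstacle \<open>1\<close>).  By the domination principle the total potential increases with \<open>\<tau>\<close>, and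
  by polarization in hyperplanes it decreases along the sphere away from \<open>e\<close>.  Let \<open>\<tau>\<close> be the largest value for
  which the potential is still \<open>1\<close> on the circle bounding the second cap.  It is then \<open>1\<close> on the whole second
  cap, and since for larger parameters the support does not meet the zone between the caps, in the limit the
  potential has the mean value property there and the support stays off the zone.  Division by the total mass
  \<open>m\<close> gives \<open>d = 1/m\<close>; the values \<open>P(0) = 1\<close> and \<open>d < 1 < M\<close> come from the fact that \<open>m\<close> is the value at the centre and
  the mean over the sphere, and \<open>d \<ge> 2\<^sup>2\<^sup>-\<^sup>n\<close> from the values on the second cap.

  For injectivity, \<open>d\<close> determines \<open>m\<close>, and \<open>M\<close> then determines the height of the obstacle.  Of two such potentials
  one lies below the other, and having equal means they coincide on the sphere.  The first cap is the set where
  the maximum is attained.  If the second caps differed, the potential would be constant on a part of the zone;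
  comparing it with its mirror image in the hyperplane bisecting two such points, unique continuation would make
  it symmetric, which contradicts the behaviour at the boundary of the first cap.\<close>

subsection \<open>The kernel, reflections and the uniform measure on the sphere\<close>

text \<open>Fixing both levels in advance leads to a linear problem whose charge may turn negative
  on the second cap; positivity of the measure is what has to be secured. The obstacle problem keeps
  the measure positive and lets its support choose itself, and the one free parameter then moves the
  edge of the lower contact set to the prescribed circle. The lower level is 1 and not
  \<open>d\<close> because the total mass is known only afterwards. Variation of the energy yields
  the obstacle inequality only almost everywhere. The Poisson integral upgrades it to every point of
  the sphere, including the boundary of the first cap, where the obstacle jumps; this is why the
  Poisson kernel is developed. Superharmonicity is expressed by spherical means, which need no
  derivatives and pass to limits, and orthogonal symmetry is used only through reflections. The
  constant 2^(2-n) is the kernel at distance 2, the diameter of the sphere.\<close>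

definition rk :: "real ^ 'n \<Rightarrow> real ^ 'n \<Rightarrow> real" where
  "rk x y = inverse (norm (x - y)) ^ (CARD('n) - 2)"

definition pot :: "(real ^ 'n) measure \<Rightarrow> real ^ 'n \<Rightarrow> ennreal" where
  "pot \<mu> x = (\<integral>\<^sup>+ y. riesz_kernel x y \<partial>\<mu>)"

text \<open>With the inverse outermost, the kernel is a continuous real function followed by the
  continuous antitone \<open>inverse\<close> of the extended reals. Continuity, measurability and
  comparison thus hold across the diagonal with no case distinction.\<close>

lemma riesz_kernel_inverse:
  fixes x y :: "real ^ 'n"
  shows "riesz_kernel x y = inverse (ennreal (norm (x - y) ^ (CARD('n) - 2)))"
proof (cases "x = y")
  case True
  show ?thesis
  proof (cases "CARD('n) - 2")
    case 0
    then show ?thesis by (simp add: riesz_kernel_def)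
  next
    case (Suc m)
    then show ?thesis using True by (simp add: riesz_kernel_def top_power_ennreal)
  qed
next
  case False
  then show ?thesis
    by (simp add: riesz_kernel_def inverse_ennreal ennreal_power power_inverse)
qed

text \<open>The two kernels differ on the diagonal when n > 2: there \<open>rk\<close> is 0, the
  real inverse of 0 being 0, while \<open>riesz_kernel\<close> is \<infinity>. The real version
  serves derivatives and Bochner integrals away from the charge.\<close>

lemma riesz_kernel_rk: "x \<noteq> y \<Longrightarrow> riesz_kernel x y = ennreal (rk x y)"
  by (simp add: riesz_kernel_def rk_def inverse_ennreal ennreal_power)

lemma riesz_kernel_commute: "riesz_kernel x y = riesz_kernel y x"
  by (simp add: riesz_kernel_def norm_minus_commute)

lemma rk_nonneg [simp]: "0 \<le> rk x y"
  by (simp add: rk_def)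

lemma continuous_on_riesz_kernel [continuous_intros]:
  fixes f g :: "'a::topological_space \<Rightarrow> real ^ 'n"
  assumes "continuous_on S f" "continuous_on S g"
  shows "continuous_on S (\<lambda>z. riesz_kernel (f z) (g z))"
  unfolding riesz_kernel_inverse using assms by (intro continuous_intros continuous_on_ennreal) auto

lemma borel_measurable_riesz_kernel [measurable]:
  fixes f g :: "'a \<Rightarrow> real ^ 'n"
  assumes [measurable]: "f \<in> borel_measurable M" "g \<in> borel_measurable M"
  shows "(\<lambda>z. riesz_kernel (f z) (g z)) \<in> borel_measurable M"
  unfolding riesz_kernel_inverse by measurable

lemma borel_measurable_rk [measurable]:
  fixes f g :: "'a \<Rightarrow> real ^ 'n"
  assumes [measurable]: "f \<in> borel_measurable M" "g \<in> borel_measurable M"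
  shows "(\<lambda>z. rk (f z) (g z)) \<in> borel_measurable M"
  unfolding rk_def by measurable

lemma borel_measurable_pot [measurable]:
  fixes \<mu> :: "(real ^ 'n) measure"
  assumes "finite_measure \<mu>" and [measurable_cong]: "sets \<mu> = sets borel"
  shows "pot \<mu> \<in> borel_measurable borel"
proof -
  interpret finite_measure \<mu> by fact
  show ?thesis unfolding pot_def by measurable
qed

lemma riesz_kernel_scale:
  fixes x y :: "real ^ 'n"
  assumes "0 < r"
  shows "riesz_kernel (r *\<^sub>R x) (r *\<^sub>R y) = ennreal (inverse r ^ (CARD('n) - 2)) * riesz_kernel x y"
proof -
  have "norm (r *\<^sub>R x - r *\<^sub>R y) = r * norm (x - y)"
    using assms by (simp flip: scaleR_diff_right)
  then show ?thesis
    using assms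
    by (simp add: riesz_kernel_inverse power_mult_distrib ennreal_mult ennreal_inverse_mult
        inverse_ennreal power_inverse del: ennreal_power)
qed

text \<open>Inversion in the unit sphere: after squaring, both sides equal |x|^2 - 2 x.y + 1 because
  |y| = 1. It transfers values of potentials from the ball to the exterior.\<close>

lemma norm_Kelvin:
  fixes x y :: "'a :: real_inner"
  assumes "norm y = 1" "x \<noteq> 0"
  shows "norm (x - y) = norm x * norm (x /\<^sub>R (norm x)\<^sup>2 - y)"
proof -
  define t where "t = inverse ((norm x)\<^sup>2)"
  have t: "(norm x)\<^sup>2 * t = 1"
    using assms(2) by (simp add: t_def)
  have "(norm (x - y))\<^sup>2 = (norm x)\<^sup>2 - 2 * (x \<bullet> y) + 1"
    using assms(1) by (simp add: power2_norm_eq_inner inner_diff_left inner_diff_right inner_commute norm_eq_1)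
  moreover have "(norm (t *\<^sub>R x - y))\<^sup>2 = t * t * (norm x)\<^sup>2 - 2 * t * (x \<bullet> y) + 1"
    using assms(1) by (simp add: power2_norm_eq_inner inner_diff_left inner_diff_right inner_commute norm_eq_1)
  ultimately have "(norm x * norm (t *\<^sub>R x - y))\<^sup>2 = (norm (x - y))\<^sup>2"
    unfolding power_mult_distrib using t by algebra
  then show ?thesis
    unfolding t_def by (metis norm_ge_zero power2_eq_imp_eq zero_le_mult_iff)
qed

lemma riesz_kernel_Kelvin:
  fixes x y :: "real ^ 'n"
  assumes "norm y = 1" "x \<noteq> 0"
  shows "riesz_kernel x y = ennreal (inverse (norm x) ^ (CARD('n) - 2)) * riesz_kernel (x /\<^sub>R (norm x)\<^sup>2) y"
  using assms(2)
  by (simp add: riesz_kernel_inverse norm_Kelvin[OF assms] power_mult_distrib ennreal_mult ennreal_inverse_mult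
        inverse_ennreal power_inverse del: ennreal_power)

section \<open>Reflections in hyperplanes through the origin\<close>

definition reflect_in :: "'a::real_inner \<Rightarrow> 'a \<Rightarrow> 'a" where
  "reflect_in v x = x - (2 * (v \<bullet> x)) *\<^sub>R v"

lemma reflect_in_linear: "linear (reflect_in v)"
  by (intro linearI) (simp_all add: reflect_in_def algebra_simps inner_add_right)

lemma reflect_in_involution [simp]: "norm v = 1 \<Longrightarrow> reflect_in v (reflect_in v x) = x"
  by (simp add: reflect_in_def inner_diff_right norm_eq_1 algebra_simps)

lemma reflect_in_inner: "norm v = 1 \<Longrightarrow> reflect_in v x \<bullet> reflect_in v y = x \<bullet> y"
  by (simp add: reflect_in_def inner_diff_right inner_diff_left norm_eq_1 inner_commute algebra_simps)

lemma norm_reflect_in [simp]: "norm v = 1 \<Longrightarrow> norm (reflect_in v x) = norm x"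
  by (simp add: norm_eq_sqrt_inner reflect_in_inner)

lemma reflect_in_diff: "reflect_in v (x - y) = reflect_in v x - reflect_in v y"
  by (simp add: linear_diff reflect_in_linear)

lemma norm_reflect_in_diff [simp]:
  "norm v = 1 \<Longrightarrow> norm (reflect_in v x - reflect_in v y) = norm (x - y)"
  by (metis norm_reflect_in reflect_in_diff)

lemma continuous_on_reflect_in [continuous_intros]:
  "continuous_on S f \<Longrightarrow> continuous_on S (\<lambda>x. reflect_in v (f x))"
  unfolding reflect_in_def by (intro continuous_intros)

lemma borel_measurable_reflect_in [measurable]:
  "reflect_in (v::'a::euclidean_space) \<in> borel_measurable borel"
  by (intro borel_measurable_continuous_onI continuous_intros)

lemma riesz_kernel_reflect_in [simp]:
  "norm v = 1 \<Longrightarrow> riesz_kernel (reflect_in v x) (reflect_in v y) = riesz_kernel x y"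
  by (simp add: riesz_kernel_def)

text \<open>The hyperplane bisecting two points of equal norm passes through the origin. Reflections
  alone therefore act transitively on every sphere, and no other rotations are required for symmetry
  arguments.\<close>

lemma reflect_in_swap:
  fixes x y :: "'a::real_inner"
  assumes "norm x = norm y" "x \<noteq> y"
  shows "reflect_in ((x - y) /\<^sub>R norm (x - y)) x = y"
proof -
  have "(norm (x - y))\<^sup>2 = 2 * ((x - y) \<bullet> x)"
    using assms(1) by (simp add: power2_norm_eq_inner inner_diff_left inner_diff_right inner_commute norm_eq)
  then have "2 * ((x - y) \<bullet> x) / (norm (x - y))\<^sup>2 = 1"
    using assms(2) by (metis divide_self norm_eq_zero power2_eq_iff_nonneg right_minus_eq zero_eq_power2)
  then show ?thesis
    by (simp add: reflect_in_def power2_eq_square divide_inverse algebra_simps)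
qed

lemma emeasure_lborel_translate:
  fixes a :: "'a::euclidean_space"
  assumes [measurable]: "A \<in> sets borel"
  shows "emeasure lborel {x. a + x \<in> A} = emeasure lborel A"
proof -
  have "emeasure lborel A = emeasure (distr lborel borel ((+) a)) A"
    by (simp add: lborel_distr_plus)
  also have "\<dots> = emeasure lborel {x. a + x \<in> A}"
    by (subst emeasure_distr) (auto simp: vimage_def)
  finally show ?thesis ..
qed

lemma emeasure_lborel_reflect_translate:
  fixes a :: "'a::euclidean_space"
  assumes [measurable]: "A \<in> sets borel"
  shows "emeasure lborel {x. a - x \<in> A} = emeasure lborel A"
proof -
  have "emeasure lborel A = emeasure (distr lborel borel (\<lambda>x. a + (- 1) *\<^sub>R x)) A"
    by (subst lborel_affine[of "- 1" a]) (auto simp: density_1)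
  also have "\<dots> = emeasure lborel {x. a - x \<in> A}"
    by (subst emeasure_distr) (auto simp: vimage_def)
  finally show ?thesis ..
qed

lemma emeasure_ball_one:
  "emeasure lborel (ball 0 1 :: 'a::euclidean_space set) \<noteq> 0"
  "emeasure lborel (ball 0 1 :: 'a::euclidean_space set) < top"
  using emeasure_lborel_ball_finite[of "0 :: 'a" 1]
    less_imp_neq[OF unit_ball_vol_pos[of "real DIM('a)", OF of_nat_0_le_iff], symmetric]
  by (auto simp: emeasure_ball)

text \<open>Two translation invariant measures are proportional: evaluate \<open>\<integral>\<integral> 1\<^sub>A(x) 1\<^sub>B(x - y)\<close> in both
  orders.  The factor is read off on the unit ball.\<close>

lemma distr_lborel_reflect_in:
  fixes v :: "'a::euclidean_space"
  assumes v: "norm v = 1"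
  shows "distr lborel borel (reflect_in v) = lborel"
proof (rule measure_eqI)
  let ?M = "distr lborel borel (reflect_in v)"
  have em: "emeasure ?M A = emeasure lborel {x. reflect_in v x \<in> A}" if "A \<in> sets borel" for A
    using that by (subst emeasure_distr) (auto simp: vimage_def)
  have sf: "sigma_finite_measure ?M"
  proof (rule sigma_finite_measure.intro, intro exI conjI)
    let ?A = "range (\<lambda>n. cball 0 (real n)) :: 'a set set"
    show "countable ?A" by simp
    show "?A \<subseteq> sets ?M" by auto
    show "\<Union>?A = space ?M" using real_arch_simple by (fastforce simp: dist_norm)
    show "\<forall>a\<in>?A. emeasure ?M a \<noteq> \<infinity>"
    proof
      fix a assume "a \<in> ?A"
      then obtain n where a: "a = cball 0 (real n)" by auto
      have "emeasure ?M a = emeasure lborel (cball (0::'a) (real n))"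
        using v by (simp add: em a cball_def)
      then show "emeasure ?M a \<noteq> \<infinity>"
        using emeasure_lborel_cball_finite[of "0::'a" "real n"] by (simp add: less_top)
    qed
  qed
  interpret M: sigma_finite_measure ?M by fact
  interpret pair_sigma_finite ?M lborel ..
  have transl: "emeasure ?M {x. a + x \<in> A} = emeasure ?M A" if [measurable]: "A \<in> sets borel" for a A
  proof -
    have "{x. a + reflect_in v x \<in> A} = {x. reflect_in v (reflect_in v a + x) \<in> A}"
      using v by (simp add: linear_add reflect_in_linear)
    then show ?thesis
      using emeasure_lborel_translate[of "{x. reflect_in v x \<in> A}" "reflect_in v a"] that by (simp add: em)
  qed
  have sym: "emeasure ?M A * emeasure lborel B = emeasure ?M B * emeasure lborel A"
    if [measurable]: "A \<in> sets borel" "B \<in> sets borel" for A B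
  proof -
    have "emeasure ?M A * emeasure lborel B = (\<integral>\<^sup>+ x. indicator A x * emeasure lborel {y. x - y \<in> B} \<partial>?M)"
      by (simp add: emeasure_lborel_reflect_translate nn_integral_multc)
    also have "\<dots> = (\<integral>\<^sup>+ x. \<integral>\<^sup>+ y. indicator A x * indicator B (x - y) \<partial>lborel \<partial>?M)"
    proof (intro nn_integral_cong)
      fix x :: 'a
      have "(\<lambda>y. indicator B (x - y) :: ennreal) = indicator {y. x - y \<in> B}"
        by (auto simp: indicator_def)
      moreover have "(\<integral>\<^sup>+ y. indicator A x * indicator B (x - y) \<partial>lborel) = indicator A x * (\<integral>\<^sup>+ y. indicator B (x - y) \<partial>lborel)"
        by (rule nn_integral_cmult) measurable
      moreover have "(\<integral>\<^sup>+ y. indicator {y. x - y \<in> B} y \<partial>lborel) = emeasure lborel {y. x - y \<in> B}"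
        by (rule nn_integral_indicator) simp
      ultimately show "indicator A x * emeasure lborel {y. x - y \<in> B} = (\<integral>\<^sup>+ y. indicator A x * indicator B (x - y) \<partial>lborel)"
        by simp
    qed
    also have "\<dots> = (\<integral>\<^sup>+ y. \<integral>\<^sup>+ x. indicator A x * indicator B (x - y) \<partial>?M \<partial>lborel)"
      by (rule Fubini'[symmetric]) measurable
    also have "\<dots> = (\<integral>\<^sup>+ y. \<integral>\<^sup>+ x. indicator A (y + x) * indicator B x \<partial>?M \<partial>lborel)"
    proof (rule nn_integral_cong)
      fix y :: 'a
      have "{x. - y + x \<in> B \<and> x \<in> A} \<in> sets borel" by measurable
      from transl[OF this, of y]
      have "emeasure ?M {x. x - y \<in> B \<and> x \<in> A} = emeasure ?M {x. x \<in> B \<and> y + x \<in> A}"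
        by simp
      then show "(\<integral>\<^sup>+ x. indicator A x * indicator B (x - y) \<partial>?M) = (\<integral>\<^sup>+ x. indicator A (y + x) * indicator B x \<partial>?M)"
        using nn_integral_indicator[of "{x. x - y \<in> B \<and> x \<in> A}" ?M]
          nn_integral_indicator[of "{x. x \<in> B \<and> y + x \<in> A}" ?M]
        by (simp add: indicator_def of_bool_conj mult.commute)
    qed
    also have "\<dots> = (\<integral>\<^sup>+ x. \<integral>\<^sup>+ y. indicator A (y + x) * indicator B x \<partial>lborel \<partial>?M)"
      by (rule Fubini') measurable
    also have "\<dots> = (\<integral>\<^sup>+ x. emeasure lborel {y. x + y \<in> A} * indicator B x \<partial>?M)"
    proof (intro nn_integral_cong)
      fix x :: 'a
      have "(\<integral>\<^sup>+ y. indicator A (y + x) \<partial>lborel) = (\<integral>\<^sup>+ y. indicator {y. x + y \<in> A} y \<partial>lborel)"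
        by (auto simp: indicator_def add.commute intro!: nn_integral_cong)
      then show "(\<integral>\<^sup>+ y. indicator A (y + x) * indicator B x \<partial>lborel) = emeasure lborel {y. x + y \<in> A} * indicator B x"
        using nn_integral_indicator[of "{y. x + y \<in> A}" lborel] by (simp add: nn_integral_multc)
    qed
    also have "\<dots> = emeasure lborel A * emeasure ?M B"
      by (simp add: emeasure_lborel_translate nn_integral_cmult_indicator)
    finally show ?thesis by (simp only: mult.commute)
  qed
  fix A assume "A \<in> sets ?M"
  then have [measurable]: "A \<in> sets borel" by simp
  have "emeasure ?M (ball 0 1) = emeasure lborel (ball 0 1 :: 'a set)"
    using v by (simp add: em ball_def)
  moreover have "emeasure lborel (ball 0 1 :: 'a set) \<noteq> 0" "emeasure lborel (ball 0 1 :: 'a set) \<noteq> top"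
    using emeasure_ball_one[where 'a='a] by (auto simp: less_top)
  ultimately show "emeasure ?M A = emeasure lborel A"
    using sym[of A "ball 0 1"] ennreal_mult_cancel_left[of "emeasure lborel (ball 0 1 :: 'a set)"]
    by (simp add: mult.commute[of _ "emeasure lborel (ball 0 1)"])
qed simp

text \<open>Normalised surface measure as the radial projection of the uniform distribution in the
  ball, so that invariance under reflections is inherited from Lebesgue measure. The centre is sent
  to 0, as \<open>inverse 0 = 0\<close>; it is a null set.\<close>

definition sph :: "(real ^ 'n) measure" where
  "sph = distr (uniform_measure lborel (ball 0 1)) borel (\<lambda>x. x /\<^sub>R norm x)"

lemma sets_sph [simp, measurable_cong]: "sets sph = sets borel"
  by (simp add: sph_def)

lemma space_sph [simp]: "space sph = UNIV"
  by (simp add: sph_def)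

lemma measurable_normalize [measurable]: "(\<lambda>x::real ^ 'n. x /\<^sub>R norm x) \<in> borel_measurable borel"
  by measurable

lemma prob_space_uniform_ball: "prob_space (uniform_measure lborel (ball 0 1 :: (real ^ 'n) set))"
  using emeasure_ball_one[where 'a="real ^ 'n"] by (intro prob_space_uniform_measure) (auto simp: less_top)

lemma prob_space_sph: "prob_space (sph :: (real ^ 'n) measure)"
  unfolding sph_def by (intro prob_space.prob_space_distr prob_space_uniform_ball) simp

interpretation sph: prob_space sph
  by (rule prob_space_sph)

lemma AE_sph_sphere: "AE x in sph. norm x = 1"
proof -
  have "AE x in lborel. x \<noteq> (0 :: real ^ 'n)"
    by (rule AE_lborel_singleton)
  then have "AE x in uniform_measure lborel (ball 0 1). x \<noteq> (0 :: real ^ 'n)"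
    by (intro AE_uniform_measureI) auto
  then have "AE x in uniform_measure lborel (ball 0 1 :: (real ^ 'n) set). norm (x /\<^sub>R norm x) = 1"
    by eventually_elim simp
  then show ?thesis
    unfolding sph_def by (subst AE_distr_iff) auto
qed

lemma distr_sph_reflect_in:
  fixes v :: "real ^ 'n"
  assumes v: "norm v = 1"
  shows "distr sph borel (reflect_in v) = sph"
proof -
  let ?u = "uniform_measure lborel (ball 0 1) :: (real ^ 'n) measure"
  have u: "distr ?u borel (reflect_in v) = ?u"
  proof (rule measure_eqI)
    fix A assume "A \<in> sets (distr ?u borel (reflect_in v))"
    then have [measurable]: "A \<in> sets borel" by simp
    have "emeasure (distr ?u borel (reflect_in v)) A =
        emeasure lborel (ball 0 1 \<inter> reflect_in v -` A) / emeasure lborel (ball 0 1 :: (real ^ 'n) set)"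
      by (simp add: emeasure_distr emeasure_uniform_measure measurable_sets_borel[OF borel_measurable_reflect_in])
    also have "ball 0 1 \<inter> reflect_in v -` A = reflect_in v -` (ball 0 1 \<inter> A)"
      using v by auto
    also have "emeasure lborel \<dots> = emeasure (distr lborel borel (reflect_in v)) (ball 0 1 \<inter> A)"
      by (subst emeasure_distr) auto
    finally show "emeasure (distr ?u borel (reflect_in v)) A = emeasure ?u A"
      by (simp add: distr_lborel_reflect_in v emeasure_uniform_measure)
  qed simp
  have "distr sph borel (reflect_in v) = distr ?u borel (reflect_in v \<circ> (\<lambda>x. x /\<^sub>R norm x))"
    unfolding sph_def by (subst distr_distr) auto
  also have "reflect_in v \<circ> (\<lambda>x. x /\<^sub>R norm x) = (\<lambda>x. x /\<^sub>R norm x) \<circ> reflect_in v"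
    using v by (auto simp: fun_eq_iff linear_cmul[OF reflect_in_linear])
  also have "distr ?u borel \<dots> = distr (distr ?u borel (reflect_in v)) borel (\<lambda>x. x /\<^sub>R norm x)"
    by (subst distr_distr) auto
  finally show ?thesis
    by (simp add: u sph_def)
qed

lemma nn_integral_sph_reflect_in:
  fixes v :: "real ^ 'n"
  assumes "norm v = 1" and [measurable]: "f \<in> borel_measurable borel"
  shows "(\<integral>\<^sup>+ x. f (reflect_in v x) \<partial>sph) = (\<integral>\<^sup>+ x. f x \<partial>sph)"
  by (subst (2) distr_sph_reflect_in[symmetric, OF assms(1)]) (simp add: nn_integral_distr)

text \<open>Radial projection is continuous at x/2, so it maps a small ball about x/2 into the given
  ball. Full support is what turns almost everywhere statements about continuous functions into
  pointwise ones.\<close>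

lemma emeasure_sph_ball_pos:
  fixes x :: "real ^ 'n"
  assumes x: "norm x = 1" and "0 < r"
  shows "0 < emeasure sph (ball x r)"
proof -
  define y where "y = x /\<^sub>R 2"
  have y: "norm y = 1 / 2" "y /\<^sub>R norm y = x"
    using x by (auto simp: y_def)
  have "isCont (\<lambda>x. x /\<^sub>R norm x) y"
    using y by (intro continuous_intros) auto
  then obtain d where d: "0 < d" "\<And>z. dist z y < d \<Longrightarrow> dist (z /\<^sub>R norm z) x < r"
    using \<open>0 < r\<close> y(2) unfolding continuous_at_eps_delta by metis
  have "ball y (min d (1/2)) \<subseteq> ball 0 1 \<inter> (\<lambda>x. x /\<^sub>R norm x) -` ball x r"
  proof
    fix z assume "z \<in> ball y (min d (1/2))"
    then have z: "dist z y < d" "dist z y < 1/2" by (auto simp: dist_commute)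
    then have "norm z < 1"
      using y(1) norm_triangle_ineq[of "z - y" y] by (simp add: dist_norm)
    then show "z \<in> ball 0 1 \<inter> (\<lambda>x. x /\<^sub>R norm x) -` ball x r"
      using d(2)[OF z(1)] by (simp add: dist_commute)
  qed
  then have "emeasure lborel (ball y (min d (1/2))) \<le> emeasure lborel (ball 0 1 \<inter> (\<lambda>x. x /\<^sub>R norm x) -` ball x r)"
    using measurable_sets_borel[OF measurable_normalize, of "ball x r"] by (intro emeasure_mono) auto
  moreover have "0 < emeasure lborel (ball y (min d (1/2)))"
    using d(1) by (auto simp: emeasure_ball)
  ultimately have "0 < emeasure lborel (ball 0 1 \<inter> (\<lambda>x. x /\<^sub>R norm x) -` ball x r)"
    by simp
  then have "0 < emeasure (uniform_measure lborel (ball 0 1)) ((\<lambda>x. x /\<^sub>R norm x) -` ball x r)"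
    using emeasure_ball_one[where 'a="real ^ 'n"] measurable_sets_borel[OF measurable_normalize, of "ball x r"]
    by (subst emeasure_uniform_measure) (auto simp: ennreal_zero_less_divide)
  then show ?thesis
    unfolding sph_def by (subst emeasure_distr) auto
qed

subsection \<open>Smoothness of potentials\<close>

text \<open>Dominated convergence for the remainders: the mean value inequality bounds the remainder
  divided by |h| by 2 C. Values in a Banach space are allowed so that the rule applies to the kernel
  and again to its gradient.\<close>

lemma has_derivative_integral_param:
  fixes f :: "'a::euclidean_space \<Rightarrow> 'c \<Rightarrow> 'b::{banach,second_countable_topology}"
  assumes "finite_measure M" and "0 < r" and "0 \<le> C"
    and int: "\<And>x. x \<in> ball x0 r \<Longrightarrow> integrable M (f x)"
    and der: "AE y in M. \<forall>x\<in>ball x0 r. ((\<lambda>x. f x y) has_derivative F x y) (at x) \<and>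
      (\<forall>h. norm (F x y h) \<le> C * norm h)"
    and [measurable]: "\<And>h. (\<lambda>y. F x0 y h) \<in> borel_measurable M"
  shows "((\<lambda>x. \<integral>y. f x y \<partial>M) has_derivative (\<lambda>h. \<integral>y. F x0 y h \<partial>M)) (at x0)"
proof -
  interpret finite_measure M by fact
  have x0: "x0 \<in> ball x0 r" using \<open>0 < r\<close> by simp
  have lin: "AE y in M. bounded_linear (F x0 y)"
    using der by eventually_elim (use x0 in \<open>auto dest: has_derivative_bounded_linear\<close>)
  have bnd: "AE y in M. norm (F x0 y h) \<le> C * norm h" for h
    using der by eventually_elim (use x0 in auto)
  have intF: "integrable M (\<lambda>y. F x0 y h)" for h
    by (rule integrable_const_bound[OF bnd]) simp
  have "bounded_linear (\<lambda>h. \<integral>y. F x0 y h \<partial>M)"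
  proof (rule bounded_linear_intro)
    fix a b :: 'a and c :: real
    have "(\<integral>y. F x0 y (a + b) \<partial>M) = (\<integral>y. F x0 y a + F x0 y b \<partial>M)"
      by (intro integral_cong_AE) (use lin in \<open>auto simp: linear_add bounded_linear.linear\<close>)
    then show "(\<integral>y. F x0 y (a + b) \<partial>M) = (\<integral>y. F x0 y a \<partial>M) + (\<integral>y. F x0 y b \<partial>M)"
      by (simp add: intF)
    have "(\<integral>y. F x0 y (c *\<^sub>R a) \<partial>M) = (\<integral>y. c *\<^sub>R F x0 y a \<partial>M)"
      by (intro integral_cong_AE) (use lin in \<open>auto simp: linear_cmul bounded_linear.linear\<close>)
    then show "(\<integral>y. F x0 y (c *\<^sub>R a) \<partial>M) = c *\<^sub>R (\<integral>y. F x0 y a \<partial>M)"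
      by simp
    have "norm (\<integral>y. F x0 y a \<partial>M) \<le> (\<integral>y. norm (F x0 y a) \<partial>M)"
      by (rule integral_norm_bound)
    also have "\<dots> \<le> (\<integral>y. C * norm a \<partial>M)"
      by (intro integral_mono_AE integrable_norm intF bnd) simp
    finally show "norm (\<integral>y. F x0 y a \<partial>M) \<le> norm a * (C * measure M (space M))"
      by (simp add: algebra_simps)
  qed
  moreover have "(\<lambda>h. norm ((\<integral>y. f (x0 + h) y \<partial>M) - (\<integral>y. f x0 y \<partial>M) - (\<integral>y. F x0 y h \<partial>M)) / norm h) \<midarrow>0\<rightarrow> 0"
    unfolding tendsto_at_iff_sequentially
  proof (intro allI impI)
    fix X :: "nat \<Rightarrow> 'a" assume X: "\<forall>i. X i \<in> UNIV - {0}" "X \<longlonglongrightarrow> 0"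
    have ev: "\<forall>\<^sub>F i in sequentially. norm (X i) < r"
      using X(2) \<open>0 < r\<close> by (simp add: tendsto_iff)
    \<comment> \<open>Only finitely many increments leave the ball; their quotients are replaced by
      0, which makes the bound 2 C valid for every index.\<close>
    define q where "q i y = (if norm (X i) < r
      then norm (f (x0 + X i) y - f x0 y - F x0 y (X i)) / norm (X i) else 0)" for i y
    have memb: "x0 + X i \<in> ball x0 r" if "norm (X i) < r" for i
      using that by (simp add: dist_norm)
    have [measurable]: "q i \<in> borel_measurable M" for i
    proof (cases "norm (X i) < r")
      case True
      have [measurable]: "f (x0 + X i) \<in> borel_measurable M" "f x0 \<in> borel_measurable M"
        using int[OF memb[OF True]] int[OF x0] by auto
      show ?thesis using True unfolding q_def by simp
    qed (simp add: q_def[abs_def])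
    have "(\<lambda>i. \<integral>y. q i y \<partial>M) \<longlonglongrightarrow> (\<integral>y. 0 \<partial>M)"
    proof (rule integral_dominated_convergence[where w="\<lambda>_. 2 * C"])
      show "AE y in M. (\<lambda>i. q i y) \<longlonglongrightarrow> 0"
        using der
      proof eventually_elim
        case (elim y)
        then have "((\<lambda>x. f x y) has_derivative F x0 y) (at x0)" using x0 by blast
        then have "(\<lambda>h. norm (f (x0 + h) y - f x0 y - F x0 y h) / norm h) \<midarrow>0\<rightarrow> 0"
          by (simp add: has_derivative_at)
        then have "(\<lambda>i. norm (f (x0 + X i) y - f x0 y - F x0 y (X i)) / norm (X i)) \<longlonglongrightarrow> 0"
          using X unfolding tendsto_at_iff_sequentially by (auto simp: comp_def)
        then show ?case
          by (rule Lim_transform_eventually) (use ev in \<open>auto simp: q_def elim!: eventually_mono\<close>)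
      qed
      show "AE y in M. norm (q i y) \<le> 2 * C" for i
        using der
      proof eventually_elim
        case (elim y)
        show ?case
        proof (cases "norm (X i) < r")
          case True
          have "norm (f (x0 + X i) y - f x0 y) \<le> C * norm (x0 + X i - x0)"
          proof (rule differentiable_bound[of "ball x0 r" _ "\<lambda>x. F x y"])
            fix x assume "x \<in> ball x0 r"
            then show "((\<lambda>x. f x y) has_derivative F x y) (at x within ball x0 r)" "onorm (F x y) \<le> C"
              using elim \<open>0 \<le> C\<close> by (auto intro: has_derivative_at_withinI onorm_bound)
          qed (use memb[OF True] x0 in auto)
          moreover have "norm (F x0 y (X i)) \<le> C * norm (X i)"
            using elim x0 by blast
          ultimately have "norm (f (x0 + X i) y - f x0 y - F x0 y (X i)) \<le> 2 * C * norm (X i)"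
            using norm_triangle_ineq4[of "f (x0 + X i) y - f x0 y" "F x0 y (X i)"] by simp
          moreover have "0 < norm (X i)" using X(1) by simp
          ultimately show ?thesis
            using True by (simp add: q_def divide_le_eq)
        qed (use \<open>0 \<le> C\<close> in \<open>simp add: q_def\<close>)
      qed
    qed (simp_all)
    then have lim: "(\<lambda>i. \<integral>y. q i y \<partial>M) \<longlonglongrightarrow> 0" by simp
    have le: "\<forall>\<^sub>F i in sequentially. norm (norm ((\<integral>y. f (x0 + X i) y \<partial>M) - (\<integral>y. f x0 y \<partial>M) - (\<integral>y. F x0 y (X i) \<partial>M)) / norm (X i))
      \<le> (\<integral>y. q i y \<partial>M)"
      using ev
    proof eventually_elim
      case (elim i)
      have "norm ((\<integral>y. f (x0 + X i) y \<partial>M) - (\<integral>y. f x0 y \<partial>M) - (\<integral>y. F x0 y (X i) \<partial>M))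
        = norm (\<integral>y. f (x0 + X i) y - f x0 y - F x0 y (X i) \<partial>M)"
        using int[OF memb[OF elim]] int[OF x0] by (simp add: intF)
      also have "\<dots> \<le> (\<integral>y. norm (f (x0 + X i) y - f x0 y - F x0 y (X i)) \<partial>M)"
        by (rule integral_norm_bound)
      finally show ?case
        using elim by (simp add: q_def divide_right_mono)
    qed
    show "((\<lambda>h. norm ((\<integral>y. f (x0 + h) y \<partial>M) - (\<integral>y. f x0 y \<partial>M) - (\<integral>y. F x0 y h \<partial>M)) / norm h) \<circ> X) \<longlonglongrightarrow> 0"
      unfolding comp_def by (rule Lim_null_comparison[OF le lim])
  qed
  ultimately show ?thesis
    by (simp add: has_derivative_at)
qed

lemma isCont_integral_param:
  fixes f :: "'a::euclidean_space \<Rightarrow> 'c \<Rightarrow> 'b::{banach,second_countable_topology}"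
  assumes "finite_measure M" and "0 < r"
    and meas: "\<And>x. x \<in> ball x0 r \<Longrightarrow> f x \<in> borel_measurable M"
    and AE: "AE y in M. isCont (\<lambda>x. f x y) x0 \<and> (\<forall>x\<in>ball x0 r. norm (f x y) \<le> C)"
  shows "isCont (\<lambda>x. \<integral>y. f x y \<partial>M) x0"
  unfolding continuous_at_sequentially
proof (intro allI impI)
  interpret finite_measure M by fact
  fix X :: "nat \<Rightarrow> 'a" assume X: "X \<longlonglongrightarrow> x0"
  define Y where "Y i = (if X i \<in> ball x0 r then X i else x0)" for i
  have ev: "\<forall>\<^sub>F i in sequentially. Y i = X i"
    using tendstoD[OF X \<open>0 < r\<close>] by eventually_elim (simp add: Y_def dist_commute)
  have Y: "Y i \<in> ball x0 r" for i using \<open>0 < r\<close> by (simp add: Y_def)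
  have "Y \<longlonglongrightarrow> x0"
    using X ev by (metis (mono_tags, lifting) Lim_transform_eventually eventually_mono)
  have "(\<lambda>i. \<integral>y. f (Y i) y \<partial>M) \<longlonglongrightarrow> (\<integral>y. f x0 y \<partial>M)"
  proof (rule integral_dominated_convergence[where w="\<lambda>_. C"])
    show "AE y in M. (\<lambda>i. f (Y i) y) \<longlonglongrightarrow> f x0 y"
      using AE by eventually_elim (use \<open>Y \<longlonglongrightarrow> x0\<close> in \<open>auto simp: continuous_at_sequentially comp_def\<close>)
    show "AE y in M. norm (f (Y i) y) \<le> C" for i
      using AE by eventually_elim (use Y in auto)
  qed (use Y \<open>0 < r\<close> in \<open>auto intro!: meas\<close>)
  then show "((\<lambda>x. \<integral>y. f x y \<partial>M) \<circ> X) \<longlonglongrightarrow> (\<integral>y. f x0 y \<partial>M)"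
    unfolding comp_def by (rule Lim_transform_eventually) (use ev in \<open>auto elim: eventually_mono\<close>)
qed

lemma has_derivative_inverse_norm_power:
  fixes x y :: "'a::real_inner"
  assumes "x \<noteq> y"
  shows "((\<lambda>x. inverse (norm (x - y)) ^ j) has_derivative
    (\<lambda>h. - real j * inverse (norm (x - y)) ^ (j + 2) * ((x - y) \<bullet> h))) (at x)"
proof -
  let ?u = "inverse (norm (x - y))"
  have "((\<lambda>x. norm (x - y)) has_derivative (\<lambda>h. sgn (x - y) \<bullet> h)) (at x)"
  proof -
    have "((\<lambda>x. x - y) has_derivative (\<lambda>h. h)) (at x)"
      by (auto intro!: derivative_eq_intros)
    moreover have "(norm has_derivative (\<lambda>h. sgn (x - y) \<bullet> h)) (at (x - y))"
      using has_derivative_norm[of "x - y"] assms by (simp add: inner_commute)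
    ultimately show ?thesis
      by (rule has_derivative_compose)
  qed
  then have "((\<lambda>x. inverse (norm (x - y))) has_derivative (\<lambda>h. - (?u * (sgn (x - y) \<bullet> h) * ?u))) (at x)"
    using assms by (intro Deriv.has_derivative_inverse) auto
  then have "((\<lambda>x. inverse (norm (x - y)) ^ j) has_derivative
     (\<lambda>h. of_nat j * (- (?u * (sgn (x - y) \<bullet> h) * ?u)) * ?u ^ (j - 1))) (at x)"
    by (rule has_derivative_power)
  moreover have "(\<lambda>h. of_nat j * (- (?u * (sgn (x - y) \<bullet> h) * ?u)) * ?u ^ (j - 1)) =
      (\<lambda>h. - real j * ?u ^ (j + 2) * ((x - y) \<bullet> h))"
    by (rule ext, cases j) (simp_all add: sgn_div_norm algebra_simps power2_eq_square)
  ultimately show ?thesis by (simp only:)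
qed

lemma borel_measurable_vec_nth [measurable (raw)]:
  fixes f :: "'a \<Rightarrow> real ^ 'n"
  assumes "f \<in> borel_measurable M"
  shows "(\<lambda>x. f x $ i) \<in> borel_measurable M"
  by (rule borel_measurable_continuous_on[OF _ assms, of "\<lambda>v. v $ i"]) (intro continuous_intros)

definition rk_grad :: "real ^ 'n \<Rightarrow> real ^ 'n \<Rightarrow> real ^ 'n" where
  "rk_grad x y = (- real (CARD('n) - 2) * inverse (norm (x - y)) ^ CARD('n)) *\<^sub>R (x - y)"

definition rk_hess :: "real ^ 'n \<Rightarrow> real ^ 'n \<Rightarrow> real ^ 'n \<Rightarrow> real ^ 'n" where
  "rk_hess x y h = (- real (CARD('n) - 2) * inverse (norm (x - y)) ^ CARD('n)) *\<^sub>R h +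
     (real (CARD('n) - 2) * real (CARD('n)) * inverse (norm (x - y)) ^ (CARD('n) + 2) * ((x - y) \<bullet> h)) *\<^sub>R (x - y)"

lemma rk_grad_measurable [measurable]:
  assumes [measurable]: "f \<in> borel_measurable M" "g \<in> borel_measurable M"
  shows "(\<lambda>z. rk_grad (f z) (g z)) \<in> borel_measurable M"
  unfolding rk_grad_def by measurable

lemma rk_hess_measurable [measurable]:
  assumes [measurable]: "f \<in> borel_measurable M" "g \<in> borel_measurable M"
  shows "(\<lambda>z. rk_hess (f z) (g z) h) \<in> borel_measurable M"
  unfolding rk_hess_def by measurable

lemma rk_has_derivative:
  fixes x y :: "real ^ 'n"
  assumes "x \<noteq> y" "2 \<le> CARD('n)"
  shows "((\<lambda>x. rk x y) has_derivative (\<lambda>h. rk_grad x y \<bullet> h)) (at x)"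
proof -
  have "CARD('n) - 2 + 2 = CARD('n)" using assms(2) by simp
  with has_derivative_inverse_norm_power[OF assms(1), of "CARD('n) - 2"] show ?thesis
    unfolding rk_def rk_grad_def inner_scaleR_left by metis
qed

lemma rk_grad_has_derivative:
  fixes x y :: "real ^ 'n"
  assumes "x \<noteq> y"
  shows "((\<lambda>x. rk_grad x y) has_derivative rk_hess x y) (at x)"
  unfolding rk_grad_def[abs_def]
  by (rule has_derivative_eq_rhs[OF has_derivative_scaleR[OF has_derivative_mult_right[OF
        has_derivative_inverse_norm_power[OF assms, of "CARD('n)"]] has_derivative_diff[OF has_derivative_ident has_derivative_const]]])
    (simp add: rk_hess_def fun_eq_iff algebra_simps)

lemma norm_rk_grad_le:
  fixes x y :: "real ^ 'n"
  assumes "0 < r" "r \<le> norm (x - y)"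
  shows "norm (rk_grad x y) \<le> real (CARD('n)) * inverse r ^ (CARD('n) - 1)"
proof -
  have "norm (rk_grad x y) = real (CARD('n) - 2) * (inverse (norm (x - y)) ^ (CARD('n) - 1) * (inverse (norm (x - y)) * norm (x - y)))"
    by (simp add: rk_grad_def abs_mult power_abs flip: power_Suc2 mult.assoc)
  also have "inverse (norm (x - y)) * norm (x - y) = 1" using assms by (intro left_inverse) auto
  also have "real (CARD('n) - 2) * (inverse (norm (x - y)) ^ (CARD('n) - 1) * 1) \<le> real (CARD('n)) * inverse r ^ (CARD('n) - 1)"
    unfolding mult_1_right using assms by (intro mult_mono power_mono le_imp_inverse_le) auto
  finally show ?thesis .
qed

lemma norm_rk_hess_le:
  fixes x y :: "real ^ 'n"
  assumes "0 < r" "r \<le> norm (x - y)"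
  shows "norm (rk_hess x y h) \<le> (real (CARD('n)) + real (CARD('n))^2) * inverse r ^ CARD('n) * norm h"
proof -
  let ?u = "inverse (norm (x - y))"
  have u: "?u * norm (x - y) = 1" "0 \<le> ?u" "?u ^ CARD('n) \<le> inverse r ^ CARD('n)"
    using assms by (auto intro!: power_mono le_imp_inverse_le left_inverse simp del: left_inverse)
  have "norm (rk_hess x y h) \<le> real (CARD('n) - 2) * ?u ^ CARD('n) * norm h +
     real (CARD('n) - 2) * real (CARD('n)) * ?u ^ (CARD('n) + 2) * \<bar>(x - y) \<bullet> h\<bar> * norm (x - y)"
    unfolding rk_hess_def by (rule order_trans[OF norm_triangle_ineq]) (simp add: abs_mult power_abs)
  also have "\<dots> \<le> real (CARD('n) - 2) * ?u ^ CARD('n) * norm h +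
     real (CARD('n) - 2) * real (CARD('n)) * ?u ^ (CARD('n) + 2) * (norm (x - y) * norm h) * norm (x - y)"
    using Cauchy_Schwarz_ineq2[of "x - y" h] by (intro add_left_mono mult_right_mono mult_left_mono) auto
  also have "\<dots> = real (CARD('n) - 2) * ?u ^ CARD('n) * norm h +
     real (CARD('n) - 2) * real (CARD('n)) * ?u ^ CARD('n) * norm h * (?u * norm (x - y))^2"
    by (simp add: power_add power2_eq_square)
  also have "\<dots> = (real (CARD('n) - 2) + real (CARD('n) - 2) * real (CARD('n))) * ?u ^ CARD('n) * norm h"
    unfolding u(1) by (simp add: algebra_simps)
  also have "\<dots> \<le> (real (CARD('n)) + real (CARD('n))^2) * inverse r ^ CARD('n) * norm h"
    using u by (intro mult_right_mono mult_mono add_mono) (auto simp: power2_eq_square intro!: mult_right_mono)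
  finally show ?thesis .
qed

lemma rk_hess_trace:
  fixes x y :: "real ^ 'n"
  assumes "x \<noteq> y"
  shows "(\<Sum>i\<in>UNIV. rk_hess x y (axis i 1) $ i) = 0"
proof -
  let ?u = "inverse (norm (x - y))" and ?n = "real (CARD('n))" and ?m = "real (CARD('n) - 2)"
  have N: "(norm (x - y))\<^sup>2 = (\<Sum>i\<in>UNIV. ((x - y) $ i)\<^sup>2)"
    by (simp add: norm_vec_def L2_set_def sum_nonneg)
  have "(\<Sum>i\<in>UNIV. rk_hess x y (axis i 1) $ i) = (\<Sum>i\<in>UNIV. - ?m * ?u ^ CARD('n) + ?m * ?n * ?u ^ (CARD('n) + 2) * ((x - y) $ i)\<^sup>2)"
    by (intro sum.cong) (simp_all add: rk_hess_def inner_axis power2_eq_square)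
  also have "\<dots> = - ?n * ?m * ?u ^ CARD('n) + ?m * ?n * ?u ^ (CARD('n) + 2) * (norm (x - y))\<^sup>2"
    by (simp only: N sum.distrib sum_distrib_left[symmetric]) simp
  also have "\<dots> = 0"
    using assms by (simp add: power_add field_simps power2_eq_square)
  finally show ?thesis .
qed

lemma rk_le:
  fixes z y :: "real ^ 'n"
  assumes "0 < r" "r \<le> norm (z - y)"
  shows "rk z y \<le> inverse r ^ (CARD('n) - 2)"
  unfolding rk_def using assms by (intro power_mono le_imp_inverse_le) auto

text \<open>The closed set \<open>A\<close> is kept as a parameter: it will be the unit sphere, the
  support of the measure, or the union of the two caps.\<close>

locale carried_measure = finite_measure \<mu> for \<mu> :: "(real ^ 'n) measure" +
  fixes A :: "(real ^ 'n) set"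
  assumes sets_eq [measurable_cong]: "sets \<mu> = sets borel"
    and closed_carrier: "closed A"
    and null_off_carrier: "emeasure \<mu> (- A) = 0"
begin

lemma space_eq [simp]: "space \<mu> = UNIV"
  using sets_eq_imp_space_eq[OF sets_eq] by simp

lemma AE_carrier: "AE y in \<mu>. y \<in> A"
  using closed_carrier null_off_carrier
  by (intro AE_I[of _ _ "- A"]) (auto simp: sets_eq borel_closed)

lemma carrier_distance:
  assumes "x \<notin> A"
  obtains r where "0 < r" "\<And>z y. z \<in> ball x r \<Longrightarrow> y \<in> A \<Longrightarrow> r \<le> norm (z - y)"
proof -
  obtain e where e: "0 < e" "ball x e \<subseteq> - A"
    using assms closed_carrier by (meson ComplI open_Compl open_contains_ball)
  show ?thesis
  proof (rule that[of "e / 2"])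
    fix z y assume "z \<in> ball x (e / 2)" "y \<in> A"
    moreover have "y \<notin> ball x e" using e \<open>y \<in> A\<close> by blast
    ultimately have "dist x z < e / 2" "e \<le> dist x y" by auto
    then show "e / 2 \<le> norm (z - y)" using dist_triangle[of x y z] by (simp add: dist_norm)
  qed (use e in simp)
qed

lemma integrable_rk:
  assumes "x \<notin> A"
  shows "integrable \<mu> (rk x)"
proof -
  obtain r where "0 < r" "\<And>z y. z \<in> ball x r \<Longrightarrow> y \<in> A \<Longrightarrow> r \<le> norm (z - y)"
    using carrier_distance[OF assms] by metis
  then have "AE y in \<mu>. norm (rk x y) \<le> inverse r ^ (CARD('n) - 2)"
    using AE_carrier by (auto elim!: eventually_mono intro!: rk_le)
  then show ?thesis by (rule integrable_const_bound) measurable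
qed

lemma pot_eq_integral:
  assumes "x \<notin> A"
  shows "pot \<mu> x = ennreal (\<integral>y. rk x y \<partial>\<mu>)"
proof -
  have "pot \<mu> x = (\<integral>\<^sup>+y. ennreal (rk x y) \<partial>\<mu>)"
    unfolding pot_def using AE_carrier assms
    by (intro nn_integral_cong_AE) (auto elim!: eventually_mono intro!: riesz_kernel_rk)
  then show ?thesis by (simp add: nn_integral_eq_integral integrable_rk assms)
qed

lemma pot_finite: "x \<notin> A \<Longrightarrow> pot \<mu> x < \<infinity>"
  by (simp add: pot_eq_integral)

text \<open>Near a point off \<open>A\<close> the kernel and its first two derivatives are bounded
  uniformly over the poles in \<open>A\<close>. So both differentiations pass under the integral,
  and the Laplacian vanishes because it does so for each pole.\<close>

lemma harmonic_on_pot: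
  assumes "2 \<le> CARD('n)"
  shows "harmonic_on (\<lambda>x. enn2real (pot \<mu> x)) (- A)"
proof -
  define g where "g x = (\<integral>y. rk_grad x y \<partial>\<mu>)" for x
  define L where "L x h = (\<integral>y. rk_hess x y h \<partial>\<mu>)" for x h
  have int_grad: "integrable \<mu> (rk_grad x)" if off: "x \<notin> A" for x
  proof -
    obtain r where "0 < r" "\<And>z y. z \<in> ball x r \<Longrightarrow> y \<in> A \<Longrightarrow> r \<le> norm (z - y)"
      using carrier_distance[OF off] by metis
    then have "AE y in \<mu>. norm (rk_grad x y) \<le> real (CARD('n)) * inverse r ^ (CARD('n) - 1)"
      using AE_carrier by (auto elim!: eventually_mono intro!: norm_rk_grad_le simp del: One_nat_def)
    then show ?thesis by (rule integrable_const_bound) measurable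
  qed
  have int_hess: "integrable \<mu> (\<lambda>y. rk_hess x y h)" if off: "x \<notin> A" for x h
  proof -
    obtain r where "0 < r" "\<And>z y. z \<in> ball x r \<Longrightarrow> y \<in> A \<Longrightarrow> r \<le> norm (z - y)"
      using carrier_distance[OF off] by metis
    then have "AE y in \<mu>. norm (rk_hess x y h) \<le> (real (CARD('n)) + real (CARD('n))^2) * inverse r ^ CARD('n) * norm h"
      using AE_carrier by (auto elim!: eventually_mono intro!: norm_rk_hess_le)
    then show ?thesis by (rule integrable_const_bound) measurable
  qed
  have du: "((\<lambda>x. enn2real (pot \<mu> x)) has_derivative (\<lambda>h. g x \<bullet> h)) (at x)"
    and dg: "(g has_derivative L x) (at x)" and cL: "isCont (\<lambda>x. L x h) x"
    if x: "x \<in> - A" for x h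
  proof -
    obtain r where r: "0 < r" and rA: "\<And>z y. z \<in> ball x r \<Longrightarrow> y \<in> A \<Longrightarrow> r \<le> norm (z - y)"
      using carrier_distance x by (metis ComplD)
    have off: "z \<notin> A" if "z \<in> ball x r" for z
      using rA[OF that, of z] r by auto
    have ne: "z \<noteq> y" if "z \<in> ball x r" "y \<in> A" for z y
      using off that by blast
    have "((\<lambda>x. \<integral>y. rk x y \<partial>\<mu>) has_derivative (\<lambda>h. \<integral>y. rk_grad x y \<bullet> h \<partial>\<mu>)) (at x)"
    proof (rule has_derivative_integral_param[OF finite_measure_axioms r])
      show "AE y in \<mu>. \<forall>z\<in>ball x r. ((\<lambda>x. rk x y) has_derivative (\<lambda>h. rk_grad z y \<bullet> h)) (at z) \<and>
          (\<forall>h. norm (rk_grad z y \<bullet> h) \<le> real (CARD('n)) * inverse r ^ (CARD('n) - 1) * norm h)"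
        using AE_carrier
      proof eventually_elim
        case (elim y)
        show ?case
        proof (intro ballI conjI allI)
          fix z h assume z: "z \<in> ball x r"
          show "((\<lambda>x. rk x y) has_derivative (\<lambda>h. rk_grad z y \<bullet> h)) (at z)"
            using ne[OF z elim] assms by (rule rk_has_derivative)
          show "norm (rk_grad z y \<bullet> h) \<le> real (CARD('n)) * inverse r ^ (CARD('n) - 1) * norm h"
            unfolding real_norm_def
            by (rule order_trans[OF Cauchy_Schwarz_ineq2 mult_right_mono[OF norm_rk_grad_le[OF r rA[OF z elim]]]]) simp
        qed
      qed
    qed (use r off in \<open>auto intro: integrable_rk\<close>)
    then have "((\<lambda>x. \<integral>y. rk x y \<partial>\<mu>) has_derivative (\<lambda>h. g x \<bullet> h)) (at x)"
      using int_grad[of x] x by (simp add: g_def)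
    then show "((\<lambda>x. enn2real (pot \<mu> x)) has_derivative (\<lambda>h. g x \<bullet> h)) (at x)"
    proof (rule has_derivative_transform_within_open)
      show "open (ball x r)" "x \<in> ball x r" using r by auto
      show "(\<integral>y. rk z y \<partial>\<mu>) = enn2real (pot \<mu> z)" if "z \<in> ball x r" for z
        using off[OF that] by (simp add: pot_eq_integral integral_nonneg)
    qed
    show "(g has_derivative L x) (at x)"
      unfolding g_def[abs_def] L_def
    proof (rule has_derivative_integral_param[OF finite_measure_axioms r])
      show "AE y in \<mu>. \<forall>z\<in>ball x r. ((\<lambda>x. rk_grad x y) has_derivative rk_hess z y) (at z) \<and>
          (\<forall>h. norm (rk_hess z y h) \<le> (real (CARD('n)) + real (CARD('n))^2) * inverse r ^ CARD('n) * norm h)"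
        using AE_carrier
      proof eventually_elim
        case (elim y)
        show ?case
        proof (intro ballI conjI allI)
          fix z h assume z: "z \<in> ball x r"
          show "((\<lambda>x. rk_grad x y) has_derivative rk_hess z y) (at z)"
            using ne[OF z elim] by (rule rk_grad_has_derivative)
          show "norm (rk_hess z y h) \<le> (real (CARD('n)) + real (CARD('n))^2) * inverse r ^ CARD('n) * norm h"
            using r rA[OF z elim] by (rule norm_rk_hess_le)
        qed
      qed
    qed (use r off in \<open>auto intro: int_grad\<close>)
    show "isCont (\<lambda>x. L x h) x"
      unfolding L_def
    proof (rule isCont_integral_param[OF finite_measure_axioms r])
      show "AE y in \<mu>. isCont (\<lambda>x. rk_hess x y h) x \<and>
          (\<forall>z\<in>ball x r. norm (rk_hess z y h) \<le> (real (CARD('n)) + real (CARD('n))^2) * inverse r ^ CARD('n) * norm h)"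
        using AE_carrier
      proof eventually_elim
        case (elim y)
        have "x \<noteq> y" using ne[OF _ elim] r by simp
        then have "isCont (\<lambda>x. rk_hess x y h) x"
          unfolding rk_hess_def by (intro continuous_intros) auto
        moreover have "norm (rk_hess z y h) \<le> (real (CARD('n)) + real (CARD('n))^2) * inverse r ^ CARD('n) * norm h"
          if "z \<in> ball x r" for z
          using r rA[OF that elim] by (rule norm_rk_hess_le)
        ultimately show ?case by blast
      qed
    qed measurable
  qed
  have mat: "(*v) (matrix (L x)) = L x" if "x \<in> - A" for x
    using has_derivative_linear[OF dg[OF that]] by (simp add: fun_eq_iff matrix_works linear_matrix_vector_mul_eq)
  have nth: "matrix (L x) $ i $ j = (\<integral>y. rk_hess x y (axis j 1) $ i \<partial>\<mu>)" if "x \<in> - A" for x i j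
    unfolding matrix_def L_def using int_hess[of x] that
    by (simp add: integral_bounded_linear[OF bounded_linear_vec_nth])
  have tr: "trace (matrix (L x)) = 0" if x: "x \<in> - A" for x
  proof -
    have "trace (matrix (L x)) = (\<integral>y. (\<Sum>i\<in>UNIV. rk_hess x y (axis i 1) $ i) \<partial>\<mu>)"
      unfolding trace_def nth[OF x]
      by (subst Bochner_Integration.integral_sum)
        (use int_hess[of x] x in \<open>auto intro: integrable_bounded_linear[OF bounded_linear_vec_nth]\<close>)
    also have "\<dots> = (\<integral>y. 0 \<partial>\<mu>)"
      using AE_carrier x by (intro integral_cong_AE) (auto elim!: eventually_mono intro!: rk_hess_trace)
    finally show ?thesis by simp
  qed
  have "continuous_on (- A) (\<lambda>x. matrix (L x))"
    unfolding matrix_def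
  proof (intro continuous_on_vec_lambda)
    fix i j :: 'n
    show "continuous_on (- A) (\<lambda>x. L x (axis j 1) $ i)"
      using cL by (intro continuous_on_component continuous_at_imp_continuous_on) auto
  qed
  then show ?thesis
    unfolding harmonic_on_def using closed_carrier du dg tr mat
    by (intro conjI exI[of _ g] exI[of _ "\<lambda>x. matrix (L x)"]) (auto simp: open_Compl)
qed

end

subsection \<open>Spherical means\<close>

lemma carried_sph: "carried_measure sph (sphere (0 :: real ^ 'n) 1)"
proof
  have "AE x in (sph :: (real ^ 'n) measure). x \<in> sphere 0 1"
    using AE_sph_sphere by simp
  then have "emeasure sph {x \<in> space (sph :: (real ^ 'n) measure). x \<notin> sphere 0 1} = 0"
    by (subst (asm) AE_iff_measurable[OF _ refl]) auto
  then show "emeasure sph (- sphere (0 :: real ^ 'n) 1) = 0"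
    by (simp add: Compl_eq)
qed auto

interpretation sph: carried_measure sph "sphere (0 :: real ^ 'n) 1"
  by (rule carried_sph)

lemma pot_sph_reflect_in:
  fixes x v :: "real ^ 'n"
  assumes v: "norm v = 1"
  shows "pot sph (reflect_in v x) = pot sph x"
proof -
  have "pot sph (reflect_in v x) = (\<integral>\<^sup>+ y. riesz_kernel (reflect_in v x) (reflect_in v y) \<partial>sph)"
    unfolding pot_def by (rule nn_integral_sph_reflect_in[OF v, symmetric]) measurable
  then show ?thesis using v by (simp add: pot_def)
qed

lemma pot_sph_radial:
  fixes x y :: "real ^ 'n"
  assumes "norm x = norm y"
  shows "pot sph x = pot sph y"
proof (cases "x = y")
  case False
  then show ?thesis
    using pot_sph_reflect_in[of "(x - y) /\<^sub>R norm (x - y)" x] reflect_in_swap[OF assms] by simp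
qed simp

lemma emeasure_sph_UNIV [simp]: "emeasure (sph :: (real ^ 'n) measure) UNIV = 1"
  using prob_space.emeasure_space_1[OF prob_space_sph] by (metis space_sph)

lemma pot_sph_0: "pot sph (0 :: real ^ 'n) = 1"
proof -
  have "pot sph (0 :: real ^ 'n) = (\<integral>\<^sup>+ y. 1 \<partial>(sph :: (real ^ 'n) measure))"
    unfolding pot_def using AE_sph_sphere
    by (intro nn_integral_cong_AE) (auto elim!: eventually_mono simp: riesz_kernel_def)
  then show ?thesis by (simp add: emeasure_sph_UNIV)
qed

text \<open>In the ball the potential of \<open>sph\<close> is radial and harmonic.  Differentiating twice along the circle
  through the axes \<open>k\<close> and \<open>i\<close> expresses each tangential second derivative by the radial first derivative, so
  the Laplace equation becomes \<open>(s\<^sup>n\<^sup>-\<^sup>1 q(s))' = 0\<close> for the radial derivative \<open>q\<close>.\<close>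

lemma pot_sph_interior:
  fixes x :: "real ^ 'n"
  assumes n: "2 \<le> CARD('n)" and x: "norm x < 1"
  shows "pot sph x = 1"
proof -
  obtain k :: 'n where True by simp
  define f where "f x = enn2real (pot sph (x :: real ^ 'n))" for x
  obtain g :: "real ^ 'n \<Rightarrow> real ^ 'n" and H :: "real ^ 'n \<Rightarrow> real ^ 'n ^ 'n"
    where df: "\<And>x. norm x < 1 \<Longrightarrow> (f has_derivative (\<lambda>h. g x \<bullet> h)) (at x)"
      and dg: "\<And>x. norm x < 1 \<Longrightarrow> (g has_derivative (\<lambda>h. H x *v h)) (at x)"
      and tr: "\<And>x. norm x < 1 \<Longrightarrow> trace (H x) = 0"
  proof -
    obtain g H where "\<forall>x\<in>- sphere 0 1. (f has_derivative (\<lambda>h. g x \<bullet> h)) (at x)"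
      "\<forall>x\<in>- sphere 0 1. (g has_derivative (\<lambda>h. H x *v h)) (at x)"
      "\<forall>x\<in>- sphere 0 1. trace (H x) = 0"
      using sph.harmonic_on_pot[OF n] unfolding harmonic_on_def f_def by blast
    then show ?thesis by (intro that[of g H]) auto
  qed
  let ?e = "\<lambda>i::'n. axis i (1::real)"
  have tang: "s * H (s *\<^sub>R ?e k) $ i $ i = g (s *\<^sub>R ?e k) $ k"
    if s: "0 < s" "s < 1" and i: "i \<noteq> k" for s i
  proof -
    define c where "c t = s *\<^sub>R (cos t *\<^sub>R ?e k + sin t *\<^sub>R ?e i)" for t
    define c' where "c' t = s *\<^sub>R (- sin t *\<^sub>R ?e k + cos t *\<^sub>R ?e i)" for t
    have dc: "(c has_vector_derivative c' t) (at t)" for t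
      unfolding c_def c'_def by (auto intro!: derivative_eq_intros simp: has_real_derivative_iff_has_vector_derivative[symmetric])
    have dc': "(c' has_vector_derivative - c t) (at t)" for t
      unfolding c_def c'_def by (auto intro!: derivative_eq_intros simp: has_real_derivative_iff_has_vector_derivative[symmetric] algebra_simps)
    have "(norm (c t))\<^sup>2 = s\<^sup>2" for t
    proof -
      have "(norm (c t))\<^sup>2 = s\<^sup>2 * ((cos t)\<^sup>2 + (sin t)\<^sup>2)"
        using i unfolding power2_norm_eq_inner c_def
        by (simp add: inner_add_left inner_add_right inner_axis_axis power2_eq_square algebra_simps
            del: sin_cos_squared_add sin_cos_squared_add2 sin_cos_squared_add3)
      then show ?thesis by simp
    qed
    then have nc: "norm (c t) = s" for t
      using s by (metis less_imp_le norm_ge_zero power2_eq_imp_eq)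
    have "g (c t) \<bullet> c' t = 0" for t
    proof -
      have "((f \<circ> c) has_vector_derivative (g (c t) \<bullet> c' t)) (at t)"
        using vector_derivative_diff_chain_within[OF dc[of t], of f "\<lambda>h. g (c t) \<bullet> h"] df[of "c t"] nc s
        by (simp add: has_derivative_at_withinI)
      moreover have "f \<circ> c = (\<lambda>_. f (c 0))"
        using nc by (auto simp: f_def fun_eq_iff intro!: arg_cong[of _ _ enn2real] pot_sph_radial)
      ultimately show ?thesis
        by (metis has_vector_derivative_const vector_derivative_unique_at)
    qed
    then have gc: "(\<lambda>t. g (c t) \<bullet> c' t) = (\<lambda>_. 0)" by auto
    have "((g \<circ> c) has_vector_derivative (H (c 0) *v c' 0)) (at 0)"
      using vector_derivative_diff_chain_within[OF dc[of 0], of g "\<lambda>h. H (c 0) *v h"] dg[of "c 0"] nc s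
      by (simp add: has_derivative_at_withinI)
    then have "((\<lambda>t. g (c t) \<bullet> c' t) has_vector_derivative (g (c 0) \<bullet> (- c 0) + (H (c 0) *v c' 0) \<bullet> c' 0)) (at 0)"
      using bounded_bilinear.has_vector_derivative[OF bounded_bilinear_inner _ dc'[of 0]] by (simp add: comp_def)
    then have "g (c 0) \<bullet> (- c 0) + (H (c 0) *v c' 0) \<bullet> c' 0 = 0"
      unfolding gc by (metis has_vector_derivative_const vector_derivative_unique_at)
    moreover have "c 0 = s *\<^sub>R ?e k" "c' 0 = s *\<^sub>R ?e i" by (auto simp: c_def c'_def)
    ultimately have "s * g (s *\<^sub>R ?e k) $ k = s\<^sup>2 * H (s *\<^sub>R ?e k) $ i $ i"
      by (auto simp add: inner_axis matrix_vector_mult_scaleR matrix_vector_mult_basis column_def power2_eq_square)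
    then show ?thesis using s by (auto simp: power2_eq_square)
  qed
  have rad: "s * H (s *\<^sub>R ?e k) $ k $ k = - real (CARD('n) - 1) * g (s *\<^sub>R ?e k) $ k"
    if s: "0 < s" "s < 1" for s
  proof -
    have "0 = s * trace (H (s *\<^sub>R ?e k))" using tr[of "s *\<^sub>R ?e k"] s by simp
    also have "\<dots> = s * H (s *\<^sub>R ?e k) $ k $ k + (\<Sum>i\<in>UNIV - {k}. s * H (s *\<^sub>R ?e k) $ i $ i)"
      unfolding trace_def by (subst sum.remove[of _ k]) (auto simp: algebra_simps sum_distrib_left)
    also have "(\<Sum>i\<in>UNIV - {k}. s * H (s *\<^sub>R ?e k) $ i $ i) = (\<Sum>i\<in>UNIV - {k}. g (s *\<^sub>R ?e k) $ k)"
      using tang[OF s] by (intro sum.cong) auto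
    finally show ?thesis by (simp add: card_Diff_singleton algebra_simps)
  qed
  have line: "((\<lambda>s. s *\<^sub>R ?e k) has_vector_derivative ?e k) (at s)" for s :: real
    by (auto intro!: derivative_eq_intros)
  have dq: "((\<lambda>s. g (s *\<^sub>R ?e k) $ k) has_real_derivative H (s *\<^sub>R ?e k) $ k $ k) (at s)"
    if "\<bar>s\<bar> < 1" for s
  proof -
    have "((g \<circ> (\<lambda>s. s *\<^sub>R ?e k)) has_vector_derivative (H (s *\<^sub>R ?e k) *v ?e k)) (at s)"
      using vector_derivative_diff_chain_within[OF line[of s], of g "\<lambda>h. H (s *\<^sub>R ?e k) *v h"] dg[of "s *\<^sub>R ?e k"] that
      by (simp add: has_derivative_at_withinI)
    from bounded_linear.has_vector_derivative[OF bounded_linear_vec_nth this, of k]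
    show ?thesis
      by (simp add: comp_def has_real_derivative_iff_has_vector_derivative matrix_vector_mult_basis column_def)
  qed
  have dF: "((\<lambda>s. f (s *\<^sub>R ?e k)) has_real_derivative g (s *\<^sub>R ?e k) $ k) (at s)"
    if "\<bar>s\<bar> < 1" for s
  proof -
    have "((f \<circ> (\<lambda>s. s *\<^sub>R ?e k)) has_vector_derivative (g (s *\<^sub>R ?e k) \<bullet> ?e k)) (at s)"
      using vector_derivative_diff_chain_within[OF line[of s], of f "\<lambda>h. g (s *\<^sub>R ?e k) \<bullet> h"] df[of "s *\<^sub>R ?e k"] that
      by (simp add: has_derivative_at_withinI)
    then show ?thesis
      by (simp add: comp_def has_real_derivative_iff_has_vector_derivative inner_axis)
  qed
  have q0: "g (s *\<^sub>R ?e k) $ k = 0" if s: "0 < s" "s < 1" for s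
  proof -
    let ?Q = "\<lambda>s. s ^ (CARD('n) - 1) * g (s *\<^sub>R ?e k) $ k"
    have dQ: "(?Q has_real_derivative real (CARD('n) - 1) * t ^ (CARD('n) - 1 - 1) * g (t *\<^sub>R ?e k) $ k
        + H (t *\<^sub>R ?e k) $ k $ k * t ^ (CARD('n) - 1)) (at t)" if "\<bar>t\<bar> < 1" for t
      using dq[OF that] by (auto intro!: derivative_eq_intros)
    have "?Q s = ?Q 0"
    proof (rule DERIV_isconst_end[OF s(1)])
      show "continuous_on {0..s} ?Q"
        using s by (intro continuous_at_imp_continuous_on ballI DERIV_isCont[OF dQ]) auto
      fix t assume t: "0 < t" "t < s"
      have "t ^ (CARD('n) - 1) = t * t ^ (CARD('n) - 1 - 1)"
        using n by (metis One_nat_def Suc_1 Suc_diff_le Suc_le_eq diff_Suc_1 power_Suc Suc_diff_Suc)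
      then have "real (CARD('n) - 1) * t ^ (CARD('n) - 1 - 1) * g (t *\<^sub>R ?e k) $ k + H (t *\<^sub>R ?e k) $ k $ k * t ^ (CARD('n) - 1)
        = t ^ (CARD('n) - 1 - 1) * (real (CARD('n) - 1) * g (t *\<^sub>R ?e k) $ k + t * H (t *\<^sub>R ?e k) $ k $ k)"
        by (simp add: algebra_simps)
      also have "\<dots> = 0" using rad[of t] t s by (simp add: algebra_simps)
      finally show "(?Q has_real_derivative 0) (at t)" using dQ[of t] t s by simp
    qed
    \<comment> \<open>The constant is the value at 0, which is 0 because the exponent n - 1 is
      positive.\<close>
    then show ?thesis using s n by (simp add: power_0_left)
  qed
  have F: "f (s *\<^sub>R ?e k) = f 0" if s: "0 < s" "s < 1" for s
  proof -
    have "(\<lambda>s. f (s *\<^sub>R ?e k)) s = (\<lambda>s. f (s *\<^sub>R ?e k)) 0"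
    proof (rule DERIV_isconst_end[OF s(1)])
      show "continuous_on {0..s} (\<lambda>s. f (s *\<^sub>R ?e k))"
        using s by (intro continuous_at_imp_continuous_on ballI DERIV_isCont[OF dF]) auto
      show "((\<lambda>s. f (s *\<^sub>R ?e k)) has_real_derivative 0) (at t)" if "0 < t" "t < s" for t
        using dF[of t] q0[of t] that s by simp
    qed
    then show ?thesis by simp
  qed
  have "f x = f 0"
  proof (cases "x = 0")
    case False
    have "f x = f (norm x *\<^sub>R ?e k)"
      unfolding f_def by (intro arg_cong[of _ _ enn2real] pot_sph_radial) simp
    then show ?thesis using F[of "norm x"] False x by simp
  qed simp
  then have "enn2real (pot sph x) = 1" by (simp add: f_def pot_sph_0)
  moreover have "pot sph x < \<infinity>" using x by (intro sph.pot_finite) auto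
  ultimately show ?thesis
    by (metis ennreal_1 ennreal_enn2real infinity_ennreal_def)
qed


section \<open>Semicontinuity, boundary values and mean values of potentials\<close>

lemma tendsto_riesz_kernel:
  assumes "X \<longlonglongrightarrow> x"
  shows "(\<lambda>i. riesz_kernel (X i) y) \<longlonglongrightarrow> riesz_kernel x y"
  using assms
  by (rule continuous_on_tendsto_compose[where f="\<lambda>z. riesz_kernel z y" and s=UNIV, rotated])
    (auto intro!: continuous_intros)

text \<open>Fatou's lemma, since the kernel is continuous into [0, \<infinity>] even on the
  diagonal.\<close>

lemma pot_lsc:
  fixes \<mu> :: "(real ^ 'n) measure"
  assumes [measurable_cong]: "sets \<mu> = sets borel" and X: "X \<longlonglongrightarrow> x"
  shows "pot \<mu> x \<le> liminf (\<lambda>i. pot \<mu> (X i))"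
proof -
  have "(\<lambda>i. riesz_kernel (X i) y) \<longlonglongrightarrow> riesz_kernel x y" for y
    using X by (rule tendsto_riesz_kernel)
  then have "liminf (\<lambda>i. riesz_kernel (X i) y) = riesz_kernel x y" for y
    by (intro lim_imp_Liminf) auto
  then have "pot \<mu> x = (\<integral>\<^sup>+ y. liminf (\<lambda>i. riesz_kernel (X i) y) \<partial>\<mu>)"
    by (simp add: pot_def)
  also have "\<dots> \<le> liminf (\<lambda>i. pot \<mu> (X i))"
    unfolding pot_def by (intro nn_integral_liminf) measurable
  finally show ?thesis .
qed

lemma pot_lsc_gt:
  fixes \<mu> :: "(real ^ 'n) measure"
  assumes "sets \<mu> = sets borel" and t: "t < pot \<mu> x"
  shows "\<exists>d>0. \<forall>y\<in>ball x d. t < pot \<mu> y"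
proof (rule ccontr)
  assume "\<not> ?thesis"
  then have "\<forall>i::nat. \<exists>y. y \<in> ball x (inverse (Suc i)) \<and> \<not> t < pot \<mu> y"
    by (metis inverse_positive_iff_positive of_nat_0_less_iff zero_less_Suc)
  then obtain X where X: "\<And>i. X i \<in> ball x (inverse (Suc i))" "\<And>i. \<not> t < pot \<mu> (X i)"
    by metis
  have "(\<lambda>i. dist (X i) x) \<longlonglongrightarrow> 0"
  proof (rule tendsto_sandwich[OF _ _ tendsto_const LIMSEQ_inverse_real_of_nat])
    show "\<forall>\<^sub>F i in sequentially. dist (X i) x \<le> inverse (real (Suc i))"
      using X(1) by (intro always_eventually allI) (simp add: dist_commute less_imp_le)
  qed simp
  then have "X \<longlonglongrightarrow> x" by (rule tendsto_dist_iff[THEN iffD2])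
  then have "pot \<mu> x \<le> liminf (\<lambda>i. pot \<mu> (X i))" by (rule pot_lsc[OF assms(1)])
  also have "\<dots> \<le> t"
    using X(2) by (intro Liminf_le always_eventually) (auto simp: not_less)
  finally show False using t by simp
qed

lemma ennreal_inverse_antimono: "x \<le> y \<Longrightarrow> inverse y \<le> inverse (x :: ennreal)"
proof (cases "x = 0 \<or> y = top")
  assume xy: "x \<le> y"
  case False
  with xy obtain a b where "x = ennreal a" "y = ennreal b" "0 < a" "0 < b"
    by (cases x; cases y) (auto simp: top_unique)
  then show ?thesis using xy by (simp add: inverse_ennreal le_imp_inverse_le)
qed auto

lemma riesz_kernel_mono_dist:
  fixes x y x' y' :: "real ^ 'n"
  assumes "0 < c" "norm (x - y) \<le> c * norm (x' - y')"
  shows "riesz_kernel x' y' \<le> ennreal (c ^ (CARD('n) - 2)) * riesz_kernel x y"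
proof -
  have "riesz_kernel x' y' = ennreal (c ^ (CARD('n) - 2)) * riesz_kernel (c *\<^sub>R x') (c *\<^sub>R y')"
  proof -
    have "c ^ (CARD('n) - 2) * inverse c ^ (CARD('n) - 2) = 1"
      using assms(1) by (simp add: power_inverse)
    then have "ennreal (c ^ (CARD('n) - 2)) * ennreal (inverse c ^ (CARD('n) - 2)) = 1"
      using assms(1) by (subst ennreal_mult[symmetric]) simp_all
    then show ?thesis
      unfolding riesz_kernel_scale[OF assms(1)] mult.assoc[symmetric] by (simp only: mult_1_left)
  qed
  also have "riesz_kernel (c *\<^sub>R x') (c *\<^sub>R y') \<le> riesz_kernel x y"
  proof -
    have "norm (x - y) \<le> norm (c *\<^sub>R x' - c *\<^sub>R y')"
      using assms by (simp flip: scaleR_diff_right)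
    then show ?thesis
      unfolding riesz_kernel_inverse by (intro ennreal_inverse_antimono ennreal_leI power_mono) auto
  qed
  finally show ?thesis by (simp add: mult_left_mono)
qed

text \<open>For x and y on the sphere and 0 \<le> r < 1 one has |x - y| \<le> 2 |r x - y|, because r
  x is at least as far from y as from x. Hence 2^(n-2) times the kernel at x dominates, and it is
  integrable when the potential at x is finite.\<close>

lemma pot_radial_limit:
  fixes \<mu> :: "(real ^ 'n) measure"
  assumes [measurable_cong]: "sets \<mu> = sets borel" and S: "AE y in \<mu>. norm y = 1"
    and x: "norm x = 1" and fin: "pot \<mu> x < \<infinity>"
    and r: "\<And>i. 0 \<le> r i" "\<And>i. r i < 1" "r \<longlonglongrightarrow> 1"
  shows "(\<lambda>i. pot \<mu> (r i *\<^sub>R x)) \<longlonglongrightarrow> pot \<mu> x"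
  unfolding pot_def
proof (rule nn_integral_dominated_convergence[where w="\<lambda>y. ennreal (2 ^ (CARD('n) - 2)) * riesz_kernel x y"])
  have "(\<lambda>i. r i *\<^sub>R x) \<longlonglongrightarrow> 1 *\<^sub>R x" by (intro tendsto_intros r)
  then show "AE y in \<mu>. (\<lambda>i. riesz_kernel (r i *\<^sub>R x) y) \<longlonglongrightarrow> riesz_kernel x y"
    by (intro AE_I2 tendsto_riesz_kernel) simp
  show "AE y in \<mu>. riesz_kernel (r i *\<^sub>R x) y \<le> ennreal (2 ^ (CARD('n) - 2)) * riesz_kernel x y" for i
    using S
  proof eventually_elim
    case (elim y)
    have "x - r i *\<^sub>R x = (1 - r i) *\<^sub>R x" by (simp add: algebra_simps)
    then have "norm (x - r i *\<^sub>R x) = 1 - r i"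
      using x r(2)[of i] by simp
    moreover have "norm (y - r i *\<^sub>R x) \<ge> 1 - r i"
      using norm_triangle_ineq2[of y "r i *\<^sub>R x"] elim x r(1)[of i] by simp
    moreover have "norm (x - y) \<le> norm (x - r i *\<^sub>R x) + norm (r i *\<^sub>R x - y)"
      using norm_triangle_ineq[of "x - r i *\<^sub>R x" "r i *\<^sub>R x - y"] by simp
    ultimately have "norm (x - y) \<le> 2 * norm (r i *\<^sub>R x - y)"
      by (simp add: norm_minus_commute)
    then show ?case by (rule riesz_kernel_mono_dist[rotated]) simp
  qed
  show "(\<integral>\<^sup>+ y. ennreal (2 ^ (CARD('n) - 2)) * riesz_kernel x y \<partial>\<mu>) < \<infinity>"
    using fin by (simp add: nn_integral_cmult pot_def ennreal_mult_less_top)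
qed measurable

definition radii :: "nat \<Rightarrow> real" where
  "radii i = 1 - inverse (real (Suc i))"

lemma radii: "0 \<le> radii i" "radii i < 1" "radii \<longlonglongrightarrow> 1"
proof -
  show "0 \<le> radii i" "radii i < 1" by (auto simp: radii_def field_simps)
  show "radii \<longlonglongrightarrow> 1"
    using tendsto_diff[OF tendsto_const LIMSEQ_inverse_real_of_nat, of 1] by (simp add: radii_def[abs_def])
qed

lemma pot_sph_le_1:
  fixes x :: "real ^ 'n"
  assumes n: "2 \<le> CARD('n)" and x: "norm x \<le> 1"
  shows "pot sph x = 1"
proof (cases "norm x = 1")
  case True
  have X: "(\<lambda>i. radii i *\<^sub>R x) \<longlonglongrightarrow> x"
    using tendsto_scaleR[OF radii(3) tendsto_const, of x] by simp
  have eq1: "pot sph (radii i *\<^sub>R x) = 1" for i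
    using radii(1,2)[of i] True by (intro pot_sph_interior[OF n]) simp
  \<comment> \<open>Lower semicontinuity first supplies finiteness at x, which the radial limit
    theorem presupposes; the radial limit then gives equality.\<close>
  have "pot sph x \<le> 1"
    using pot_lsc[OF sets_sph X] by (simp add: eq1 Liminf_const)
  then have "pot sph x < \<infinity>" by (auto simp: less_top[symmetric] top_unique)
  from pot_radial_limit[OF sets_sph AE_sph_sphere True this radii]
  have "(\<lambda>i. 1) \<longlonglongrightarrow> pot sph x" by (simp only: eq1)
  then show ?thesis by (simp add: LIMSEQ_const_iff)
qed (use pot_sph_interior[OF n] x in auto)

lemma pot_Kelvin:
  fixes \<mu> :: "(real ^ 'n) measure"
  assumes [measurable_cong]: "sets \<mu> = sets borel" and S: "AE y in \<mu>. norm y = 1" and x: "x \<noteq> 0"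
  shows "pot \<mu> x = ennreal (inverse (norm x) ^ (CARD('n) - 2)) * pot \<mu> (x /\<^sub>R (norm x)\<^sup>2)"
proof -
  have "pot \<mu> x = (\<integral>\<^sup>+ y. ennreal (inverse (norm x) ^ (CARD('n) - 2)) * riesz_kernel (x /\<^sub>R (norm x)\<^sup>2) y \<partial>\<mu>)"
    unfolding pot_def using S x
    by (intro nn_integral_cong_AE) (auto elim!: eventually_mono intro!: riesz_kernel_Kelvin)
  then show ?thesis by (simp add: nn_integral_cmult pot_def)
qed

lemma pot_sph_ge_1:
  fixes x :: "real ^ 'n"
  assumes n: "2 \<le> CARD('n)" and x: "1 \<le> norm x"
  shows "pot sph x = ennreal (inverse (norm x) ^ (CARD('n) - 2))"
proof -
  have "x \<noteq> 0" using x by auto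
  have "norm (x /\<^sub>R (norm x)\<^sup>2) = inverse (norm x)"
    using x \<open>x \<noteq> 0\<close> by (simp add: power2_eq_square)
  also have "\<dots> \<le> 1" using x by (simp add: inverse_le_1_iff)
  finally have "pot sph (x /\<^sub>R (norm x)\<^sup>2) = 1" by (rule pot_sph_le_1[OF n])
  then show ?thesis using pot_Kelvin[OF sets_sph AE_sph_sphere \<open>x \<noteq> 0\<close>] by simp
qed

text \<open>Newton's theorem on spherical shells: after translation and scaling, the mean is the
  potential of \<open>sph\<close> at the relative position \<open>u\<close> of the pole, constant
  inside the shell and that of a central unit charge outside.\<close>

lemma sphere_mean_riesz_kernel:
  fixes c y :: "real ^ 'n"
  assumes n: "2 \<le> CARD('n)" and \<rho>: "0 < \<rho>"
  shows "(\<integral>\<^sup>+ z. riesz_kernel (c + \<rho> *\<^sub>R z) y \<partial>sph) =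
    (if norm (c - y) \<le> \<rho> then ennreal (inverse \<rho> ^ (CARD('n) - 2)) else riesz_kernel c y)"
proof -
  define u where "u = (y - c) /\<^sub>R \<rho>"
  have y: "y = c + \<rho> *\<^sub>R u" using \<rho> by (simp add: u_def)
  have nu: "norm (c - y) = \<rho> * norm u" using \<rho> by (simp add: y)
  have K: "riesz_kernel (c + \<rho> *\<^sub>R z) y = ennreal (inverse \<rho> ^ (CARD('n) - 2)) * riesz_kernel u z" for z
    using riesz_kernel_scale[OF \<rho>, of z u] unfolding y
    by (simp add: riesz_kernel_def norm_minus_commute)
  have "(\<integral>\<^sup>+ z. riesz_kernel (c + \<rho> *\<^sub>R z) y \<partial>sph) = ennreal (inverse \<rho> ^ (CARD('n) - 2)) * pot sph u"
    by (simp add: K nn_integral_cmult pot_def)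
  also have "\<dots> = (if norm (c - y) \<le> \<rho> then ennreal (inverse \<rho> ^ (CARD('n) - 2)) else riesz_kernel c y)"
  proof (cases "norm u \<le> 1")
    case True
    then show ?thesis using \<rho> pot_sph_le_1[OF n True] by (simp add: nu)
  next
    case False
    then have "u \<noteq> 0" by auto
    have "riesz_kernel c y = ennreal (inverse \<rho> ^ (CARD('n) - 2)) * riesz_kernel u 0"
      using K[of 0] by simp
    also have "riesz_kernel u 0 = ennreal (inverse (norm u) ^ (CARD('n) - 2))"
      using \<open>u \<noteq> 0\<close> by (simp add: riesz_kernel_rk rk_def)
    finally show ?thesis using \<rho> pot_sph_ge_1[OF n, of u] False by (simp add: nu not_le)
  qed
  finally show ?thesis .
qed

text \<open>By Fubini, averaging a potential over a sphere cuts its kernel off at the height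
  \<rho>^(2-n). This makes both the super-mean value inequality and its case of equality
  visible.\<close>

lemma sphere_mean_pot:
  fixes \<mu> :: "(real ^ 'n) measure"
  assumes n: "2 \<le> CARD('n)" and \<rho>: "0 < \<rho>" and "finite_measure \<mu>" and [measurable_cong]: "sets \<mu> = sets borel"
  shows "(\<integral>\<^sup>+ z. pot \<mu> (c + \<rho> *\<^sub>R z) \<partial>sph) =
    (\<integral>\<^sup>+ y. (if norm (c - y) \<le> \<rho> then ennreal (inverse \<rho> ^ (CARD('n) - 2)) else riesz_kernel c y) \<partial>\<mu>)"
proof -
  interpret finite_measure \<mu> by fact
  interpret pair_sigma_finite sph \<mu> ..
  have "(\<integral>\<^sup>+ z. pot \<mu> (c + \<rho> *\<^sub>R z) \<partial>sph) = (\<integral>\<^sup>+ y. \<integral>\<^sup>+ z. riesz_kernel (c + \<rho> *\<^sub>R z) y \<partial>sph \<partial>\<mu>)"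
    unfolding pot_def by (rule Fubini'[symmetric]) measurable
  then show ?thesis by (simp add: sphere_mean_riesz_kernel[OF n \<rho>])
qed

lemma mean_kernel_le:
  fixes c y :: "real ^ 'n"
  assumes "0 < \<rho>"
  shows "(if norm (c - y) \<le> \<rho> then ennreal (inverse \<rho> ^ (CARD('n) - 2)) else riesz_kernel c y) \<le> riesz_kernel c y"
proof (cases "norm (c - y) \<le> \<rho>")
  case True
  have "inverse (ennreal (\<rho> ^ (CARD('n) - 2))) \<le> riesz_kernel c y"
    unfolding riesz_kernel_inverse using True by (intro ennreal_inverse_antimono ennreal_leI power_mono) auto
  then show ?thesis using True assms by (simp add: inverse_ennreal power_inverse)
qed simp

lemma sphere_mean_pot_le:
  fixes \<mu> :: "(real ^ 'n) measure"
  assumes "2 \<le> CARD('n)" "0 < \<rho>" "finite_measure \<mu>" "sets \<mu> = sets borel"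
  shows "(\<integral>\<^sup>+ z. pot \<mu> (c + \<rho> *\<^sub>R z) \<partial>sph) \<le> pot \<mu> c"
  unfolding sphere_mean_pot[OF assms] unfolding pot_def by (intro nn_integral_mono mean_kernel_le assms)

lemma sphere_mean_pot_eq:
  fixes \<mu> :: "(real ^ 'n) measure"
  assumes "2 \<le> CARD('n)" "0 < \<rho>" "finite_measure \<mu>" and sets: "sets \<mu> = sets borel"
    and off: "AE y in \<mu>. \<rho> \<le> norm (c - y)"
  shows "(\<integral>\<^sup>+ z. pot \<mu> (c + \<rho> *\<^sub>R z) \<partial>sph) = pot \<mu> c"
  unfolding sphere_mean_pot[OF assms(1-4)] unfolding pot_def using off
proof (intro nn_integral_cong_AE, eventually_elim)
  case (elim y)
  show ?case
    using elim \<open>0 < \<rho>\<close> by (auto simp: riesz_kernel_inverse inverse_ennreal power_inverse)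
qed

subsection \<open>Support, minimum principle and domination\<close>

definition msupp :: "'a::metric_space measure \<Rightarrow> 'a set" where
  "msupp \<mu> = {x. \<forall>e>0. emeasure \<mu> (ball x e) \<noteq> 0}"

lemma closed_msupp:
  assumes [simp]: "sets \<mu> = sets borel"
  shows "closed (msupp \<mu>)"
proof -
  have "\<exists>e>0. ball x e \<subseteq> - msupp \<mu>" if x: "x \<in> - msupp \<mu>" for x
  proof -
    obtain e where e: "0 < e" "emeasure \<mu> (ball x e) = 0"
      using x by (auto simp: msupp_def)
    have "y \<notin> msupp \<mu>" if "y \<in> ball x (e / 2)" for y
    proof -
      have "ball y (e / 2) \<subseteq> ball x e"
      proof
        fix z assume "z \<in> ball y (e / 2)"
        then show "z \<in> ball x e" using that dist_triangle[of x z y] by auto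
      qed
      then have "emeasure \<mu> (ball y (e / 2)) \<le> emeasure \<mu> (ball x e)"
        by (intro emeasure_mono) auto
      then show ?thesis using e by (auto simp: msupp_def intro!: exI[of _ "e / 2"])
    qed
    then show ?thesis using e by (intro exI[of _ "e / 2"]) auto
  qed
  then show ?thesis unfolding closed_def open_contains_ball by blast
qed

lemma null_off_msupp:
  fixes \<mu> :: "'a::{metric_space, second_countable_topology} measure"
  assumes [simp]: "sets \<mu> = sets borel"
  shows "emeasure \<mu> (- msupp \<mu>) = 0"
proof -
  define F where "F = {B. \<exists>x e. B = ball x e \<and> emeasure \<mu> B = 0}"
  obtain F' where F': "F' \<subseteq> F" "countable F'" "\<Union>F' = \<Union>F"
    using Lindelof[of F] unfolding F_def by blast
  have "- msupp \<mu> \<subseteq> \<Union>F"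
  proof
    fix x assume "x \<in> - msupp \<mu>"
    then obtain e where "0 < e" "emeasure \<mu> (ball x e) = 0" by (auto simp: msupp_def)
    then show "x \<in> \<Union>F" unfolding F_def by (intro UnionI[of "ball x e"]) auto
  qed
  moreover have "\<Union>F' \<in> null_sets \<mu>"
    using F'(2)
  proof (rule null_sets_UN'[of F' "\<lambda>B. B", simplified])
    show "B \<in> null_sets \<mu>" if "B \<in> F'" for B
      using that F'(1) by (auto simp: F_def null_sets_def)
  qed
  ultimately have "emeasure \<mu> (- msupp \<mu>) \<le> emeasure \<mu> (\<Union>F')"
    using F'(3) by (intro emeasure_mono) (auto dest: null_setsD2)
  also have "\<dots> = 0" using \<open>\<Union>F' \<in> null_sets \<mu>\<close> by (rule null_setsD1)
  finally show ?thesis by simp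
qed

lemma msupp_subset:
  assumes [simp]: "sets \<mu> = sets borel" and "closed A" and A: "AE y in \<mu>. y \<in> A"
  shows "msupp \<mu> \<subseteq> A"
proof (rule ccontr)
  assume "\<not> msupp \<mu> \<subseteq> A"
  then obtain x where x: "x \<in> msupp \<mu>" "x \<notin> A" by blast
  then obtain e where e: "0 < e" "ball x e \<subseteq> - A"
    using \<open>closed A\<close> by (meson ComplI open_Compl open_contains_ball)
  have "AE y in \<mu>. y \<notin> ball x e" using A by eventually_elim (use e in auto)
  then have "emeasure \<mu> (ball x e) = 0"
    using emeasure_eq_0_AE[of "\<lambda>y. y \<in> ball x e" \<mu>] by (simp add: ball_def sets_eq_imp_space_eq[OF assms(1)])
  then show False using x e by (auto simp: msupp_def)
qed

text \<open>The measures live on the Borel sets of the whole space and sit on the sphere only almost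
  everywhere, so that sums, densities and weak limits stay within one sigma-algebra. The passage to
  the sigma-algebra of the sphere is postponed to \<open>normalised_potential\<close>.\<close>

locale sphere_measure = finite_measure \<mu> for \<mu> :: "(real ^ 'n) measure" +
  assumes sets_eq [measurable_cong]: "sets \<mu> = sets borel"
    and AE_sphere: "AE y in \<mu>. norm y = 1"

sublocale sphere_measure \<subseteq> carried_measure \<mu> "msupp \<mu>"
  by unfold_locales (auto simp: sets_eq closed_msupp null_off_msupp)

lemma sphere_measure_sph: "sphere_measure sph"
  by unfold_locales (auto simp: AE_sph_sphere)

context sphere_measure
begin

lemma msupp_sphere: "msupp \<mu> \<subseteq> sphere 0 1"
  using AE_sphere by (intro msupp_subset) (auto simp: sets_eq)

lemma tendsto_pot_far:
  assumes B [measurable]: "B \<in> sets borel" and \<delta>: "0 < \<delta>" "\<And>y. y \<in> B \<Longrightarrow> \<delta> \<le> dist x0 y"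
    and X: "X \<longlonglongrightarrow> x0"
  shows "(\<lambda>i. \<integral>\<^sup>+y. riesz_kernel (X i) y * indicator B y \<partial>\<mu>) \<longlonglongrightarrow> (\<integral>\<^sup>+y. riesz_kernel x0 y * indicator B y \<partial>\<mu>)"
proof -
  define Y where "Y i = (if dist (X i) x0 < \<delta> / 2 then X i else x0)" for i
  have ev: "\<forall>\<^sub>F i in sequentially. Y i = X i"
    using tendstoD[OF X, of "\<delta> / 2"] \<delta> by (auto simp: Y_def elim!: eventually_mono)
  have Y: "Y \<longlonglongrightarrow> x0"
    using X ev by (metis (mono_tags, lifting) Lim_transform_eventually eventually_mono)
  have Yd: "dist (Y i) x0 < \<delta> / 2" for i using \<delta> by (auto simp: Y_def)
  have "(\<lambda>i. \<integral>\<^sup>+y. riesz_kernel (Y i) y * indicator B y \<partial>\<mu>) \<longlonglongrightarrow> (\<integral>\<^sup>+y. riesz_kernel x0 y * indicator B y \<partial>\<mu>)"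
  proof (rule nn_integral_dominated_convergence[where w="\<lambda>_. ennreal (inverse (\<delta> / 2) ^ (CARD('n) - 2))"])
    show "AE y in \<mu>. riesz_kernel (Y i) y * indicator B y \<le> ennreal (inverse (\<delta> / 2) ^ (CARD('n) - 2))" for i
    proof (intro AE_I2)
      fix y
      show "riesz_kernel (Y i) y * indicator B y \<le> ennreal (inverse (\<delta> / 2) ^ (CARD('n) - 2))"
      proof (cases "y \<in> B")
        case True
        have "\<delta> / 2 \<le> norm (Y i - y)"
          using \<delta>(2)[OF True] Yd[of i] dist_triangle[of x0 y "Y i"] by (simp add: dist_commute[of "Y i"] flip: dist_norm)
        moreover from this have "Y i \<noteq> y" using \<delta> by auto
        ultimately show ?thesis
          using True rk_le[of "\<delta> / 2" "Y i" y] \<delta> by (simp add: riesz_kernel_rk ennreal_leI)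
      qed simp
    qed
    show "AE y in \<mu>. (\<lambda>i. riesz_kernel (Y i) y * indicator B y) \<longlonglongrightarrow> riesz_kernel x0 y * indicator B y"
    proof (intro AE_I2)
      fix y
      show "(\<lambda>i. riesz_kernel (Y i) y * indicator B y) \<longlonglongrightarrow> riesz_kernel x0 y * indicator B y"
        using tendsto_riesz_kernel[OF Y, of y] by (cases "y \<in> B") auto
    qed
    show "(\<integral>\<^sup>+y. ennreal (inverse (\<delta> / 2) ^ (CARD('n) - 2)) \<partial>\<mu>) < \<infinity>"
      by (simp add: less_top[symmetric] ennreal_mult_eq_top_iff)
  qed measurable
  then show ?thesis
    by (rule Lim_transform_eventually) (use ev in \<open>auto elim: eventually_mono\<close>)
qed

lemma tendsto_pot_off:
  assumes "x0 \<notin> msupp \<mu>" and X: "X \<longlonglongrightarrow> x0"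
  shows "(\<lambda>i. pot \<mu> (X i)) \<longlonglongrightarrow> pot \<mu> x0"
proof -
  obtain \<delta> where \<delta>: "0 < \<delta>" "\<And>y. y \<in> msupp \<mu> \<Longrightarrow> \<delta> \<le> dist x0 y"
    using carrier_distance[OF assms(1)] by (metis centre_in_ball dist_norm)
  have [measurable]: "msupp \<mu> \<in> sets borel" using closed_carrier by (rule borel_closed)
  have "pot \<mu> x = (\<integral>\<^sup>+y. riesz_kernel x y * indicator (msupp \<mu>) y \<partial>\<mu>)" for x
    unfolding pot_def using AE_carrier by (intro nn_integral_cong_AE) (auto elim!: eventually_mono)
  then show ?thesis using tendsto_pot_far[OF _ \<delta> X] by simp
qed

lemma AE_not_atom:
  assumes n: "3 \<le> CARD('n)" and fin: "pot \<mu> x < \<infinity>"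
  shows "AE y in \<mu>. y \<noteq> x"
proof -
  have "AE y in \<mu>. riesz_kernel x y \<noteq> \<infinity>"
    using fin unfolding pot_def by (intro nn_integral_PInf_AE) auto
  then show ?thesis
    by eventually_elim (use n in \<open>auto simp: riesz_kernel_inverse\<close>)
qed

text \<open>For \<open>x\<close> off the support and \<open>a\<close> a nearest point of the support, \<open>|a - y| \<le> 2 |x - y|\<close> for all \<open>y\<close> in the
  support.  So smallness near \<open>x0\<close> of the part of the potential generated near \<open>x0\<close> need only be checked on the
  support.\<close>

lemma continuity_principle:
  assumes n: "3 \<le> CARD('n)"
    and fin: "\<And>x. x \<in> msupp \<mu> \<Longrightarrow> pot \<mu> x < \<infinity>"
    and cont: "\<And>X x. (\<And>i. X i \<in> msupp \<mu>) \<Longrightarrow> x \<in> msupp \<mu> \<Longrightarrow> X \<longlonglongrightarrow> x \<Longrightarrow> (\<lambda>i. pot \<mu> (X i)) \<longlonglongrightarrow> pot \<mu> x"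
  shows "continuous_on UNIV (pot \<mu>)"
proof -
  let ?m = "CARD('n) - 2"
  have "(\<lambda>i. pot \<mu> (X i)) \<longlonglongrightarrow> pot \<mu> x0" if X: "X \<longlonglongrightarrow> x0" for X x0
  proof (cases "x0 \<in> msupp \<mu>")
    case False
    then show ?thesis using tendsto_pot_off X by blast
  next
    case x0: True
    have fin0: "pot \<mu> x0 < \<infinity>" using fin x0 by blast
    define N where "N \<delta> x = (\<integral>\<^sup>+y. riesz_kernel x y * indicator (ball x0 \<delta>) y \<partial>\<mu>)" for \<delta> x
    define F where "F \<delta> x = (\<integral>\<^sup>+y. riesz_kernel x y * indicator (- ball x0 \<delta>) y \<partial>\<mu>)" for \<delta> x
    have [measurable]: "ball x0 \<delta> \<in> sets borel" "- ball x0 \<delta> \<in> sets borel" for \<delta> by auto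
    have split: "pot \<mu> x = N \<delta> x + F \<delta> x" for x \<delta>
    proof -
      have "N \<delta> x + F \<delta> x = (\<integral>\<^sup>+y. riesz_kernel x y * indicator (ball x0 \<delta>) y + riesz_kernel x y * indicator (- ball x0 \<delta>) y \<partial>\<mu>)"
        unfolding N_def F_def by (rule nn_integral_add[symmetric]) measurable
      also have "\<dots> = pot \<mu> x"
        unfolding pot_def by (intro nn_integral_cong) (auto simp: indicator_def)
      finally show ?thesis ..
    qed
    have F: "(\<lambda>i. F \<delta> (Y i)) \<longlonglongrightarrow> F \<delta> x0" if "0 < \<delta>" "Y \<longlonglongrightarrow> x0" for \<delta> Y
      unfolding F_def using that by (intro tendsto_pot_far[where \<delta>=\<delta>]) auto
    have N0: "(\<lambda>j. N (inverse (Suc j)) x0) \<longlonglongrightarrow> 0"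
    proof -
      have "(\<lambda>j. N (inverse (Suc j)) x0) \<longlonglongrightarrow> (\<integral>\<^sup>+y. 0 \<partial>\<mu>)"
        unfolding N_def
      proof (rule nn_integral_dominated_convergence[where w="riesz_kernel x0"])
        show "AE y in \<mu>. (\<lambda>j. riesz_kernel x0 y * indicator (ball x0 (inverse (Suc j))) y) \<longlonglongrightarrow> 0"
          using AE_not_atom[OF n fin0]
        proof eventually_elim
          case (elim y)
          then have "\<forall>\<^sub>F j in sequentially. inverse (real (Suc j)) < dist x0 y"
            by (intro order_tendstoD(2)[OF LIMSEQ_inverse_real_of_nat]) simp
          then have "\<forall>\<^sub>F j in sequentially. 0 = riesz_kernel x0 y * indicator (ball x0 (inverse (Suc j))) y"
            by eventually_elim simp
          then show ?case by (rule Lim_transform_eventually[OF tendsto_const])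
        qed
      qed (use fin0 in \<open>auto simp: pot_def indicator_def\<close>)
      then show ?thesis by simp
    qed
    define a where "a i = closest_point (msupp \<mu>) (X i)" for i
    have ne: "msupp \<mu> \<noteq> {}" using x0 by auto
    have a: "a i \<in> msupp \<mu>" and a_le: "\<And>y. y \<in> msupp \<mu> \<Longrightarrow> dist (X i) (a i) \<le> dist (X i) y" for i
      unfolding a_def using closest_point_exists[OF closed_carrier ne] by auto
    have "(\<lambda>i. dist (a i) x0) \<longlonglongrightarrow> 0"
    proof (rule tendsto_sandwich[OF _ _ tendsto_const])
      show "\<forall>\<^sub>F i in sequentially. dist (a i) x0 \<le> 2 * dist (X i) x0"
      proof (intro always_eventually allI)
        fix i show "dist (a i) x0 \<le> 2 * dist (X i) x0"
          using a_le[OF x0, of i] dist_triangle[of "a i" x0 "X i"] by (simp add: dist_commute)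
      qed
      show "(\<lambda>i. 2 * dist (X i) x0) \<longlonglongrightarrow> 0"
        using X by (intro tendsto_mult_right_zero) (simp add: tendsto_dist_iff[symmetric])
    qed simp
    then have alim: "a \<longlonglongrightarrow> x0" by (rule tendsto_dist_iff[THEN iffD2])
    have Nle: "N \<delta> (X i) \<le> ennreal (2 ^ ?m) * N \<delta> (a i)" for \<delta> i
    proof -
      have "N \<delta> (X i) \<le> (\<integral>\<^sup>+y. ennreal (2 ^ ?m) * (riesz_kernel (a i) y * indicator (ball x0 \<delta>) y) \<partial>\<mu>)"
        unfolding N_def using AE_carrier
      proof (intro nn_integral_mono_AE, eventually_elim)
        case (elim y)
        have "norm (a i - y) \<le> 2 * norm (X i - y)"
          using a_le[OF elim(2), of i] dist_triangle[of "a i" y "X i"] by (simp add: dist_norm norm_minus_commute)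
        then have "riesz_kernel (X i) y \<le> ennreal (2 ^ ?m) * riesz_kernel (a i) y"
          by (rule riesz_kernel_mono_dist[rotated]) simp
        then show ?case by (auto simp: indicator_def)
      qed
      also have "\<dots> = ennreal (2 ^ ?m) * N \<delta> (a i)"
        unfolding N_def by (rule nn_integral_cmult) measurable
      finally show ?thesis .
    qed
    have "limsup (\<lambda>i. pot \<mu> (X i)) \<le> pot \<mu> x0 + ennreal e" if e: "0 < e" for e :: real
    proof -
      have "0 < ennreal (e / 2 ^ ?m)" using e by simp
      from order_tendstoD(2)[OF N0 this] obtain j where j: "N (inverse (Suc j)) x0 < ennreal (e / 2 ^ ?m)"
        by (auto simp: eventually_sequentially)
      define \<delta> where "\<delta> = inverse (real (Suc j))"
      have \<delta>: "0 < \<delta>" by (simp add: \<delta>_def)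
      have "F \<delta> x0 \<le> pot \<mu> x0" unfolding split[of x0 \<delta>] by simp
      then have Ffin: "F \<delta> x0 < \<infinity>" using fin0 by (rule le_less_trans)
      have NF: "N \<delta> x = pot \<mu> x - F \<delta> x" if "F \<delta> x < \<infinity>" for x
        using split[of x \<delta>] that by (auto simp: less_top[symmetric])
      \<comment> \<open>At the support points \<open>a i\<close> the whole potential converges by
        hypothesis and the far part converges anyway. So their difference, the near part, converges
        to its value at \<open>x0\<close>, which is below e / 2^(n-2).\<close>
      have "(\<lambda>i. pot \<mu> (a i) - F \<delta> (a i)) \<longlonglongrightarrow> pot \<mu> x0 - F \<delta> x0"
        using fin0 Ffin by (intro tendsto_diff_ennreal F[OF \<delta> alim] cont a x0 alim) auto
      then have "\<forall>\<^sub>F i in sequentially. pot \<mu> (a i) - F \<delta> (a i) < ennreal (e / 2 ^ ?m)"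
        using j NF[OF Ffin] by (intro order_tendstoD(2)) (auto simp: \<delta>_def)
      moreover have "\<forall>\<^sub>F i in sequentially. F \<delta> (a i) < \<infinity>"
        by (rule order_tendstoD(2)[OF F[OF \<delta> alim] Ffin])
      ultimately have "\<forall>\<^sub>F i in sequentially. pot \<mu> (X i) \<le> ennreal e + F \<delta> (X i)"
      proof eventually_elim
        case (elim i)
        have "N \<delta> (X i) \<le> ennreal (2 ^ ?m) * ennreal (e / 2 ^ ?m)"
          using elim NF[of "a i"] by (intro order_trans[OF Nle] mult_left_mono) auto
        also have "\<dots> = ennreal e" using e by (simp flip: ennreal_mult)
        finally show ?case unfolding split[of "X i" \<delta>] by (rule add_right_mono)
      qed
      then have "limsup (\<lambda>i. pot \<mu> (X i)) \<le> limsup (\<lambda>i. ennreal e + F \<delta> (X i))"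
        by (rule Limsup_mono)
      also have "\<dots> = ennreal e + F \<delta> x0"
        by (intro lim_imp_Limsup tendsto_add tendsto_const F[OF \<delta> X]) simp
      also have "\<dots> \<le> pot \<mu> x0 + ennreal e"
        unfolding split[of x0 \<delta>] by (simp add: add.commute add_left_mono)
      finally show ?thesis .
    qed
    then have "limsup (\<lambda>i. pot \<mu> (X i)) \<le> pot \<mu> x0"
      by (rule ennreal_le_epsilon)
    moreover have "pot \<mu> x0 \<le> liminf (\<lambda>i. pot \<mu> (X i))"
      by (rule pot_lsc[OF sets_eq X])
    ultimately show ?thesis
      by (metis Liminf_le_Limsup antisym order_trans tendsto_iff_Liminf_eq_Limsup trivial_limit_sequentially)
  qed
  then show ?thesis
    by (auto simp: continuous_on_sequentially comp_def)
qed

end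

section \<open>Minimum principle and domination through spherical means\<close>

lemma measure_sph_UNIV [simp]: "measure (sph :: (real ^ 'n) measure) UNIV = 1"
  by (simp add: measure_def)

lemma AE_sph_obtain:
  fixes v :: "real ^ 'n"
  assumes P: "AE z in sph. P z" and v: "norm v = 1" "0 < r"
  obtains z where "z \<in> ball v r" "norm z = 1" "P z"
proof (rule ccontr)
  assume "\<not> thesis"
  then have no: "\<not> (z \<in> ball v r \<and> norm z = 1 \<and> P z)" for z using that by blast
  have "AE z in sph. z \<notin> ball v r"
    using P AE_sph_sphere by eventually_elim (use no in blast)
  then have "emeasure sph (ball v r) = 0"
    using emeasure_eq_0_AE[of "\<lambda>z. z \<in> ball v r" sph] by (simp add: ball_def)
  then show False using emeasure_sph_ball_pos[OF v] by simp
qed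

lemma integrable_sph_continuous:
  fixes f :: "real ^ 'n \<Rightarrow> real"
  assumes "continuous_on UNIV f"
  shows "integrable sph (\<lambda>z. f (c + \<rho> *\<^sub>R z))"
proof -
  have "compact ((\<lambda>z. f (c + \<rho> *\<^sub>R z)) ` sphere 0 1)"
    by (intro compact_continuous_image continuous_on_compose2[OF assms] continuous_intros) auto
  then obtain B where "\<forall>z\<in>sphere 0 1. norm (f (c + \<rho> *\<^sub>R z)) \<le> B"
    by (auto dest!: compact_imp_bounded simp: bounded_iff)
  then have "AE z in sph. norm (f (c + \<rho> *\<^sub>R z)) \<le> B"
    using AE_sph_sphere by (auto elim!: eventually_mono)
  moreover have "f \<in> borel_measurable borel"
    using assms by (rule borel_measurable_continuous_onI)
  ultimately show ?thesis
    by (intro sph.integrable_const_bound) auto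
qed

text \<open>A negative infimum is attained, since \<open>W\<close> is almost non-negative far out.
  Among the minimum points take one farthest from the origin: a spherical mean about it which is not
  above the minimum forces the minimum at almost all points of that small sphere, some of which are
  farther out. One radius for each point is enough for this argument, and connectedness of
  \<open>D\<close> does not enter.\<close>

lemma min_principle:
  fixes W :: "real ^ 'n \<Rightarrow> real"
  assumes D: "closed D" "continuous_on D W"
    and inf: "\<And>e. 0 < e \<Longrightarrow> \<exists>r. \<forall>x\<in>D. r < norm x \<longrightarrow> - e \<le> W x"
    and loc: "\<And>x. x \<in> D \<Longrightarrow> W x < 0 \<Longrightarrow> \<exists>\<rho>>0. cball x \<rho> \<subseteq> D \<and> (\<integral>z. W (x + \<rho> *\<^sub>R z) \<partial>sph) \<le> W x"
    and x: "x \<in> D"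
  shows "0 \<le> W x"
proof (rule ccontr)
  assume "\<not> 0 \<le> W x"
  then have neg: "W x < 0" by simp
  obtain r where r: "\<And>y. y \<in> D \<Longrightarrow> r < norm y \<Longrightarrow> W x / 2 \<le> W y"
    using inf[of "- W x / 2"] neg by auto
  define D' where "D' = D \<inter> cball 0 (max r (norm x))"
  have D': "compact D'" "x \<in> D'" "D' \<subseteq> D"
    using D(1) x by (auto simp: D'_def closed_Int_compact)
  obtain y where y: "y \<in> D'" "\<And>z. z \<in> D' \<Longrightarrow> W y \<le> W z"
    using continuous_attains_inf[OF D'(1) _ continuous_on_subset[OF D(2) D'(3)]] D'(2) by blast
  have min: "W y \<le> W z" if "z \<in> D" for z
  proof (cases "z \<in> D'")
    case False
    then have "W x / 2 \<le> W z" using that by (intro r) (auto simp: D'_def)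
    then show ?thesis using y(2)[OF D'(2)] neg by simp
  qed (use y in blast)
  have Wy: "W y < 0" using y(2)[OF D'(2)] neg by simp
  define M where "M = {z \<in> D'. W z = W y}"
  have "M = D' \<inter> W -` {W y}" by (auto simp: M_def)
  moreover have "closed (D' \<inter> W -` {W y})"
    using D' by (intro continuous_closed_preimage continuous_on_subset[OF D(2)]) (auto simp: compact_imp_closed)
  ultimately have "compact M" using D'(1) by (metis compact_Int_closed inf_idem inf_left_idem)
  moreover have "M \<noteq> {}" using y(1) by (auto simp: M_def)
  ultimately obtain w where w: "w \<in> M" "\<And>z. z \<in> M \<Longrightarrow> norm z \<le> norm w"
    using continuous_attains_sup[of M norm] by (auto intro: continuous_on_norm_id)
  have wD: "w \<in> D" "W w = W y" using w(1) D'(3) by (auto simp: M_def)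
  obtain \<rho> where \<rho>: "0 < \<rho>" "cball w \<rho> \<subseteq> D" "(\<integral>z. W (w + \<rho> *\<^sub>R z) \<partial>sph) \<le> W w"
    using loc[OF wD(1)] wD(2) Wy by auto
  \<comment> \<open>A function that is not integrable has integral 0 by convention, and 0 is not
    below the negative value \<open>W w\<close>.\<close>
  have int: "integrable sph (\<lambda>z. W (w + \<rho> *\<^sub>R z))"
    using \<rho>(3) wD(2) Wy not_integrable_integral_eq[of sph "\<lambda>z. W (w + \<rho> *\<^sub>R z)"] by fastforce
  have ge: "AE z in sph. 0 \<le> W (w + \<rho> *\<^sub>R z) - W y"
    using AE_sph_sphere
  proof eventually_elim
    case (elim z)
    then have "w + \<rho> *\<^sub>R z \<in> D" using \<rho> by (intro subsetD[OF \<rho>(2)]) (simp add: dist_norm)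
    then show ?case using min by simp
  qed
  have "(\<integral>z. W (w + \<rho> *\<^sub>R z) - W y \<partial>sph) \<le> 0"
    using \<rho>(3) wD(2) int by simp
  moreover have "0 \<le> (\<integral>z. W (w + \<rho> *\<^sub>R z) - W y \<partial>sph)"
    by (rule integral_nonneg_AE[OF ge])
  ultimately have "(\<integral>z. W (w + \<rho> *\<^sub>R z) - W y \<partial>sph) = 0" by simp
  then have eq: "AE z in sph. W (w + \<rho> *\<^sub>R z) - W y = 0"
    using integral_nonneg_eq_0_iff_AE[OF _ ge] int by simp
  define v where "v = (if w = 0 then axis (SOME i. True) 1 else w /\<^sub>R norm w)"
  have v: "norm v = 1" by (simp add: v_def)
  have wv: "w = norm w *\<^sub>R v" by (simp add: v_def)
  obtain z where z: "z \<in> ball v 1" "norm z = 1" "W (w + \<rho> *\<^sub>R z) - W y = 0"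
    using AE_sph_obtain[OF eq v, of 1] by auto
  have "(norm (v - z))\<^sup>2 < 1" using z(1) by (simp add: dist_norm power_less_one_iff)
  then have "0 < v \<bullet> z"
    using v z(2) by (simp add: power2_norm_eq_inner inner_diff_left inner_diff_right norm_eq_1 inner_commute)
  then have "0 \<le> w \<bullet> z" by (subst wv) simp
  have "(norm (w + \<rho> *\<^sub>R z))\<^sup>2 = (norm w)\<^sup>2 + 2 * \<rho> * (w \<bullet> z) + \<rho>\<^sup>2"
    using z(2) unfolding power2_norm_eq_inner norm_eq_1
    by (simp add: inner_add_left inner_add_right inner_commute power2_eq_square)
  also have "\<dots> > (norm w)\<^sup>2"
    using \<rho>(1) \<open>0 \<le> w \<bullet> z\<close> by (simp add: add_nonneg_pos)
  finally have bigger: "norm w < norm (w + \<rho> *\<^sub>R z)"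
    by (rule power2_less_imp_less) simp
  have "w + \<rho> *\<^sub>R z \<in> D" using \<rho> z(2) by (intro subsetD[OF \<rho>(2)]) (simp add: dist_norm)
  moreover have "w + \<rho> *\<^sub>R z \<in> cball 0 (max r (norm x))"
  proof (rule ccontr)
    assume "w + \<rho> *\<^sub>R z \<notin> cball 0 (max r (norm x))"
    then have "W x / 2 \<le> W (w + \<rho> *\<^sub>R z)" using calculation by (intro r) auto
    then show False using z(3) y(2)[OF D'(2)] neg by simp
  qed
  ultimately have "w + \<rho> *\<^sub>R z \<in> M" using z(3) by (simp add: M_def D'_def)
  then show False using w(2) bigger by fastforce
qed

definition supermean :: "(real ^ 'n \<Rightarrow> real) \<Rightarrow> bool" where
  "supermean s \<longleftrightarrow> continuous_on UNIV s \<and> (\<forall>x. 0 \<le> s x) \<and>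
     (\<forall>c \<rho>. 0 < \<rho> \<longrightarrow> (\<integral>z. s (c + \<rho> *\<^sub>R z) \<partial>sph) \<le> s c)"

lemma supermean_add: "supermean s \<Longrightarrow> supermean t \<Longrightarrow> supermean (\<lambda>x. s x + t x)"
  unfolding supermean_def by (auto simp: integrable_sph_continuous intro!: continuous_intros add_mono)

lemma supermean_cmult: "supermean s \<Longrightarrow> 0 \<le> a \<Longrightarrow> supermean (\<lambda>x. a * s x)"
  unfolding supermean_def by (auto simp: integrable_sph_continuous intro!: continuous_intros mult_left_mono)

abbreviation pr :: "(real ^ 'n) measure \<Rightarrow> real ^ 'n \<Rightarrow> real" where
  "pr \<mu> x \<equiv> enn2real (pot \<mu> x)"

lemma continuous_on_pr:
  assumes "continuous_on UNIV (pot \<mu>)" "\<And>x. pot \<mu> x < \<infinity>"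
  shows "continuous_on UNIV (pr \<mu>)"
proof -
  have "(\<lambda>i. pr \<mu> (X i)) \<longlonglongrightarrow> pr \<mu> x" if "X \<longlonglongrightarrow> x" for X x
    using continuous_on_tendsto_compose[OF assms(1) that] assms(2)[of x]
    by (intro tendsto_enn2real) (auto simp: less_top)
  then show ?thesis by (auto simp: continuous_on_sequentially comp_def)
qed

lemma pr_mean:
  fixes \<mu> :: "(real ^ 'n) measure"
  assumes "2 \<le> CARD('n)" "finite_measure \<mu>" "sets \<mu> = sets borel"
    and cont: "continuous_on UNIV (pot \<mu>)" and fin: "\<And>x. pot \<mu> x < \<infinity>" and \<rho>: "0 < \<rho>"
  shows "ennreal (\<integral>z. pr \<mu> (c + \<rho> *\<^sub>R z) \<partial>sph) = (\<integral>\<^sup>+ z. pot \<mu> (c + \<rho> *\<^sub>R z) \<partial>sph)"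
proof -
  have "ennreal (\<integral>z. pr \<mu> (c + \<rho> *\<^sub>R z) \<partial>sph) = (\<integral>\<^sup>+ z. ennreal (pr \<mu> (c + \<rho> *\<^sub>R z)) \<partial>sph)"
    by (intro nn_integral_eq_integral[symmetric] integrable_sph_continuous continuous_on_pr cont fin) simp
  then show ?thesis using fin by (simp add: less_top)
qed

lemma supermean_pr:
  fixes \<mu> :: "(real ^ 'n) measure"
  assumes "2 \<le> CARD('n)" "finite_measure \<mu>" "sets \<mu> = sets borel"
    and cont: "continuous_on UNIV (pot \<mu>)" and fin: "\<And>x. pot \<mu> x < \<infinity>"
  shows "supermean (pr \<mu>)"
  unfolding supermean_def
proof (intro conjI allI impI)
  fix c :: "real ^ 'n" and \<rho> :: real assume \<rho>: "0 < \<rho>"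
  have "ennreal (\<integral>z. pr \<mu> (c + \<rho> *\<^sub>R z) \<partial>sph) \<le> ennreal (pr \<mu> c)"
    unfolding pr_mean[OF assms \<rho>] using sphere_mean_pot_le[OF assms(1) \<rho> assms(2,3), of c] fin[of c]
    by (simp add: less_top)
  then show "(\<integral>z. pr \<mu> (c + \<rho> *\<^sub>R z) \<partial>sph) \<le> pr \<mu> c"
    by (simp add: ennreal_le_iff)
qed (use continuous_on_pr[OF cont fin] in auto)

lemma pr_mean_eq:
  fixes \<mu> :: "(real ^ 'n) measure"
  assumes "2 \<le> CARD('n)" "finite_measure \<mu>" "sets \<mu> = sets borel"
    and cont: "continuous_on UNIV (pot \<mu>)" and fin: "\<And>x. pot \<mu> x < \<infinity>" and \<rho>: "0 < \<rho>"
    and off: "AE y in \<mu>. \<rho> \<le> norm (c - y)"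
  shows "(\<integral>z. pr \<mu> (c + \<rho> *\<^sub>R z) \<partial>sph) = pr \<mu> c"
proof -
  have "ennreal (\<integral>z. pr \<mu> (c + \<rho> *\<^sub>R z) \<partial>sph) = ennreal (pr \<mu> c)"
    unfolding pr_mean[OF assms(1-6)] using sphere_mean_pot_eq[OF assms(1) \<rho> assms(2,3) off] fin[of c]
    by (simp add: less_top)
  then show ?thesis by (simp add: integral_nonneg)
qed

context sphere_measure
begin

lemma pot_le_far:
  assumes n: "3 \<le> CARD('n)" and x: "2 \<le> norm x"
  shows "pot \<mu> x \<le> ennreal (measure \<mu> UNIV / (norm x - 1))"
proof -
  have "pot \<mu> x \<le> (\<integral>\<^sup>+y. ennreal (inverse (norm x - 1)) \<partial>\<mu>)"
    unfolding pot_def using AE_sphere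
  proof (intro nn_integral_mono_AE, eventually_elim)
    case (elim y)
    have d: "norm x - 1 \<le> norm (x - y)" using norm_triangle_ineq2[of x y] elim by simp
    then have ne: "x \<noteq> y" using x by auto
    have "rk x y \<le> inverse (norm x - 1) ^ (CARD('n) - 2)" using d x by (intro rk_le) auto
    also have "\<dots> \<le> inverse (norm x - 1) ^ 1"
      using n x by (intro power_decreasing) (auto simp: inverse_le_1_iff)
    finally show ?case using ne by (simp add: riesz_kernel_rk ennreal_leI)
  qed
  also have "\<dots> = ennreal (measure \<mu> UNIV / (norm x - 1))"
    using x emeasure_eq_measure[of UNIV] by (simp add: divide_inverse mult.commute flip: ennreal_mult)
  finally show ?thesis .
qed

lemma pr_vanishes_at_infinity:
  assumes n: "3 \<le> CARD('n)" and e: "0 < e"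
  shows "\<exists>r. \<forall>x. r < norm x \<longrightarrow> pr \<mu> x \<le> e"
proof (intro exI[of _ "2 + measure \<mu> UNIV / e"] allI impI)
  fix x :: "real ^ 'n" assume x: "2 + measure \<mu> UNIV / e < norm x"
  have m: "0 \<le> measure \<mu> UNIV / e" using e by simp
  have x2: "2 \<le> norm x" using m x by linarith
  have "pr \<mu> x \<le> measure \<mu> UNIV / (norm x - 1)"
    using x2 by (intro enn2real_leI pot_le_far[OF n]) auto
  also have "\<dots> \<le> e"
  proof -
    have "measure \<mu> UNIV / e \<le> norm x - 1" using x by simp
    then show ?thesis using e x2 by (simp add: divide_simps mult.commute split: if_splits)
  qed
  finally show "pr \<mu> x \<le> e" .
qed

text \<open>Off the support \<open>pr \<mu>\<close> has the mean value property on small spheres, so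
  \<open>s - pr \<mu>\<close> satisfies the super-mean inequality wherever it could be negative. At
  infinity \<open>pr \<mu>\<close> vanishes while \<open>s\<close> is non-negative.\<close>

lemma domination:
  assumes n: "3 \<le> CARD('n)"
    and cont: "continuous_on UNIV (pot \<mu>)" and fin: "\<And>x. pot \<mu> x < \<infinity>"
    and s: "supermean s" and le: "\<And>x. x \<in> msupp \<mu> \<Longrightarrow> pr \<mu> x \<le> s x"
  shows "pr \<mu> x \<le> s x"
proof -
  have n2: "2 \<le> CARD('n)" using n by simp
  have "0 \<le> s x - pr \<mu> x"
  proof (rule min_principle[where D=UNIV])
    show "continuous_on UNIV (\<lambda>x. s x - pr \<mu> x)"
      using s continuous_on_pr[OF cont fin] by (auto simp: supermean_def intro!: continuous_intros)
    fix e :: real assume e: "0 < e"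
    obtain r where r: "\<And>x. r < norm x \<Longrightarrow> pr \<mu> x \<le> e" using pr_vanishes_at_infinity[OF n e] by blast
    have "- e \<le> s x - pr \<mu> x" if "r < norm x" for x
      using r[OF that] s by (auto simp: supermean_def intro: add_nonneg_nonneg order_trans[of _ "- pr \<mu> x"])
    then show "\<exists>r. \<forall>x\<in>UNIV. r < norm x \<longrightarrow> - e \<le> s x - pr \<mu> x" by blast
  next
    fix x assume "s x - pr \<mu> x < 0"
    then have "x \<notin> msupp \<mu>" using le[of x] by auto
    then obtain \<rho> where \<rho>: "0 < \<rho>" "\<And>y. y \<in> msupp \<mu> \<Longrightarrow> \<rho> \<le> norm (x - y)"
      using carrier_distance by (metis centre_in_ball)
    have "(\<integral>z. pr \<mu> (x + \<rho> *\<^sub>R z) \<partial>sph) = pr \<mu> x"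
      using AE_carrier \<rho> finite_measure_axioms
      by (intro pr_mean_eq[OF n2 _ sets_eq cont fin]) (auto elim: eventually_mono)
    moreover have "(\<integral>z. s (x + \<rho> *\<^sub>R z) \<partial>sph) \<le> s x"
      using s \<rho>(1) by (auto simp: supermean_def)
    moreover have "integrable sph (\<lambda>z. s (x + \<rho> *\<^sub>R z))" "integrable sph (\<lambda>z. pr \<mu> (x + \<rho> *\<^sub>R z))"
      using s continuous_on_pr[OF cont fin] by (auto simp: supermean_def intro: integrable_sph_continuous)
    ultimately show "\<exists>\<rho>>0. cball x \<rho> \<subseteq> UNIV \<and> (\<integral>z. s (x + \<rho> *\<^sub>R z) - pr \<mu> (x + \<rho> *\<^sub>R z) \<partial>sph) \<le> s x - pr \<mu> x"
      using \<rho>(1) by (intro exI[of _ \<rho>]) auto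
  qed auto
  then show ?thesis by simp
qed

end

text \<open>The case of equality in the mean value inequality: a non-negative function with mean 0
  vanishes almost everywhere on each small sphere about x, hence everywhere there by continuity and
  full support.\<close>

lemma zero_spread:
  fixes W :: "real ^ 'n \<Rightarrow> real"
  assumes W: "continuous_on (ball x r) W" "\<And>y. y \<in> ball x r \<Longrightarrow> 0 \<le> W y" "W x = 0"
    and mean: "\<And>\<rho>. 0 < \<rho> \<Longrightarrow> \<rho> < r \<Longrightarrow> integrable sph (\<lambda>z. W (x + \<rho> *\<^sub>R z)) \<and> (\<integral>z. W (x + \<rho> *\<^sub>R z) \<partial>sph) \<le> W x"
    and y: "y \<in> ball x r"
  shows "W y = 0"
proof (cases "y = x")
  case False
  define \<rho> where "\<rho> = norm (y - x)"
  have \<rho>: "0 < \<rho>" "\<rho> < r" using False y by (auto simp: \<rho>_def dist_norm norm_minus_commute)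
  define v where "v = (y - x) /\<^sub>R \<rho>"
  have v: "norm v = 1" "x + \<rho> *\<^sub>R v = y" using \<rho> by (auto simp: v_def \<rho>_def)
  have memb: "x + \<rho> *\<^sub>R z \<in> ball x r" if "norm z = 1" for z
    using that \<rho> by (simp add: dist_norm)
  have ge: "AE z in sph. 0 \<le> W (x + \<rho> *\<^sub>R z)"
    using AE_sph_sphere by eventually_elim (use W(2) memb in blast)
  have "(\<integral>z. W (x + \<rho> *\<^sub>R z) \<partial>sph) = 0"
    using mean[OF \<rho>] W(3) integral_nonneg_AE[OF ge] by simp
  then have ae: "AE z in sph. W (x + \<rho> *\<^sub>R z) = 0"
    using integral_nonneg_eq_0_iff_AE[OF _ ge] mean[OF \<rho>] by simp
  show ?thesis
  proof (rule ccontr)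
    assume "W y \<noteq> 0"
    have "isCont W y" using W(1) y by (simp add: continuous_on_eq_continuous_at)
    then obtain d where d: "0 < d" "\<And>z. dist z y < d \<Longrightarrow> dist (W z) (W y) < \<bar>W y\<bar>"
      using \<open>W y \<noteq> 0\<close> unfolding continuous_at_eps_delta by (metis zero_less_abs_iff)
    obtain z where z: "z \<in> ball v (d / \<rho>)" "norm z = 1" "W (x + \<rho> *\<^sub>R z) = 0"
      using AE_sph_obtain[OF ae v(1), of "d / \<rho>"] d(1) \<rho>(1) by auto
    have "dist (x + \<rho> *\<^sub>R z) y = \<rho> * dist z v"
      using \<rho>(1) v(2)[symmetric] by (simp add: dist_norm flip: scaleR_diff_right)
    also have "\<dots> < d" using z(1) \<rho>(1) by (simp add: dist_commute field_simps)
    finally show False using d(2) z(3) by (fastforce simp: dist_norm)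
  qed
qed (use W in simp)

subsection \<open>The Poisson integral\<close>

definition pk :: "real ^ 'n \<Rightarrow> real ^ 'n \<Rightarrow> real" where
  "pk x z = (1 - (norm x)\<^sup>2) * inverse (norm (x - z)) ^ CARD('n)"

lemma pk_nonneg: "norm x \<le> 1 \<Longrightarrow> 0 \<le> pk x z"
  by (simp add: pk_def abs_square_le_1)

lemma borel_measurable_pk [measurable]:
  assumes [measurable]: "f \<in> borel_measurable M" "g \<in> borel_measurable M"
  shows "(\<lambda>w. pk (f w) (g w)) \<in> borel_measurable M"
  unfolding pk_def by measurable

text \<open>The Poisson kernel is u + 2/(n-2) x.grad u for the Riesz kernel u with the same pole. As
  x.grad is the derivative along dilations, integral identities for u yield those for the Poisson
  kernel by differentiation in the dilation factor.\<close>

lemma pk_eq_rk_grad: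
  fixes x z :: "real ^ 'n"
  assumes n: "3 \<le> CARD('n)" and z: "norm z = 1" "x \<noteq> z"
  shows "pk x z = rk x z + 2 / (real (CARD('n)) - 2) * (rk_grad x z \<bullet> x)"
proof -
  let ?u = "inverse (norm (x - z))" and ?n = "real (CARD('n))"
  have Q: "2 * ((x - z) \<bullet> x) = (norm (x - z))\<^sup>2 + (norm x)\<^sup>2 - 1"
    using z(1) unfolding power2_norm_eq_inner norm_eq_1 by (simp add: inner_diff_left inner_diff_right inner_commute)
  have "2 / (?n - 2) * (rk_grad x z \<bullet> x) = - (?u ^ CARD('n)) * ((norm (x - z))\<^sup>2 + (norm x)\<^sup>2 - 1)"
  proof -
    have aux: "(2 - a) * b * c = - ((a - 2) * (b * c))" for a b c :: real
      by (simp add: algebra_simps)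
    have "rk_grad x z \<bullet> x = - ((?n - 2) * (?u ^ CARD('n) * ((x - z) \<bullet> x)))"
      using n by (simp add: rk_grad_def of_nat_diff aux)
    moreover have "?n - 2 \<noteq> 0" using n by simp
    ultimately have "2 / (?n - 2) * (rk_grad x z \<bullet> x) = - (?u ^ CARD('n)) * (2 * ((x - z) \<bullet> x))"
      by simp
    also note Q
    finally show ?thesis .
  qed
  also have "\<dots> = pk x z - ?u ^ CARD('n) * (norm (x - z))\<^sup>2"
    by (simp add: pk_def algebra_simps)
  also have "?u ^ CARD('n) = ?u ^ (CARD('n) - 2) * ?u\<^sup>2"
  proof -
    have "CARD('n) - 2 + 2 = CARD('n)" using n by simp
    then show ?thesis by (metis power_add)
  qed
  also have "\<dots> * (norm (x - z))\<^sup>2 = rk x z * (?u * norm (x - z))\<^sup>2"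
    by (simp add: rk_def power_mult_distrib)
  also have "?u * norm (x - z) = 1"
    using z(2) by simp
  finally show ?thesis by simp
qed

lemma has_derivative_radial_integral:
  fixes a b :: "'c \<Rightarrow> real ^ 'n"
  assumes n: "3 \<le> CARD('n)" and "finite_measure M" and q: "0 \<le> q" "q < 1"
    and [measurable]: "a \<in> borel_measurable M" "b \<in> borel_measurable M"
    and AE: "AE w in M. norm (a w) \<le> q \<and> norm (b w) = 1"
  shows "((\<lambda>t. \<integral>w. rk (t *\<^sub>R a w) (b w) \<partial>M) has_derivative (\<lambda>h. \<integral>w. h * (rk_grad (a w) (b w) \<bullet> a w) \<partial>M)) (at 1)"
proof -
  interpret finite_measure M by fact
  define r where "r = (1 - q) / 2"
  have r: "0 < r" using q by (simp add: r_def)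
  have sep: "r \<le> norm (t *\<^sub>R u - v)" if "t \<in> ball 1 r" "norm u \<le> q" "norm v = 1" for t :: real and u v :: "real ^ 'n"
  proof -
    have "\<bar>t\<bar> \<le> 1 + r" using that(1) by (auto simp: dist_real_def)
    then have "\<bar>t\<bar> * norm u \<le> (1 + r) * q" using that(2) q r by (intro mult_mono) auto
    also have "\<dots> \<le> q + r" using q r mult_left_mono[of q 1 r] by (simp add: algebra_simps)
    finally have "norm (t *\<^sub>R u) \<le> q + r" by simp
    then show ?thesis
      using norm_triangle_ineq2[of v "t *\<^sub>R u"] that(3) by (simp add: r_def norm_minus_commute field_simps)
  qed
  have "((\<lambda>t. \<integral>w. rk (t *\<^sub>R a w) (b w) \<partial>M) has_derivative
      (\<lambda>h. \<integral>w. rk_grad (1 *\<^sub>R a w) (b w) \<bullet> (h *\<^sub>R a w) \<partial>M)) (at 1)"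
  proof (rule has_derivative_integral_param[OF \<open>finite_measure M\<close> r,
        where F="\<lambda>t w h. rk_grad (t *\<^sub>R a w) (b w) \<bullet> (h *\<^sub>R a w)" and C="real (CARD('n)) * inverse r ^ (CARD('n) - 1) * q"])
    show "0 \<le> real (CARD('n)) * inverse r ^ (CARD('n) - 1) * q" using q r by simp
    fix t assume t: "t \<in> ball (1::real) r"
    have "AE w in M. norm (rk (t *\<^sub>R a w) (b w)) \<le> inverse r ^ (CARD('n) - 2)"
      using AE
    proof eventually_elim
      case (elim w)
      have "rk (t *\<^sub>R a w) (b w) \<le> inverse r ^ (CARD('n) - 2)"
        using elim by (intro rk_le r sep[OF t]) auto
      then show ?case by simp
    qed
    then show "integrable M (\<lambda>w. rk (t *\<^sub>R a w) (b w))"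
      by (rule integrable_const_bound) measurable
  next
    show "AE w in M. \<forall>t\<in>ball 1 r. ((\<lambda>t. rk (t *\<^sub>R a w) (b w)) has_derivative (\<lambda>h. rk_grad (t *\<^sub>R a w) (b w) \<bullet> (h *\<^sub>R a w))) (at t) \<and>
        (\<forall>h. norm (rk_grad (t *\<^sub>R a w) (b w) \<bullet> (h *\<^sub>R a w)) \<le> real (CARD('n)) * inverse r ^ (CARD('n) - 1) * q * norm h)"
      using AE
    proof eventually_elim
      case (elim w)
      show ?case
      proof (intro ballI conjI allI)
        fix t h :: real assume t: "t \<in> ball 1 r"
        have s: "r \<le> norm (t *\<^sub>R a w - b w)" using elim by (intro sep[OF t]) auto
        then have "t *\<^sub>R a w \<noteq> b w" using r by auto
        then have "((\<lambda>x. rk x (b w)) has_derivative (\<lambda>h. rk_grad (t *\<^sub>R a w) (b w) \<bullet> h)) (at (t *\<^sub>R a w))"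
          using n by (intro rk_has_derivative) auto
        moreover have "((\<lambda>t. t *\<^sub>R a w) has_derivative (\<lambda>h. h *\<^sub>R a w)) (at t)"
          by (auto intro!: derivative_eq_intros)
        ultimately show "((\<lambda>t. rk (t *\<^sub>R a w) (b w)) has_derivative (\<lambda>h. rk_grad (t *\<^sub>R a w) (b w) \<bullet> (h *\<^sub>R a w))) (at t)"
          by (rule has_derivative_compose[rotated])
        have "norm (rk_grad (t *\<^sub>R a w) (b w) \<bullet> (h *\<^sub>R a w)) \<le> norm (rk_grad (t *\<^sub>R a w) (b w)) * norm (h *\<^sub>R a w)"
          unfolding real_norm_def by (rule Cauchy_Schwarz_ineq2)
        also have "\<dots> \<le> (real (CARD('n)) * inverse r ^ (CARD('n) - 1)) * (\<bar>h\<bar> * q)"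
          using elim norm_rk_grad_le[OF r s] r by (intro mult_mono) (auto intro!: mult_left_mono)
        finally show "norm (rk_grad (t *\<^sub>R a w) (b w) \<bullet> (h *\<^sub>R a w)) \<le> real (CARD('n)) * inverse r ^ (CARD('n) - 1) * q * norm h"
          by (simp add: mult_ac)
      qed
    qed
  qed measurable
  then show ?thesis by simp
qed

text \<open>Differentiate a known mean \<open>g t\<close> of the dilated Riesz kernels at t = 1.
  There are two uses: the point runs over a small sphere with fixed pole (mean value property of
  \<open>pk\<close>), or the point is fixed and the pole runs over the unit sphere (total mass
  1).\<close>

lemma radial_derivative_mean:
  fixes a b :: "'c \<Rightarrow> real ^ 'n" and g :: "real \<Rightarrow> real"
  assumes n: "3 \<le> CARD('n)" and "finite_measure M" and q: "0 \<le> q" "q < 1"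
    and [measurable]: "a \<in> borel_measurable M" "b \<in> borel_measurable M"
    and AE: "AE w in M. norm (a w) \<le> q \<and> norm (b w) = 1"
    and g: "\<forall>\<^sub>F t in nhds 1. (\<integral>w. rk (t *\<^sub>R a w) (b w) \<partial>M) = g t" "(g has_derivative (\<lambda>h. h * D)) (at 1)"
  shows "(\<integral>w. pk (a w) (b w) \<partial>M) = g 1 + 2 / (real (CARD('n)) - 2) * D"
proof -
  interpret finite_measure M by fact
  have sep: "1 - q \<le> norm (a w - b w)" if "norm (a w) \<le> q \<and> norm (b w) = 1" for w
    using norm_triangle_ineq2[of "b w" "a w"] that by (simp add: norm_minus_commute)
  have int1: "integrable M (\<lambda>w. rk (a w) (b w))"
  proof (rule integrable_const_bound)
    show "AE w in M. norm (rk (a w) (b w)) \<le> inverse (1 - q) ^ (CARD('n) - 2)"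
      using AE
    proof eventually_elim
      case (elim w)
      show ?case using rk_le[OF _ sep[OF elim]] q by simp
    qed
  qed measurable
  have int2: "integrable M (\<lambda>w. rk_grad (a w) (b w) \<bullet> a w)"
  proof (rule integrable_const_bound)
    show "AE w in M. norm (rk_grad (a w) (b w) \<bullet> a w) \<le> (real (CARD('n)) * inverse (1 - q) ^ (CARD('n) - 1)) * q"
      using AE
    proof eventually_elim
      case (elim w)
      have "norm (rk_grad (a w) (b w) \<bullet> a w) \<le> norm (rk_grad (a w) (b w)) * norm (a w)"
        unfolding real_norm_def by (rule Cauchy_Schwarz_ineq2)
      also have "\<dots> \<le> (real (CARD('n)) * inverse (1 - q) ^ (CARD('n) - 1)) * q"
        using elim norm_rk_grad_le[OF _ sep[OF elim]] q by (intro mult_mono) auto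
      finally show ?case .
    qed
  qed measurable
  have "((\<lambda>t. \<integral>w. rk (t *\<^sub>R a w) (b w) \<partial>M) has_derivative (\<lambda>h. h * D)) (at 1)"
  proof (rule has_derivative_transform_eventually[OF g(2)])
    show "\<forall>\<^sub>F t in at 1. g t = (\<integral>w. rk (t *\<^sub>R a w) (b w) \<partial>M)"
      using g(1) by (auto simp: eventually_nhds_conv_at elim!: eventually_mono)
    show "g 1 = (\<integral>w. rk (1 *\<^sub>R a w) (b w) \<partial>M)"
      using eventually_nhds_x_imp_x[OF g(1)] by simp
  qed simp
  from has_derivative_unique[OF this has_derivative_radial_integral[OF assms(1-7)]]
  have "1 * D = (\<integral>w. 1 * (rk_grad (a w) (b w) \<bullet> a w) \<partial>M)"
    by (rule fun_cong)
  then have D: "D = (\<integral>w. rk_grad (a w) (b w) \<bullet> a w \<partial>M)"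
    by simp
  have "AE w in M. pk (a w) (b w) = rk (a w) (b w) + 2 / (real (CARD('n)) - 2) * (rk_grad (a w) (b w) \<bullet> a w)"
    using AE
  proof eventually_elim
    case (elim w)
    show ?case using elim sep[OF elim] q by (intro pk_eq_rk_grad[OF n]) auto
  qed
  then have "(\<integral>w. pk (a w) (b w) \<partial>M) = (\<integral>w. rk (a w) (b w) + 2 / (real (CARD('n)) - 2) * (rk_grad (a w) (b w) \<bullet> a w) \<partial>M)"
    by (intro integral_cong_AE) measurable
  also have "\<dots> = (\<integral>w. rk (a w) (b w) \<partial>M) + 2 / (real (CARD('n)) - 2) * D"
    using int1 int2 by (simp add: D)
  also have "(\<integral>w. rk (a w) (b w) \<partial>M) = g 1"
    using eventually_nhds_x_imp_x[OF g(1)] by simp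
  finally show ?thesis .
qed

lemma sphere_mean_rk:
  fixes c y :: "real ^ 'n"
  assumes n: "2 \<le> CARD('n)" and \<rho>: "0 < \<rho>" "\<rho> < norm (c - y)"
  shows "(\<integral>z. rk (c + \<rho> *\<^sub>R z) y \<partial>sph) = rk c y"
proof -
  have "ennreal (rk c y) = riesz_kernel c y" using \<rho> by (intro riesz_kernel_rk[symmetric]) auto
  also have "\<dots> = (\<integral>\<^sup>+ z. riesz_kernel (c + \<rho> *\<^sub>R z) y \<partial>sph)"
    using sphere_mean_riesz_kernel[OF n \<rho>(1), of c y] \<rho> by simp
  also have "\<dots> = (\<integral>\<^sup>+ z. ennreal (rk (c + \<rho> *\<^sub>R z) y) \<partial>sph)"
  proof (rule nn_integral_cong_AE)
    show "AE z in sph. riesz_kernel (c + \<rho> *\<^sub>R z) y = ennreal (rk (c + \<rho> *\<^sub>R z) y)"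
      using AE_sph_sphere
    proof eventually_elim
      case (elim z)
      have "c + \<rho> *\<^sub>R z \<noteq> y"
      proof
        assume "c + \<rho> *\<^sub>R z = y"
        then have "norm (c - y) = norm (\<rho> *\<^sub>R z)" by (metis add_diff_cancel_left' norm_minus_commute)
        then show False using elim \<rho> by simp
      qed
      then show ?case by (rule riesz_kernel_rk)
    qed
  qed
  finally have "(\<integral>\<^sup>+ z. ennreal (rk (c + \<rho> *\<^sub>R z) y) \<partial>sph) = ennreal (rk c y)" ..
  then show ?thesis
    by (subst integral_eq_nn_integral) auto
qed

lemma sphere_mean_pk:
  fixes c z :: "real ^ 'n"
  assumes n: "3 \<le> CARD('n)" and \<rho>: "0 < \<rho>" "norm c + \<rho> < 1" and z: "norm z = 1"
  shows "(\<integral>w. pk (c + \<rho> *\<^sub>R w) z \<partial>sph) = pk c z"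
proof -
  have cz: "c \<noteq> z" using \<rho> z by auto
  have "(\<integral>w. pk (c + \<rho> *\<^sub>R w) z \<partial>sph) = rk (1 *\<^sub>R c) z + 2 / (real (CARD('n)) - 2) * (rk_grad c z \<bullet> c)"
  proof (rule radial_derivative_mean[where M=sph and a="\<lambda>w. c + \<rho> *\<^sub>R w" and q="norm c + \<rho>" and b="\<lambda>_. z" and g="\<lambda>t. rk (t *\<^sub>R c) z", OF n])
    show "AE w in sph. norm (c + \<rho> *\<^sub>R w) \<le> norm c + \<rho> \<and> norm z = 1"
      using AE_sph_sphere
    proof eventually_elim
      case (elim w)
      then show ?case using norm_triangle_ineq[of c "\<rho> *\<^sub>R w"] \<rho> z by simp
    qed
    have "((\<lambda>t. t * (norm c + \<rho>)) \<longlongrightarrow> 1 * (norm c + \<rho>)) (nhds 1)"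
      by (intro tendsto_intros filterlim_ident)
    then have "\<forall>\<^sub>F t in nhds 1. t * (norm c + \<rho>) < 1"
      using \<rho>(2) by (intro order_tendstoD(2)) auto
    moreover have "\<forall>\<^sub>F t in nhds 1. (0::real) < t"
      by (rule eventually_nhds_in_open[of "{0<..}" "1::real", simplified])
    ultimately show "\<forall>\<^sub>F t in nhds 1. (\<integral>w. rk (t *\<^sub>R (c + \<rho> *\<^sub>R w)) z \<partial>sph) = rk (t *\<^sub>R c) z"
    proof eventually_elim
      case (elim t)
      have "norm z - norm (t *\<^sub>R c) \<le> norm (t *\<^sub>R c - z)"
        using norm_triangle_ineq2[of z "t *\<^sub>R c"] by (simp add: norm_minus_commute)
      then have "t * \<rho> < norm (t *\<^sub>R c - z)" using elim z by (simp add: algebra_simps)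
      then have "(\<integral>w. rk (t *\<^sub>R c + (t * \<rho>) *\<^sub>R w) z \<partial>sph) = rk (t *\<^sub>R c) z"
        using n \<rho> elim by (intro sphere_mean_rk) auto
      then show ?case by (simp add: scaleR_add_right)
    qed
    have "((\<lambda>x. rk x z) has_derivative (\<lambda>h. rk_grad (1 *\<^sub>R c) z \<bullet> h)) (at (1 *\<^sub>R c))"
      using n cz by (intro rk_has_derivative) auto
    moreover have "((\<lambda>t. t *\<^sub>R c) has_derivative (\<lambda>h. h *\<^sub>R c)) (at (1::real))"
      by (auto intro!: derivative_eq_intros)
    ultimately have "((\<lambda>t. rk (t *\<^sub>R c) z) has_derivative (\<lambda>h. rk_grad (1 *\<^sub>R c) z \<bullet> (h *\<^sub>R c))) (at 1)"
      by (rule has_derivative_compose[rotated])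
    then show "((\<lambda>t. rk (t *\<^sub>R c) z) has_derivative (\<lambda>h. h * (rk_grad c z \<bullet> c))) (at 1)"
      by simp
    show "finite_measure sph" using prob_space_sph by (rule prob_space.finite_measure)
  qed (use \<rho> in auto)
  then show ?thesis using pk_eq_rk_grad[OF n z cz] by simp
qed

text \<open>The potential of \<open>sph\<close> is constant in the ball, so its radial derivative
  contributes nothing.\<close>

lemma integral_pk:
  fixes x :: "real ^ 'n"
  assumes n: "3 \<le> CARD('n)" and x: "norm x < 1"
  shows "(\<integral>z. pk x z \<partial>sph) = 1"
proof -
  have n2: "2 \<le> CARD('n)" using n by simp
  have "(\<integral>z. pk x z \<partial>sph) = 1 + 2 / (real (CARD('n)) - 2) * 0"
  proof (rule radial_derivative_mean[where M=sph and q="norm x" and a="\<lambda>_. x" and b="\<lambda>z. z" and g="\<lambda>_. 1", OF n])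
    have "((\<lambda>t. \<bar>t\<bar> * norm x) \<longlongrightarrow> \<bar>1\<bar> * norm x) (nhds 1)"
      by (intro tendsto_intros filterlim_ident)
    then have "\<forall>\<^sub>F t in nhds 1. \<bar>t\<bar> * norm x < 1"
      using x by (intro order_tendstoD(2)) auto
    then show "\<forall>\<^sub>F t in nhds 1. (\<integral>z. rk (t *\<^sub>R x) z \<partial>sph) = 1"
    proof eventually_elim
      case (elim t)
      then have "t *\<^sub>R x \<notin> sphere 0 1" by auto
      then have "ennreal (\<integral>z. rk (t *\<^sub>R x) z \<partial>sph) = pot sph (t *\<^sub>R x)"
        by (rule sph.pot_eq_integral[symmetric])
      also have "\<dots> = 1" using elim by (intro pot_sph_le_1[OF n2]) simp
      finally show ?case by (simp add: ennreal_eq_1)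
    qed
    show "finite_measure sph" using prob_space_sph by (rule prob_space.finite_measure)
    show "((\<lambda>_. 1) has_derivative (\<lambda>h. h * 0)) (at (1::real))" by simp
  qed (use x AE_sph_sphere in auto)
  then show ?thesis by simp
qed


lemma integrable_pk:
  fixes x :: "real ^ 'n"
  assumes "norm x < 1"
  shows "integrable sph (pk x)"
proof (rule sph.integrable_const_bound)
  show "AE z in sph. norm (pk x z) \<le> inverse (1 - norm x) ^ CARD('n)"
    using AE_sph_sphere
  proof eventually_elim
    case (elim z)
    have "1 - norm x \<le> norm (x - z)"
      using norm_triangle_ineq2[of z x] elim by (simp add: norm_minus_commute)
    then have "inverse (norm (x - z)) ^ CARD('n) \<le> inverse (1 - norm x) ^ CARD('n)"
      using assms by (intro power_mono le_imp_inverse_le) auto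
    moreover have "1 - (norm x)\<^sup>2 \<le> 1" "0 \<le> 1 - (norm x)\<^sup>2" using assms by (auto simp: abs_square_le_1)
    ultimately show ?case
      unfolding pk_def using mult_mono[of "1 - (norm x)\<^sup>2" 1 "inverse (norm (x - z)) ^ CARD('n)"]
      by (simp add: abs_mult)
  qed
qed simp

lemma nn_integral_pk:
  fixes x :: "real ^ 'n"
  assumes n: "3 \<le> CARD('n)" and x: "norm x < 1"
  shows "(\<integral>\<^sup>+z. ennreal (pk x z) \<partial>sph) = 1"
  using integral_pk[OF assms] integrable_pk[OF x] x
  by (subst nn_integral_eq_integral) (auto simp: pk_nonneg less_imp_le)

lemma nn_sphere_mean_pk:
  fixes c z :: "real ^ 'n"
  assumes n: "3 \<le> CARD('n)" and \<rho>: "0 < \<rho>" "norm c + \<rho> < 1" and z: "norm z = 1"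
  shows "(\<integral>\<^sup>+w. ennreal (pk (c + \<rho> *\<^sub>R w) z) \<partial>sph) = ennreal (pk c z)"
proof -
  have in_ball: "norm (c + \<rho> *\<^sub>R w) < 1" if "norm w = 1" for w
    using norm_triangle_ineq[of c "\<rho> *\<^sub>R w"] that \<rho> by simp
  \<comment> \<open>Otherwise the integral would be 0 by convention, whereas the mean value identity
    gives the positive number \<open>pk c z\<close>.\<close>
  have "integrable sph (\<lambda>w. pk (c + \<rho> *\<^sub>R w) z)"
  proof (rule ccontr)
    assume "\<not> ?thesis"
    then have "pk c z = 0" using sphere_mean_pk[OF assms] by (simp add: not_integrable_integral_eq)
    moreover have "norm c < 1" "c \<noteq> z" using \<rho> z by auto
    moreover from this have "(norm c)\<^sup>2 < 1" by (simp add: abs_square_less_1)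
    ultimately show False by (simp add: pk_def)
  qed
  moreover have "AE w in sph. 0 \<le> pk (c + \<rho> *\<^sub>R w) z"
    using AE_sph_sphere by eventually_elim (intro pk_nonneg less_imp_le in_ball)
  ultimately show ?thesis
    using sphere_mean_pk[OF assms] by (subst nn_integral_eq_integral) auto
qed

text \<open>For x in the open ball, the harmonic measure of the unit ball seen from x.\<close>

definition poisson_measure :: "real ^ 'n \<Rightarrow> (real ^ 'n) measure" where
  "poisson_measure x = density sph (\<lambda>z. ennreal (pk x z))"

lemma sets_poisson_measure [simp, measurable_cong]: "sets (poisson_measure x) = sets borel"
  by (simp add: poisson_measure_def)

lemma space_poisson_measure [simp]: "space (poisson_measure x) = UNIV"
  by (simp add: poisson_measure_def)

lemma nn_integral_poisson_measure:
  "f \<in> borel_measurable borel \<Longrightarrow> (\<integral>\<^sup>+z. f z \<partial>poisson_measure x) = (\<integral>\<^sup>+z. ennreal (pk x z) * f z \<partial>sph)"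
  unfolding poisson_measure_def by (subst nn_integral_density) auto

lemma prob_space_poisson_measure:
  fixes x :: "real ^ 'n"
  assumes "3 \<le> CARD('n)" "norm x < 1"
  shows "prob_space (poisson_measure x)"
  using nn_integral_pk[OF assms]
  by (intro prob_spaceI) (simp add: poisson_measure_def emeasure_density)

lemma AE_poisson_sphere: "AE z in poisson_measure x. norm z = 1"
  unfolding poisson_measure_def using AE_sph_sphere
  by (subst AE_density) (auto elim: eventually_mono)

lemma pk_far_le:
  fixes x z :: "real ^ 'n"
  assumes "norm x \<le> 1" "norm (x - p) \<le> d / 2" "d \<le> norm (z - p)" "0 < d"
  shows "pk x z \<le> (1 - (norm x)\<^sup>2) * (2 / d) ^ CARD('n)"
proof -
  have "norm (z - p) \<le> norm (x - z) + norm (x - p)"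
    using norm_triangle_ineq[of "z - x" "x - p"] by (simp add: norm_minus_commute)
  then have "d / 2 \<le> norm (x - z)" using assms by simp
  then have "inverse (norm (x - z)) ^ CARD('n) \<le> inverse (d / 2) ^ CARD('n)"
    using assms by (intro power_mono le_imp_inverse_le) auto
  then show ?thesis
    unfolding pk_def using assms by (intro mult_left_mono) (auto simp: abs_square_le_1)
qed

lemma poisson_measure_far:
  fixes x p :: "real ^ 'n"
  assumes n: "3 \<le> CARD('n)" and x: "norm x < 1" "norm (x - p) \<le> d / 2" "0 < d"
  shows "measure (poisson_measure x) (- ball p d) \<le> (1 - (norm x)\<^sup>2) * (2 / d) ^ CARD('n)"
proof -
  have "emeasure (poisson_measure x) (- ball p d) = (\<integral>\<^sup>+z. ennreal (pk x z) * indicator (- ball p d) z \<partial>sph)"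
    by (simp add: poisson_measure_def emeasure_density)
  also have "\<dots> \<le> (\<integral>\<^sup>+z. ennreal ((1 - (norm x)\<^sup>2) * (2 / d) ^ CARD('n)) \<partial>(sph :: (real ^ 'n) measure))"
  proof (rule nn_integral_mono)
    fix z :: "real ^ 'n"
    show "ennreal (pk x z) * indicator (- ball p d) z \<le> ennreal ((1 - (norm x)\<^sup>2) * (2 / d) ^ CARD('n))"
      using pk_far_le[of x p d z] x
      by (cases "z \<in> ball p d") (auto simp: dist_norm norm_minus_commute intro!: ennreal_leI)
  qed
  also have "\<dots> = ennreal ((1 - (norm x)\<^sup>2) * (2 / d) ^ CARD('n))" by simp
  finally show ?thesis
    unfolding measure_def using x
    by (intro enn2real_leI) (auto simp: abs_square_le_1 intro!: mult_nonneg_nonneg)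
qed

text \<open>The Poisson measures form an approximate identity at \<open>p\<close>: the mass outside
  a fixed ball about \<open>p\<close> is of order 1 - |x|^2 and meets only the bound 2 B, while
  inside the ball \<open>h\<close> is close to \<open>h p\<close>.\<close>

lemma poisson_integral_boundary:
  fixes h :: "real ^ 'n \<Rightarrow> real" and X :: "nat \<Rightarrow> real ^ 'n"
  assumes n: "3 \<le> CARD('n)" and p: "norm p = 1" and X: "X \<longlonglongrightarrow> p" "\<And>i. norm (X i) < 1"
    and [measurable]: "h \<in> borel_measurable borel" and B: "\<And>z. norm z = 1 \<Longrightarrow> \<bar>h z\<bar> \<le> B" and cont: "isCont h p"
  shows "(\<lambda>i. \<integral>z. h z \<partial>poisson_measure (X i)) \<longlonglongrightarrow> h p"
proof (rule LIMSEQ_I)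
  fix e :: real assume e: "0 < e"
  have B0: "0 \<le> B" using B[OF p] by simp
  obtain d where d: "0 < d" "\<And>z. dist z p < d \<Longrightarrow> \<bar>h z - h p\<bar> < e / 2"
    using cont e unfolding continuous_at_eps_delta dist_real_def by (metis half_gt_zero)
  let ?C = "2 * B * (2 / d) ^ CARD('n)"
  have lim: "(\<lambda>i. ?C * (1 - (norm (X i))\<^sup>2)) \<longlonglongrightarrow> ?C * (1 - (norm p)\<^sup>2)"
    by (intro tendsto_intros X)
  then have ev: "\<forall>\<^sub>F i in sequentially. ?C * (1 - (norm (X i))\<^sup>2) < e / 2"
    using e p by (intro order_tendstoD(2)) auto
  have ev2: "\<forall>\<^sub>F i in sequentially. dist (X i) p < d / 2"
    using tendstoD[OF X(1), of "d / 2"] d by simp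
  have "\<forall>\<^sub>F i in sequentially. norm ((\<integral>z. h z \<partial>poisson_measure (X i)) - h p) < e"
    using ev ev2
  proof eventually_elim
    case (elim i)
    interpret prob_space "poisson_measure (X i)" by (rule prob_space_poisson_measure[OF n X(2)])
    have int: "integrable (poisson_measure (X i)) h"
      using AE_poisson_sphere[of "X i"] B by (intro integrable_const_bound[where B=B]) (auto elim!: eventually_mono)
    have "\<bar>(\<integral>z. h z \<partial>poisson_measure (X i)) - h p\<bar> = \<bar>\<integral>z. h z - h p \<partial>poisson_measure (X i)\<bar>"
      using int prob_space by simp
    also have "\<dots> \<le> (\<integral>z. \<bar>h z - h p\<bar> \<partial>poisson_measure (X i))"
      by (rule integral_abs_bound)
    also have "\<dots> \<le> (\<integral>z. e / 2 + 2 * B * indicator (- ball p d) z \<partial>poisson_measure (X i))"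
    proof (rule integral_mono_AE)
      show "AE z in poisson_measure (X i). \<bar>h z - h p\<bar> \<le> e / 2 + 2 * B * indicator (- ball p d) z"
        using AE_poisson_sphere[of "X i"]
      proof eventually_elim
        case (elim z)
        show ?case
        proof (cases "z \<in> ball p d")
          case True
          then show ?thesis using d(2)[of z] by (simp add: dist_commute)
        next
          case False
          then show ?thesis using B[OF elim] B[OF p] e by (simp add: abs_le_iff)
        qed
      qed
      show "integrable (poisson_measure (X i)) (\<lambda>z. e / 2 + 2 * B * indicator (- ball p d) z)"
        using e B0 by (intro integrable_const_bound[where B="e / 2 + 2 * B"]) (auto simp: indicator_def)
    qed (use int in simp)
    also have "\<dots> = e / 2 + 2 * B * measure (poisson_measure (X i)) (- ball p d)"
    proof -
      have "integrable (poisson_measure (X i)) (indicat_real (- ball p d))"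
        by (intro integrable_const_bound[where B=1]) (auto simp: indicator_def)
      then show ?thesis using prob_space by simp
    qed
    also have "\<dots> \<le> e / 2 + 2 * B * ((1 - (norm (X i))\<^sup>2) * (2 / d) ^ CARD('n))"
      using elim(2) d(1) B0 by (intro add_left_mono mult_left_mono poisson_measure_far[OF n X(2)]) (auto simp: dist_norm)
    also have "\<dots> < e" using elim(1) by (simp add: mult_ac)
    finally show ?case by simp
  qed
  then show "\<exists>no. \<forall>i\<ge>no. norm ((\<integral>z. h z \<partial>poisson_measure (X i)) - h p) < e"
    by (simp add: eventually_sequentially)
qed


text \<open>Both sides are harmonic in the ball with the same boundary values.\<close>

lemma poisson_formula_outside:
  fixes x y :: "real ^ 'n"
  assumes n: "3 \<le> CARD('n)" and x: "norm x < 1" and y: "1 < norm y"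
  shows "(\<integral>z. rk z y \<partial>poisson_measure x) = rk x y"
proof -
  define h where "h z = rk z y" for z
  define B where "B = inverse (norm y - 1) ^ (CARD('n) - 2)"
  have sep: "norm y - 1 \<le> norm (z - y)" if "norm z \<le> 1" for z
    using norm_triangle_ineq2[of y z] that by (simp add: norm_minus_commute)
  have hB: "\<bar>h z\<bar> \<le> B" if "norm z \<le> 1" for z
    using rk_le[OF _ sep[OF that]] y by (simp add: h_def B_def)
  have [measurable]: "h \<in> borel_measurable borel" unfolding h_def by measurable
  have hcont: "isCont h z" if "norm z \<le> 1" for z
    unfolding h_def rk_def using that y by (intro continuous_intros) auto
  \<comment> \<open>Continuing the Poisson integral by \<open>h\<close> itself gives a single
    function on the closed ball, so the minimum principle sees a difference that vanishes on the
    boundary.\<close>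
  define F where "F x = (if norm x < 1 then \<integral>z. h z \<partial>poisson_measure x else h x)" for x
  have int: "integrable (poisson_measure x) h" if "norm x < 1" for x
  proof -
    interpret prob_space "poisson_measure x" by (rule prob_space_poisson_measure[OF n that])
    show ?thesis
      using AE_poisson_sphere[of x] hB by (intro integrable_const_bound[where B=B]) (auto elim!: eventually_mono)
  qed
  have Feq: "ennreal (F x) = (\<integral>\<^sup>+z. ennreal (pk x z) * ennreal (h z) \<partial>sph)" if "norm x < 1" for x
    using that int[OF that] nn_integral_eq_integral[of "poisson_measure x" h]
    by (simp add: F_def h_def nn_integral_poisson_measure)
  have Fker: "(\<integral>z. pk x z * h z \<partial>sph) = F x" if "norm x < 1" for x
  proof -
    have "AE z in sph. 0 \<le> pk x z" using that by (intro AE_I2 pk_nonneg) simp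
    then show ?thesis
      using that unfolding F_def poisson_measure_def by (subst integral_density) auto
  qed
  have "F = (\<lambda>x. if norm x < 1 then \<integral>z. pk x z * h z \<partial>sph else h x)"
    by (auto simp: fun_eq_iff Fker) (simp add: F_def)
  also have "\<dots> \<in> borel_measurable borel" by measurable
  finally have [measurable]: "F \<in> borel_measurable borel" .
  have Fnn: "0 \<le> F x" for x by (simp add: F_def h_def)
  have Fmean: "(\<integral>\<^sup>+w. ennreal (F (c + \<rho> *\<^sub>R w)) \<partial>sph) = ennreal (F c)"
    if \<rho>: "0 < \<rho>" "norm c + \<rho> < 1" for c :: "real ^ 'n" and \<rho> :: real
  proof -
    interpret P: pair_sigma_finite "sph :: (real ^ 'n) measure" "sph :: (real ^ 'n) measure" ..
    have in_ball: "norm (c + \<rho> *\<^sub>R w) < 1" if "norm w = 1" for w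
      using norm_triangle_ineq[of c "\<rho> *\<^sub>R w"] that \<rho> by simp
    have "(\<integral>\<^sup>+w. ennreal (F (c + \<rho> *\<^sub>R w)) \<partial>sph) = (\<integral>\<^sup>+w. \<integral>\<^sup>+z. ennreal (pk (c + \<rho> *\<^sub>R w) z) * ennreal (h z) \<partial>sph \<partial>sph)"
    proof (rule nn_integral_cong_AE)
      show "AE w in sph. ennreal (F (c + \<rho> *\<^sub>R w)) = (\<integral>\<^sup>+z. ennreal (pk (c + \<rho> *\<^sub>R w) z) * ennreal (h z) \<partial>sph)"
        using AE_sph_sphere by eventually_elim (intro Feq in_ball)
    qed
    also have "\<dots> = (\<integral>\<^sup>+z. \<integral>\<^sup>+w. ennreal (pk (c + \<rho> *\<^sub>R w) z) * ennreal (h z) \<partial>sph \<partial>sph)"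
      by (rule P.Fubini'[symmetric]) measurable
    also have "\<dots> = (\<integral>\<^sup>+z. ennreal (pk c z) * ennreal (h z) \<partial>sph)"
    proof (rule nn_integral_cong_AE)
      show "AE z in sph. (\<integral>\<^sup>+w. ennreal (pk (c + \<rho> *\<^sub>R w) z) * ennreal (h z) \<partial>sph) = ennreal (pk c z) * ennreal (h z)"
        using AE_sph_sphere by eventually_elim (simp add: nn_integral_multc nn_sphere_mean_pk[OF n \<rho>])
    qed
    also have "\<dots> = ennreal (F c)" using \<rho> by (subst Feq) auto
    finally show ?thesis .
  qed
  have contF: "continuous_on (cball 0 1) F"
    unfolding continuous_on_sequentially
  proof (intro allI ballI impI, elim conjE)
    fix X p assume p: "p \<in> cball (0 :: real ^ 'n) 1" and X: "\<forall>i. X i \<in> cball 0 1" "X \<longlonglongrightarrow> p"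
    show "(F \<circ> X) \<longlonglongrightarrow> F p"
    proof (cases "norm p < 1")
      case True
      define r where "r = (1 - norm p) / 2"
      have r: "0 < r" using True by (simp add: r_def)
      have near: "norm x < 1" "1 - (norm p + r) \<le> norm (x - z)" if "x \<in> ball p r" "norm z = 1" for x z
      proof -
        have "norm x \<le> norm p + norm (x - p)" using norm_triangle_ineq[of p "x - p"] by simp
        then have nx: "norm x < norm p + r" using that by (simp add: dist_norm norm_minus_commute)
        then show "norm x < 1" using True by (simp add: r_def field_simps)
        show "1 - (norm p + r) \<le> norm (x - z)"
          using norm_triangle_ineq2[of z x] nx that by (simp add: norm_minus_commute)
      qed
      have pr: "0 < 1 - (norm p + r)" using True by (simp add: r_def field_simps)
      have "isCont (\<lambda>x. \<integral>z. pk x z * h z \<partial>sph) p"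
      proof (rule isCont_integral_param[OF prob_space.finite_measure[OF prob_space_sph] r])
        show "AE z in sph. isCont (\<lambda>x. pk x z * h z) p \<and>
          (\<forall>x\<in>ball p r. norm (pk x z * h z) \<le> inverse (1 - (norm p + r)) ^ CARD('n) * B)"
          using AE_sph_sphere
        proof eventually_elim
          case (elim z)
          have "p \<noteq> z" using elim True by auto
          then have "isCont (\<lambda>x. pk x z * h z) p"
            unfolding pk_def by (intro continuous_intros) auto
          moreover have "norm (pk x z * h z) \<le> inverse (1 - (norm p + r)) ^ CARD('n) * B" if "x \<in> ball p r" for x
          proof -
            have "inverse (norm (x - z)) ^ CARD('n) \<le> inverse (1 - (norm p + r)) ^ CARD('n)"
              using near[OF that elim] pr by (intro power_mono le_imp_inverse_le) auto
            moreover have "0 \<le> 1 - (norm x)\<^sup>2" "1 - (norm x)\<^sup>2 \<le> 1"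
              using near[OF that elim] by (auto simp: abs_square_le_1)
            ultimately have "pk x z \<le> inverse (1 - (norm p + r)) ^ CARD('n)"
              unfolding pk_def using mult_mono[of "1 - (norm x)\<^sup>2" 1 "inverse (norm (x - z)) ^ CARD('n)"] by simp
            then show ?thesis
              using near[OF that elim] hB[of z] elim pk_nonneg[of x z] by (auto simp: abs_mult intro!: mult_mono)
          qed
          ultimately show ?case by blast
        qed
      qed measurable
      then have "(\<lambda>i. \<integral>z. pk (X i) z * h z \<partial>sph) \<longlonglongrightarrow> (\<integral>z. pk p z * h z \<partial>sph)"
        using X(2) by (simp add: continuous_at_sequentially comp_def)
      moreover note Fker
      moreover have "\<forall>\<^sub>F i in sequentially. norm (X i) < 1"
        using True tendsto_norm[OF X(2)] by (intro order_tendstoD(2)) auto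
      ultimately show ?thesis
        using True by (auto simp: comp_def elim!: Lim_transform_eventually eventually_mono)
    next
      case False
      then have np: "norm p = 1" using p by simp
      \<comment> \<open>The sequence may alternate between the open ball and the sphere. Its
        boundary terms are replaced by radial approximants of \<open>p\<close> to apply the boundary
        limit; for the replaced terms \<open>F\<close> is \<open>h\<close>, which is
        continuous.\<close>
      define Y where "Y i = (if norm (X i) < 1 then X i else radii i *\<^sub>R p)" for i
      have Y: "norm (Y i) < 1" for i using np radii(1,2)[of i] by (simp add: Y_def)
      have rp: "(\<lambda>i. radii i *\<^sub>R p) \<longlonglongrightarrow> p"
        using tendsto_scaleR[OF radii(3) tendsto_const, of p] by simp
      have Yp: "Y \<longlonglongrightarrow> p"
      proof (rule tendsto_dist_iff[THEN iffD2], rule tendsto_sandwich[OF _ _ tendsto_const])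
        show "\<forall>\<^sub>F i in sequentially. dist (Y i) p \<le> dist (X i) p + dist (radii i *\<^sub>R p) p"
          by (simp add: Y_def)
        show "(\<lambda>i. dist (X i) p + dist (radii i *\<^sub>R p) p) \<longlonglongrightarrow> 0"
          using tendsto_add[OF tendsto_dist_iff[THEN iffD1, OF X(2)] tendsto_dist_iff[THEN iffD1, OF rp]] by simp
      qed simp
      have G: "(\<lambda>i. F (Y i)) \<longlonglongrightarrow> h p"
      proof -
        have "(\<lambda>i. \<integral>z. h z \<partial>poisson_measure (Y i)) \<longlonglongrightarrow> h p"
          by (rule poisson_integral_boundary[OF n np Yp Y, where B=B]) (use hB hcont np in auto)
        then show ?thesis using Y by (simp add: F_def)
      qed
      have H: "(\<lambda>i. h (X i)) \<longlonglongrightarrow> h p"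
        using hcont[of p] np X(2) by (simp add: continuous_at_sequentially comp_def)
      have "(\<lambda>i. F (X i)) \<longlonglongrightarrow> h p"
      proof (rule tendsto_dist_iff[THEN iffD2], rule tendsto_sandwich[OF _ _ tendsto_const])
        show "\<forall>\<^sub>F i in sequentially. dist (F (X i)) (h p) \<le> dist (F (Y i)) (h p) + dist (h (X i)) (h p)"
          by (simp add: Y_def F_def)
        show "(\<lambda>i. dist (F (Y i)) (h p) + dist (h (X i)) (h p)) \<longlonglongrightarrow> 0"
          using tendsto_add[OF tendsto_dist_iff[THEN iffD1, OF G] tendsto_dist_iff[THEN iffD1, OF H]] by simp
      qed simp
      then show ?thesis using np by (simp add: comp_def F_def)
    qed
  qed
  have hc: "continuous_on (cball 0 1) h"
    using hcont by (intro continuous_at_imp_continuous_on) auto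
  have sides: "0 \<le> s * (F x - h x)" if s: "\<bar>s\<bar> = 1" for s :: real
  proof (rule min_principle[where D="cball 0 1"])
    show "continuous_on (cball 0 1) (\<lambda>x. s * (F x - h x))"
      by (intro continuous_intros contF hc)
    show "\<exists>r. \<forall>x\<in>cball 0 1. r < norm x \<longrightarrow> - e \<le> s * (F x - h x)" if "0 < e" for e
      by (intro exI[of _ 1]) auto
    show "x \<in> cball 0 1" using x by simp
    fix c assume c: "c \<in> cball (0 :: real ^ 'n) 1" "s * (F c - h c) < 0"
    then have c1: "norm c < 1" by (cases "norm c < 1") (auto simp: F_def)
    define \<rho> where "\<rho> = (1 - norm c) / 2"
    have \<rho>: "0 < \<rho>" "norm c + \<rho> < 1" using c1 by (auto simp: \<rho>_def field_simps)
    have in_ball: "norm (c + \<rho> *\<^sub>R w) < 1" if "norm w = 1" for w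
      using norm_triangle_ineq[of c "\<rho> *\<^sub>R w"] that \<rho> by simp
    have sub: "cball c \<rho> \<subseteq> cball 0 1"
    proof
      fix z assume "z \<in> cball c \<rho>"
      then show "z \<in> cball 0 1"
        using norm_triangle_ineq[of c "z - c"] \<rho> by (simp add: dist_norm norm_minus_commute)
    qed
    have Fme: "(\<integral>w. F (c + \<rho> *\<^sub>R w) \<partial>sph) = F c" and iF: "integrable sph (\<lambda>w. F (c + \<rho> *\<^sub>R w))"
    proof -
      have bm: "(\<lambda>w. F (c + \<rho> *\<^sub>R w)) \<in> borel_measurable sph"
        by measurable
      then show "(\<integral>w. F (c + \<rho> *\<^sub>R w) \<partial>sph) = F c"
        using Fmean[OF \<rho>] Fnn by (subst integral_eq_nn_integral) auto
      show "integrable sph (\<lambda>w. F (c + \<rho> *\<^sub>R w))"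
        using bm Fmean[OF \<rho>] Fnn by (intro integrableI_nonneg) auto
    qed
    have "(\<integral>w. h (c + \<rho> *\<^sub>R w) \<partial>sph) = h c"
    proof -
      have "\<rho> < norm (c - y)"
        using norm_triangle_ineq2[of y c] \<rho> y by (simp add: norm_minus_commute)
      then show ?thesis unfolding h_def using n \<rho> by (intro sphere_mean_rk) auto
    qed
    moreover have "integrable sph (\<lambda>w. h (c + \<rho> *\<^sub>R w))"
    proof (rule sph.integrable_const_bound)
      show "AE w in sph. norm (h (c + \<rho> *\<^sub>R w)) \<le> B"
        using AE_sph_sphere unfolding real_norm_def by eventually_elim (intro hB less_imp_le in_ball)
    qed measurable
    ultimately show "\<exists>\<rho>>0. cball c \<rho> \<subseteq> cball 0 1 \<and> (\<integral>w. s * (F (c + \<rho> *\<^sub>R w) - h (c + \<rho> *\<^sub>R w)) \<partial>sph) \<le> s * (F c - h c)"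
      using \<rho>(1) sub Fme iF by (intro exI[of _ \<rho>]) simp
  qed simp
  have "F x = h x" using sides[of 1] sides[of "- 1"] by simp
  then show ?thesis using x by (simp add: F_def h_def[abs_def])
qed

text \<open>Push the pole outward along its ray, where the formula is known. For z on the sphere the
  kernel grows as the pole returns to y, so Fatou's lemma gives one inequality and monotonicity the
  other; an infinite limit does no harm.\<close>

lemma poisson_formula_sphere:
  fixes x y :: "real ^ 'n"
  assumes n: "3 \<le> CARD('n)" and x: "norm x < 1" and y: "norm y = 1"
  shows "(\<integral>\<^sup>+z. riesz_kernel z y \<partial>poisson_measure x) = riesz_kernel x y"
proof -
  define Y where "Y j = (1 + inverse (real (Suc j))) *\<^sub>R y" for j
  have nY: "norm (Y j) = 1 + inverse (real (Suc j))" "1 < norm (Y j)" for j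
  proof -
    have pos: "0 < inverse (real (Suc j))" by simp
    show "norm (Y j) = 1 + inverse (real (Suc j))"
      unfolding Y_def using pos y by (simp only: norm_scaleR) simp
    then show "1 < norm (Y j)" using pos by simp
  qed
  have "Y \<longlonglongrightarrow> (1 + 0) *\<^sub>R y"
    unfolding Y_def by (intro tendsto_intros LIMSEQ_inverse_real_of_nat)
  then have Y: "Y \<longlonglongrightarrow> y" by simp
  interpret prob_space "poisson_measure x" by (rule prob_space_poisson_measure[OF n x])
  have eq: "(\<integral>\<^sup>+z. riesz_kernel z (Y j) \<partial>poisson_measure x) = riesz_kernel x (Y j)" for j
  proof -
    have sep: "norm (Y j) - 1 \<le> norm (z - Y j)" if "norm z \<le> 1" for z
      using norm_triangle_ineq2[of "Y j" z] that by (simp add: norm_minus_commute)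
    have ne: "z \<noteq> Y j" if "norm z \<le> 1" for z using that nY(2)[of j] by auto
    have int: "integrable (poisson_measure x) (\<lambda>z. rk z (Y j))"
    proof (rule integrable_const_bound[where B="inverse (norm (Y j) - 1) ^ (CARD('n) - 2)"])
      show "AE z in poisson_measure x. norm (rk z (Y j)) \<le> inverse (norm (Y j) - 1) ^ (CARD('n) - 2)"
        using AE_poisson_sphere by eventually_elim (use rk_le[OF _ sep] nY(2)[of j] in auto)
    qed measurable
    have "(\<integral>\<^sup>+z. riesz_kernel z (Y j) \<partial>poisson_measure x) = (\<integral>\<^sup>+z. ennreal (rk z (Y j)) \<partial>poisson_measure x)"
    proof (rule nn_integral_cong_AE)
      show "AE z in poisson_measure x. riesz_kernel z (Y j) = ennreal (rk z (Y j))"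
        using AE_poisson_sphere by eventually_elim (intro riesz_kernel_rk ne, simp)
    qed
    also have "\<dots> = ennreal (rk x (Y j))"
      using int poisson_formula_outside[OF n x nY(2)] by (simp add: nn_integral_eq_integral)
    also have "\<dots> = riesz_kernel x (Y j)" using ne[of x] x by (simp add: riesz_kernel_rk)
    finally show ?thesis .
  qed
  have lim: "(\<lambda>j. riesz_kernel z (Y j)) \<longlonglongrightarrow> riesz_kernel z y" for z
    using tendsto_riesz_kernel[OF Y, of z] by (simp add: riesz_kernel_commute)
  have le: "riesz_kernel z (Y j) \<le> riesz_kernel z y" if z: "norm z = 1" for z j
  proof -
    define t where "t = inverse (real (Suc j))"
    have t: "0 < t" by (simp add: t_def)
    have Yt: "Y j = (1 + t) *\<^sub>R y" by (simp add: Y_def t_def)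
    have zy: "z \<bullet> y \<le> 1" using norm_cauchy_schwarz[of z y] z y by simp
    have "(norm (z - Y j))\<^sup>2 = (norm (z - y))\<^sup>2 + 2 * t * (1 - z \<bullet> y) + t\<^sup>2"
      using z y unfolding Yt power2_norm_eq_inner norm_eq_1
      by (simp add: inner_diff_left inner_diff_right inner_commute algebra_simps power2_eq_square)
    then have "(norm (z - y))\<^sup>2 \<le> (norm (z - Y j))\<^sup>2" using t zy by simp
    then have "norm (z - y) \<le> 1 * norm (z - Y j)" using power2_le_imp_le by force
    from riesz_kernel_mono_dist[OF _ this] show ?thesis by simp
  qed
  have limx: "(\<lambda>j. riesz_kernel x (Y j)) \<longlonglongrightarrow> riesz_kernel x y" by (rule lim)
  have "(\<integral>\<^sup>+z. riesz_kernel z y \<partial>poisson_measure x) = (\<integral>\<^sup>+z. liminf (\<lambda>j. riesz_kernel z (Y j)) \<partial>poisson_measure x)"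
    by (intro nn_integral_cong) (simp add: lim_imp_Liminf[OF _ lim])
  also have "\<dots> \<le> liminf (\<lambda>j. \<integral>\<^sup>+z. riesz_kernel z (Y j) \<partial>poisson_measure x)"
    by (intro nn_integral_liminf) measurable
  also have "\<dots> = riesz_kernel x y" unfolding eq by (rule lim_imp_Liminf[OF _ limx]) simp
  finally have "(\<integral>\<^sup>+z. riesz_kernel z y \<partial>poisson_measure x) \<le> riesz_kernel x y" .
  moreover have "riesz_kernel x (Y j) \<le> (\<integral>\<^sup>+z. riesz_kernel z y \<partial>poisson_measure x)" for j
    unfolding eq[symmetric] using AE_poisson_sphere[of x] le
    by (intro nn_integral_mono_AE) (auto elim: eventually_mono)
  then have "riesz_kernel x y \<le> (\<integral>\<^sup>+z. riesz_kernel z y \<partial>poisson_measure x)"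
    by (intro LIMSEQ_le_const2[OF limx]) auto
  ultimately show ?thesis by (rule antisym)
qed

context sphere_measure
begin

lemma poisson_formula_pot:
  assumes n: "3 \<le> CARD('n)" and x: "norm x < 1"
  shows "(\<integral>\<^sup>+z. pot \<mu> z \<partial>poisson_measure x) = pot \<mu> x"
proof -
  interpret P: prob_space "poisson_measure x" by (rule prob_space_poisson_measure[OF n x])
  interpret pair_sigma_finite "poisson_measure x" \<mu> ..
  have "(\<integral>\<^sup>+z. pot \<mu> z \<partial>poisson_measure x) = (\<integral>\<^sup>+y. \<integral>\<^sup>+z. riesz_kernel z y \<partial>poisson_measure x \<partial>\<mu>)"
    unfolding pot_def by (rule Fubini'[symmetric]) measurable
  also have "\<dots> = pot \<mu> x"
    unfolding pot_def using AE_sphere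
    by (intro nn_integral_cong_AE) (auto elim!: eventually_mono simp: poisson_formula_sphere[OF n x])
  finally show ?thesis .
qed

text \<open>If \<open>pot \<mu> \<ge> a\<close> almost everywhere on a set which captures a fixed proportion \<open>c\<close> of the Poisson
  measures approaching \<open>p\<close>, then \<open>pot \<mu> p \<ge> a\<close>: near \<open>p\<close> the potential is at least \<open>pot \<mu> p - \<eta>\<close> by lower
  semicontinuity, so \<open>pot \<mu> p \<ge> c a + (1 - c) (pot \<mu> p - \<eta>)\<close>.\<close>

lemma pot_regular_point:
  assumes n: "3 \<le> CARD('n)" and p: "norm p = 1" and A [measurable]: "A \<in> sets borel"
    and a: "0 \<le> a" "AE z in sph. z \<in> A \<longrightarrow> ennreal a \<le> pot \<mu> z"
    and c: "0 < c" "\<forall>\<^sub>F i in sequentially. c \<le> measure (poisson_measure (radii i *\<^sub>R p)) A"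
  shows "ennreal a \<le> pot \<mu> p"
proof (rule ccontr)
  assume "\<not> ennreal a \<le> pot \<mu> p"
  then have lt: "pot \<mu> p < ennreal a" by simp
  then have fin: "pot \<mu> p < \<infinity>" by (metis ennreal_less_top infinity_ennreal_def less_trans)
  define b where "b = enn2real (pot \<mu> p)"
  have b: "pot \<mu> p = ennreal b" "0 \<le> b" "b < a"
    using fin lt a(1) by (auto simp: b_def less_top ennreal_less_iff)
  have x1: "norm (radii i *\<^sub>R p) < 1" for i using p radii(1,2)[of i] by simp
  have pot_lim: "(\<lambda>i. pot \<mu> (radii i *\<^sub>R p)) \<longlonglongrightarrow> ennreal b"
    using pot_radial_limit[OF sets_eq AE_sphere p fin radii] by (simp add: b)
  have xlim: "(\<lambda>i. radii i *\<^sub>R p) \<longlonglongrightarrow> p"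
    using tendsto_scaleR[OF radii(3) tendsto_const, of p] by simp
  \<comment> \<open>Here \<open>t\<close> is a lower bound for the potential near \<open>p\<close>
    (0 always qualifies) and \<open>e\<close> bounds the Poisson mass far from \<open>p\<close>. Of
    the near mass, at least 1 - e in all, at least c - e lies in \<open>A\<close>, where the bound
    improves from t to a.\<close>
  have key: "t * (1 - e) + (a - t) * (c - e) \<le> b" if t: "0 \<le> t" "t < b \<or> t = 0" and e: "0 < e" "e < 1" "e < c" for t e
  proof -
    obtain d where d: "0 < d" "\<And>y. y \<in> ball p d \<Longrightarrow> ennreal t \<le> pot \<mu> y"
    proof (cases "t = 0")
      case False
      then have "ennreal t < pot \<mu> p" using t b by (simp add: ennreal_less_iff)
      from pot_lsc_gt[OF sets_eq this] show ?thesis using that by (meson less_imp_le)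
    qed (use that[of 1] in auto)
    have "(\<lambda>i. (1 - (norm (radii i *\<^sub>R p))\<^sup>2) * (2 / d) ^ CARD('n)) \<longlonglongrightarrow> (1 - (norm p)\<^sup>2) * (2 / d) ^ CARD('n)"
      by (intro tendsto_intros xlim)
    then have "\<forall>\<^sub>F i in sequentially. (1 - (norm (radii i *\<^sub>R p))\<^sup>2) * (2 / d) ^ CARD('n) < e"
      using e p by (intro order_tendstoD(2)) auto
    moreover have "\<forall>\<^sub>F i in sequentially. dist (radii i *\<^sub>R p) p < d / 2"
      using tendstoD[OF xlim, of "d / 2"] d(1) by simp
    ultimately have "\<forall>\<^sub>F i in sequentially. ennreal (t * (1 - e) + (a - t) * (c - e)) \<le> pot \<mu> (radii i *\<^sub>R p)"
      using c(2)
    proof eventually_elim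
      case (elim i)
      let ?P = "poisson_measure (radii i *\<^sub>R p)"
      interpret P: prob_space ?P by (rule prob_space_poisson_measure[OF n x1])
      have far: "measure ?P (- ball p d) \<le> e"
        using poisson_measure_far[OF n x1, of i p d] elim(1,2) d(1) by (simp add: dist_norm)
      have U: "measure ?P UNIV = 1" using P.prob_space by simp
      have N: "1 - e \<le> measure ?P (ball p d)"
        using far U P.finite_measure_Union[of "ball p d" "- ball p d"] by (simp add: Compl_partition)
      have "measure ?P A \<le> measure ?P (A \<inter> ball p d) + measure ?P (- ball p d)"
      proof -
        have "measure ?P A \<le> measure ?P ((A \<inter> ball p d) \<union> - ball p d)"
          by (rule P.finite_measure_mono) auto
        also have "\<dots> \<le> measure ?P (A \<inter> ball p d) + measure ?P (- ball p d)"
          by (rule measure_Un_le) auto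
        finally show ?thesis .
      qed
      then have AN: "c - e \<le> measure ?P (A \<inter> ball p d)" using far elim(3) by simp
      have split: "measure ?P (ball p d) = measure ?P (A \<inter> ball p d) + measure ?P (ball p d - A)"
      proof -
        have "ball p d = (A \<inter> ball p d) \<union> (ball p d - A)" by auto
        moreover have "measure ?P ((A \<inter> ball p d) \<union> (ball p d - A)) = measure ?P (A \<inter> ball p d) + measure ?P (ball p d - A)"
          by (rule P.finite_measure_Union) auto
        ultimately show ?thesis by simp
      qed
      have "t * (1 - e) + (a - t) * (c - e) \<le> t * measure ?P (ball p d) + (a - t) * measure ?P (A \<inter> ball p d)"
        using t b N AN by (intro add_mono mult_left_mono) auto
      also have "\<dots> = a * measure ?P (A \<inter> ball p d) + t * measure ?P (ball p d - A)"
        unfolding split by (simp add: algebra_simps)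
      finally have "ennreal (t * (1 - e) + (a - t) * (c - e)) \<le> ennreal a * emeasure ?P (A \<inter> ball p d) + ennreal t * emeasure ?P (ball p d - A)"
        using t a by (simp add: P.emeasure_eq_measure flip: ennreal_mult ennreal_plus)
      also have "\<dots> = (\<integral>\<^sup>+z. ennreal a * indicator (A \<inter> ball p d) z + ennreal t * indicator (ball p d - A) z \<partial>?P)"
      proof -
        have [measurable]: "A \<inter> ball p d \<in> sets ?P" "ball p d - A \<in> sets ?P" by auto
        show ?thesis by (subst nn_integral_add) (measurable, simp add: nn_integral_cmult_indicator)
      qed
      also have "\<dots> \<le> (\<integral>\<^sup>+z. pot \<mu> z \<partial>?P)"
      proof (rule nn_integral_mono_AE)
        have "AE z in ?P. z \<in> A \<longrightarrow> ennreal a \<le> pot \<mu> z"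
          unfolding poisson_measure_def using a(2) finite_measure_axioms
          by (subst AE_density) (auto simp: sets_eq elim!: eventually_mono)
        then show "AE z in ?P. ennreal a * indicator (A \<inter> ball p d) z + ennreal t * indicator (ball p d - A) z \<le> pot \<mu> z"
          by eventually_elim (use d(2) in \<open>auto simp: indicator_def\<close>)
      qed
      also have "\<dots> = pot \<mu> (radii i *\<^sub>R p)" by (rule poisson_formula_pot[OF n x1])
      finally show ?case .
    qed
    then have "ennreal (t * (1 - e) + (a - t) * (c - e)) \<le> ennreal b"
      by (intro tendsto_lowerbound[OF pot_lim]) auto
    then show ?thesis using b by (simp add: ennreal_le_iff)
  qed
  have c1: "c \<le> 1"
  proof -
    obtain i where i: "c \<le> measure (poisson_measure (radii i *\<^sub>R p)) A"
      using c(2) by (auto simp: eventually_sequentially)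
    interpret P: prob_space "poisson_measure (radii i *\<^sub>R p)" by (rule prob_space_poisson_measure[OF n x1])
    show ?thesis using i P.prob_le_1 by (rule order_trans)
  qed
  \<comment> \<open>With t \<ge> b - \<eta> the estimate becomes c (a - b) \<le> \<eta> (1 - c)
    \<le> \<eta>, so half of c (a - b) is already contradictory.\<close>
  define \<eta> where "\<eta> = c * (a - b) / 2"
  define t where "t = max 0 (b - \<eta>)"
  have \<eta>: "0 < \<eta>" using c b by (simp add: \<eta>_def)
  have t: "0 \<le> t" "t < b \<or> t = 0" "b - \<eta> \<le> t" "t \<le> b" using \<eta> b by (auto simp: t_def)
  have "t + (a - t) * c \<le> b"
  proof (rule field_le_epsilon)
    fix e :: real assume e: "0 < e"
    define e' where "e' = Min {e / (a + 1), 1 / 2, c / 2}"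
    have e': "0 < e'" "e' < 1" "e' < c" "e' \<le> e / (a + 1)"
      using e a c by (auto simp: e'_def)
    have "t * (1 - e') + (a - t) * (c - e') \<le> b" using t e' by (intro key) auto
    then have "t + (a - t) * c \<le> b + a * e'" by (simp add: algebra_simps)
    also have "a * e' \<le> a * (e / (a + 1))" using a e' by (intro mult_left_mono) auto
    also have "\<dots> \<le> e" using a e by (simp add: field_simps)
    finally show "t + (a - t) * c \<le> b + e" by simp
  qed
  moreover have "t * (1 - c) \<ge> (b - \<eta>) * (1 - c)" using t c1 by (intro mult_right_mono) auto
  ultimately have "(b - \<eta>) * (1 - c) + a * c \<le> b" by (simp add: algebra_simps)
  then have "c * (a - b) \<le> \<eta> * (1 - c)" by (simp add: algebra_simps)
  also have "\<dots> \<le> \<eta>" using \<eta> c by (simp add: algebra_simps)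
  finally show False using \<eta> by (simp add: \<eta>_def)
qed

end

lemma poisson_measure_sphere_UNIV:
  fixes x :: "real ^ 'n"
  assumes "3 \<le> CARD('n)" "norm x < 1"
  shows "measure (poisson_measure x) UNIV = 1"
  using prob_space.prob_space[OF prob_space_poisson_measure[OF assms]] by simp

lemma poisson_measure_reflect_in:
  fixes x v :: "real ^ 'n"
  assumes v: "norm v = 1" and [measurable]: "A \<in> sets borel"
  shows "emeasure (poisson_measure (reflect_in v x)) A = emeasure (poisson_measure x) {z. reflect_in v z \<in> A}"
proof -
  have [measurable]: "{z. reflect_in v z \<in> A} \<in> sets borel" by measurable
  have "emeasure (poisson_measure (reflect_in v x)) A = (\<integral>\<^sup>+z. ennreal (pk (reflect_in v x) z) * indicator A z \<partial>sph)"
    by (simp add: poisson_measure_def emeasure_density)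
  also have "\<dots> = (\<integral>\<^sup>+z. ennreal (pk (reflect_in v x) (reflect_in v z)) * indicator A (reflect_in v z) \<partial>sph)"
    by (rule nn_integral_sph_reflect_in[OF v, symmetric]) measurable
  also have "\<dots> = (\<integral>\<^sup>+z. ennreal (pk x z) * indicator {z. reflect_in v z \<in> A} z \<partial>sph)"
    using v by (simp add: pk_def indicator_def)
  finally show ?thesis by (simp add: poisson_measure_def emeasure_density)
qed

text \<open>A neighbourhood of a boundary point \<open>p\<close> of a cap is covered by finitely many rotated copies of the cap about
  the axis \<open>p\<close>, one for each vector of an orthonormal basis of the hyperplane orthogonal to \<open>p\<close> and its negative.\<close>

lemma poisson_measure_cap:
  fixes e p :: "real ^ 'n"
  assumes n: "3 \<le> CARD('n)" and e: "norm e = 1" and p: "norm p = 1" and s: "-1 < s" "s < 1" "s \<le> p \<bullet> e"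
  shows "\<exists>c>0. \<forall>\<^sub>F i in sequentially. c \<le> measure (poisson_measure (radii i *\<^sub>R p)) {z. s \<le> z \<bullet> e}"
proof -
  have x1: "norm (radii i *\<^sub>R p) < 1" for i using p radii(1,2)[of i] by simp
  have xlim: "(\<lambda>i. radii i *\<^sub>R p) \<longlonglongrightarrow> p"
    using tendsto_scaleR[OF radii(3) tendsto_const, of p] by simp
  have near: "\<forall>\<^sub>F i in sequentially. 1 / 2 \<le> measure (poisson_measure (radii i *\<^sub>R p)) (ball p d)" if d: "0 < d" for d
  proof -
    have "(\<lambda>i. (1 - (norm (radii i *\<^sub>R p))\<^sup>2) * (2 / d) ^ CARD('n)) \<longlonglongrightarrow> (1 - (norm p)\<^sup>2) * (2 / d) ^ CARD('n)"
      by (intro tendsto_intros xlim)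
    then have "\<forall>\<^sub>F i in sequentially. (1 - (norm (radii i *\<^sub>R p))\<^sup>2) * (2 / d) ^ CARD('n) < 1 / 2"
      using p by (intro order_tendstoD(2)) auto
    moreover have "\<forall>\<^sub>F i in sequentially. dist (radii i *\<^sub>R p) p < d / 2"
      using tendstoD[OF xlim, of "d / 2"] d(1) by simp
    ultimately show ?thesis
    proof eventually_elim
      case (elim i)
      let ?P = "poisson_measure (radii i *\<^sub>R p)"
      interpret P: prob_space ?P by (rule prob_space_poisson_measure[OF n x1])
      have "measure ?P (- ball p d) \<le> 1 / 2"
        using poisson_measure_far[OF n x1, of i p d] elim d(1) by (simp add: dist_norm)
      then show ?case
        using P.prob_space P.finite_measure_Union[of "ball p d" "- ball p d"] by (simp add: Compl_partition)
    qed
  qed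
  show ?thesis
  proof (cases "s < p \<bullet> e")
    case True
    have "open {z. s < z \<bullet> e}" by (intro open_Collect_less continuous_intros)
    then obtain d where d: "0 < d" "ball p d \<subseteq> {z. s < z \<bullet> e}"
      by (rule openE[of _ p]) (use True in auto)
    show ?thesis
    proof (intro exI[of _ "1 / 2"] conjI)
      show "\<forall>\<^sub>F i in sequentially. 1 / 2 \<le> measure (poisson_measure (radii i *\<^sub>R p)) {z. s \<le> z \<bullet> e}"
        using near[OF d(1)]
      proof eventually_elim
        case (elim i)
        interpret P: prob_space "poisson_measure (radii i *\<^sub>R p)" by (rule prob_space_poisson_measure[OF n x1])
        show ?case using d(2) by (intro order_trans[OF elim] P.finite_measure_mono) auto
      qed
    qed simp
  next
    case False
    then have pe: "p \<bullet> e = s" using s by simp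
    define t where "t = sqrt (1 - s\<^sup>2)"
    have s2: "s\<^sup>2 < 1" using s by (simp add: abs_square_less_1)
    then have t: "0 < t" "t\<^sup>2 = 1 - s\<^sup>2" by (auto simp: t_def)
    \<comment> \<open>At a boundary point, e = s p + t b with a unit vector b orthogonal to p.
      Replacing b by another such vector v gives the image of the cap under a reflection that fixes
      p, so the Poisson measure at a multiple of p does not distinguish these copies.\<close>
    define b where "b = (e - s *\<^sub>R p) /\<^sub>R t"
    have eb: "e = s *\<^sub>R p + t *\<^sub>R b" using t by (simp add: b_def)
    have bp: "b \<bullet> p = 0"
      using p pe by (simp add: b_def inner_diff_left inner_diff_right inner_commute norm_eq_1)
    have "(norm e)\<^sup>2 = s\<^sup>2 + t\<^sup>2 * (norm b)\<^sup>2"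
      using p bp unfolding eb power2_norm_eq_inner norm_eq_1
      by (simp add: inner_add_left inner_add_right inner_commute power2_eq_square algebra_simps)
    then have "t\<^sup>2 * (norm b)\<^sup>2 = 1 - s\<^sup>2" using e by simp
    then have "t\<^sup>2 * (norm b)\<^sup>2 = t\<^sup>2 * 1" by (simp only: t(2) mult_1_right)
    then have "(norm b)\<^sup>2 = 1" using t(1) by (subst (asm) mult_cancel_left) auto
    then have nb: "norm b = 1" by (metis abs_norm_cancel abs_square_eq_1)
    define E where "E v = {z. s \<le> z \<bullet> (s *\<^sub>R p + t *\<^sub>R v)}" for v
    have [measurable]: "E v \<in> sets borel" for v
      unfolding E_def by (intro borel_closed closed_Collect_le continuous_intros)
    have Eeq: "measure (poisson_measure (r *\<^sub>R p)) (E v) = measure (poisson_measure (r *\<^sub>R p)) (E b)"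
      if v: "norm v = 1" "v \<bullet> p = 0" for v r
    proof (cases "v = b")
      case False
      define w where "w = (v - b) /\<^sub>R norm (v - b)"
      have w: "norm w = 1" using False by (simp add: w_def)
      have wp: "reflect_in w p = p" using v bp by (simp add: reflect_in_def w_def inner_diff_left)
      have wv: "reflect_in w v = b"
        unfolding w_def using v nb False by (intro reflect_in_swap) auto
      then have wb: "reflect_in w b = v" using w by (metis reflect_in_involution)
      have "{z. reflect_in w z \<in> E v} = E b"
      proof -
        have "reflect_in w z \<bullet> (s *\<^sub>R p + t *\<^sub>R v) = z \<bullet> (s *\<^sub>R p + t *\<^sub>R b)" for z
          using reflect_in_inner[OF w, of z "s *\<^sub>R p + t *\<^sub>R b"]
          by (simp add: linear_add linear_cmul reflect_in_linear wp wb)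
        then show ?thesis by (simp add: E_def)
      qed
      then show ?thesis
        using poisson_measure_reflect_in[OF w, of "E v" "r *\<^sub>R p"]
        by (simp add: measure_def linear_cmul reflect_in_linear wp)
    qed simp
    have "subspace {z. z \<bullet> p = 0}" by (auto simp: subspace_def inner_add_left)
    then obtain B where B: "B \<subseteq> {z. z \<bullet> p = 0}" "pairwise orthogonal B" "\<And>x. x \<in> B \<Longrightarrow> norm x = 1"
      "independent B" "span B = {z. z \<bullet> p = 0}"
      by (metis orthonormal_basis_subspace)
    have finB: "finite B" using B(4) by (rule independent_imp_finite)
    define V where "V = B \<union> uminus ` B"
    have V: "finite V" "\<And>v. v \<in> V \<Longrightarrow> norm v = 1 \<and> v \<bullet> p = 0"
      using finB B by (auto simp: V_def)
    \<comment> \<open>The radius comes from the covering estimate. If z lies in no copy, then with u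
      = 1 - z.p all coordinates orthogonal to p are at most u/t in modulus, so their vector y has
      |y| \<le> N u/t; but |y|^2 \<ge> u. Hence u = 0 or u \<ge> (t/N)^2, and the latter contradicts
      2 u = |z - p|^2 < d^2 \<le> (t/N)^2.\<close>
    define N where "N = real (card B) + 1"
    have N: "0 < N" by (simp add: N_def)
    define d where "d = min 1 (t / N)"
    have d: "0 < d" "d \<le> 1" "d \<le> t / N" using t N by (auto simp: d_def)
    have cover: "z \<in> (\<Union>v\<in>insert b V. E v)" if z: "z \<in> ball p d" "norm z = 1" for z
    proof (rule ccontr)
      assume no: "z \<notin> (\<Union>v\<in>insert b V. E v)"
      define u where "u = 1 - z \<bullet> p"
      have "(norm (z - p))\<^sup>2 = 2 * u"
        using z p unfolding u_def power2_norm_eq_inner norm_eq_1 by (simp add: inner_diff_left inner_diff_right inner_commute)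
      moreover have "(norm (z - p))\<^sup>2 < d\<^sup>2"
        using z(1) d by (intro power_strict_mono) (auto simp: dist_norm norm_minus_commute)
      ultimately have u2: "2 * u < d\<^sup>2" "0 \<le> u" by (auto simp: zero_le_mult_iff) (metis mult_less_cancel_left_disj mult_zero_right not_less zero_le_power2 zero_less_numeral)
      have bnd: "t * (z \<bullet> v) < u" if v: "v \<in> insert b V" for v
      proof -
        have "s * (z \<bullet> p) + t * (z \<bullet> v) < s"
          using no v by (auto simp: E_def inner_add_right not_le)
        then have "t * (z \<bullet> v) < s * u" by (simp add: u_def algebra_simps)
        also have "\<dots> \<le> 1 * u" using s u2 by (intro mult_right_mono) auto
        finally show ?thesis by simp
      qed
      have absb: "\<bar>z \<bullet> v\<bar> \<le> u / t" if "v \<in> B" for v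
        using bnd[of v] bnd[of "- v"] that t by (auto simp: V_def abs_le_iff field_simps)
      define y where "y = z - (z \<bullet> p) *\<^sub>R p"
      have "y \<in> span B" using p unfolding B(5) y_def norm_eq_1 by (simp add: inner_diff_left)
      then have "y = (\<Sum>i\<in>B. (y \<bullet> i) *\<^sub>R i)"
        using orthonormal_basis_expand[OF B(2,3)] finB by simp
      also have "\<dots> = (\<Sum>i\<in>B. (z \<bullet> i) *\<^sub>R i)"
      proof (intro sum.cong refl)
        fix i assume "i \<in> B"
        then have "p \<bullet> i = 0" using B(1) by (auto simp: inner_commute)
        then show "(y \<bullet> i) *\<^sub>R i = (z \<bullet> i) *\<^sub>R i" by (simp add: y_def inner_diff_left)
      qed
      finally have "norm y \<le> (\<Sum>i\<in>B. norm ((z \<bullet> i) *\<^sub>R i))" by (metis norm_sum)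
      also have "\<dots> \<le> (\<Sum>i\<in>B. u / t)" using absb B(3) by (intro sum_mono) simp
      also have "\<dots> \<le> N * (u / t)" using u2 t by (simp add: N_def divide_right_mono mult_right_mono)
      finally have "norm y \<le> N * u / t" by simp
      then have "(norm y)\<^sup>2 \<le> (N * u / t)\<^sup>2" by (intro power_mono) auto
      moreover have "(norm y)\<^sup>2 = 1 - (z \<bullet> p)\<^sup>2"
        using z(2) p unfolding y_def power2_norm_eq_inner norm_eq_1
        by (simp add: inner_diff_left inner_diff_right inner_commute power2_eq_square)
      moreover have "1 - (z \<bullet> p)\<^sup>2 \<ge> u"
      proof -
        have "d\<^sup>2 \<le> 1" using d by (simp add: abs_square_le_1)
        then have "0 \<le> z \<bullet> p" "z \<bullet> p \<le> 1" using u2 by (auto simp: u_def)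
        then have "(z \<bullet> p)\<^sup>2 \<le> z \<bullet> p" by (simp add: power2_eq_square mult_left_le)
        then show ?thesis by (simp add: u_def)
      qed
      ultimately have q: "u \<le> (N * u / t)\<^sup>2" by simp
      show False
      proof (cases "u = 0")
        case True
        then have "t * (z \<bullet> b) < 0" using bnd[of b] by simp
        moreover have "(norm (z - p))\<^sup>2 = 0" using \<open>(norm (z - p))\<^sup>2 = 2 * u\<close> True by simp
        ultimately show False using bp by (simp add: inner_commute)
      next
        case False
        then have up: "0 < u" using u2 by simp
        have "(N * u / t)\<^sup>2 = u * ((N / t)\<^sup>2 * u)" by (simp add: power2_eq_square)
        then have "1 \<le> (N / t)\<^sup>2 * u" using q up by simp
        also have "\<dots> < (N / t)\<^sup>2 * (t / N)\<^sup>2"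
        proof (intro mult_strict_left_mono)
          have "d\<^sup>2 \<le> (t / N)\<^sup>2" using d by (intro power_mono) auto
          then show "u < (t / N)\<^sup>2" using u2 up by simp
        qed (use t N in simp)
        also have "\<dots> = ((N / t) * (t / N))\<^sup>2" by (rule power_mult_distrib[symmetric])
        also have "\<dots> = 1" using t(1) N by simp
        finally show False by simp
      qed
    qed
    let ?W = "insert b V"
    have W: "finite ?W" "\<And>v. v \<in> ?W \<Longrightarrow> norm v = 1 \<and> v \<bullet> p = 0"
      using V nb bp by auto
    show ?thesis
    proof (intro exI[of _ "1 / (2 * real (card ?W))"] conjI)
      have cW: "0 < real (card ?W)" using W(1) by (simp add: card_gt_0_iff)
      then show "0 < 1 / (2 * real (card ?W))" by simp
      show "\<forall>\<^sub>F i in sequentially. 1 / (2 * real (card ?W)) \<le> measure (poisson_measure (radii i *\<^sub>R p)) {z. s \<le> z \<bullet> e}"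
        using near[OF d(1)]
      proof eventually_elim
        case (elim i)
        let ?P = "poisson_measure (radii i *\<^sub>R p)"
        interpret P: prob_space ?P by (rule prob_space_poisson_measure[OF n x1])
        have "measure ?P (ball p d) \<le> measure ?P (\<Union>v\<in>?W. E v)"
        proof (rule P.finite_measure_mono_AE)
          show "AE z in ?P. z \<in> ball p d \<longrightarrow> z \<in> (\<Union>v\<in>?W. E v)"
            using AE_poisson_sphere by eventually_elim (use cover in blast)
          show "(\<Union>v\<in>?W. E v) \<in> P.events"
            using W(1) by (intro sets.finite_UN) auto
        qed
        also have "\<dots> \<le> (\<Sum>v\<in>?W. measure ?P (E v))"
          by (intro P.finite_measure_subadditive_finite W(1)) auto
        also have "\<dots> = (\<Sum>v\<in>?W. measure ?P (E b))"
          using W(2) by (intro sum.cong refl Eeq) auto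
        also have "\<dots> = real (card ?W) * measure ?P (E b)" by simp
        also have "E b = {z. s \<le> z \<bullet> e}" unfolding E_def eb ..
        finally show ?case using elim cW by (simp add: field_simps)
      qed
    qed
  qed
qed

subsection \<open>Weak compactness\<close>

text \<open>At the first differing digit k the sums differ by 3^(-k), and all later digits change
  this by at most half of it. In base 2 with digits 0 and 1 the tail could cancel the leading
  difference.\<close>

lemma ternary_digits_separated:
  fixes a b :: "nat \<Rightarrow> real"
  assumes a: "\<And>l. a l \<in> {0, 1}" and b: "\<And>l. b l \<in> {0, 1}" and ex: "\<exists>l\<le>L. a l \<noteq> b l"
  shows "(1/3) ^ L / 2 \<le> \<bar>(\<Sum>l. (1/3) ^ l * a l) - (\<Sum>l. (1/3) ^ l * b l)\<bar>"
proof -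
  define d where "d l = (1/3) ^ l * (a l - b l)" for l :: nat
  have geo: "summable (\<lambda>l. (1/3 :: real) ^ l)" by (rule summable_geometric) simp
  have dle: "norm (d l) \<le> (1/3) ^ l" for l
    using a[of l] b[of l] by (auto simp: d_def)
  have sa: "summable (\<lambda>l. (1/3) ^ l * a l)" and sb: "summable (\<lambda>l. (1/3) ^ l * b l)"
  proof -
    have "norm ((1/3) ^ l * a l) \<le> (1/3) ^ l" "norm ((1/3) ^ l * b l) \<le> (1/3) ^ l" for l
      using a[of l] b[of l] by auto
    then show "summable (\<lambda>l. (1/3) ^ l * a l)" "summable (\<lambda>l. (1/3) ^ l * b l)"
      by (intro summable_comparison_test'[OF geo, of 0]; blast)+
  qed
  have sd: "summable d" by (rule summable_comparison_test'[OF geo dle])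
  have diff: "(\<Sum>l. (1/3) ^ l * a l) - (\<Sum>l. (1/3) ^ l * b l) = suminf d"
    unfolding suminf_diff[OF sa sb] by (simp add: d_def[abs_def] algebra_simps)
  define k where "k = (LEAST l. a l \<noteq> b l)"
  obtain l where l: "l \<le> L" "a l \<noteq> b l" using ex by blast
  have k: "a k \<noteq> b k" "k \<le> L" "\<And>j. j < k \<Longrightarrow> a j = b j"
  proof -
    show "a k \<noteq> b k" unfolding k_def by (rule LeastI[of "\<lambda>l. a l \<noteq> b l", OF l(2)])
    show "k \<le> L" unfolding k_def using Least_le[of "\<lambda>l. a l \<noteq> b l", OF l(2)] l(1) by (rule order_trans)
    show "a j = b j" if "j < k" for j using not_less_Least[OF that[unfolded k_def]] by simp
  qed
  have "suminf d = (\<Sum>i. d (i + Suc k)) + (\<Sum>i<Suc k. d i)"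
    by (rule suminf_split_initial_segment[OF sd])
  also have "(\<Sum>i<Suc k. d i) = d k" using k(3) by (simp add: d_def)
  finally have split: "suminf d = (\<Sum>i. d (i + Suc k)) + d k" .
  have "norm (\<Sum>i. d (i + Suc k)) \<le> (\<Sum>i. (1/3) ^ i * (1/3) ^ Suc k)"
  proof (rule norm_suminf_le)
    show "norm (d (i + Suc k)) \<le> (1/3) ^ i * (1/3) ^ Suc k" for i
      using dle[of "i + Suc k"] by (simp only: power_add)
    show "summable (\<lambda>i. (1/3 :: real) ^ i * (1/3) ^ Suc k)" by (intro summable_mult2 geo)
  qed
  also have "\<dots> = (\<Sum>i. (1/3) ^ i) * (1/3) ^ Suc k" by (rule suminf_mult2[OF geo, symmetric])
  also have "(\<Sum>i. (1/3 :: real) ^ i) = 3/2" by (subst suminf_geometric) auto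
  finally have "\<bar>\<Sum>i. d (i + Suc k)\<bar> \<le> (1/3) ^ k / 2" by simp
  moreover have "\<bar>d k\<bar> = (1/3) ^ k" using k(1) a[of k] b[of k] by (auto simp: d_def)
  ultimately have "(1/3) ^ k / 2 \<le> \<bar>suminf d\<bar>" unfolding split by linarith
  moreover have "(1/3 :: real) ^ L \<le> (1/3) ^ k" using k(2) by (intro power_decreasing) auto
  ultimately show ?thesis unfolding diff by linarith
qed

text \<open>A Borel injection of a compact set into the line with uniformly continuous inverse: the ternary digits
  record membership in the sets of a countable basis.\<close>

lemma compact_borel_code:
  fixes S :: "'a::euclidean_space set"
  assumes S: "compact S"
  obtains s :: "'a \<Rightarrow> real" and g :: "real \<Rightarrow> 'a" where
    "s \<in> borel_measurable borel" "\<And>x. 0 \<le> s x \<and> s x \<le> 2" "continuous_on UNIV g" "\<And>x. x \<in> S \<Longrightarrow> g (s x) = x"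
proof -
  obtain B :: "'a set set" where B: "countable B" "topological_basis B"
    using ex_countable_basis by blast
  have Bne: "B \<noteq> {}" using B(2) by (meson UNIV_I empty_iff open_UNIV topological_basisE)
  define A where "A = from_nat_into B"
  have A: "range A = B" unfolding A_def by (rule range_from_nat_into[OF Bne B(1)])
  have Aopen: "open (A l)" for l
    using A B(2) by (metis rangeI topological_basis_open)
  then have [measurable]: "A l \<in> sets borel" for l by simp
  define s where "s x = (\<Sum>l. (1/3) ^ l * indicator (A l) x :: real)" for x
  have geo: "summable (\<lambda>l. (1/3 :: real) ^ l)" by (rule summable_geometric) simp
  have meas: "s \<in> borel_measurable borel" unfolding s_def by measurable
  have sm: "summable (\<lambda>l. (1/3) ^ l * indicator (A l) x :: real)" for x
    by (rule summable_comparison_test'[OF geo, of 0]) (auto simp: indicator_def)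
  have bnd: "0 \<le> s x \<and> s x \<le> 2" for x
  proof
    show "0 \<le> s x" unfolding s_def by (intro suminf_nonneg sm) auto
    have "s x \<le> (\<Sum>l. (1/3 :: real) ^ l)"
      unfolding s_def by (intro suminf_le sm geo) (auto simp: indicator_def)
    also have "\<dots> = 3/2" by (subst suminf_geometric) auto
    finally show "s x \<le> 2" by simp
  qed
  have inv: "\<exists>d>0. \<forall>x\<in>S. \<forall>y\<in>S. \<bar>s x - s y\<bar> < d \<longrightarrow> dist x y < e" if e: "0 < e" for e
  proof -
    \<comment> \<open>Finitely many basis sets of small diameter cover \<open>S\<close>. If the
      codes of x and y are so close that the digits agree up to the largest index \<open>L\<close>
      of these sets, both points lie in a common small set.\<close>
    define C where "C = {U \<in> B. \<exists>x. U \<subseteq> ball x (e / 2)}"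
    have cov: "S \<subseteq> \<Union>C"
    proof
      fix x assume "x \<in> S"
      obtain U where "U \<in> B" "x \<in> U" "U \<subseteq> ball x (e / 2)"
        using topological_basisE[OF B(2) open_ball, of x x "e / 2"] e by (metis centre_in_ball half_gt_zero)
      then show "x \<in> \<Union>C" by (auto simp: C_def)
    qed
    have "\<And>U. U \<in> C \<Longrightarrow> open U" using B(2) by (auto simp: C_def topological_basis_open)
    then obtain D where D: "D \<subseteq> C" "finite D" "S \<subseteq> \<Union>D"
      using compactE[OF S cov] by metis
    have "\<exists>l. A l = U" if "U \<in> D" for U using that D(1) A by (force simp: C_def)
    then obtain idx where idx: "\<And>U. U \<in> D \<Longrightarrow> A (idx U) = U" by metis
    define L where "L = Max (insert 0 (idx ` D))"
    have idxL: "idx U \<le> L" if "U \<in> D" for U using that D(2) by (auto simp: L_def)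
    show ?thesis
    proof (intro exI[of _ "(1/3) ^ L / 2"] conjI ballI impI)
      fix x y assume xy: "x \<in> S" "y \<in> S" and close: "\<bar>s x - s y\<bar> < (1/3) ^ L / 2"
      have agree: "\<forall>l\<le>L. indicator (A l) x = (indicator (A l) y :: real)"
      proof (rule ccontr)
        assume "\<not> ?thesis"
        then have "(1/3) ^ L / 2 \<le> \<bar>s x - s y\<bar>"
          unfolding s_def by (intro ternary_digits_separated) (auto simp: indicator_def)
        then show False using close by simp
      qed
      obtain U where U: "U \<in> D" "x \<in> U" using D(3) xy(1) by blast
      then have "y \<in> U"
        using agree[rule_format, OF idxL[OF U(1)]] idx[OF U(1)] by (auto simp: indicator_def split: if_splits)
      moreover obtain z where "U \<subseteq> ball z (e / 2)" using U D(1) by (auto simp: C_def)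
      ultimately have "dist z x < e / 2" "dist z y < e / 2" using U(2) by auto
      then show "dist x y < e" using dist_triangle2[of x y z] by (simp add: dist_commute)
    qed simp
  qed
  have inj: "x = y" if "x \<in> S" "y \<in> S" "s x = s y" for x y
  proof (rule ccontr)
    assume "x \<noteq> y"
    then obtain d where "0 < d" "\<forall>x'\<in>S. \<forall>y'\<in>S. \<bar>s x' - s y'\<bar> < d \<longrightarrow> dist x' y' < dist x y"
      using inv[of "dist x y"] by auto
    then show False using that by force
  qed
  define c where "c = inv_into S s"
  have c: "c (s x) = x" if "x \<in> S" for x
    unfolding c_def using inj that by (intro inv_into_f_f) (auto simp: inj_on_def)
  have uc: "uniformly_continuous_on (s ` S) c"
    unfolding uniformly_continuous_on_def
  proof (intro allI impI)
    fix e :: real assume "0 < e"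
    from inv[OF this] obtain d where "0 < d" "\<forall>x\<in>S. \<forall>y\<in>S. \<bar>s x - s y\<bar> < d \<longrightarrow> dist x y < e" by blast
    then show "\<exists>d>0. \<forall>x\<in>s ` S. \<forall>x'\<in>s ` S. dist x' x < d \<longrightarrow> dist (c x') (c x) < e"
      by (intro exI[of _ d]) (auto simp: c dist_real_def)
  qed
  obtain c' where c': "uniformly_continuous_on (closure (s ` S)) c'" "\<And>x. x \<in> s ` S \<Longrightarrow> c x = c' x"
  proof (rule uniformly_continuous_on_extension_on_closure[OF uc])
    fix f assume "uniformly_continuous_on (closure (s ` S)) f" "\<And>x. x \<in> s ` S \<Longrightarrow> c x = f x"
    then show thesis by (rule that)
  qed
  \<comment> \<open>The inverse is extended to the whole line so that \<open>h \<circ> g\<close> is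
    an admissible test function for weak convergence there, for every continuous h.\<close>
  obtain g where g: "continuous_on UNIV g" "\<And>x. x \<in> closure (s ` S) \<Longrightarrow> g x = c' x"
    using Tietze_unbounded[OF uniformly_continuous_imp_continuous[OF c'(1)], of UNIV] by auto
  have "g (s x) = x" if "x \<in> S" for x
    using that g(2) c'(2) c closure_subset by (metis image_eqI subsetD)
  then show ?thesis using that meas bnd g(1) by blast
qed

text \<open>The images under the code live in [0, 2] and are tight, so Helly selection on the line
  applies; the limit is carried back by \<open>g\<close>. Only \<open>g\<close> has to be
  continuous, not the code, because on \<open>S\<close> a test function h equals
  \<open>h \<circ> g\<close> evaluated at the code.\<close>

lemma weak_compactness_prob:
  fixes \<nu> :: "nat \<Rightarrow> 'a::euclidean_space measure"
  assumes S: "compact S" and "\<And>j. prob_space (\<nu> j)" and sets [simp]: "\<And>j. sets (\<nu> j) = sets borel"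
    and AE: "\<And>j. AE x in \<nu> j. x \<in> S"
  shows "\<exists>r \<nu>'. strict_mono (r :: nat \<Rightarrow> nat) \<and> prob_space \<nu>' \<and> sets \<nu>' = sets borel \<and> (AE x in \<nu>'. x \<in> S) \<and>
    (\<forall>h :: 'a \<Rightarrow> real. continuous_on UNIV h \<longrightarrow> bounded (range h) \<longrightarrow> (\<lambda>j. \<integral>x. h x \<partial>\<nu> (r j)) \<longlonglongrightarrow> (\<integral>x. h x \<partial>\<nu>'))"
proof -
  interpret \<nu>: prob_space "\<nu> j" for j by fact
  obtain s :: "'a \<Rightarrow> real" and g where s: "s \<in> borel_measurable borel" "\<And>x. 0 \<le> s x \<and> s x \<le> 2"
    and g: "continuous_on UNIV g" "\<And>x. x \<in> S \<Longrightarrow> g (s x) = x"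
    using compact_borel_code[OF S] by blast
  note sets [measurable_cong] and s(1) [measurable]
  have [measurable]: "g \<in> borel_measurable borel" using g(1) by (rule borel_measurable_continuous_onI)
  define m where "m j = distr (\<nu> j) borel s" for j
  have rd: "real_distribution (m j)" for j
    unfolding m_def real_distribution_def real_distribution_axioms_def
    by (auto intro!: \<nu>.prob_space_distr)
  have "tight m"
    unfolding tight_def
  proof (intro conjI allI impI)
    fix e :: real assume e: "0 < e"
    have "measure (m j) {-1<..2} = 1" for j
    proof -
      have "-1 < s x" "s x \<le> 2" for x using s(2)[of x] by linarith+
      then have "s -` {-1<..2} \<inter> space (\<nu> j) = space (\<nu> j)" by auto
      then show ?thesis unfolding m_def by (simp add: measure_distr \<nu>.prob_space)
    qed
    then show "\<exists>a b. a < b \<and> (\<forall>n. 1 - e < measure (m n) {a<..b})"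
      using e by (intro exI[of _ "-1"] exI[of _ 2]) auto
  qed (rule rd)
  from tight_imp_convergent_subsubsequence[OF this strict_mono_id]
  obtain r M where r: "strict_mono (r :: nat \<Rightarrow> nat)" and M: "real_distribution M" "weak_conv_m (m \<circ> r) M"
    by (auto simp: comp_def)
  interpret M: real_distribution M by fact
  define \<nu>' where "\<nu>' = distr M borel g"
  have [measurable]: "g \<in> borel_measurable M" by (simp cong: measurable_cong_sets)
  have prob: "prob_space \<nu>'" unfolding \<nu>'_def by (rule M.prob_space_distr) measurable
  have conv: "(\<lambda>j. \<integral>x. h x \<partial>\<nu> (r j)) \<longlonglongrightarrow> (\<integral>x. h x \<partial>\<nu>')"
    if h: "continuous_on UNIV h" "bounded (range h)" for h :: "'a \<Rightarrow> real"
  proof -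
    have [measurable]: "h \<in> borel_measurable borel" using h(1) by (rule borel_measurable_continuous_onI)
    obtain K where K: "\<And>x. norm (h x) \<le> K" using h(2) by (auto simp: bounded_iff)
    have "(\<lambda>j. integral\<^sup>L ((m \<circ> r) j) (\<lambda>t. h (g t))) \<longlonglongrightarrow> integral\<^sup>L M (\<lambda>t. h (g t))"
    proof (rule weak_conv_imp_integral_bdd_continuous_conv[OF _ M])
      show "real_distribution ((m \<circ> r) j)" for j using rd by simp
      have "continuous_on UNIV (\<lambda>t. h (g t))"
        by (rule continuous_on_compose2[OF h(1) g(1)]) simp
      then show "isCont (\<lambda>t. h (g t)) x" for x by (simp add: continuous_on_eq_continuous_at)
    qed (rule K)
    moreover have "integral\<^sup>L ((m \<circ> r) j) (\<lambda>t. h (g t)) = (\<integral>x. h x \<partial>\<nu> (r j))" for j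
    proof -
      have "integral\<^sup>L ((m \<circ> r) j) (\<lambda>t. h (g t)) = (\<integral>x. h (g (s x)) \<partial>\<nu> (r j))"
        by (simp add: m_def integral_distr)
      also have "\<dots> = (\<integral>x. h x \<partial>\<nu> (r j))"
      proof (rule integral_cong_AE)
        show "AE x in \<nu> (r j). h (g (s x)) = h x" using AE[of "r j"] by eventually_elim (simp add: g(2))
      qed measurable
      finally show ?thesis .
    qed
    moreover have "integral\<^sup>L M (\<lambda>t. h (g t)) = (\<integral>x. h x \<partial>\<nu>')"
      by (simp add: \<nu>'_def integral_distr)
    ultimately show ?thesis by simp
  qed
  have "AE x in \<nu>'. x \<in> S"
  proof -
    interpret \<nu>': prob_space \<nu>' by fact
    have Sne: "S \<noteq> {}" using AE[of 0] \<nu>.AE_False by auto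
    \<comment> \<open>Testing the limit with the truncated distance from \<open>S\<close> shows that
      no mass leaves \<open>S\<close>.\<close>
    define h where "h x = min 1 (infdist x S)" for x
    have h: "continuous_on UNIV h" "bounded (range h)" "\<And>x. 0 \<le> h x"
      unfolding h_def by (auto intro!: continuous_intros boundedI[of _ 1] simp: infdist_nonneg)
    have hm: "h \<in> borel_measurable borel" using h(1) by (rule borel_measurable_continuous_onI)
    have "(\<integral>x. h x \<partial>\<nu> (r j)) = 0" for j
    proof -
      have "(\<integral>x. h x \<partial>\<nu> (r j)) = (\<integral>x. 0 \<partial>\<nu> (r j))"
      proof (rule integral_cong_AE)
        show "AE x in \<nu> (r j). h x = 0" using AE[of "r j"] by eventually_elim (simp add: h_def)
      qed (use hm in \<open>simp_all cong: measurable_cong_sets\<close>)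
      then show ?thesis by simp
    qed
    with conv[OF h(1,2)] have "(\<integral>x. h x \<partial>\<nu>') = 0" by (simp add: LIMSEQ_const_iff)
    moreover have "integrable \<nu>' h"
      using hm h(3) by (intro \<nu>'.integrable_const_bound[where B=1]) (auto simp: h_def \<nu>'_def)
    ultimately have "AE x in \<nu>'. h x = 0"
      using integral_nonneg_eq_0_iff_AE[of \<nu>' h] h(3) by simp
    then show ?thesis
    proof eventually_elim
      case (elim x)
      then have "infdist x S = 0" by (auto simp: h_def min_def split: if_splits)
      then show ?case using in_closure_iff_infdist_zero[OF Sne] compact_imp_closed[OF S] by (simp add: closure_closed)
    qed
  qed
  then show ?thesis using r prob conv by (intro exI[of _ r] exI[of _ \<nu>']) (auto simp: \<nu>'_def)
qed

section \<open>Weak limits of finite measures on the sphere\<close>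

definition weakly_converges :: "(nat \<Rightarrow> 'a::euclidean_space measure) \<Rightarrow> 'a measure \<Rightarrow> bool" where
  "weakly_converges \<nu> \<nu>' \<longleftrightarrow> (\<forall>h :: 'a \<Rightarrow> real. continuous_on UNIV h \<longrightarrow> bounded (range h) \<longrightarrow>
     (\<lambda>j. \<integral>x. h x \<partial>\<nu> j) \<longlonglongrightarrow> (\<integral>x. h x \<partial>\<nu>'))"

lemma sphere_measure_density_const:
  fixes p :: "(real ^ 'n) measure"
  assumes "prob_space p" "sets p = sets borel" "AE x in p. norm x = 1" "0 \<le> a"
  shows "sphere_measure (density p (\<lambda>_. ennreal a))"
proof -
  interpret p: prob_space p by fact
  have sp: "space p = UNIV" using sets_eq_imp_space_eq[OF assms(2)] by simp
  show ?thesis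
  proof (intro sphere_measure.intro finite_measureI sphere_measure_axioms.intro)
    have "emeasure (density p (\<lambda>_. ennreal a)) (space p) = ennreal a"
      using p.emeasure_space_1 by (simp add: emeasure_density nn_integral_cmult_indicator)
    then show "emeasure (density p (\<lambda>_. ennreal a)) (space (density p (\<lambda>_. ennreal a))) \<noteq> \<infinity>" by simp
    show "AE y in density p (\<lambda>_. ennreal a). norm y = 1"
      using assms(3) by (subst AE_density) (auto elim: eventually_mono)
  qed (use assms(2) in simp)
qed

lemma weak_compactness_sphere:
  fixes \<nu> :: "nat \<Rightarrow> (real ^ 'n) measure"
  assumes "\<And>j. sphere_measure (\<nu> j)" and C: "\<And>j. measure (\<nu> j) UNIV \<le> C"
  shows "\<exists>r \<nu>'. strict_mono (r :: nat \<Rightarrow> nat) \<and> sphere_measure \<nu>' \<and> weakly_converges (\<lambda>j. \<nu> (r j)) \<nu>'"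
proof -
  interpret \<nu>: sphere_measure "\<nu> j" for j by fact
  define a where "a j = measure (\<nu> j) UNIV" for j
  \<comment> \<open>Mass and shape are treated separately: the masses have a convergent subsequence
    in a compact interval. When the mass is 0 any probability measure can stand for the shape, and
    \<open>sph\<close> is taken.\<close>
  define p where "p j = (if a j = 0 then sph else density (\<nu> j) (\<lambda>_. ennreal (1 / a j)))" for j
  have a0: "0 \<le> a j" for j by (simp add: a_def)
  have p: "prob_space (p j)" "sets (p j) = sets borel" "AE x in p j. x \<in> sphere 0 1" for j
  proof -
    show "prob_space (p j)"
    proof (cases "a j = 0")
      case False
      then have "0 < a j" using a0[of j] by simp
      then have "emeasure (density (\<nu> j) (\<lambda>_. ennreal (1 / a j))) UNIV = 1"
        using \<nu>.emeasure_eq_measure[of j UNIV]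
        by (simp add: emeasure_density \<nu>.sets_eq nn_integral_cmult_indicator a_def flip: ennreal_mult)
      then show ?thesis using False by (intro prob_spaceI) (simp add: p_def)
    qed (simp add: p_def prob_space_sph)
    show "sets (p j) = sets borel" by (simp add: p_def \<nu>.sets_eq)
    show "AE x in p j. x \<in> sphere 0 1"
    proof (cases "a j = 0")
      case True
      then have "p j = sph" by (simp add: p_def)
      then show ?thesis unfolding mem_sphere_0 using AE_sph_sphere by metis
    next
      case False
      then have pj: "p j = density (\<nu> j) (\<lambda>_. ennreal (1 / a j))" by (simp add: p_def)
      show ?thesis
        unfolding pj using \<nu>.AE_sphere[of j] by (subst AE_density) (auto elim: eventually_mono)
    qed
  qed
  have int: "(\<integral>x. h x \<partial>\<nu> j) = a j * (\<integral>x. h x \<partial>p j)" if "h \<in> borel_measurable borel" for h :: "real ^ 'n \<Rightarrow> real" and j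
  proof (cases "a j = 0")
    case True
    then have "emeasure (\<nu> j) UNIV = 0" using \<nu>.emeasure_eq_measure[of j UNIV] by (simp add: a_def)
    then have "AE x in \<nu> j. h x = 0" by (intro AE_I[of _ _ UNIV]) (auto simp: \<nu>.sets_eq)
    then have "(\<integral>x. h x \<partial>\<nu> j) = 0" by (rule integral_eq_zero_AE)
    then show ?thesis using True by simp
  next
    case False
    then have "0 < a j" using a0[of j] by simp
    then show ?thesis using that
      by (simp add: p_def integral_density \<nu>.sets_eq cong: measurable_cong_sets)
  qed
  obtain r1 p' where r1: "strict_mono (r1 :: nat \<Rightarrow> nat)" and p': "prob_space p'" "sets p' = sets borel" "AE x in p'. x \<in> sphere 0 1"
    and conv: "\<And>h :: real ^ 'n \<Rightarrow> real. continuous_on UNIV h \<Longrightarrow> bounded (range h) \<Longrightarrow> (\<lambda>j. \<integral>x. h x \<partial>p (r1 j)) \<longlonglongrightarrow> (\<integral>x. h x \<partial>p')"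
    using weak_compactness_prob[where \<nu>=p, OF compact_sphere p] by blast
  have "\<forall>j. a (r1 j) \<in> {0..C}" using C a0 by (simp add: a_def)
  then obtain a' r2 where r2: "strict_mono (r2 :: nat \<Rightarrow> nat)" "((\<lambda>j. a (r1 j)) \<circ> r2) \<longlonglongrightarrow> a'" "a' \<in> {0..C}"
    using compact_Icc[of 0 C] unfolding compact_def by metis
  define \<nu>' where "\<nu>' = density p' (\<lambda>_. ennreal a')"
  have "weakly_converges (\<lambda>j. \<nu> ((r1 \<circ> r2) j)) \<nu>'"
    unfolding weakly_converges_def
  proof (intro allI impI)
    fix h :: "real ^ 'n \<Rightarrow> real" assume h: "continuous_on UNIV h" "bounded (range h)"
    have hm: "h \<in> borel_measurable borel" using h(1) by (rule borel_measurable_continuous_onI)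
    have "(\<lambda>j. \<integral>x. h x \<partial>p (r1 (r2 j))) \<longlonglongrightarrow> (\<integral>x. h x \<partial>p')"
      using LIMSEQ_subseq_LIMSEQ[OF conv[OF h] r2(1)] by (simp add: comp_def)
    from tendsto_mult[OF r2(2) this]
    show "(\<lambda>j. \<integral>x. h x \<partial>\<nu> ((r1 \<circ> r2) j)) \<longlonglongrightarrow> (\<integral>x. h x \<partial>\<nu>')"
      using hm r2(3) p'(2) by (simp add: int comp_def \<nu>'_def integral_density cong: measurable_cong_sets)
  qed
  moreover have "sphere_measure \<nu>'"
    unfolding \<nu>'_def using p' r2(3) by (intro sphere_measure_density_const) auto
  moreover have "strict_mono (r1 \<circ> r2)" using r1 r2(1) by (rule strict_mono_o)
  ultimately show ?thesis by blast
qed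

lemma weakly_converges_mass:
  fixes \<nu> :: "nat \<Rightarrow> (real ^ 'n) measure"
  assumes "\<And>j. sphere_measure (\<nu> j)" "sphere_measure \<nu>'" "weakly_converges \<nu> \<nu>'"
  shows "(\<lambda>j. measure (\<nu> j) UNIV) \<longlonglongrightarrow> measure \<nu>' UNIV"
proof -
  interpret \<nu>: sphere_measure "\<nu> j" for j by fact
  interpret \<nu>': sphere_measure \<nu>' by fact
  have "(\<lambda>j. \<integral>x. 1 \<partial>\<nu> j) \<longlonglongrightarrow> (\<integral>x. (1::real) \<partial>\<nu>')"
    using assms(3) unfolding weakly_converges_def by (elim allE[of _ "\<lambda>_. 1"]) auto
  then show ?thesis by simp
qed

text \<open>The inner integrals converge pointwise and, by uniform continuity of the kernel on the
  compact product, are equicontinuous with bounded masses. So they converge uniformly on the sphere,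
  and the inner integral may be replaced by its limit before the outer measure moves.\<close>

lemma weakly_converges_double:
  fixes \<nu> :: "nat \<Rightarrow> (real ^ 'n) measure" and K :: "real ^ 'n \<Rightarrow> real ^ 'n \<Rightarrow> real"
  assumes \<nu>: "\<And>j. sphere_measure (\<nu> j)" and \<nu>': "sphere_measure \<nu>'" and w: "weakly_converges \<nu> \<nu>'"
    and C: "\<And>j. measure (\<nu> j) UNIV \<le> C"
    and K: "continuous_on UNIV (\<lambda>(x, y). K x y)" and B: "\<And>x y. \<bar>K x y\<bar> \<le> B"
  shows "(\<lambda>j. \<integral>x. \<integral>y. K x y \<partial>\<nu> j \<partial>\<nu> j) \<longlonglongrightarrow> (\<integral>x. \<integral>y. K x y \<partial>\<nu>' \<partial>\<nu>')"
proof -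
  interpret \<nu>: sphere_measure "\<nu> j" for j by fact
  interpret \<nu>': sphere_measure \<nu>' by fact
  let ?S = "sphere (0 :: real ^ 'n) 1"
  have C0: "0 \<le> C" using C[of 0] measure_nonneg order_trans by blast
  have C': "measure \<nu>' UNIV \<le> C"
    by (rule LIMSEQ_le_const2[OF weakly_converges_mass[OF \<nu> \<nu>' w]]) (use C in auto)
  have B0: "0 \<le> B" using B[of 0 0] by simp
  have Km [measurable]: "(\<lambda>(x, y). K x y) \<in> borel_measurable borel"
    using K by (rule borel_measurable_continuous_onI)
  have Kx: "continuous_on UNIV (K x)" for x
    using continuous_on_compose2[OF K, of UNIV "\<lambda>y. (x, y)"] by (simp add: continuous_on_Pair continuous_on_const continuous_on_id)
  have Ky: "continuous_on UNIV (\<lambda>x. K x y)" for y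
    using continuous_on_compose2[OF K, of UNIV "\<lambda>x. (x, y)"] by (simp add: continuous_on_Pair continuous_on_const continuous_on_id)
  have Kxm [measurable]: "K x \<in> borel_measurable borel" for x
    using Kx by (rule borel_measurable_continuous_onI)
  have int: "integrable \<mu> (K x)" if "sphere_measure \<mu>" for \<mu> x
  proof -
    interpret sphere_measure \<mu> by fact
    show ?thesis using B by (intro integrable_const_bound[where B=B]) auto
  qed
  define G where "G \<mu> x = (\<integral>y. K x y \<partial>\<mu>)" for \<mu> x
  have Gc: "continuous_on UNIV (G \<mu>)" if "sphere_measure \<mu>" for \<mu>
  proof -
    interpret sphere_measure \<mu> by fact
    show ?thesis
      unfolding G_def continuous_on_eq_continuous_at[OF open_UNIV]
      using B Ky
      by (intro ballI isCont_integral_param[where r=1 and C=B]) (auto simp: continuous_on_eq_continuous_at finite_measure_axioms)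
  qed
  have Gm: "G \<mu> \<in> borel_measurable borel" if "sphere_measure \<mu>" for \<mu>
    using Gc[OF that] by (rule borel_measurable_continuous_onI)
  have Gb: "\<bar>G \<mu> x\<bar> \<le> B * measure \<mu> UNIV" if "sphere_measure \<mu>" for \<mu> x
  proof -
    interpret sphere_measure \<mu> by fact
    have "\<bar>G \<mu> x\<bar> \<le> (\<integral>y. \<bar>K x y\<bar> \<partial>\<mu>)" unfolding G_def by (rule integral_abs_bound)
    also have "\<dots> \<le> (\<integral>y. B \<partial>\<mu>)" using B int[OF that] by (intro integral_mono) auto
    finally show ?thesis by (simp add: mult.commute)
  qed
  have Gconv: "(\<lambda>j. G (\<nu> j) x) \<longlonglongrightarrow> G \<nu>' x" for x
    using w Kx[of x] B unfolding weakly_converges_def G_def by (auto intro!: boundedI[of _ B])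
  have unif: "\<forall>\<^sub>F j in sequentially. \<forall>x\<in>?S. \<bar>G (\<nu> j) x - G \<nu>' x\<bar> \<le> e" if e: "0 < e" for e
  proof -
    \<comment> \<open>The three differences below cost C e', e' and C e'.\<close>
    define e' where "e' = e / (2 * C + 1)"
    have e': "0 < e'" using e C0 by (simp add: e'_def)
    have "uniformly_continuous_on (?S \<times> ?S) (\<lambda>(x, y). K x y)"
      by (intro compact_uniformly_continuous compact_Times compact_sphere continuous_on_subset[OF K]) auto
    then obtain d where d: "0 < d" "\<And>u v. u \<in> ?S \<times> ?S \<Longrightarrow> v \<in> ?S \<times> ?S \<Longrightarrow> dist v u < d \<Longrightarrow> dist (case v of (x, y) \<Rightarrow> K x y) (case u of (x, y) \<Rightarrow> K x y) < e'"
      unfolding uniformly_continuous_on_def using e' by metis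
    have eq: "\<bar>K x y - K x' y\<bar> \<le> e'" if "x \<in> ?S" "x' \<in> ?S" "y \<in> ?S" "dist x x' < d" for x x' y
      using d(2)[of "(x', y)" "(x, y)"] that by (simp add: dist_real_def dist_Pair_Pair)
    have Geq: "\<bar>G \<mu> x - G \<mu> x'\<bar> \<le> e' * C" if \<mu>: "sphere_measure \<mu>" "measure \<mu> UNIV \<le> C" and x: "x \<in> ?S" "x' \<in> ?S" "dist x x' < d" for \<mu> x x'
    proof -
      interpret sphere_measure \<mu> by fact
      have "\<bar>G \<mu> x - G \<mu> x'\<bar> = \<bar>\<integral>y. K x y - K x' y \<partial>\<mu>\<bar>" using int[OF \<mu>(1)] by (simp add: G_def)
      also have "\<dots> \<le> (\<integral>y. \<bar>K x y - K x' y\<bar> \<partial>\<mu>)" by (rule integral_abs_bound)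
      also have "\<dots> \<le> (\<integral>y. e' \<partial>\<mu>)"
      proof (rule integral_mono_AE)
        show "AE y in \<mu>. \<bar>K x y - K x' y\<bar> \<le> e'" using AE_sphere by eventually_elim (use eq x in simp)
      qed (use int[OF \<mu>(1)] in auto)
      also have "\<dots> \<le> e' * C" using \<mu>(2) e' by (simp add: mult.commute)
      finally show ?thesis .
    qed
    obtain F where F: "F \<subseteq> ?S" "finite F" "?S \<subseteq> (\<Union>x\<in>F. ball x d)"
    proof (rule compactE_image[OF compact_sphere, of "?S" "\<lambda>x. ball x d" 0 1])
      show "?S \<subseteq> (\<Union>x\<in>?S. ball x d)" using d(1) by (intro subsetI UN_I) auto
    qed auto
    have "\<forall>\<^sub>F j in sequentially. \<forall>x\<in>F. \<bar>G (\<nu> j) x - G \<nu>' x\<bar> < e'"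
      using tendstoD[OF Gconv e'] by (intro eventually_ball_finite[OF F(2)]) (auto simp: dist_real_def)
    then show ?thesis
    proof eventually_elim
      case (elim j)
      show ?case
      proof
        fix x assume x: "x \<in> ?S"
        then obtain x' where x': "x' \<in> F" "dist x x' < d" using F(3) by (auto simp: dist_commute)
        then have x'S: "x' \<in> ?S" using F(1) by blast
        have "\<bar>G (\<nu> j) x - G \<nu>' x\<bar> \<le> \<bar>G (\<nu> j) x - G (\<nu> j) x'\<bar> + \<bar>G (\<nu> j) x' - G \<nu>' x'\<bar> + \<bar>G \<nu>' x - G \<nu>' x'\<bar>"
          by linarith
        also have "\<dots> \<le> e' * C + e' + e' * C"
          using elim x'(1) by (intro add_mono Geq \<nu> \<nu>' C C' x x'S x'(2)) (auto simp: less_imp_le)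
        also have "\<dots> = e' * (2 * C + 1)" by (simp add: algebra_simps)
        also have "\<dots> = e" using C0 by (simp add: e'_def)
        finally show "\<bar>G (\<nu> j) x - G \<nu>' x\<bar> \<le> e" .
      qed
    qed
  qed
  have "(\<lambda>j. \<integral>x. G (\<nu> j) x \<partial>\<nu> j) \<longlonglongrightarrow> (\<integral>x. G \<nu>' x \<partial>\<nu>')"
  proof -
    have lim2: "(\<lambda>j. \<integral>x. G \<nu>' x \<partial>\<nu> j) \<longlonglongrightarrow> (\<integral>x. G \<nu>' x \<partial>\<nu>')"
      using w Gc[OF \<nu>'] Gb[OF \<nu>'] unfolding weakly_converges_def by (auto intro!: boundedI[of _ "B * measure \<nu>' UNIV"])
    have "(\<lambda>j. (\<integral>x. G (\<nu> j) x \<partial>\<nu> j) - (\<integral>x. G \<nu>' x \<partial>\<nu> j)) \<longlonglongrightarrow> 0"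
    proof (rule LIMSEQ_I)
      fix e :: real assume e: "0 < e"
      define e' where "e' = e / (2 * (C + 1))"
      have e': "0 < e'" using e C0 by (simp add: e'_def)
      then have "e' * C < e' * (2 * (C + 1))" using C0 by (intro mult_strict_left_mono) auto
      also have "\<dots> = e" using C0 by (simp add: e'_def)
      finally have e'C: "e' * C < e" .
      from unif[OF e'] have "\<forall>\<^sub>F j in sequentially. norm ((\<integral>x. G (\<nu> j) x \<partial>\<nu> j) - (\<integral>x. G \<nu>' x \<partial>\<nu> j) - 0) < e"
      proof eventually_elim
        case (elim j)
        have i1: "integrable (\<nu> j) (G \<mu>)" if "sphere_measure \<mu>" for \<mu>
          using Gm[OF that] Gb[OF that] by (intro \<nu>.integrable_const_bound[where B="B * measure \<mu> UNIV"]) (auto cong: measurable_cong_sets)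
        have "norm ((\<integral>x. G (\<nu> j) x \<partial>\<nu> j) - (\<integral>x. G \<nu>' x \<partial>\<nu> j) - 0) = \<bar>\<integral>x. G (\<nu> j) x - G \<nu>' x \<partial>\<nu> j\<bar>"
          using i1[OF \<nu>] i1[OF \<nu>'] by simp
        also have "\<dots> \<le> (\<integral>x. \<bar>G (\<nu> j) x - G \<nu>' x\<bar> \<partial>\<nu> j)" by (rule integral_abs_bound)
        also have "\<dots> \<le> (\<integral>x. e' \<partial>\<nu> j)"
        proof (rule integral_mono_AE)
          show "AE x in \<nu> j. \<bar>G (\<nu> j) x - G \<nu>' x\<bar> \<le> e'"
            using \<nu>.AE_sphere[of j] by eventually_elim (use elim in auto)
        qed (use i1[OF \<nu>] i1[OF \<nu>'] in auto)
        also have "\<dots> \<le> e' * C" using C[of j] e' by (simp add: mult.commute)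
        also have "\<dots> < e" by (rule e'C)
        finally show ?case .
      qed
      then show "\<exists>no. \<forall>j\<ge>no. norm ((\<integral>x. G (\<nu> j) x \<partial>\<nu> j) - (\<integral>x. G \<nu>' x \<partial>\<nu> j) - 0) < e"
        by (simp add: eventually_sequentially)
    qed
    from tendsto_add[OF this lim2] show ?thesis by simp
  qed
  then show ?thesis by (simp add: G_def)
qed

subsection \<open>Energy and the obstacle problem\<close>

definition add_measure :: "'a measure \<Rightarrow> 'a measure \<Rightarrow> 'a measure" where
  "add_measure \<mu> \<nu> = measure_of (space \<mu>) (sets \<mu>) (\<lambda>A. emeasure \<mu> A + emeasure \<nu> A)"

lemma sets_add_measure [simp, measurable_cong]: "sets (add_measure \<mu> \<nu>) = sets \<mu>"
  by (simp add: add_measure_def)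

lemma space_add_measure [simp]: "space (add_measure \<mu> \<nu>) = space \<mu>"
  by (simp add: add_measure_def)

lemma emeasure_add_measure:
  assumes "sets \<nu> = sets \<mu>" "A \<in> sets \<mu>"
  shows "emeasure (add_measure \<mu> \<nu>) A = emeasure \<mu> A + emeasure \<nu> A"
  unfolding add_measure_def
proof (rule emeasure_measure_of_sigma)
  show "sigma_algebra (space \<mu>) (sets \<mu>)" by (rule sets.sigma_algebra_axioms)
  show "positive (sets \<mu>) (\<lambda>A. emeasure \<mu> A + emeasure \<nu> A)" by (simp add: positive_def)
  show "countably_additive (sets \<mu>) (\<lambda>A. emeasure \<mu> A + emeasure \<nu> A)"
    unfolding countably_additive_def
  proof (intro allI impI)
    fix F :: "nat \<Rightarrow> 'a set" assume F: "range F \<subseteq> sets \<mu>" "disjoint_family F"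
    then show "(\<Sum>i. emeasure \<mu> (F i) + emeasure \<nu> (F i)) = emeasure \<mu> (\<Union> (range F)) + emeasure \<nu> (\<Union> (range F))"
      using assms(1) suminf_emeasure[of F \<mu>] suminf_emeasure[of F \<nu>] by (simp add: suminf_add[symmetric])
  qed
qed fact

lemma nn_integral_add_measure:
  assumes sets: "sets \<nu> = sets \<mu>" and f: "f \<in> borel_measurable \<mu>"
  shows "(\<integral>\<^sup>+x. f x \<partial>add_measure \<mu> \<nu>) = (\<integral>\<^sup>+x. f x \<partial>\<mu>) + (\<integral>\<^sup>+x. f x \<partial>\<nu>)"
  using f
proof (induction rule: borel_measurable_induct)
  case (cong f g)
  have "space \<nu> = space \<mu>" using sets_eq_imp_space_eq[OF sets] .
  then have "(\<integral>\<^sup>+x. f x \<partial>M) = (\<integral>\<^sup>+x. g x \<partial>M)" if "M \<in> {\<mu>, \<nu>, add_measure \<mu> \<nu>}" for M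
    using that cong(3) by (intro nn_integral_cong) auto
  then show ?case using cong(4) by simp
next
  case (set A)
  then show ?case using sets by (simp add: emeasure_add_measure)
next
  case (mult u c)
  then have "u \<in> borel_measurable \<nu>" using sets by (simp cong: measurable_cong_sets)
  then show ?case using mult by (simp add: nn_integral_cmult distrib_left)
next
  case (add u v)
  then have "u \<in> borel_measurable \<nu>" "v \<in> borel_measurable \<nu>" using sets by (simp_all cong: measurable_cong_sets)
  then show ?case using add by (simp add: nn_integral_add add_ac)
next
  case (seq U)
  have m: "U i \<in> borel_measurable \<nu>" for i using seq(1) sets by (simp cong: measurable_cong_sets)
  have eq: "(\<integral>\<^sup>+x. (SUP i. U i) x \<partial>M) = (SUP i. \<integral>\<^sup>+x. U i x \<partial>M)" if "\<And>i. U i \<in> borel_measurable M" for M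
    using that seq(3) nn_integral_monotone_convergence_SUP[of U M] by (simp add: SUP_apply image_comp)
  have inc: "incseq (\<lambda>i. \<integral>\<^sup>+x. U i x \<partial>M)" for M
    using seq(3) by (auto simp: incseq_def le_fun_def intro!: nn_integral_mono)
  have ma: "U i \<in> borel_measurable (add_measure \<mu> \<nu>)" for i
    using seq(1) by (simp cong: measurable_cong_sets)
  show ?case
    unfolding eq[of \<mu>, OF seq(1)] eq[of \<nu>, OF m] eq[of "add_measure \<mu> \<nu>", OF ma] seq.IH
    by (rule ennreal_SUP_add[OF inc inc])
qed

lemma finite_measure_add_measure:
  assumes "finite_measure \<mu>" "finite_measure \<nu>" "sets \<nu> = sets \<mu>"
  shows "finite_measure (add_measure \<mu> \<nu>)"
proof (rule finite_measureI)
  interpret \<mu>: finite_measure \<mu> by fact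
  interpret \<nu>: finite_measure \<nu> by fact
  show "emeasure (add_measure \<mu> \<nu>) (space (add_measure \<mu> \<nu>)) \<noteq> \<infinity>"
    using assms(3) by (simp add: emeasure_add_measure ennreal_add_eq_top)
qed

lemma AE_add_measure:
  assumes sets: "sets \<nu> = sets \<mu>" and "AE x in \<mu>. P x" "AE x in \<nu>. P x"
  shows "AE x in add_measure \<mu> \<nu>. P x"
proof -
  obtain N1 where N1: "{x \<in> space \<mu>. \<not> P x} \<subseteq> N1" "emeasure \<mu> N1 = 0" "N1 \<in> sets \<mu>" using assms(2) by (rule AE_E)
  obtain N2 where N2: "{x \<in> space \<nu>. \<not> P x} \<subseteq> N2" "emeasure \<nu> N2 = 0" "N2 \<in> sets \<nu>" using assms(3) by (rule AE_E)
  have sp: "space \<nu> = space \<mu>" using sets_eq_imp_space_eq[OF sets] .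
  have "emeasure \<mu> (N1 \<inter> N2) \<le> emeasure \<mu> N1"
    by (rule emeasure_mono[OF _ N1(3)]) simp
  moreover have "emeasure \<nu> (N1 \<inter> N2) \<le> emeasure \<nu> N2"
    by (rule emeasure_mono[OF _ N2(3)]) simp
  ultimately have "emeasure \<mu> (N1 \<inter> N2) = 0" "emeasure \<nu> (N1 \<inter> N2) = 0"
    using N1(2) N2(2) by simp_all
  then have "emeasure (add_measure \<mu> \<nu>) (N1 \<inter> N2) = 0"
    using N1(3) N2(3) sets by (simp add: emeasure_add_measure)
  then show ?thesis
    using N1 N2 sets sp by (intro AE_I[of _ _ "N1 \<inter> N2"]) auto
qed

lemma sphere_measure_add:
  assumes "sphere_measure \<mu>" "sphere_measure \<nu>"
  shows "sphere_measure (add_measure \<mu> \<nu>)"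
proof -
  interpret \<mu>: sphere_measure \<mu> by fact
  interpret \<nu>: sphere_measure \<nu> by fact
  show ?thesis
    using \<mu>.finite_measure_axioms \<nu>.finite_measure_axioms \<mu>.AE_sphere \<nu>.AE_sphere
    by (intro sphere_measure.intro finite_measure_add_measure sphere_measure_axioms.intro AE_add_measure)
      (simp_all add: \<mu>.sets_eq \<nu>.sets_eq)
qed

lemma sphere_measure_density:
  assumes "sphere_measure \<mu>" and [measurable]: "f \<in> borel_measurable borel" and B: "\<And>x. f x \<le> ennreal B"
  shows "sphere_measure (density \<mu> f)"
proof -
  interpret sphere_measure \<mu> by fact
  show ?thesis
  proof (intro sphere_measure.intro finite_measureI sphere_measure_axioms.intro)
    have "emeasure (density \<mu> f) UNIV = (\<integral>\<^sup>+x. f x \<partial>\<mu>)" by (subst emeasure_density) auto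
    also have "\<dots> \<le> (\<integral>\<^sup>+x. ennreal B \<partial>\<mu>)" using B by (intro nn_integral_mono) auto
    also have "\<dots> < \<infinity>" by (simp add: less_top[symmetric] ennreal_mult_eq_top_iff)
    finally show "emeasure (density \<mu> f) (space (density \<mu> f)) \<noteq> \<infinity>" by simp
    show "AE x in density \<mu> f. norm x = 1"
      using AE_sphere by (subst AE_density) (auto elim: eventually_mono)
  qed (simp add: sets_eq)
qed

lemma pot_add_measure:
  assumes [measurable_cong]: "sets \<mu> = sets borel" "sets \<nu> = sets borel"
  shows "pot (add_measure \<mu> \<nu>) x = pot \<mu> x + pot \<nu> x"
  unfolding pot_def using assms by (intro nn_integral_add_measure) auto

lemma pot_density_const:
  assumes [measurable_cong]: "sets \<mu> = sets borel"
  shows "pot (density \<mu> (\<lambda>_. a)) x = a * pot \<mu> x"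
  unfolding pot_def by (subst nn_integral_density) (auto simp: nn_integral_cmult)

definition mutual_energy :: "(real ^ 'n) measure \<Rightarrow> (real ^ 'n) measure \<Rightarrow> ennreal" where
  "mutual_energy \<mu> \<nu> = (\<integral>\<^sup>+x. pot \<mu> x \<partial>\<nu>)"

lemma mutual_energy_commute:
  assumes "sphere_measure \<mu>" "sphere_measure \<nu>"
  shows "mutual_energy \<mu> \<nu> = mutual_energy \<nu> \<mu>"
proof -
  interpret \<mu>: sphere_measure \<mu> by fact
  interpret \<nu>: sphere_measure \<nu> by fact
  interpret pair_sigma_finite \<mu> \<nu> ..
  have "mutual_energy \<mu> \<nu> = (\<integral>\<^sup>+x. \<integral>\<^sup>+y. riesz_kernel x y \<partial>\<mu> \<partial>\<nu>)" by (simp add: mutual_energy_def pot_def)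
  also have "\<dots> = (\<integral>\<^sup>+y. \<integral>\<^sup>+x. riesz_kernel x y \<partial>\<nu> \<partial>\<mu>)" by (rule Fubini') measurable
  also have "\<dots> = mutual_energy \<nu> \<mu>" by (simp add: mutual_energy_def pot_def riesz_kernel_commute)
  finally show ?thesis .
qed

text \<open>A point of the ball and a point of the sphere are at most 2 apart. This one bound makes
  the energy coercive, keeps the parameter \<tau> bounded, and gives d \<ge> 2^(2-n).\<close>

lemma pot_ge_mass:
  fixes \<mu> :: "(real ^ 'n) measure"
  assumes "sphere_measure \<mu>" and x: "norm x \<le> 1"
  shows "ennreal ((1/2) ^ (CARD('n) - 2)) * emeasure \<mu> UNIV \<le> pot \<mu> x"
proof -
  interpret sphere_measure \<mu> by fact
  have "ennreal ((1/2) ^ (CARD('n) - 2)) * emeasure \<mu> UNIV = (\<integral>\<^sup>+y. ennreal ((1/2) ^ (CARD('n) - 2)) \<partial>\<mu>)"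
    by simp
  also have "\<dots> \<le> pot \<mu> x"
    unfolding pot_def
  proof (rule nn_integral_mono_AE)
    show "AE y in \<mu>. ennreal ((1/2) ^ (CARD('n) - 2)) \<le> riesz_kernel x y"
      using AE_sphere
    proof eventually_elim
      case (elim y)
      have "norm (x - y) \<le> 2" using norm_triangle_ineq4[of x y] elim x by simp
      then have "inverse (ennreal (2 ^ (CARD('n) - 2))) \<le> riesz_kernel x y"
        unfolding riesz_kernel_inverse by (intro ennreal_inverse_antimono ennreal_leI power_mono) auto
      then show ?case by (simp add: inverse_ennreal power_inverse inverse_eq_divide power_divide)
    qed
  qed
  finally show ?thesis .
qed

text \<open>The bounded continuous kernels \<open>max (|x - y|) (1/(i+1))\<close> to the power \<open>2 - n\<close> increase to the Riesz kernel.\<close>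

definition cutoff_kernel :: "nat \<Rightarrow> real ^ 'n \<Rightarrow> real ^ 'n \<Rightarrow> real" where
  "cutoff_kernel i x y = inverse (max (norm (x - y)) (inverse (real (Suc i)))) ^ (CARD('n) - 2)"

lemma cutoff_kernel_bounds:
  fixes x y :: "real ^ 'n"
  shows "0 \<le> cutoff_kernel i x y" "cutoff_kernel i x y \<le> real (Suc i) ^ (CARD('n) - 2)"
proof -
  have p: "0 < inverse (real (Suc i))" by simp
  have "inverse (max (norm (x - y)) (inverse (real (Suc i)))) \<le> inverse (inverse (real (Suc i)))"
    using p by (intro le_imp_inverse_le) auto
  moreover have pm: "0 \<le> inverse (max (norm (x - y)) (inverse (real (Suc i))))"
    using p by (simp add: le_max_iff_disj)
  ultimately show "cutoff_kernel i x y \<le> real (Suc i) ^ (CARD('n) - 2)"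
    unfolding cutoff_kernel_def by (intro power_mono) auto
  show "0 \<le> cutoff_kernel i x y" unfolding cutoff_kernel_def using pm by simp
qed

lemma continuous_on_cutoff_kernel: "continuous_on UNIV (\<lambda>(x, y). cutoff_kernel i x (y :: real ^ 'n))"
proof -
  have "max (norm (x - y)) (inverse (real (Suc i))) \<noteq> 0" for x y :: "real ^ 'n"
  proof -
    have "0 < max (norm (x - y)) (inverse (real (Suc i)))" by (simp add: less_max_iff_disj)
    then show ?thesis by simp
  qed
  then show ?thesis
    unfolding cutoff_kernel_def split_beta' by (intro continuous_intros) auto
qed

lemma continuous_on_cutoff_kernel2: "continuous_on UNIV (cutoff_kernel i (x :: real ^ 'n))"
  using continuous_on_compose2[OF continuous_on_cutoff_kernel, of UNIV "\<lambda>y. (x, y)"]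
  by (simp add: continuous_on_Pair continuous_on_const continuous_on_id)

lemma borel_measurable_cutoff_kernel [measurable]:
  assumes [measurable]: "f \<in> borel_measurable M" "g \<in> borel_measurable M"
  shows "(\<lambda>w. cutoff_kernel i (f w) (g w)) \<in> borel_measurable M"
  unfolding cutoff_kernel_def by measurable

lemma ennreal_cutoff_kernel:
  fixes x y :: "real ^ 'n"
  shows "ennreal (cutoff_kernel i x y) = inverse (ennreal (max (norm (x - y)) (inverse (real (Suc i))) ^ (CARD('n) - 2)))"
proof -
  have "0 < max (norm (x - y)) (inverse (real (Suc i)))" by (simp add: less_max_iff_disj)
  then show ?thesis unfolding cutoff_kernel_def by (simp add: inverse_ennreal power_inverse)
qed

lemma incseq_cutoff_kernel: "incseq (\<lambda>i. ennreal (cutoff_kernel i x y))"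
  unfolding ennreal_cutoff_kernel incseq_def
proof (intro allI impI ennreal_inverse_antimono ennreal_leI power_mono max.mono order_refl)
  fix i j :: nat assume "i \<le> j"
  then show "inverse (real (Suc j)) \<le> inverse (real (Suc i))" by (intro le_imp_inverse_le) auto
qed (simp add: le_max_iff_disj)

lemma cutoff_kernel_mono: "i \<le> j \<Longrightarrow> cutoff_kernel i x y \<le> cutoff_kernel j x y"
  using incseqD[OF incseq_cutoff_kernel, of i j x y] cutoff_kernel_bounds(1)[of j x y] by (simp add: ennreal_le_iff)

lemma tendsto_cutoff_kernel: "(\<lambda>i. ennreal (cutoff_kernel i x y)) \<longlonglongrightarrow> riesz_kernel x y"
proof -
  have "(\<lambda>i. max (norm (x - y)) (inverse (real (Suc i))) ^ (CARD('a) - 2)) \<longlonglongrightarrow> max (norm (x - y)) 0 ^ (CARD('a) - 2)"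
    by (intro tendsto_intros LIMSEQ_inverse_real_of_nat)
  then have "(\<lambda>i. ennreal (max (norm (x - y)) (inverse (real (Suc i))) ^ (CARD('a) - 2))) \<longlonglongrightarrow> ennreal (norm (x - y) ^ (CARD('a) - 2))"
    by (intro tendsto_ennrealI) simp
  from continuous_on_tendsto_compose[where s=UNIV and f=inverse, OF continuous_on_inverse_ennreal[OF continuous_on_id] this]
  show ?thesis unfolding ennreal_cutoff_kernel riesz_kernel_inverse by simp
qed

text \<open>The obstacle is \<open>R\<close> on the cap \<open>E\<close> and \<open>1\<close> on the rest of the sphere; \<open>c\<close> is the mass of a point charge
  at the centre \<open>e\<close> of the cap.\<close>

locale obstacle =
  fixes e :: "real ^ 'n" and s c R :: real
  assumes n: "3 \<le> CARD('n)" and e: "norm e = 1" and s: "-1 < s" "s \<le> 1"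
    and c: "0 \<le> c" and R: "1 \<le> R" and sR: "1 < R \<Longrightarrow> s < 1"
begin

definition E :: "(real ^ 'n) set" where
  "E = {z. norm z = 1 \<and> s \<le> z \<bullet> e}"

lemma closed_E: "closed E"
  unfolding E_def by (intro closed_Collect_conj closed_Collect_eq closed_Collect_le continuous_intros)

lemma E_sets [measurable]: "E \<in> sets borel"
  using closed_E by (rule borel_closed)

lemma e_in_E: "e \<in> E"
  using e s by (simp add: E_def norm_eq_1)

text \<open>The functional to be minimised is the Gauss functional: the energy minus twice the
  integral of the obstacle reduced by the potential of the charge c at e. Writing the obstacle as R
  minus R - 1 on the complement of \<open>E\<close> leaves only non-negative terms in
  \<open>T\<close>, so it may be infinite without ill-defined differences; the remaining term -2 R
  times the mass is weakly continuous and is added in \<open>objective\<close>.\<close>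

definition T :: "(real ^ 'n) measure \<Rightarrow> ennreal" where
  "T \<nu> = mutual_energy \<nu> \<nu> + ennreal (2 * c) * pot \<nu> e + ennreal (2 * (R - 1)) * emeasure \<nu> (- E)"

lemma min_infdist_mono: "i \<le> j \<Longrightarrow> min 1 (real i * infdist x E) \<le> min 1 (real j * infdist x E)"
  by (intro min.mono order_refl mult_right_mono) (auto simp: infdist_nonneg)

text \<open>Weakly continuous functionals increasing to \<open>T\<close>: cut-off kernels, and a
  truncated multiple of the distance in place of the indicator of the open complement of
  \<open>E\<close>. They make \<open>T\<close> weakly lower semicontinuous.\<close>

definition Ti :: "nat \<Rightarrow> (real ^ 'n) measure \<Rightarrow> real" where
  "Ti i \<nu> = (\<integral>x. \<integral>y. cutoff_kernel i x y \<partial>\<nu> \<partial>\<nu>) + (2 * c) * (\<integral>y. cutoff_kernel i e y \<partial>\<nu>)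
     + (2 * (R - 1)) * (\<integral>x. min 1 (real i * infdist x E) \<partial>\<nu>)"

lemma ennreal_Ti:
  assumes "sphere_measure \<nu>"
  shows "ennreal (Ti i \<nu>) = (\<integral>\<^sup>+x. \<integral>\<^sup>+y. ennreal (cutoff_kernel i x y) \<partial>\<nu> \<partial>\<nu>)
     + ennreal (2 * c) * (\<integral>\<^sup>+y. ennreal (cutoff_kernel i e y) \<partial>\<nu>)
     + ennreal (2 * (R - 1)) * (\<integral>\<^sup>+x. ennreal (min 1 (real i * infdist x E)) \<partial>\<nu>)"
proof -
  interpret sphere_measure \<nu> by fact
  let ?B = "real (Suc i) ^ (CARD('n) - 2)"
  have i1: "integrable \<nu> (cutoff_kernel i x)" for x
    using cutoff_kernel_bounds[of i x] by (intro integrable_const_bound[where B="?B"]) auto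
  have m: "(\<lambda>x. \<integral>y. cutoff_kernel i x y \<partial>\<nu>) \<in> borel_measurable \<nu>" by measurable
  have b: "0 \<le> (\<integral>y. cutoff_kernel i x y \<partial>\<nu>)" "(\<integral>y. cutoff_kernel i x y \<partial>\<nu>) \<le> ?B * measure \<nu> UNIV" for x
  proof -
    show "0 \<le> (\<integral>y. cutoff_kernel i x y \<partial>\<nu>)" using cutoff_kernel_bounds by (intro Bochner_Integration.integral_nonneg) auto
    have "(\<integral>y. cutoff_kernel i x y \<partial>\<nu>) \<le> (\<integral>y. ?B \<partial>\<nu>)"
      using i1 cutoff_kernel_bounds by (intro integral_mono) auto
    then show "(\<integral>y. cutoff_kernel i x y \<partial>\<nu>) \<le> ?B * measure \<nu> UNIV" by (simp add: mult.commute)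
  qed
  have i2: "integrable \<nu> (\<lambda>x. \<integral>y. cutoff_kernel i x y \<partial>\<nu>)"
    using m b by (intro integrable_const_bound[where B="?B * measure \<nu> UNIV"]) auto
  have i3: "integrable \<nu> (\<lambda>x. min 1 (real i * infdist x E))"
  proof (rule integrable_const_bound[where B=1])
    have "(\<lambda>x. min 1 (real i * infdist x E)) \<in> borel_measurable borel"
      by (intro borel_measurable_continuous_onI continuous_intros)
    then show "(\<lambda>x. min 1 (real i * infdist x E)) \<in> borel_measurable \<nu>" by measurable
  qed (auto simp: infdist_nonneg)
  have n1: "(\<integral>\<^sup>+y. ennreal (cutoff_kernel i x y) \<partial>\<nu>) = ennreal (\<integral>y. cutoff_kernel i x y \<partial>\<nu>)" for x
    by (intro nn_integral_eq_integral AE_I2 cutoff_kernel_bounds i1)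
  have n2: "(\<integral>\<^sup>+x. ennreal (\<integral>y. cutoff_kernel i x y \<partial>\<nu>) \<partial>\<nu>) = ennreal (\<integral>x. \<integral>y. cutoff_kernel i x y \<partial>\<nu> \<partial>\<nu>)"
    using i2 b by (intro nn_integral_eq_integral) auto
  have n3: "(\<integral>\<^sup>+x. ennreal (min 1 (real i * infdist x E)) \<partial>\<nu>) = ennreal (\<integral>x. min 1 (real i * infdist x E) \<partial>\<nu>)"
    using i3 by (intro nn_integral_eq_integral) (auto simp: infdist_nonneg)
  have nn: "0 \<le> (\<integral>x. \<integral>y. cutoff_kernel i x y \<partial>\<nu> \<partial>\<nu>)" "0 \<le> (\<integral>x. min 1 (real i * infdist x E) \<partial>\<nu>)"
    using b by (auto intro!: Bochner_Integration.integral_nonneg simp: infdist_nonneg)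
  show ?thesis
    unfolding Ti_def n1 n2 n3 using nn b[of e] c R by (simp add: ennreal_plus ennreal_mult del: ennreal_plus[symmetric])
qed

lemma tendsto_Ti:
  assumes "sphere_measure \<nu>"
  shows "(\<lambda>i. ennreal (Ti i \<nu>)) \<longlonglongrightarrow> T \<nu>"
proof -
  interpret sphere_measure \<nu> by fact
  have l1: "(\<lambda>i. \<integral>\<^sup>+y. ennreal (cutoff_kernel i x y) \<partial>\<nu>) \<longlonglongrightarrow> pot \<nu> x" for x
    unfolding pot_def
    by (rule nn_integral_LIMSEQ) (use incseq_cutoff_kernel tendsto_cutoff_kernel in \<open>auto simp: incseq_def le_fun_def\<close>)
  have l2: "(\<lambda>i. \<integral>\<^sup>+x. \<integral>\<^sup>+y. ennreal (cutoff_kernel i x y) \<partial>\<nu> \<partial>\<nu>) \<longlonglongrightarrow> mutual_energy \<nu> \<nu>"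
    unfolding mutual_energy_def
  proof (rule nn_integral_LIMSEQ)
    show "incseq (\<lambda>i x. \<integral>\<^sup>+y. ennreal (cutoff_kernel i x y) \<partial>\<nu>)"
      using incseq_cutoff_kernel by (auto simp: incseq_def le_fun_def intro!: nn_integral_mono)
  qed (use l1 in auto)
  have l3: "(\<lambda>i. \<integral>\<^sup>+x. ennreal (min 1 (real i * infdist x E)) \<partial>\<nu>) \<longlonglongrightarrow> emeasure \<nu> (- E)"
  proof -
    have "(\<lambda>i. \<integral>\<^sup>+x. ennreal (min 1 (real i * infdist x E)) \<partial>\<nu>) \<longlonglongrightarrow> (\<integral>\<^sup>+x. indicator (- E) x \<partial>\<nu>)"
    proof (rule nn_integral_LIMSEQ)
      show "incseq (\<lambda>i x. ennreal (min 1 (real i * infdist x E)))"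
        unfolding incseq_def le_fun_def by (intro allI impI ennreal_leI min_infdist_mono)
      show "(\<lambda>x. ennreal (min 1 (real i * infdist x E))) \<in> borel_measurable \<nu>" for i
      proof -
        have "(\<lambda>x. min 1 (real i * infdist x E)) \<in> borel_measurable borel"
          by (intro borel_measurable_continuous_onI continuous_intros)
        then show ?thesis by measurable
      qed
      show "(\<lambda>i. ennreal (min 1 (real i * infdist x E))) \<longlonglongrightarrow> indicator (- E) x" for x
      proof (cases "x \<in> E")
        case False
        then have pos: "0 < infdist x E"
          using infdist_pos_not_in_closed[OF closed_E] e_in_E by auto
        obtain N :: nat where N: "1 / infdist x E \<le> real N" using real_arch_simple by blast
        have "\<forall>\<^sub>F i in sequentially. ennreal (min 1 (real i * infdist x E)) = 1"
          using eventually_ge_at_top[of N]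
        proof eventually_elim
          case (elim i)
          have "1 \<le> real N * infdist x E" using N pos by (simp add: field_simps)
          also have "\<dots> \<le> real i * infdist x E" using elim pos by (intro mult_right_mono) auto
          finally show ?case by (simp add: min_def)
        qed
        then show ?thesis using False by (auto intro: tendsto_eventually)
      qed simp
    qed
    then show ?thesis by (simp add: sets_eq)
  qed
  have "(\<lambda>i. (\<integral>\<^sup>+x. \<integral>\<^sup>+y. ennreal (cutoff_kernel i x y) \<partial>\<nu> \<partial>\<nu>)
     + ennreal (2 * c) * (\<integral>\<^sup>+y. ennreal (cutoff_kernel i e y) \<partial>\<nu>)
     + ennreal (2 * (R - 1)) * (\<integral>\<^sup>+x. ennreal (min 1 (real i * infdist x E)) \<partial>\<nu>)) \<longlonglongrightarrow> T \<nu>"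
    unfolding T_def by (intro tendsto_add l1 l2 l3 ennreal_tendsto_cmult) auto
  then show ?thesis by (simp add: ennreal_Ti[OF assms])
qed

lemma Ti_mono:
  assumes "sphere_measure \<nu>"
  shows "ennreal (Ti i \<nu>) \<le> T \<nu>"
proof (rule LIMSEQ_le_const[OF tendsto_Ti[OF assms]], intro exI[of _ i] allI impI)
  fix j assume "i \<le> j"
  then show "ennreal (Ti i \<nu>) \<le> ennreal (Ti j \<nu>)"
    unfolding ennreal_Ti[OF assms]
    by (intro add_mono mult_left_mono nn_integral_mono ennreal_leI min_infdist_mono cutoff_kernel_mono) auto
qed

definition objective :: "(real ^ 'n) measure \<Rightarrow> real" where
  "objective \<nu> = enn2real (T \<nu>) - 2 * R * measure \<nu> UNIV"

lemma objective_lower: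
  assumes "sphere_measure \<nu>" "T \<nu> < \<infinity>"
  shows "(1/2) ^ (CARD('n) - 2) * (measure \<nu> UNIV)\<^sup>2 - 2 * R * measure \<nu> UNIV \<le> objective \<nu>"
proof -
  interpret sphere_measure \<nu> by fact
  let ?k = "(1/2) ^ (CARD('n) - 2) :: real" and ?a = "measure \<nu> UNIV"
  have "ennreal (?k * ?a\<^sup>2) = (\<integral>\<^sup>+x. ennreal ?k * emeasure \<nu> UNIV \<partial>\<nu>)"
    by (simp add: emeasure_eq_measure power2_eq_square mult.assoc flip: ennreal_mult)
  also have "\<dots> \<le> mutual_energy \<nu> \<nu>"
    unfolding mutual_energy_def
  proof (rule nn_integral_mono_AE)
    show "AE x in \<nu>. ennreal ?k * emeasure \<nu> UNIV \<le> pot \<nu> x"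
      using AE_sphere by eventually_elim (intro pot_ge_mass assms, simp)
  qed
  also have "\<dots> \<le> T \<nu>" by (simp add: T_def add.assoc)
  finally have "?k * ?a\<^sup>2 \<le> enn2real (T \<nu>)"
    using assms(2) by (metis enn2real_ennreal enn2real_mono infinity_ennreal_def mult_nonneg_nonneg zero_le_power2 zero_le_power zero_le_divide_1_iff zero_le_numeral)
  then show ?thesis by (simp add: objective_def)
qed

text \<open>The direct method: the quadratic lower bound controls the masses of a minimising
  sequence, a subsequence converges weakly, each \<open>Ti\<close> passes to the limit, and then i
  tends to infinity.\<close>

lemma minimizer_exists:
  obtains \<mu> where "sphere_measure \<mu>" "T \<mu> < \<infinity>" "\<And>\<nu>. sphere_measure \<nu> \<Longrightarrow> T \<nu> < \<infinity> \<Longrightarrow> objective \<mu> \<le> objective \<nu>"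
proof -
  define V where "V = {objective \<nu> | \<nu>. sphere_measure \<nu> \<and> T \<nu> < \<infinity>}"
  let ?k = "(1/2) ^ (CARD('n) - 2) :: real"
  have k: "0 < ?k" by simp
  define z where "z = density sph (\<lambda>_::real ^ 'n. ennreal 0)"
  have z: "sphere_measure z" unfolding z_def by (rule sphere_measure_density[OF sphere_measure_sph, of _ 0]) auto
  have "pot z = (\<lambda>_. 0)" by (simp add: fun_eq_iff z_def pot_density_const)
  then have "T z = 0"
    unfolding T_def mutual_energy_def by (simp add: z_def emeasure_density)
  then have Vne: "V \<noteq> {}" unfolding V_def using z by (auto intro!: exI[of _ z])
  have "- (R\<^sup>2 / ?k) \<le> v" if "v \<in> V" for v
  proof -
    obtain \<nu> where \<nu>: "sphere_measure \<nu>" "T \<nu> < \<infinity>" "v = objective \<nu>" using \<open>v \<in> V\<close> by (auto simp: V_def)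
    let ?a = "measure \<nu> UNIV"
    have "0 \<le> ?k * (?a - R / ?k)\<^sup>2" by simp
    also have "\<dots> = ?k * ?a\<^sup>2 - 2 * R * ?a + R\<^sup>2 / ?k"
      using k by (simp add: power2_eq_square field_simps)
    finally show ?thesis using objective_lower[OF \<nu>(1,2)] \<nu>(3) by simp
  qed
  then have Vb: "bdd_below V" by (auto simp: bdd_below_def)
  define v where "v = Inf V"
  have "\<exists>\<nu>. sphere_measure \<nu> \<and> T \<nu> < \<infinity> \<and> objective \<nu> < v + inverse (real (Suc j))" for j
  proof -
    have "v < v + inverse (real (Suc j))" by simp
    then obtain w where "w \<in> V" "w < v + inverse (real (Suc j))"
      unfolding v_def using cInf_less_iff[OF Vne Vb] by blast
    then show ?thesis by (auto simp: V_def)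
  qed
  then obtain \<nu> where \<nu>: "\<And>j. sphere_measure (\<nu> j)" "\<And>j. T (\<nu> j) < \<infinity>" "\<And>j. objective (\<nu> j) < v + inverse (real (Suc j))"
    by metis
  \<comment> \<open>Chosen so that for larger masses a the bound 2^(2-n) a^2 - 2 R a exceeds v + 1,
    which no member of the sequence reaches.\<close>
  define C where "C = (2 * R + \<bar>v\<bar> + 1) / ?k + 1"
  have mass: "measure (\<nu> j) UNIV \<le> C" for j
  proof (rule ccontr)
    let ?a = "measure (\<nu> j) UNIV"
    assume "\<not> ?a \<le> C"
    then have a: "C < ?a" by simp
    have C1: "1 \<le> C" using k R by (simp add: C_def)
    have "2 * R + \<bar>v\<bar> + 1 = ?k * (C - 1)" by (simp add: C_def)
    also have "\<dots> < ?k * ?a" using k a by (intro mult_strict_left_mono) auto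
    finally have "\<bar>v\<bar> + 1 < ?k * ?a - 2 * R" by simp
    also have "\<dots> \<le> ?a * (?k * ?a - 2 * R)"
      using a C1 calculation by (intro mult_right_mono[of 1 ?a, simplified]) auto
    also have "\<dots> = ?k * ?a\<^sup>2 - 2 * R * ?a" by (simp add: power2_eq_square algebra_simps)
    also have "\<dots> \<le> objective (\<nu> j)" by (rule objective_lower[OF \<nu>(1,2)])
    also have "\<dots> < v + inverse (real (Suc j))" by (rule \<nu>(3))
    also have "\<dots> \<le> v + 1" by (simp add: inverse_le_1_iff)
    finally show False by simp
  qed
  obtain r \<mu> where r: "strict_mono (r :: nat \<Rightarrow> nat)" and \<mu>: "sphere_measure \<mu>" and w: "weakly_converges (\<lambda>j. \<nu> (r j)) \<mu>"
    using weak_compactness_sphere[of \<nu> C] \<nu>(1) mass by blast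
  have massl: "(\<lambda>j. measure (\<nu> (r j)) UNIV) \<longlonglongrightarrow> measure \<mu> UNIV"
    by (rule weakly_converges_mass[OF \<nu>(1) \<mu> w])
  have Ti_le: "Ti i \<mu> \<le> v + 2 * R * measure \<mu> UNIV" for i
  proof -
    let ?B = "real (Suc i) ^ (CARD('n) - 2)"
    have b: "\<bar>cutoff_kernel i x y\<bar> \<le> ?B" for x y :: "real ^ 'n" using cutoff_kernel_bounds[of i x y] by simp
    have "(\<lambda>j. \<integral>x. \<integral>y. cutoff_kernel i x y \<partial>\<nu> (r j) \<partial>\<nu> (r j)) \<longlonglongrightarrow> (\<integral>x. \<integral>y. cutoff_kernel i x y \<partial>\<mu> \<partial>\<mu>)"
      by (rule weakly_converges_double[OF \<nu>(1) \<mu> w mass continuous_on_cutoff_kernel b])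
    moreover have "(\<lambda>j. \<integral>y. cutoff_kernel i e y \<partial>\<nu> (r j)) \<longlonglongrightarrow> (\<integral>y. cutoff_kernel i e y \<partial>\<mu>)"
      using w continuous_on_cutoff_kernel2[of i e] b unfolding weakly_converges_def by (auto intro!: boundedI[of _ ?B])
    moreover have "(\<lambda>j. \<integral>x. min 1 (real i * infdist x E) \<partial>\<nu> (r j)) \<longlonglongrightarrow> (\<integral>x. min 1 (real i * infdist x E) \<partial>\<mu>)"
    proof -
      have "continuous_on UNIV (\<lambda>x. min 1 (real i * infdist x E))" by (intro continuous_intros)
      moreover have "bounded (range (\<lambda>x. min 1 (real i * infdist x E)))"
        by (auto intro!: boundedI[of _ 1] simp: infdist_nonneg)
      ultimately show ?thesis using w unfolding weakly_converges_def by blast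
    qed
    ultimately have lim: "(\<lambda>j. Ti i (\<nu> (r j))) \<longlonglongrightarrow> Ti i \<mu>"
      unfolding Ti_def by (intro tendsto_intros)
    have le: "Ti i (\<nu> (r j)) \<le> v + inverse (real (Suc (r j))) + 2 * R * measure (\<nu> (r j)) UNIV" for j
    proof -
      have "enn2real (ennreal (Ti i (\<nu> (r j)))) \<le> enn2real (T (\<nu> (r j)))"
        using Ti_mono[OF \<nu>(1)] \<nu>(2) by (intro enn2real_mono) auto
      then have "Ti i (\<nu> (r j)) \<le> enn2real (T (\<nu> (r j)))"
        by (metis enn2real_ennreal enn2real_nonneg linear order_trans)
      then show ?thesis using \<nu>(3)[of "r j"] by (simp add: objective_def)
    qed
    have "(\<lambda>j. v + inverse (real (Suc (r j))) + 2 * R * measure (\<nu> (r j)) UNIV) \<longlonglongrightarrow> v + 0 + 2 * R * measure \<mu> UNIV"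
      using LIMSEQ_subseq_LIMSEQ[OF LIMSEQ_inverse_real_of_nat r]
      by (intro tendsto_intros massl) (simp add: comp_def)
    then show ?thesis using LIMSEQ_le[OF lim] le by auto
  qed
  have T\<mu>: "T \<mu> \<le> ennreal (v + 2 * R * measure \<mu> UNIV)"
    by (rule LIMSEQ_le_const2[OF tendsto_Ti[OF \<mu>]]) (use Ti_le in \<open>auto intro!: ennreal_leI\<close>)
  then have fin: "T \<mu> < \<infinity>" by (metis ennreal_less_top infinity_ennreal_def le_less_trans)
  have nn: "0 \<le> v + 2 * R * measure \<mu> UNIV"
  proof -
    have "0 \<le> Ti 0 \<mu>"
      unfolding Ti_def using c R cutoff_kernel_bounds by (intro add_nonneg_nonneg mult_nonneg_nonneg Bochner_Integration.integral_nonneg) (auto simp: infdist_nonneg)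
    then show ?thesis using Ti_le[of 0] by simp
  qed
  have "objective \<mu> \<le> v"
    using enn2real_mono[OF T\<mu>] nn by (simp add: objective_def)
  moreover have "v \<le> objective \<nu>'" if "sphere_measure \<nu>'" "T \<nu>' < \<infinity>" for \<nu>'
    unfolding v_def using that by (intro cInf_lower Vb) (auto simp: V_def)
  ultimately show ?thesis using that \<mu> fin by (meson order_trans)
qed

end

lemma mutual_energy_add_left:
  assumes "sphere_measure \<mu>" "sphere_measure \<nu>" "sphere_measure \<kappa>"
  shows "mutual_energy (add_measure \<mu> \<nu>) \<kappa> = mutual_energy \<mu> \<kappa> + mutual_energy \<nu> \<kappa>"
proof -
  interpret \<mu>: sphere_measure \<mu> by fact
  interpret \<nu>: sphere_measure \<nu> by fact
  interpret \<kappa>: sphere_measure \<kappa> by fact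
  have [measurable]: "pot \<mu> \<in> borel_measurable borel" "pot \<nu> \<in> borel_measurable borel"
    by (auto intro!: borel_measurable_pot simp: \<mu>.sets_eq \<nu>.sets_eq \<mu>.finite_measure_axioms \<nu>.finite_measure_axioms)
  have eq: "pot (add_measure \<mu> \<nu>) = (\<lambda>x. pot \<mu> x + pot \<nu> x)"
    by (rule ext) (rule pot_add_measure[OF \<mu>.sets_eq \<nu>.sets_eq])
  show ?thesis
    unfolding mutual_energy_def eq by (rule nn_integral_add) measurable
qed

lemma mutual_energy_add_right:
  assumes "sphere_measure \<mu>" "sphere_measure \<nu>" "sphere_measure \<kappa>"
  shows "mutual_energy \<kappa> (add_measure \<mu> \<nu>) = mutual_energy \<kappa> \<mu> + mutual_energy \<kappa> \<nu>"
  using mutual_energy_add_left[OF assms] assms by (simp add: mutual_energy_commute sphere_measure_add)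

lemma mutual_energy_scale_right:
  assumes "sphere_measure \<mu>" "sphere_measure \<nu>"
  shows "mutual_energy \<mu> (density \<nu> (\<lambda>_. a)) = a * mutual_energy \<mu> \<nu>"
proof -
  interpret \<mu>: sphere_measure \<mu> by fact
  interpret \<nu>: sphere_measure \<nu> by fact
  have [measurable]: "pot \<mu> \<in> borel_measurable borel"
    by (auto intro!: borel_measurable_pot simp: \<mu>.sets_eq \<mu>.finite_measure_axioms)
  show ?thesis unfolding mutual_energy_def by (subst nn_integral_density) (auto simp: nn_integral_cmult)
qed

lemma sphere_measure_scale: "sphere_measure \<mu> \<Longrightarrow> sphere_measure (density \<mu> (\<lambda>_. ennreal t))"
  by (rule sphere_measure_density[where B=t]) auto

lemma mutual_energy_scale_left:
  assumes "sphere_measure \<mu>" "sphere_measure \<nu>"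
  shows "mutual_energy (density \<mu> (\<lambda>_. ennreal a)) \<nu> = ennreal a * mutual_energy \<mu> \<nu>"
  using mutual_energy_scale_right[OF assms(2,1)] assms by (simp add: mutual_energy_commute sphere_measure_scale)

lemma emeasure_scale:
  assumes "sphere_measure \<nu>" "A \<in> sets borel"
  shows "emeasure (density \<nu> (\<lambda>_. a)) A = a * emeasure \<nu> A"
proof -
  interpret \<nu>: sphere_measure \<nu> by fact
  show ?thesis using assms(2) by (simp add: emeasure_density nn_integral_cmult_indicator \<nu>.sets_eq)
qed

definition point_charge :: "'a::euclidean_space \<Rightarrow> real \<Rightarrow> 'a measure" where
  "point_charge e c = density (return borel e) (\<lambda>_. ennreal c)"

lemma sets_point_charge [simp, measurable_cong]: "sets (point_charge e c) = sets borel"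
  by (simp add: point_charge_def)

lemma sphere_measure_point_charge:
  fixes e :: "real ^ 'n"
  assumes "norm e = 1" "0 \<le> c"
  shows "sphere_measure (point_charge e c)"
  unfolding point_charge_def using assms
  by (intro sphere_measure_density_const) (auto simp: prob_space_return AE_return)

lemma pot_point_charge: "pot (point_charge e c) x = ennreal c * riesz_kernel x e"
  unfolding point_charge_def
  by (subst pot_density_const) (auto simp: pot_def nn_integral_return)

section \<open>First variation: the obstacle conditions for the minimizer\<close>

context obstacle
begin

definition obstacle_fn :: "real ^ 'n \<Rightarrow> real" where
  "obstacle_fn x = (if x \<in> E then R else 1)"

text \<open>Half the derivative of \<open>T\<close> at \<beta> in the direction \<alpha>; the
  quadratic remainder is the energy of \<alpha>.\<close>

definition X :: "(real ^ 'n) measure \<Rightarrow> (real ^ 'n) measure \<Rightarrow> ennreal" where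
  "X \<beta> \<alpha> = mutual_energy \<beta> \<alpha> + ennreal c * pot \<alpha> e + ennreal (R - 1) * emeasure \<alpha> (- E)"

lemma T_variation:
  assumes \<beta>: "sphere_measure \<beta>" and \<alpha>: "sphere_measure \<alpha>" and t: "0 \<le> t"
  shows "T (add_measure \<beta> (density \<alpha> (\<lambda>_. ennreal t))) =
    T \<beta> + ennreal (2 * t) * X \<beta> \<alpha> + ennreal (t\<^sup>2) * mutual_energy \<alpha> \<alpha>"
proof -
  interpret \<beta>: sphere_measure \<beta> by fact
  interpret \<alpha>: sphere_measure \<alpha> by fact
  let ?\<alpha> = "density \<alpha> (\<lambda>_. ennreal t)"
  have t\<alpha>: "sphere_measure ?\<alpha>" using \<alpha> by (rule sphere_measure_scale)
  have me: "mutual_energy (add_measure \<beta> ?\<alpha>) (add_measure \<beta> ?\<alpha>) =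
      mutual_energy \<beta> \<beta> + ennreal t * mutual_energy \<beta> \<alpha> + (ennreal t * mutual_energy \<beta> \<alpha> + ennreal t * (ennreal t * mutual_energy \<alpha> \<alpha>))"
    using mutual_energy_commute[OF \<alpha> \<beta>]
    by (simp add: mutual_energy_add_left mutual_energy_add_right mutual_energy_scale_left mutual_energy_scale_right
        sphere_measure_add t\<alpha> \<alpha> \<beta> distrib_left)
  have po: "pot (add_measure \<beta> ?\<alpha>) e = pot \<beta> e + ennreal t * pot \<alpha> e"
    by (simp add: pot_add_measure pot_density_const \<alpha>.sets_eq \<beta>.sets_eq)
  have em: "emeasure (add_measure \<beta> ?\<alpha>) (- E) = emeasure \<beta> (- E) + ennreal t * emeasure \<alpha> (- E)"
    by (simp add: emeasure_add_measure emeasure_scale \<alpha> \<alpha>.sets_eq \<beta>.sets_eq)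
  have two: "ennreal (2 * c) = 2 * ennreal c" "ennreal (2 * (R - 1)) = 2 * ennreal (R - 1)" "ennreal (2 * t) = 2 * ennreal t"
    "ennreal (t\<^sup>2) = ennreal t * ennreal t"
    using c R t ennreal_mult[of 2 c] ennreal_mult[of 2 "R - 1"] ennreal_mult[of 2 t] ennreal_mult[of t t]
    by (simp_all add: power2_eq_square del: right_diff_distrib_numeral)
  show ?thesis
    unfolding T_def X_def me po em two by (simp add: mult_2 distrib_left distrib_right mult_ac add_ac)
qed

lemma mass_variation:
  assumes "sphere_measure \<beta>" "sphere_measure \<alpha>" "0 \<le> t"
  shows "measure (add_measure \<beta> (density \<alpha> (\<lambda>_. ennreal t))) UNIV = measure \<beta> UNIV + t * measure \<alpha> UNIV"
proof -
  interpret \<beta>: sphere_measure \<beta> by fact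
  interpret \<alpha>: sphere_measure \<alpha> by fact
  have "emeasure (add_measure \<beta> (density \<alpha> (\<lambda>_. ennreal t))) UNIV = ennreal (measure \<beta> UNIV + t * measure \<alpha> UNIV)"
    using assms(3)
    by (simp add: emeasure_add_measure emeasure_scale assms \<alpha>.sets_eq \<beta>.sets_eq \<alpha>.emeasure_eq_measure
        \<beta>.emeasure_eq_measure ennreal_mult)
  then have "measure (add_measure \<beta> (density \<alpha> (\<lambda>_. ennreal t))) UNIV = enn2real (ennreal (measure \<beta> UNIV + t * measure \<alpha> UNIV))"
    by (metis measure_def)
  also have "\<dots> = measure \<beta> UNIV + t * measure \<alpha> UNIV"
    using assms(3) by (intro enn2real_ennreal) simp
  finally show ?thesis .
qed

lemma objective_variation:
  assumes \<beta>: "sphere_measure \<beta>" and \<alpha>: "sphere_measure \<alpha>" and t: "0 \<le> t"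
    and fin: "T \<beta> < \<infinity>" "X \<beta> \<alpha> < \<infinity>" "mutual_energy \<alpha> \<alpha> < \<infinity>"
  shows "T (add_measure \<beta> (density \<alpha> (\<lambda>_. ennreal t))) < \<infinity>"
    and "objective (add_measure \<beta> (density \<alpha> (\<lambda>_. ennreal t))) =
      objective \<beta> + 2 * t * (enn2real (X \<beta> \<alpha>) - R * measure \<alpha> UNIV) + t\<^sup>2 * enn2real (mutual_energy \<alpha> \<alpha>)"
proof -
  obtain a b d where r: "T \<beta> = ennreal a" "X \<beta> \<alpha> = ennreal b" "mutual_energy \<alpha> \<alpha> = ennreal d" "0 \<le> a" "0 \<le> b" "0 \<le> d"
    using fin by (metis ennreal_cases infinity_ennreal_def less_irrefl)
  have eq: "T (add_measure \<beta> (density \<alpha> (\<lambda>_. ennreal t))) = ennreal (a + 2 * t * b + t\<^sup>2 * d)"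
    unfolding T_variation[OF \<beta> \<alpha> t] r using r t by (simp add: ennreal_mult)
  then show "T (add_measure \<beta> (density \<alpha> (\<lambda>_. ennreal t))) < \<infinity>" by simp
  show "objective (add_measure \<beta> (density \<alpha> (\<lambda>_. ennreal t))) =
      objective \<beta> + 2 * t * (enn2real (X \<beta> \<alpha>) - R * measure \<alpha> UNIV) + t\<^sup>2 * enn2real (mutual_energy \<alpha> \<alpha>)"
  proof -
    have "enn2real (ennreal (a + 2 * t * b + t\<^sup>2 * d)) = a + 2 * t * b + t\<^sup>2 * d"
      using r t by (intro enn2real_ennreal) simp
    then show ?thesis
      unfolding objective_def eq mass_variation[OF \<beta> \<alpha> t] using r by (simp only: enn2real_ennreal) (simp add: algebra_simps)
  qed
qed

context
  fixes \<mu>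
  assumes \<mu>: "sphere_measure \<mu>" "T \<mu> < \<infinity>" and min: "\<And>\<nu>. sphere_measure \<nu> \<Longrightarrow> T \<nu> < \<infinity> \<Longrightarrow> objective \<mu> \<le> objective \<nu>"
begin

interpretation \<mu>: sphere_measure \<mu> by (rule \<mu>)

text \<open>Adding a small multiple of \<alpha> must not lower the objective. The second order term
  has to be finite for this, so directions are confined to measures of finite energy.\<close>

lemma variation_up:
  assumes \<alpha>: "sphere_measure \<alpha>" and fin: "X \<mu> \<alpha> < \<infinity>" "mutual_energy \<alpha> \<alpha> < \<infinity>"
  shows "ennreal (R * measure \<alpha> UNIV) \<le> X \<mu> \<alpha>"
proof (rule ccontr)
  assume "\<not> ?thesis"
  then have lt: "enn2real (X \<mu> \<alpha>) < R * measure \<alpha> UNIV"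
    using fin(1) by (cases "X \<mu> \<alpha>") (auto simp: ennreal_less_iff not_le)
  define g where "g = R * measure \<alpha> UNIV - enn2real (X \<mu> \<alpha>)"
  define i where "i = enn2real (mutual_energy \<alpha> \<alpha>)"
  have g: "0 < g" "0 \<le> i" using lt by (auto simp: g_def i_def)
  \<comment> \<open>Any step with t i < 2 g makes the first order gain win; this one has t i \<le>
    g.\<close>
  define t where "t = g / (i + 1)"
  have t: "0 < t" "t * i \<le> g" using g by (auto simp: t_def field_simps)
  have "sphere_measure (add_measure \<mu> (density \<alpha> (\<lambda>_. ennreal t)))"
    by (intro sphere_measure_add \<mu> sphere_measure_scale \<alpha>)
  from min[OF this objective_variation(1)[OF \<mu>(1) \<alpha> _ \<mu>(2) fin]] t(1)
  have "0 \<le> 2 * t * (- g) + t\<^sup>2 * i"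
    using objective_variation(2)[OF \<mu>(1) \<alpha> _ \<mu>(2) fin, of t] by (simp add: g_def i_def)
  also have "\<dots> = t * (t * i - 2 * g)" by (simp add: power2_eq_square algebra_simps)
  also have "\<dots> < 0" using t g by (intro mult_pos_neg) auto
  finally show False by simp
qed

text \<open>The part \<alpha> of \<mu> in \<open>A\<close> is shrunk to t \<alpha> with t < 1. As
  nothing can be subtracted from a measure, the variation starts from the rest \<beta>; minimality
  at t = 1 gives 2 x + (1 + t) i \<le> 2 R a after division by 1 - t, and t tends to 1.\<close>

lemma variation_down:
  assumes A [measurable]: "A \<in> sets borel"
  shows "X \<mu> (density \<mu> (indicator A)) \<le> ennreal (R * measure (density \<mu> (indicator A)) UNIV)"
proof -
  define \<alpha> where "\<alpha> = density \<mu> (indicator A)"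
  define \<beta> where "\<beta> = density \<mu> (indicator (- A))"
  have \<alpha>: "sphere_measure \<alpha>" and \<beta>: "sphere_measure \<beta>"
    unfolding \<alpha>_def \<beta>_def using A by (auto intro!: sphere_measure_density[OF \<mu>(1), of _ 1] simp: indicator_def)
  interpret \<alpha>: sphere_measure \<alpha> by fact
  interpret \<beta>: sphere_measure \<beta> by fact
  have \<mu>eq: "add_measure \<beta> (density \<alpha> (\<lambda>_. ennreal 1)) = \<mu>"
  proof (rule measure_eqI)
    show "sets (add_measure \<beta> (density \<alpha> (\<lambda>_. ennreal 1))) = sets \<mu>" by (simp add: \<beta>_def)
    fix B assume "B \<in> sets (add_measure \<beta> (density \<alpha> (\<lambda>_. ennreal 1)))"
    then have B [measurable]: "B \<in> sets borel" by (simp add: \<beta>.sets_eq)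
    have "emeasure (add_measure \<beta> (density \<alpha> (\<lambda>_. ennreal 1))) B = emeasure \<beta> B + emeasure \<alpha> B"
      by (simp add: emeasure_add_measure \<alpha>.sets_eq \<beta>.sets_eq emeasure_scale[OF \<alpha>])
    also have "\<dots> = (\<integral>\<^sup>+x. indicator (- A) x * indicator B x \<partial>\<mu>) + (\<integral>\<^sup>+x. indicator A x * indicator B x \<partial>\<mu>)"
      unfolding \<alpha>_def \<beta>_def using A by (simp add: emeasure_density \<mu>.sets_eq)
    also have "\<dots> = (\<integral>\<^sup>+x. indicator (- A) x * indicator B x + indicator A x * indicator B x \<partial>\<mu>)"
      using A by (intro nn_integral_add[symmetric]) auto
    also have "\<dots> = (\<integral>\<^sup>+x. indicator B x \<partial>\<mu>)"
      by (intro nn_integral_cong) (auto simp: indicator_def)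
    also have "\<dots> = emeasure \<mu> B" by (simp add: \<mu>.sets_eq)
    finally show "emeasure (add_measure \<beta> (density \<alpha> (\<lambda>_. ennreal 1))) B = emeasure \<mu> B" .
  qed
  have T\<mu>: "T \<mu> = T \<beta> + ennreal 2 * X \<beta> \<alpha> + mutual_energy \<alpha> \<alpha>"
    using T_variation[OF \<beta> \<alpha>, of 1] \<mu>eq by simp
  have fin: "T \<beta> < \<infinity>" "X \<beta> \<alpha> < \<infinity>" "mutual_energy \<alpha> \<alpha> < \<infinity>"
    using \<mu>(2) unfolding T\<mu> by (auto simp: less_top[symmetric] ennreal_mult_eq_top_iff)
  have X\<mu>: "X \<mu> \<alpha> = X \<beta> \<alpha> + mutual_energy \<alpha> \<alpha>"
    unfolding X_def using mutual_energy_add_left[OF \<beta> sphere_measure_scale[OF \<alpha>] \<alpha>, of 1] \<mu>eq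
      mutual_energy_scale_left[OF \<alpha> \<alpha>, of 1] by (simp add: add_ac)
  define x where "x = enn2real (X \<beta> \<alpha>)"
  define i where "i = enn2real (mutual_energy \<alpha> \<alpha>)"
  define a where "a = measure \<alpha> UNIV"
  have i0: "0 \<le> i" "0 \<le> x" by (auto simp: i_def x_def)
  have obj: "objective (add_measure \<beta> (density \<alpha> (\<lambda>_. ennreal t))) = objective \<beta> + 2 * t * (x - R * a) + t\<^sup>2 * i"
    if "0 \<le> t" for t
    using objective_variation(2)[OF \<beta> \<alpha> that fin] by (simp add: x_def i_def a_def)
  have key: "2 * x + (1 + t) * i \<le> 2 * R * a" if t: "0 \<le> t" "t < 1" for t
  proof -
    have "sphere_measure (add_measure \<beta> (density \<alpha> (\<lambda>_. ennreal t)))"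
      by (intro sphere_measure_add \<beta> sphere_measure_scale \<alpha>)
    from min[OF this objective_variation(1)[OF \<beta> \<alpha> t(1) fin]]
    have "2 * (x - R * a) + i \<le> 2 * t * (x - R * a) + t\<^sup>2 * i"
      using obj[of t] obj[of 1] t \<mu>eq by simp
    then have "(1 - t) * (2 * x + (1 + t) * i - 2 * R * a) \<le> 0"
      by (simp add: power2_eq_square algebra_simps)
    then show ?thesis using t by (simp add: mult_le_0_iff)
  qed
  have "2 * x + 2 * i \<le> 2 * R * a"
  proof (rule field_le_epsilon)
    fix d :: real assume d: "0 < d"
    define t where "t = max 0 (1 - d / (i + 1))"
    have t: "0 \<le> t" "t < 1" using d i0 by (auto simp: t_def)
    have "1 - t \<le> d / (i + 1)" by (simp add: t_def)
    then have "(1 - t) * i \<le> d / (i + 1) * i" using i0 by (intro mult_right_mono) auto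
    also have "\<dots> \<le> d" using d i0 by (simp add: field_simps)
    finally show "2 * x + 2 * i \<le> 2 * R * a + d" using key[OF t] by (simp add: algebra_simps)
  qed
  then have "x + i \<le> R * a" by simp
  moreover have "X \<mu> \<alpha> = ennreal (x + i)"
    unfolding X\<mu> x_def i_def using fin by (simp add: ennreal_plus less_top)
  ultimately show ?thesis
    unfolding \<alpha>_def[symmetric] a_def by (simp add: ennreal_leI)
qed

definition P :: "real ^ 'n \<Rightarrow> ennreal" where
  "P x = pot \<mu> x + ennreal c * riesz_kernel x e"

text \<open>The jump of the obstacle is moved over to the potential, so the obstacle becomes the
  constant R, and \<open>X \<mu>\<close> is integration against \<open>F\<close>.\<close>

definition F :: "real ^ 'n \<Rightarrow> ennreal" where
  "F x = P x + ennreal (R - 1) * indicator (- E) x"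

lemma pot_meas [measurable]: "pot \<mu> \<in> borel_measurable borel"
  by (auto intro!: borel_measurable_pot simp: \<mu>.sets_eq \<mu>.finite_measure_axioms)

lemma P_meas [measurable]: "P \<in> borel_measurable borel"
  unfolding P_def[abs_def] by measurable

lemma F_meas [measurable]: "F \<in> borel_measurable borel"
  unfolding F_def[abs_def] by measurable

lemma X_eq_integral:
  assumes "sphere_measure \<nu>" and A [measurable]: "A \<in> sets borel"
  shows "X \<mu> (density \<nu> (indicator A)) = (\<integral>\<^sup>+x. indicator A x * F x \<partial>\<nu>)"
proof -
  interpret \<nu>: sphere_measure \<nu> by fact
  have "X \<mu> (density \<nu> (indicator A)) = (\<integral>\<^sup>+x. indicator A x * pot \<mu> x \<partial>\<nu>)
      + ennreal c * (\<integral>\<^sup>+x. indicator A x * riesz_kernel e x \<partial>\<nu>) + ennreal (R - 1) * (\<integral>\<^sup>+x. indicator A x * indicator (- E) x \<partial>\<nu>)"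
    unfolding X_def mutual_energy_def pot_def[of "density \<nu> (indicator A)"]
    by (subst (1 2) nn_integral_density) (auto simp: emeasure_density \<nu>.sets_eq)
  also have "\<dots> = (\<integral>\<^sup>+x. indicator A x * pot \<mu> x + ennreal c * (indicator A x * riesz_kernel e x) + ennreal (R - 1) * (indicator A x * indicator (- E) x) \<partial>\<nu>)"
    by (simp add: nn_integral_add nn_integral_cmult)
  also have "\<dots> = (\<integral>\<^sup>+x. indicator A x * F x \<partial>\<nu>)"
    by (intro nn_integral_cong) (auto simp: F_def P_def distrib_left mult_ac riesz_kernel_commute indicator_def)
  finally show ?thesis .
qed

lemma density_mass:
  assumes "sphere_measure \<nu>" and A [measurable]: "A \<in> sets borel"
  shows "ennreal (R * measure (density \<nu> (indicator A)) UNIV) = (\<integral>\<^sup>+x. indicator A x * ennreal R \<partial>\<nu>)"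
proof -
  interpret \<nu>: sphere_measure \<nu> by fact
  have "emeasure (density \<nu> (indicator A)) UNIV = emeasure \<nu> A"
    by (simp add: emeasure_density \<nu>.sets_eq)
  then have "measure (density \<nu> (indicator A)) UNIV = measure \<nu> A" by (simp add: measure_def)
  moreover have "(\<integral>\<^sup>+x. indicator A x * ennreal R \<partial>\<nu>) = emeasure \<nu> A * ennreal R"
    by (subst nn_integral_multc) (auto simp: \<nu>.sets_eq)
  ultimately show ?thesis
    using R by (simp add: \<nu>.emeasure_eq_measure ennreal_mult mult.commute)
qed

text \<open>The test direction is \<open>sph\<close> restricted to the exceptional set. Its
  potential is at most 1 on the sphere, so its energy is finite; if the set had positive measure,
  the variation would be below R times the mass.\<close>

lemma F_lower: "AE x in sph. ennreal R \<le> F x"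
proof -
  define A where "A = {x. F x < ennreal R}"
  have A [measurable]: "A \<in> sets borel" unfolding A_def by measurable
  let ?\<alpha> = "density sph (indicator A)"
  have \<alpha>: "sphere_measure ?\<alpha>"
    using A by (intro sphere_measure_density[OF sphere_measure_sph, of _ 1]) (auto simp: indicator_def)
  interpret \<alpha>: sphere_measure ?\<alpha> by (rule \<alpha>)
  have Xle: "X \<mu> ?\<alpha> \<le> (\<integral>\<^sup>+x. indicator A x * ennreal R \<partial>sph)"
    unfolding X_eq_integral[OF sphere_measure_sph A]
    by (intro nn_integral_mono) (auto simp: indicator_def A_def)
  also have Rfin: "\<dots> < \<infinity>"
    unfolding density_mass[OF sphere_measure_sph A, symmetric] by simp
  finally have Xfin: "X \<mu> ?\<alpha> < \<infinity>" .
  have pot1: "pot ?\<alpha> x \<le> 1" if "norm x = 1" for x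
  proof -
    have "pot ?\<alpha> x = (\<integral>\<^sup>+y. indicator A y * riesz_kernel x y \<partial>sph)"
      unfolding pot_def by (subst nn_integral_density) auto
    also have "\<dots> \<le> pot sph x"
      unfolding pot_def by (intro nn_integral_mono) (auto simp: indicator_def)
    finally show ?thesis using pot_sph_le_1[of x] n that by simp
  qed
  have "mutual_energy ?\<alpha> ?\<alpha> \<le> (\<integral>\<^sup>+x. 1 \<partial>?\<alpha>)"
    unfolding mutual_energy_def using \<alpha>.AE_sphere by (intro nn_integral_mono_AE) (auto elim: eventually_mono intro: pot1)
  also have "\<dots> < \<infinity>" by (simp add: less_top[symmetric])
  finally have Ifin: "mutual_energy ?\<alpha> ?\<alpha> < \<infinity>" .
  have le: "(\<integral>\<^sup>+x. indicator A x * ennreal R \<partial>sph) \<le> (\<integral>\<^sup>+x. indicator A x * F x \<partial>sph)"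
    using variation_up[OF \<alpha> Xfin Ifin] unfolding density_mass[OF sphere_measure_sph A] X_eq_integral[OF sphere_measure_sph A] .
  have "(\<integral>\<^sup>+x. indicator A x * ennreal R - indicator A x * F x \<partial>sph) =
      (\<integral>\<^sup>+x. indicator A x * ennreal R \<partial>sph) - (\<integral>\<^sup>+x. indicator A x * F x \<partial>sph)"
    using Xfin unfolding X_eq_integral[OF sphere_measure_sph A]
    by (intro nn_integral_diff) (auto simp: indicator_def A_def)
  also have "\<dots> = 0" using le Rfin by (simp add: diff_eq_0_iff_ennreal)
  finally have "AE x in sph. indicator A x * ennreal R - indicator A x * F x = 0"
    by (subst (asm) nn_integral_0_iff_AE) auto
  then show ?thesis
  proof eventually_elim
    case (elim x)
    show ?case
    proof (rule ccontr)
      assume "\<not> ?case"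
      then have x: "x \<in> A" "F x < ennreal R" by (auto simp: A_def)
      then have "ennreal R - F x = 0" using elim by simp
      then show False using x(2) by (auto simp: diff_eq_0_iff_ennreal)
    qed
  qed
qed

lemma F_upper: "AE x in \<mu>. F x \<le> ennreal R"
proof -
  define A where "A = {x. ennreal R < F x}"
  have A [measurable]: "A \<in> sets borel" unfolding A_def by measurable
  have le: "(\<integral>\<^sup>+x. indicator A x * F x \<partial>\<mu>) \<le> (\<integral>\<^sup>+x. indicator A x * ennreal R \<partial>\<mu>)"
    using variation_down[OF A] unfolding density_mass[OF \<mu>(1) A] X_eq_integral[OF \<mu>(1) A] .
  have Rfin: "(\<integral>\<^sup>+x. indicator A x * ennreal R \<partial>\<mu>) < \<infinity>"
    unfolding density_mass[OF \<mu>(1) A, symmetric] by simp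
  have "(\<integral>\<^sup>+x. indicator A x * F x - indicator A x * ennreal R \<partial>\<mu>) =
      (\<integral>\<^sup>+x. indicator A x * F x \<partial>\<mu>) - (\<integral>\<^sup>+x. indicator A x * ennreal R \<partial>\<mu>)"
    using Rfin by (intro nn_integral_diff) (auto simp: indicator_def A_def)
  also have "\<dots> = 0" using le le_less_trans[OF le Rfin] by (simp add: diff_eq_0_iff_ennreal)
  finally have "AE x in \<mu>. indicator A x * F x - indicator A x * ennreal R = 0"
    by (subst (asm) nn_integral_0_iff_AE) auto
  then show ?thesis
  proof eventually_elim
    case (elim x)
    show ?case
    proof (rule ccontr)
      assume "\<not> ?case"
      then have x: "x \<in> A" "ennreal R < F x" by (auto simp: A_def)
      then have "F x - ennreal R = 0" using elim by simp
      then show False using x(2) by (auto simp: diff_eq_0_iff_ennreal)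
    qed
  qed
qed

lemma F_P: "ennreal R \<le> F x \<longleftrightarrow> ennreal (obstacle_fn x) \<le> P x" "F x \<le> ennreal R \<longleftrightarrow> P x \<le> ennreal (obstacle_fn x)"
proof -
  have "ennreal R = 1 + ennreal (R - 1)" using R by (simp flip: ennreal_1 ennreal_plus)
  then show "ennreal R \<le> F x \<longleftrightarrow> ennreal (obstacle_fn x) \<le> P x" "F x \<le> ennreal R \<longleftrightarrow> P x \<le> ennreal (obstacle_fn x)"
    by (auto simp: F_def obstacle_fn_def add.commute[of "P x"] add.commute[of 1])
qed

definition M :: "(real ^ 'n) measure" where
  "M = add_measure \<mu> (point_charge e c)"

lemma M: "sphere_measure M" "pot M x = P x"
proof -
  show "sphere_measure M" unfolding M_def by (intro sphere_measure_add \<mu> sphere_measure_point_charge e c)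
  show "pot M x = P x" unfolding M_def P_def
    by (subst pot_add_measure) (auto simp: \<mu>.sets_eq pot_point_charge)
qed

interpretation M: sphere_measure M by (rule M)

text \<open>From almost everywhere to everywhere by \<open>pot_regular_point\<close>: at level 1 the
  whole sphere carries the Poisson measures, and at level R a fixed proportion is carried by the
  first cap, even as seen from its boundary.\<close>

lemma P_ge:
  assumes x: "norm x = 1"
  shows "ennreal (obstacle_fn x) \<le> P x"
proof -
  have x1: "norm (radii i *\<^sub>R x) < 1" for i using x radii(1,2)[of i] by simp
  have AE: "AE z in sph. ennreal (obstacle_fn z) \<le> P z"
    using F_lower by (simp add: F_P)
  have one: "ennreal 1 \<le> P x"
    unfolding M(2)[symmetric]
  proof (rule M.pot_regular_point[OF n x, where A=UNIV and c=1])
    show "AE z in sph. z \<in> UNIV \<longrightarrow> ennreal 1 \<le> pot M z"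
      using AE
    proof eventually_elim
      case (elim z)
      have "ennreal 1 \<le> ennreal (obstacle_fn z)" using R by (intro ennreal_leI) (auto simp: obstacle_fn_def)
      also note elim
      finally show ?case by (simp add: M(2))
    qed
    show "\<forall>\<^sub>F i in sequentially. 1 \<le> measure (poisson_measure (radii i *\<^sub>R x)) UNIV"
      by (simp add: poisson_measure_sphere_UNIV[OF n x1])
  qed auto
  show ?thesis
  proof (cases "x \<in> E \<and> 1 < R")
    case False
    then have "obstacle_fn x = 1" using R by (auto simp: obstacle_fn_def)
    then show ?thesis using one by simp
  next
    case True
    \<comment> \<open>A raised obstacle occurs only on a cap that is more than a point, by
      \<open>sR\<close>; the Poisson estimate for caps requires this.\<close>
    then have s1: "s < 1" "s \<le> x \<bullet> e" using sR by (auto simp: E_def)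
    from poisson_measure_cap[OF n e x s(1) s1] obtain d where d: "0 < d"
      "\<forall>\<^sub>F i in sequentially. d \<le> measure (poisson_measure (radii i *\<^sub>R x)) {z. s \<le> z \<bullet> e}" by blast
    have "ennreal R \<le> P x"
      unfolding M(2)[symmetric]
    proof (rule M.pot_regular_point[OF n x _ _ _ d])
      show "{z. s \<le> z \<bullet> e} \<in> sets borel" by (intro borel_closed closed_Collect_le continuous_intros)
      show "AE z in sph. z \<in> {z. s \<le> z \<bullet> e} \<longrightarrow> ennreal R \<le> pot M z"
        using AE AE_sph_sphere by eventually_elim (auto simp: M(2) obstacle_fn_def E_def)
    qed (use R in auto)
    then show ?thesis using True by (simp add: obstacle_fn_def)
  qed
qed

text \<open>\<open>P\<close> is lower and the obstacle upper semicontinuous, so a strict excess at x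
  would persist nearby; by \<open>F_upper\<close> this neighbourhood would be null, against x being
  in the support.\<close>

lemma P_le_supp:
  assumes x: "x \<in> msupp \<mu>"
  shows "P x \<le> ennreal (obstacle_fn x)"
proof (rule ccontr)
  assume "\<not> ?thesis"
  then have "ennreal (obstacle_fn x) < pot M x" by (simp add: M(2))
  from pot_lsc_gt[OF M.sets_eq this] obtain d where d: "0 < d" "\<And>y. y \<in> ball x d \<Longrightarrow> ennreal (obstacle_fn x) < P y"
    by (auto simp: M(2))
  obtain d' where d': "0 < d'" "\<And>y. y \<in> ball x d' \<Longrightarrow> obstacle_fn y \<le> obstacle_fn x"
  proof (cases "x \<in> E")
    case True
    then show ?thesis using R by (intro that[of 1]) (auto simp: obstacle_fn_def)
  next
    case False
    then obtain d' where "0 < d'" "ball x d' \<subseteq> - E"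
      using closed_E by (meson ComplI open_Compl open_contains_ball)
    then show ?thesis using False by (intro that[of d']) (auto simp: obstacle_fn_def)
  qed
  have "AE y in \<mu>. y \<notin> ball x (min d d')"
    using F_upper
  proof eventually_elim
    case (elim y)
    show ?case
    proof
      assume "y \<in> ball x (min d d')"
      then have "ennreal (obstacle_fn y) < P y"
        using d(2)[of y] d'(2)[of y] by (auto intro: le_less_trans ennreal_leI)
      then show False using elim by (simp add: F_P)
    qed
  qed
  then have "emeasure \<mu> (ball x (min d d')) = 0"
    using emeasure_eq_0_AE[of "\<lambda>y. y \<in> ball x (min d d')" \<mu>] by (simp add: ball_def)
  then show False using x d(1) d'(1) by (auto simp: msupp_def)
qed

lemma P_eq_supp:
  assumes "x \<in> msupp \<mu>"
  shows "P x = ennreal (obstacle_fn x)"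
  using P_le_supp[OF assms] P_ge[of x] \<mu>.msupp_sphere assms by (auto intro: antisym)

lemma pot_finite_everywhere: "pot \<mu> x < \<infinity>"
proof (cases "x \<in> msupp \<mu>")
  case True
  have "pot \<mu> x \<le> P x" by (simp add: P_def)
  also have "\<dots> < \<infinity>" using P_eq_supp[OF True] by simp
  finally show ?thesis .
qed (rule \<mu>.pot_finite)

text \<open>By the continuity principle only the support matters, and there \<open>P\<close> equals
  the obstacle. Its jump is harmless: near a support point in \<open>E\<close> with R > 1, lower
  semicontinuity keeps \<open>P\<close> above 1, so nearby support points have obstacle value R as
  well.\<close>

lemma continuous_pot: "continuous_on UNIV (pot \<mu>)"
proof (rule \<mu>.continuity_principle[OF n pot_finite_everywhere])
  fix Y x assume Y: "\<And>i. Y i \<in> msupp \<mu>" and x: "x \<in> msupp \<mu>" and lim: "Y \<longlonglongrightarrow> x"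
  have obs: "\<forall>\<^sub>F i in sequentially. obstacle_fn (Y i) = obstacle_fn x"
  proof (cases "x \<in> E \<and> 1 < R")
    case True
    have "1 < pot M x" using P_eq_supp[OF x] True by (simp add: M(2) obstacle_fn_def)
    from pot_lsc_gt[OF M.sets_eq this] obtain d where d: "0 < d" "\<And>y. y \<in> ball x d \<Longrightarrow> 1 < P y"
      by (auto simp: M(2))
    have "\<forall>\<^sub>F i in sequentially. dist (Y i) x < d" using tendstoD[OF lim d(1)] .
    then show ?thesis
    proof eventually_elim
      case (elim i)
      then have "1 < ennreal (obstacle_fn (Y i))" using d(2)[of "Y i"] P_eq_supp[OF Y] by (simp add: dist_commute)
      then show ?case using True by (auto simp: obstacle_fn_def split: if_splits)
    qed
  next
    case False
    show ?thesis
    proof (cases "x \<in> E")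
      case True
      then have "R = 1" using False R by simp
      then show ?thesis unfolding obstacle_fn_def by simp
    next
      case nE: False
      have "\<forall>\<^sub>F i in sequentially. Y i \<in> - E"
        using lim nE closed_E by (intro topological_tendstoD) (auto simp: open_Compl)
      then show ?thesis by eventually_elim (use nE in \<open>simp add: obstacle_fn_def\<close>)
    qed
  qed
  have Pfin: "ennreal c * riesz_kernel y e < \<infinity>" if "y \<in> msupp \<mu>" for y
  proof -
    have "ennreal c * riesz_kernel y e \<le> P y" by (simp add: P_def)
    also have "\<dots> < \<infinity>" using P_eq_supp[OF that] by simp
    finally show ?thesis .
  qed
  have pot_eq: "pot \<mu> y = ennreal (obstacle_fn y) - ennreal c * riesz_kernel y e" if "y \<in> msupp \<mu>" for y
    using P_eq_supp[OF that] Pfin[OF that] unfolding P_def by (metis ennreal_add_diff_cancel_right infinity_ennreal_def less_irrefl)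
  have "(\<lambda>i. ennreal c * riesz_kernel (Y i) e) \<longlonglongrightarrow> ennreal c * riesz_kernel x e"
    by (intro ennreal_tendsto_cmult tendsto_riesz_kernel lim) simp
  then have "(\<lambda>i. ennreal (obstacle_fn x) - ennreal c * riesz_kernel (Y i) e) \<longlonglongrightarrow> ennreal (obstacle_fn x) - ennreal c * riesz_kernel x e"
    using Pfin[OF x] by (intro tendsto_diff_ennreal tendsto_const) auto
  then show "(\<lambda>i. pot \<mu> (Y i)) \<longlonglongrightarrow> pot \<mu> x"
    unfolding pot_eq[OF x] pot_eq[OF Y]
    by (rule Lim_transform_eventually) (use obs in \<open>auto elim: eventually_mono\<close>)
qed

lemmas P_ge_expanded = P_ge[unfolded P_def obstacle_fn_def]
  and P_eq_supp_expanded = P_eq_supp[unfolded P_def obstacle_fn_def]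

end

theorem obstacle_solution:
  obtains \<mu> where "sphere_measure \<mu>" "continuous_on UNIV (pot \<mu>)" "\<And>x. pot \<mu> x < \<infinity>"
    "\<And>x. norm x = 1 \<Longrightarrow> ennreal (if x \<in> E then R else 1) \<le> pot \<mu> x + ennreal c * riesz_kernel x e"
    "\<And>x. x \<in> msupp \<mu> \<Longrightarrow> pot \<mu> x + ennreal c * riesz_kernel x e = ennreal (if x \<in> E then R else 1)"
proof -
  obtain \<mu> where \<mu>: "sphere_measure \<mu>" "T \<mu> < \<infinity>" "\<And>\<nu>. sphere_measure \<nu> \<Longrightarrow> T \<nu> < \<infinity> \<Longrightarrow> objective \<mu> \<le> objective \<nu>"
  proof (rule minimizer_exists)
    fix \<mu> assume "sphere_measure \<mu>" "T \<mu> < \<infinity>" "\<And>\<nu>. sphere_measure \<nu> \<Longrightarrow> T \<nu> < \<infinity> \<Longrightarrow> objective \<mu> \<le> objective \<nu>"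
    then show thesis by (rule that)
  qed
  show ?thesis
  proof (rule that[OF \<mu>(1)])
    show "continuous_on UNIV (pot \<mu>)" using \<mu> by (rule continuous_pot)
    show "pot \<mu> x < \<infinity>" for x using \<mu> by (rule pot_finite_everywhere)
    show "ennreal (if x \<in> E then R else 1) \<le> pot \<mu> x + ennreal c * riesz_kernel x e" if "norm x = 1" for x
      using \<mu> that by (rule P_ge_expanded)
    show "pot \<mu> x + ennreal c * riesz_kernel x e = ennreal (if x \<in> E then R else 1)" if "x \<in> msupp \<mu>" for x
      using \<mu> that by (rule P_eq_supp_expanded)
  qed
qed

end

subsection \<open>Comparison and polarization\<close>

text \<open>A finite substitute for the kernel with pole e. The kernel itself is infinite at e and
  so cannot enter a \<open>supermean\<close>; outside the radius \<rho> the two agree.\<close>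

definition trunc_kernel :: "real \<Rightarrow> real ^ 'n \<Rightarrow> real ^ 'n \<Rightarrow> real" where
  "trunc_kernel \<rho> e x = inverse (max \<rho> (norm (x - e))) ^ (CARD('n) - 2)"

lemma trunc_kernel_cases:
  assumes "0 < \<rho>"
  shows "trunc_kernel \<rho> e x = (if norm (x - e) \<le> \<rho> then inverse \<rho> ^ (CARD('n) - 2) else rk x (e :: real ^ 'n))"
  using assms by (auto simp: trunc_kernel_def rk_def max_def)

lemma trunc_kernel_le:
  fixes e x :: "real ^ 'n"
  assumes "0 < \<rho>"
  shows "ennreal (trunc_kernel \<rho> e x) \<le> riesz_kernel x e"
proof (cases "norm (x - e) \<le> \<rho>")
  case True
  then show ?thesis
    using mean_kernel_le[OF assms, of x e] assms by (simp add: trunc_kernel_cases)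
next
  case False
  then have "x \<noteq> e" using assms by auto
  then show ?thesis using False assms by (simp add: trunc_kernel_cases riesz_kernel_rk)
qed

lemma trunc_kernel_nonneg: "0 < \<rho> \<Longrightarrow> 0 \<le> trunc_kernel \<rho> e x"
  by (simp add: trunc_kernel_def le_max_iff_disj)

text \<open>The truncated kernel is the potential of the uniform distribution on the sphere of radius \<open>\<rho>\<close> about \<open>e\<close>.\<close>

lemma trunc_kernel_potential:
  fixes e :: "real ^ 'n"
  assumes n: "3 \<le> CARD('n)" and \<rho>: "0 < \<rho>"
  shows "supermean (trunc_kernel \<rho> e)"
    and "\<And>c r. 0 < r \<Longrightarrow> \<rho> + r \<le> norm (c - e) \<Longrightarrow> (\<integral>z. trunc_kernel \<rho> e (c + r *\<^sub>R z) \<partial>sph) = trunc_kernel \<rho> e c"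
proof -
  define \<sigma> where "\<sigma> = distr sph borel (\<lambda>z. e + \<rho> *\<^sub>R z)"
  have fin: "finite_measure \<sigma>"
    unfolding \<sigma>_def by (intro prob_space.finite_measure prob_space.prob_space_distr prob_space_sph) measurable
  have sets: "sets \<sigma> = sets borel" by (simp add: \<sigma>_def)
  have n2: "2 \<le> CARD('n)" using n by simp
  have pot: "pot \<sigma> x = ennreal (trunc_kernel \<rho> e x)" for x
  proof -
    have "pot \<sigma> x = (\<integral>\<^sup>+z. riesz_kernel (e + \<rho> *\<^sub>R z) x \<partial>sph)"
      unfolding pot_def \<sigma>_def by (subst nn_integral_distr) (auto simp: riesz_kernel_commute)
    also have "\<dots> = ennreal (trunc_kernel \<rho> e x)"
    proof (cases "norm (x - e) \<le> \<rho>")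
      case True
      then show ?thesis
        using sphere_mean_riesz_kernel[OF n2 \<rho>, of e x] \<rho> by (simp add: trunc_kernel_cases norm_minus_commute)
    next
      case False
      then have "x \<noteq> e" using \<rho> by auto
      then show ?thesis
        using sphere_mean_riesz_kernel[OF n2 \<rho>, of e x] \<rho> False riesz_kernel_rk[of x e]
        by (simp add: trunc_kernel_cases norm_minus_commute riesz_kernel_commute)
    qed
    finally show ?thesis .
  qed
  have ne: "max \<rho> (norm (x - e)) \<noteq> 0" for x using \<rho> by (auto simp: max_def)
  have cont: "continuous_on UNIV (trunc_kernel \<rho> e)"
    unfolding trunc_kernel_def using ne by (intro continuous_intros) auto
  have pcont: "continuous_on UNIV (pot \<sigma>)"
    unfolding pot[abs_def] by (intro continuous_on_ennreal cont)
  have pfin: "pot \<sigma> x < \<infinity>" for x by (simp add: pot)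
  have pr: "pr \<sigma> = trunc_kernel \<rho> e"
    using trunc_kernel_nonneg[OF \<rho>, of e] by (intro ext) (simp only: pot enn2real_ennreal)
  show "supermean (trunc_kernel \<rho> e)"
    using supermean_pr[OF n2 fin sets pcont pfin] by (simp only: pr)
  fix c :: "real ^ 'n" and r :: real assume r: "0 < r" "\<rho> + r \<le> norm (c - e)"
  have "AE z in sph. r \<le> norm (c - (e + \<rho> *\<^sub>R z))"
    using AE_sph_sphere
  proof eventually_elim
    case (elim z)
    have "norm (c - e) \<le> norm (c - (e + \<rho> *\<^sub>R z)) + norm (\<rho> *\<^sub>R z)"
      using norm_triangle_ineq[of "c - (e + \<rho> *\<^sub>R z)" "\<rho> *\<^sub>R z"] by simp
    then show ?case using elim r \<rho> by simp
  qed
  then have "AE y in \<sigma>. r \<le> norm (c - y)"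
    unfolding \<sigma>_def by (subst AE_distr_iff) auto
  from pr_mean_eq[OF n2 fin sets pcont pfin r(1) this]
  show "(\<integral>z. trunc_kernel \<rho> e (c + r *\<^sub>R z) \<partial>sph) = trunc_kernel \<rho> e c"
    using fun_cong[OF pr] by (simp only:)
qed

text \<open>Truncation must not spoil the comparison with the obstacle: with this \<rho> the
  truncated charge alone reaches the level C wherever it differs from the true one. In the minimum,
  1 makes powers of 1/\<rho> increase with the exponent.\<close>

lemma trunc_kernel_large:
  fixes b d C :: real
  assumes n: "3 \<le> CARD('n::finite)" and b: "0 < b" and d: "0 < d"
  obtains \<rho> where "0 < \<rho>" "\<rho> < d" "C \<le> b * inverse \<rho> ^ (CARD('n) - 2)"
proof -
  define \<rho> where "\<rho> = Min {d / 2, 1, b / (\<bar>C\<bar> + 1)}"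
  have \<rho>: "0 < \<rho>" "\<rho> \<le> d / 2" "\<rho> \<le> 1" "\<rho> \<le> b / (\<bar>C\<bar> + 1)" using b d by (simp add: \<rho>_def) (simp_all only: \<rho>_def min.coboundedI1 Min_le finite.intros insertI1 insertI2)
  have "\<rho> * (\<bar>C\<bar> + 1) \<le> b" using \<rho>(4) by (simp add: pos_le_divide_eq)
  then have "\<bar>C\<bar> + 1 \<le> b * inverse \<rho>" using \<rho>(1) by (simp add: field_simps)
  also have "\<dots> \<le> b * inverse \<rho> ^ (CARD('n) - 2)"
  proof -
    have "1 \<le> inverse \<rho>" using \<rho> by (simp add: one_le_inverse_iff)
    then have "inverse \<rho> ^ 1 \<le> inverse \<rho> ^ (CARD('n) - 2)" using n by (intro power_increasing) auto
    then show ?thesis using b by simp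
  qed
  finally show ?thesis using that[of \<rho>] \<rho> d by simp
qed

lemma integral_sph_reflect_in:
  fixes v :: "real ^ 'n" and f :: "real ^ 'n \<Rightarrow> real"
  assumes "norm v = 1" and [measurable]: "f \<in> borel_measurable borel"
  shows "(\<integral>x. f (reflect_in v x) \<partial>sph) = (\<integral>x. f x \<partial>sph)"
  by (subst (2) distr_sph_reflect_in[symmetric, OF assms(1)]) (simp add: integral_distr)

lemma sphere_mean_reflect_in:
  fixes v :: "real ^ 'n" and f :: "real ^ 'n \<Rightarrow> real"
  assumes v: "norm v = 1" and f: "continuous_on UNIV f"
  shows "(\<integral>z. f (reflect_in v (x + r *\<^sub>R z)) \<partial>sph) = (\<integral>z. f (reflect_in v x + r *\<^sub>R z) \<partial>sph)"
proof -
  have [measurable]: "f \<in> borel_measurable borel" using f by (rule borel_measurable_continuous_onI)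
  have "(\<integral>z. f (reflect_in v x + r *\<^sub>R reflect_in v z) \<partial>sph) = (\<integral>z. f (reflect_in v x + r *\<^sub>R z) \<partial>sph)"
    by (rule integral_sph_reflect_in[OF v]) measurable
  then show ?thesis by (simp add: linear_add linear_cmul reflect_in_linear)
qed

locale obstacle_sol = obstacle e s c R + sphere_measure \<mu>
  for e :: "real ^ 'n" and s c R :: real and \<mu> +
  assumes cont_pot: "continuous_on UNIV (pot \<mu>)" and fin_pot: "\<And>x. pot \<mu> x < \<infinity>"
    and pot_ge: "\<And>x. norm x = 1 \<Longrightarrow> ennreal (obstacle_fn x) \<le> pot \<mu> x + ennreal c * riesz_kernel x e"
    and pot_supp: "\<And>x. x \<in> msupp \<mu> \<Longrightarrow> pot \<mu> x + ennreal c * riesz_kernel x e = ennreal (obstacle_fn x)"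

lemma (in obstacle) obstacle_sol_exists: "\<exists>\<mu>. obstacle_sol e s c R \<mu>"
proof (rule obstacle_solution)
  fix \<mu> assume "sphere_measure \<mu>" "continuous_on UNIV (pot \<mu>)" "\<And>x. pot \<mu> x < \<infinity>"
    "\<And>x. norm x = 1 \<Longrightarrow> ennreal (if x \<in> E then R else 1) \<le> pot \<mu> x + ennreal c * riesz_kernel x e"
    "\<And>x. x \<in> msupp \<mu> \<Longrightarrow> pot \<mu> x + ennreal c * riesz_kernel x e = ennreal (if x \<in> E then R else 1)"
  then have "obstacle_sol e s c R \<mu>"
    by (intro obstacle_sol.intro obstacle_axioms obstacle_sol_axioms.intro) (simp_all add: obstacle_fn_def)
  then show ?thesis by blast
qed

context obstacle_sol
begin

lemma n2: "2 \<le> CARD('n)"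
  using n by simp

definition Pot :: "real ^ 'n \<Rightarrow> ennreal" where
  "Pot x = pot \<mu> x + ennreal c * riesz_kernel x e"

lemma cont_pr: "continuous_on UNIV (pr \<mu>)"
  by (rule continuous_on_pr[OF cont_pot fin_pot])

lemma pot_pr: "pot \<mu> x = ennreal (pr \<mu> x)"
  using fin_pot[of x] by (simp add: less_top)

lemma continuous_on_Pot: "continuous_on UNIV Pot"
proof -
  have "continuous_on UNIV (\<lambda>x. ennreal c * riesz_kernel x e)"
    using ennreal_continuous_on_cmult[OF _ continuous_on_riesz_kernel[OF continuous_on_id continuous_on_const], of "ennreal c" UNIV e]
    by simp
  then show ?thesis
    unfolding Pot_def[abs_def] by (intro continuous_on_add_ennreal cont_pot)
qed

lemma obstacle_fn_bounds: "1 \<le> obstacle_fn x" "obstacle_fn x \<le> R"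
  using R by (auto simp: obstacle_fn_def)

lemma Pot_real:
  assumes "x \<noteq> e \<or> c = 0"
  shows "Pot x = ennreal (pr \<mu> x + c * rk x e)"
proof -
  have "ennreal c * riesz_kernel x e = ennreal (c * rk x e)"
    using assms c by (auto simp: riesz_kernel_rk ennreal_mult)
  then show ?thesis
    using c by (subst ennreal_plus) (auto simp: Pot_def pot_pr[symmetric])
qed

lemma Pot_center: "0 < c \<Longrightarrow> Pot e = top"
proof -
  assume "0 < c"
  moreover have "riesz_kernel e e = top" using n by (simp add: riesz_kernel_def power_eq_top_ennreal)
  ultimately show ?thesis by (simp add: Pot_def ennreal_mult_top)
qed

lemma supp_not_center:
  assumes "x \<in> msupp \<mu>" "0 < c"
  shows "x \<noteq> e"
proof
  assume "x = e"
  then have "Pot x = top" using Pot_center[OF assms(2)] by simp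
  then show False using pot_supp[OF assms(1)] by (simp add: Pot_def)
qed

lemma Pot_supp: "x \<in> msupp \<mu> \<Longrightarrow> Pot x = ennreal (obstacle_fn x)"
  using pot_supp by (simp add: Pot_def)

lemma Pot_ge: "norm x = 1 \<Longrightarrow> ennreal (obstacle_fn x) \<le> Pot x"
  using pot_ge by (simp add: Pot_def)

lemma supp_real:
  assumes "x \<in> msupp \<mu>"
  shows "pr \<mu> x + c * rk x e = obstacle_fn x"
proof -
  have "x \<noteq> e \<or> c = 0" using supp_not_center[OF assms] c by (cases "c = 0") auto
  then have "ennreal (pr \<mu> x + c * rk x e) = ennreal (obstacle_fn x)" using Pot_supp[OF assms] Pot_real by simp
  then show ?thesis
    using c obstacle_fn_bounds(1)[of x] by (subst (asm) ennreal_inj) auto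
qed

text \<open>The solution is the least admissible potential. Domination by \<open>pr \<nu>\<close>
  plus the truncated charge b has to be checked on the support of \<mu> only: there
  \<open>pr \<mu>\<close> plus its own charge is the obstacle, which the competitor exceeds, and
  inside the truncation radius the charge b alone is at least R.\<close>

lemma comparison:
  assumes \<nu>: "sphere_measure \<nu>" "continuous_on UNIV (pot \<nu>)" "\<And>x. pot \<nu> x < \<infinity>" and b: "0 \<le> b"
    and ge: "\<And>x. norm x = 1 \<Longrightarrow> ennreal (obstacle_fn x) \<le> pot \<nu> x + ennreal (c + b) * riesz_kernel x e"
  shows "pot \<mu> x \<le> pot \<nu> x + ennreal b * riesz_kernel x e"
proof -
  interpret \<nu>: sphere_measure \<nu> by fact
  have p\<nu>: "pot \<nu> x = ennreal (pr \<nu> x)" for x using \<nu>(3)[of x] by (simp add: less_top)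
  obtain \<rho> where \<rho>: "0 < \<rho>" "b = 0 \<or> R \<le> b * inverse \<rho> ^ (CARD('n) - 2)"
  proof (cases "b = 0")
    case False
    then have "0 < b" using b by simp
    from trunc_kernel_large[OF n this, of 1 R] that show ?thesis by (metis zero_less_one)
  qed (use that[of 1] in auto)
  have s: "supermean (\<lambda>x. pr \<nu> x + b * trunc_kernel \<rho> e x)"
    by (intro supermean_add supermean_cmult supermean_pr trunc_kernel_potential \<rho> b n n2 \<nu> \<nu>.finite_measure_axioms \<nu>.sets_eq)
  have "pr \<mu> x \<le> pr \<nu> x + b * trunc_kernel \<rho> e x"
  proof (rule domination[OF n cont_pot fin_pot s])
    fix x assume x: "x \<in> msupp \<mu>"
    then have nx: "norm x = 1" using msupp_sphere by auto
    have eq: "pr \<mu> x + c * rk x e = obstacle_fn x" by (rule supp_real[OF x])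
    show "pr \<mu> x \<le> pr \<nu> x + b * trunc_kernel \<rho> e x"
    proof (cases "0 < b \<and> norm (x - e) \<le> \<rho>")
      case True
      then have "R \<le> b * trunc_kernel \<rho> e x" using \<rho> by (simp add: trunc_kernel_cases)
      moreover have "pr \<mu> x \<le> R" using eq obstacle_fn_bounds(2)[of x] c by (smt (verit) mult_nonneg_nonneg rk_nonneg)
      ultimately show ?thesis by (smt (verit) enn2real_nonneg)
    next
      case False
      then have bt: "b * trunc_kernel \<rho> e x = b * rk x e" using b \<rho> by (auto simp: trunc_kernel_cases)
      have xe: "x \<noteq> e \<or> c + b = 0" using False \<rho>(1) supp_not_center[OF x] b c by fastforce
      have "ennreal (obstacle_fn x) \<le> ennreal (pr \<nu> x + (c + b) * rk x e)"
      proof -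
        have "ennreal (c + b) * riesz_kernel x e = ennreal ((c + b) * rk x e)"
          using xe b c by (cases "x = e") (auto simp: riesz_kernel_rk ennreal_mult simp del: ennreal_plus)
        then show ?thesis
          using ge[OF nx] b c by (subst ennreal_plus) (auto simp: p\<nu>[symmetric])
      qed
      then have "obstacle_fn x \<le> pr \<nu> x + (c + b) * rk x e"
        using b c by (subst (asm) ennreal_le_iff) auto
      then show ?thesis unfolding bt using eq by (simp add: algebra_simps)
    qed
  qed
  then have "pot \<mu> x \<le> ennreal (pr \<nu> x + b * trunc_kernel \<rho> e x)"
    by (subst pot_pr) (rule ennreal_leI)
  also have "\<dots> = pot \<nu> x + ennreal b * ennreal (trunc_kernel \<rho> e x)"
    using b trunc_kernel_nonneg[OF \<rho>(1), of e x] by (subst ennreal_plus) (auto simp: p\<nu>[symmetric] ennreal_mult)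
  also have "\<dots> \<le> pot \<nu> x + ennreal b * riesz_kernel x e"
    by (intro add_left_mono mult_left_mono trunc_kernel_le \<rho>) simp
  finally show ?thesis .
qed

text \<open>R times \<open>sph\<close> is an admissible competitor, because its potential is R on
  the whole sphere.\<close>

lemma pot_le_sph:
  assumes "c = 0"
  shows "pot \<mu> x \<le> ennreal R * pot sph x"
proof -
  let ?\<nu> = "density sph (\<lambda>_::real ^ 'n. ennreal R)"
  have pot: "pot ?\<nu> x = ennreal R * pot sph x" for x by (rule pot_density_const) simp
  have psph: "pot sph x = ennreal (trunc_kernel 1 0 x)" for x :: "real ^ 'n"
    using pot_sph_le_1[OF n2, of x] pot_sph_ge_1[OF n2, of x] by (auto simp: trunc_kernel_def max_def)
  have c1: "continuous_on UNIV (pot ?\<nu>)"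
  proof -
    have "continuous_on UNIV (trunc_kernel 1 (0 :: real ^ 'n))"
      using trunc_kernel_potential(1)[OF n, of 1 0] by (simp add: supermean_def)
    then have "continuous_on UNIV (\<lambda>x. ennreal R * ennreal (trunc_kernel 1 0 (x :: real ^ 'n)))"
      by (intro ennreal_continuous_on_cmult continuous_on_ennreal) simp
    then show ?thesis by (simp add: pot[abs_def] psph)
  qed
  have "pot \<mu> x \<le> pot ?\<nu> x + ennreal 0 * riesz_kernel x e"
  proof (rule comparison[OF sphere_measure_scale[OF sphere_measure_sph] c1])
    show "pot ?\<nu> x < \<infinity>" for x by (simp add: pot psph ennreal_mult_less_top)
    show "ennreal (obstacle_fn x) \<le> pot ?\<nu> x + ennreal (c + 0) * riesz_kernel x e" if "norm x = 1" for x
      using that obstacle_fn_bounds(2)[of x] by (simp add: pot pot_sph_le_1[OF n2] assms ennreal_leI)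
  qed simp
  then show ?thesis by (simp add: pot)
qed

lemma pot_le_R: "c = 0 \<Longrightarrow> pot \<mu> x \<le> ennreal R"
proof -
  assume c0: "c = 0"
  have "pot sph x \<le> 1"
    using pot_sph_le_1[OF n2, of x] pot_sph_ge_1[OF n2, of x]
    by (cases "norm x \<le> 1") (auto simp: power_le_one inverse_le_1_iff)
  then have "ennreal R * pot sph x \<le> ennreal R * 1" by (intro mult_left_mono) auto
  then show "pot \<mu> x \<le> ennreal R" using pot_le_sph[OF c0, of x] by simp
qed

lemma pr_mean_off:
  assumes "0 < \<rho>" "\<And>y. y \<in> msupp \<mu> \<Longrightarrow> \<rho> \<le> norm (x - y)"
  shows "(\<integral>z. pr \<mu> (x + \<rho> *\<^sub>R z) \<partial>sph) = pr \<mu> x"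
  using AE_carrier assms finite_measure_axioms
  by (intro pr_mean_eq[OF n2 _ sets_eq cont_pot fin_pot]) (auto elim: eventually_mono)

lemma supp_distance:
  assumes "x \<notin> msupp \<mu>"
  obtains r where "0 < r" "\<And>y. y \<in> msupp \<mu> \<Longrightarrow> r \<le> norm (x - y)"
  using carrier_distance[OF assms] by (metis centre_in_ball)

text \<open>If the upper bound R were attained off the support, it would spread to a full ball about
  x, which contains points outside the closed unit ball. There the bound by R times the potential of
  \<open>sph\<close> is strictly below R.\<close>

lemma strict_below:
  assumes c0: "c = 0" and x: "norm x = 1" "x \<notin> msupp \<mu>"
  shows "pot \<mu> x < ennreal R"
proof (rule ccontr)
  assume "\<not> ?thesis"
  then have "pot \<mu> x = ennreal R" using pot_le_R[OF c0, of x] by auto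
  then have prx: "pr \<mu> x = R" using R by simp
  obtain r where r: "0 < r" "\<And>y. y \<in> msupp \<mu> \<Longrightarrow> r \<le> norm (x - y)" using supp_distance[OF x(2)] by blast
  have le: "pr \<mu> y \<le> R" for y using enn2real_mono[OF pot_le_R[OF c0, of y]] R by simp
  define y where "y = (1 + r / 2) *\<^sub>R x"
  have ny: "norm y = 1 + r / 2" using r x by (simp add: y_def)
  have "norm (y - x) = r / 2" using r x by (simp add: y_def algebra_simps)
  then have "y \<in> ball x r" using r by (simp add: dist_norm norm_minus_commute)
  have "R - pr \<mu> y = 0"
  proof (rule zero_spread[where W="\<lambda>y. R - pr \<mu> y"])
    show "continuous_on (ball x r) (\<lambda>y. R - pr \<mu> y)"
      by (intro continuous_intros continuous_on_subset[OF cont_pr]) auto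
    fix \<rho> assume \<rho>: "0 < \<rho>" "\<rho> < r"
    have "integrable sph (\<lambda>z. pr \<mu> (x + \<rho> *\<^sub>R z))" by (rule integrable_sph_continuous[OF cont_pr])
    moreover have "(\<integral>z. pr \<mu> (x + \<rho> *\<^sub>R z) \<partial>sph) = pr \<mu> x"
      using \<rho> r(2) by (intro pr_mean_off) (auto intro: order_trans less_imp_le)
    ultimately show "integrable sph (\<lambda>z. R - pr \<mu> (x + \<rho> *\<^sub>R z)) \<and> (\<integral>z. R - pr \<mu> (x + \<rho> *\<^sub>R z) \<partial>sph) \<le> R - pr \<mu> x"
      by simp
  qed (use le prx \<open>y \<in> ball x r\<close> in auto)
  then have "ennreal R = pot \<mu> y" by (simp add: pot_pr[symmetric])
  also have "\<dots> \<le> ennreal R * pot sph y" by (rule pot_le_sph[OF c0])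
  also have "\<dots> = ennreal (R * inverse (1 + r / 2) ^ (CARD('n) - 2))"
    using R r ny pot_sph_ge_1[OF n2, of y] by (simp add: ennreal_mult)
  finally have "R \<le> R * inverse (1 + r / 2) ^ (CARD('n) - 2)"
    using R r by (subst (asm) ennreal_le_iff) auto
  moreover have "inverse (1 + r / 2) ^ (CARD('n) - 2) < 1"
    using r n by (intro power_less_one_iff[THEN iffD2]) (auto simp: inverse_less_1_iff)
  ultimately show False using R by simp
qed

lemma reflect_in_closer:
  assumes v: "norm v = 1" "0 \<le> v \<bullet> e" and x: "0 \<le> x \<bullet> v"
  shows "norm (x - e) \<le> norm (reflect_in v x - e)"
proof -
  have "0 \<le> (v \<bullet> x) * (v \<bullet> e)" using v x by (simp add: inner_commute)
  then have "reflect_in v x \<bullet> e \<le> x \<bullet> e"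
    by (simp add: reflect_in_def inner_diff_left mult_ac)
  moreover have "(norm (reflect_in v x - e))\<^sup>2 = (norm (reflect_in v x))\<^sup>2 - 2 * (reflect_in v x \<bullet> e) + 1"
    "(norm (x - e))\<^sup>2 = (norm x)\<^sup>2 - 2 * (x \<bullet> e) + 1"
    using e unfolding power2_norm_eq_inner norm_eq_1 by (simp_all add: inner_diff_left inner_diff_right inner_commute)
  ultimately have "(norm (x - e))\<^sup>2 \<le> (norm (reflect_in v x - e))\<^sup>2"
    using v by simp
  then show ?thesis by (rule power2_le_imp_le) simp
qed

text \<open>Two-point symmetrisation: at a negative minimum of \<open>Pot x - Pot x'\<close>, where \<open>x'\<close> is the mirror image of \<open>x\<close>,
  the point \<open>x'\<close> is off the support, since on the support \<open>Pot x'\<close> equals the obstacle, which is largest on the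
  side of \<open>e\<close>.\<close>

lemma polarization_real:
  assumes v: "norm v = 1" "0 \<le> v \<bullet> e" and x: "0 \<le> x \<bullet> v"
    and c': "c' = (if v \<bullet> e = 0 then 0 else c)" and \<rho>: "0 < \<rho>" "0 < v \<bullet> e \<Longrightarrow> \<rho> < v \<bullet> e"
      "0 < c \<Longrightarrow> R \<le> c * inverse \<rho> ^ (CARD('n) - 2)"
  shows "pr \<mu> (reflect_in v x) + c' * trunc_kernel \<rho> e (reflect_in v x) \<le> pr \<mu> x + c' * trunc_kernel \<rho> e x"
proof -
  let ?H = "reflect_in v" and ?t = "trunc_kernel \<rho> e"
  \<comment> \<open>If the hyperplane contains e, the charge is its own mirror image and cancels
    from the difference, hence c' = 0. Otherwise \<rho> is below the distance of e from the
    hyperplane, so the truncation radius does not reach the mirror side.\<close>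
  define W where "W x = (pr \<mu> x + c' * ?t x) - (pr \<mu> (?H x) + c' * ?t (?H x))" for x
  have c0: "0 \<le> c'" using c c' by simp
  have tc: "continuous_on UNIV ?t" and ts: "\<And>x r. 0 < r \<Longrightarrow> (\<integral>z. ?t (x + r *\<^sub>R z) \<partial>sph) \<le> ?t x"
    using trunc_kernel_potential(1)[OF n \<rho>(1), of e] by (auto simp: supermean_def)
  have cH: "continuous_on UNIV (\<lambda>x. f (?H x))" if "continuous_on UNIV f" for f :: "real ^ 'n \<Rightarrow> real"
    by (rule continuous_on_compose2[OF that]) (auto intro!: continuous_intros)
  have tmono: "?t (?H y) \<le> ?t y" if "0 \<le> y \<bullet> v" for y
    unfolding trunc_kernel_def using reflect_in_closer[OF v that] \<rho>(1)
    by (intro power_mono le_imp_inverse_le) (auto simp: less_max_iff_disj le_max_iff_disj)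
  have "0 \<le> W x"
  proof (rule min_principle[where D="{x. 0 \<le> x \<bullet> v}"])
    show "closed {x. 0 \<le> x \<bullet> v}" by (intro closed_Collect_le continuous_intros)
    show "continuous_on {x. 0 \<le> x \<bullet> v} W"
      unfolding W_def by (intro continuous_intros continuous_on_subset[OF cont_pr] continuous_on_subset[OF tc]
          continuous_on_subset[OF cH[OF cont_pr]] continuous_on_subset[OF cH[OF tc]]) auto
    show "x \<in> {x. 0 \<le> x \<bullet> v}" using x by simp
  next
    fix \<epsilon> :: real assume "0 < \<epsilon>"
    then obtain r where r: "\<And>x. r < norm x \<Longrightarrow> pr \<mu> x \<le> \<epsilon>" using pr_vanishes_at_infinity[OF n] by blast
    have "- \<epsilon> \<le> W y" if y: "0 \<le> y \<bullet> v" "r < norm y" for y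
    proof -
      have "pr \<mu> (?H y) \<le> \<epsilon>" using y v by (intro r) simp
      moreover have "c' * ?t (?H y) \<le> c' * ?t y" using tmono[OF y(1)] c0 by (rule mult_left_mono)
      moreover have "0 \<le> pr \<mu> y" by simp
      ultimately show ?thesis unfolding W_def by linarith
    qed
    then show "\<exists>r. \<forall>x\<in>{x. 0 \<le> x \<bullet> v}. r < norm x \<longrightarrow> - \<epsilon> \<le> W x" by blast
  next
    fix y assume y: "y \<in> {x. 0 \<le> x \<bullet> v}" "W y < 0"
    have yv: "0 < y \<bullet> v"
    proof (rule ccontr)
      assume "\<not> 0 < y \<bullet> v"
      then have "?H y = y" using y by (simp add: reflect_in_def inner_commute)
      then show False using y by (simp add: W_def)
    qed
    have dist_e: "v \<bullet> e + y \<bullet> v \<le> norm (?H y - e)"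
    proof -
      have "(e - ?H y) \<bullet> v \<le> norm (e - ?H y) * norm v" by (rule norm_cauchy_schwarz)
      moreover have "(e - ?H y) \<bullet> v = v \<bullet> e + y \<bullet> v"
        using v(1) by (simp add: reflect_in_def inner_diff_left inner_diff_right inner_commute norm_eq_1)
      ultimately show ?thesis using v(1) by (simp add: norm_minus_commute)
    qed
    have off: "?H y \<notin> msupp \<mu>"
    proof
      assume H: "?H y \<in> msupp \<mu>"
      then have "norm (?H y) = 1" using msupp_sphere by auto
      then have ny: "norm y = 1" using v by simp
      have "0 \<le> (v \<bullet> y) * (v \<bullet> e)" using v yv by (simp add: inner_commute)
      then have "?H y \<bullet> e \<le> y \<bullet> e" by (simp add: reflect_in_def inner_diff_left mult_ac)
      then have obs: "obstacle_fn (?H y) \<le> obstacle_fn y"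
        using ny v R by (auto simp: obstacle_fn_def E_def)
      have eqH: "pr \<mu> (?H y) + c * rk (?H y) e = obstacle_fn (?H y)" by (rule supp_real[OF H])
      have "0 \<le> W y"
      proof (cases "v \<bullet> e = 0")
        case True
        then have "?H e = e" by (simp add: reflect_in_def)
        then have "rk (?H y) e = rk y e" using v(1) by (metis norm_reflect_in_diff rk_def)
        moreover have "y \<noteq> e \<or> c = 0"
          using supp_not_center[OF H] \<open>?H e = e\<close> c by force
        then have "ennreal (obstacle_fn y) \<le> ennreal (pr \<mu> y + c * rk y e)" using Pot_ge[OF ny] Pot_real by simp
        then have "obstacle_fn y \<le> pr \<mu> y + c * rk y e" using c by (subst (asm) ennreal_le_iff) auto
        ultimately show ?thesis using eqH obs True c' by (simp add: W_def)
      next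
        case False
        then have ve: "0 < v \<bullet> e" using v by simp
        then have cc: "c' = c" using c' by simp
        have "\<rho> < norm (?H y - e)" using \<rho>(2)[OF ve] dist_e yv by simp
        then have tH: "?t (?H y) = rk (?H y) e" using \<rho>(1) by (simp add: trunc_kernel_cases)
        have "obstacle_fn (?H y) \<le> pr \<mu> y + c * ?t y"
        proof (cases "0 < c \<and> norm (y - e) \<le> \<rho>")
          case True
          then have "R \<le> c * ?t y" using \<rho> by (simp add: trunc_kernel_cases)
          moreover have "obstacle_fn (?H y) \<le> R" by (rule obstacle_fn_bounds)
          moreover have "0 \<le> pr \<mu> y" by simp
          ultimately show ?thesis by linarith
        next
          case nF: False
          then have "c * ?t y = c * rk y e" "y \<noteq> e \<or> c = 0" using c \<rho>(1) by (auto simp: trunc_kernel_cases)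
          moreover from this have "ennreal (obstacle_fn y) \<le> ennreal (pr \<mu> y + c * rk y e)" using Pot_ge[OF ny] Pot_real by simp
          then have "obstacle_fn y \<le> pr \<mu> y + c * rk y e" using c by (subst (asm) ennreal_le_iff) auto
          ultimately show ?thesis using obs by (simp only:)
        qed
        then show ?thesis using eqH tH cc by (simp add: W_def)
      qed
      then show False using y by simp
    qed
    obtain r0 where r0: "0 < r0" "\<And>z. z \<in> msupp \<mu> \<Longrightarrow> r0 \<le> norm (?H y - z)" using supp_distance[OF off] by blast
    \<comment> \<open>Small enough that the mirrored sphere avoids the support and the original one
      stays in the half-space.\<close>
    define r where "r = min r0 (y \<bullet> v)"
    have r: "0 < r" "r \<le> r0" "r \<le> y \<bullet> v" using r0 yv by (auto simp: r_def)
    have sub: "cball y r \<subseteq> {x. 0 \<le> x \<bullet> v}"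
    proof
      fix z assume "z \<in> cball y r"
      then have "norm (y - z) \<le> r" by (simp add: dist_norm)
      moreover have "(y - z) \<bullet> v \<le> norm (y - z) * norm v" by (rule norm_cauchy_schwarz)
      ultimately show "z \<in> {x. 0 \<le> x \<bullet> v}" using r v by (simp add: inner_diff_left)
    qed
    have m1: "(\<integral>z. pr \<mu> (y + r *\<^sub>R z) \<partial>sph) \<le> pr \<mu> y"
      using supermean_pr[OF n2 finite_measure_axioms sets_eq cont_pot fin_pot] r by (simp add: supermean_def)
    have m2: "c' * (\<integral>z. ?t (y + r *\<^sub>R z) \<partial>sph) \<le> c' * ?t y" using ts[OF r(1)] c0 by (intro mult_left_mono) auto
    have m3: "(\<integral>z. pr \<mu> (?H (y + r *\<^sub>R z)) \<partial>sph) = pr \<mu> (?H y)"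
      unfolding sphere_mean_reflect_in[OF v(1) cont_pr] using r r0 by (intro pr_mean_off) (auto intro: order_trans)
    have m4: "c' * (\<integral>z. ?t (?H (y + r *\<^sub>R z)) \<partial>sph) = c' * ?t (?H y)"
    proof (cases "v \<bullet> e = 0")
      case False
      then have "\<rho> + r \<le> norm (?H y - e)" using \<rho>(2) v dist_e r by force
      then show ?thesis
        unfolding sphere_mean_reflect_in[OF v(1) tc] using trunc_kernel_potential(2)[OF n \<rho>(1) r(1)] by simp
    qed (simp add: c')
    have "(\<integral>z. W (y + r *\<^sub>R z) \<partial>sph) = (\<integral>z. pr \<mu> (y + r *\<^sub>R z) \<partial>sph) + c' * (\<integral>z. ?t (y + r *\<^sub>R z) \<partial>sph)
       - ((\<integral>z. pr \<mu> (?H (y + r *\<^sub>R z)) \<partial>sph) + c' * (\<integral>z. ?t (?H (y + r *\<^sub>R z)) \<partial>sph))"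
      unfolding W_def
      using integrable_sph_continuous[OF cont_pr] integrable_sph_continuous[OF tc]
        integrable_sph_continuous[OF cH[OF cont_pr]] integrable_sph_continuous[OF cH[OF tc]] by simp
    also have "\<dots> \<le> W y" unfolding m3 m4 W_def using m1 m2 by simp
    finally show "\<exists>\<rho>>0. cball y \<rho> \<subseteq> {x. 0 \<le> x \<bullet> v} \<and> (\<integral>z. W (y + \<rho> *\<^sub>R z) \<partial>sph) \<le> W y"
      using r(1) sub by blast
  qed
  then show ?thesis by (simp add: W_def)
qed

lemma polarization:
  assumes v: "norm v = 1" "0 \<le> v \<bullet> e" and x: "0 \<le> x \<bullet> v"
  shows "Pot (reflect_in v x) \<le> Pot x"
proof (cases "x = e \<and> 0 < c")
  case True
  then have "Pot x = top" using Pot_center by simp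
  then show ?thesis by simp
next
  case False
  let ?H = "reflect_in v"
  \<comment> \<open>With \<rho> below these distances the truncation is invisible both at x and at
    its mirror image; the value 1 replaces a distance that is 0.\<close>
  define d where "d = min (if v \<bullet> e = 0 then 1 else v \<bullet> e) (if x = e then 1 else norm (x - e))"
  have d: "0 < d" using v by (auto simp: d_def)
  obtain \<rho> where \<rho>: "0 < \<rho>" "\<rho> < d" "0 < c \<Longrightarrow> R \<le> c * inverse \<rho> ^ (CARD('n) - 2)"
  proof (cases "0 < c")
    case True
    from trunc_kernel_large[OF n this d, of R] that show ?thesis by metis
  qed (use that[of "d / 2"] d in auto)
  define c' where "c' = (if v \<bullet> e = 0 then 0 else c)"
  have le: "pr \<mu> (?H x) + c' * trunc_kernel \<rho> e (?H x) \<le> pr \<mu> x + c' * trunc_kernel \<rho> e x"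
    using \<rho> by (intro polarization_real[OF v x c'_def]) (auto simp: d_def)
  have far: "norm (x - e) \<le> norm (?H x - e)" by (rule reflect_in_closer[OF v x])
  have xe: "x \<noteq> e \<or> c = 0" using False c by auto
  then have He: "?H x \<noteq> e \<or> c = 0" using far by auto
  have "pr \<mu> (?H x) + c * rk (?H x) e \<le> pr \<mu> x + c * rk x e"
  proof (cases "c = 0")
    case True
    then have "c' = 0" by (simp add: c'_def)
    then show ?thesis using le True by simp
  next
    case cn: False
    then have "x \<noteq> e" using xe by simp
    then have "\<rho> < norm (x - e)" using \<rho>(2) by (simp add: d_def)
    then have t: "trunc_kernel \<rho> e x = rk x e" "trunc_kernel \<rho> e (?H x) = rk (?H x) e"
      using far \<rho>(1) by (auto simp: trunc_kernel_cases)
    show ?thesis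
    proof (cases "v \<bullet> e = 0")
      case True
      then have "?H e = e" by (simp add: reflect_in_def)
      then have "rk (?H x) e = rk x e" using v(1) by (metis norm_reflect_in_diff rk_def)
      then show ?thesis using le True by (simp add: c'_def)
    next
      case False
      then show ?thesis using le t by (simp add: c'_def)
    qed
  qed
  then show ?thesis unfolding Pot_real[OF xe] Pot_real[OF He] by (rule ennreal_leI)
qed

text \<open>Polarization in the hyperplane bisecting x and y, which has e on the side of x. At equal
  heights it applies both ways, so \<open>Pot\<close> is also symmetric about the axis through
  e.\<close>

lemma Pot_decreasing:
  assumes "norm x = norm y" "y \<bullet> e \<le> x \<bullet> e"
  shows "Pot y \<le> Pot x"
proof (cases "x = y")
  case False
  define v where "v = (x - y) /\<^sub>R norm (x - y)"
  have v: "norm v = 1" "0 \<le> v \<bullet> e" using False assms(2) by (auto simp: v_def inner_diff_left)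
  have "x \<bullet> y \<le> norm x * norm y" by (rule norm_cauchy_schwarz)
  then have "0 \<le> (x - y) \<bullet> x"
    using assms(1) dot_square_norm[of x] by (simp add: inner_diff_left inner_commute[of y] power2_eq_square)
  then have "0 \<le> x \<bullet> v" by (simp add: v_def inner_commute)
  from polarization[OF v this] show ?thesis
    using reflect_in_swap[OF assms(1) False] by (simp add: v_def)
qed simp

end

subsection \<open>Strict monotonicity between the caps\<close>

text \<open>Averaging over the sphere of radius r strictly lowers the kernel of each pole nearer
  than r and raises none. If the mean loses nothing, there is no mass in the ball.\<close>

lemma (in sphere_measure) not_supp_of_mean_ge:
  assumes n: "3 \<le> CARD('n)" and fin: "pot \<mu> x < \<infinity>" and r: "0 < r"
    and le: "pot \<mu> x \<le> (\<integral>\<^sup>+z. pot \<mu> (x + r *\<^sub>R z) \<partial>sph)"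
  shows "x \<notin> msupp \<mu>"
proof -
  let ?m = "\<lambda>y. if norm (x - y) \<le> r then ennreal (inverse r ^ (CARD('n) - 2)) else riesz_kernel x y"
  have mean: "(\<integral>\<^sup>+z. pot \<mu> (x + r *\<^sub>R z) \<partial>sph) = (\<integral>\<^sup>+y. ?m y \<partial>\<mu>)"
    using n r by (intro sphere_mean_pot finite_measure_axioms sets_eq) auto
  have le': "?m y \<le> riesz_kernel x y" for y by (rule mean_kernel_le[OF r])
  have "(\<integral>\<^sup>+y. ?m y \<partial>\<mu>) \<le> pot \<mu> x" unfolding pot_def by (intro nn_integral_mono le')
  then have mfin: "(\<integral>\<^sup>+y. ?m y \<partial>\<mu>) \<noteq> \<infinity>" using fin by auto
  have "(\<integral>\<^sup>+y. riesz_kernel x y - ?m y \<partial>\<mu>) = (\<integral>\<^sup>+y. riesz_kernel x y \<partial>\<mu>) - (\<integral>\<^sup>+y. ?m y \<partial>\<mu>)"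
    using mfin le' by (intro nn_integral_diff) auto
  also have "\<dots> = 0"
    using le[unfolded mean] fin unfolding pot_def by (simp add: diff_eq_0_iff_ennreal)
  finally have "AE y in \<mu>. riesz_kernel x y - ?m y = 0"
    by (subst (asm) nn_integral_0_iff_AE) auto
  then have "AE y in \<mu>. y \<notin> ball x r"
  proof eventually_elim
    case (elim y)
    show ?case
    proof
      assume "y \<in> ball x r"
      then have d: "norm (x - y) < r" by (simp add: dist_norm)
      show False
      proof (cases "x = y")
        case True
        have "riesz_kernel x y = top" using n True by (simp add: riesz_kernel_def power_eq_top_ennreal)
        then show False using elim r d by simp
      next
        case False
        have "riesz_kernel x y = ennreal (rk x y)" using False by (rule riesz_kernel_rk)
        then have "rk x y \<le> inverse r ^ (CARD('n) - 2)"
          using elim d r by (simp add: diff_eq_0_iff_ennreal)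
        moreover have "inverse r ^ (CARD('n) - 2) < rk x y"
          unfolding rk_def using n d r False by (intro power_strict_mono less_imp_inverse_less) auto
        ultimately show False by simp
      qed
    qed
  qed
  then have "emeasure \<mu> (ball x r) = 0"
    using emeasure_eq_0_AE[of "\<lambda>y. y \<in> ball x r" \<mu>] by (simp add: ball_def)
  then show ?thesis using r by (auto simp: msupp_def)
qed

text \<open>The zero set in \<open>C\<close> is closed by continuity and open by
  \<open>zero_spread\<close>.\<close>

lemma zero_propagates:
  fixes W :: "real ^ 'n \<Rightarrow> real"
  assumes U: "open U" "continuous_on U W" "\<And>y. y \<in> U \<Longrightarrow> 0 \<le> W y"
    and mean: "\<And>y \<rho> r. 0 < \<rho> \<Longrightarrow> \<rho> < r \<Longrightarrow> ball y r \<subseteq> U \<Longrightarrow>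
      integrable sph (\<lambda>z. W (y + \<rho> *\<^sub>R z)) \<and> (\<integral>z. W (y + \<rho> *\<^sub>R z) \<partial>sph) \<le> W y"
    and C: "connected C" "C \<subseteq> U" "x \<in> C" "W x = 0" and y: "y \<in> C"
  shows "W y = 0"
proof -
  let ?Z = "{z \<in> C. W z = 0}"
  have "closedin (top_of_set C) ?Z"
    by (intro continuous_closedin_preimage_constant continuous_on_subset[OF U(2) C(2)])
  moreover have "openin (top_of_set C) ?Z"
    unfolding openin_euclidean_subtopology_iff
  proof (intro conjI ballI)
    fix z assume z: "z \<in> ?Z"
    then have "z \<in> U" using C by auto
    then obtain r where r: "0 < r" "ball z r \<subseteq> U" using U(1) by (meson open_contains_ball)
    have "W w = 0" if "w \<in> ball z r" for w
      by (rule zero_spread[OF continuous_on_subset[OF U(2) r(2)] _ _ mean[OF _ _ r(2)] that]) (use z r U(3) in auto)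
    then show "\<exists>e>0. \<forall>x'\<in>C. dist x' z < e \<longrightarrow> x' \<in> ?Z"
      using r(1) by (intro exI[of _ r]) (auto simp: dist_commute)
  qed auto
  ultimately have "?Z = {} \<or> ?Z = C" using C(1) unfolding connected_clopen by blast
  then show ?thesis using C y by auto
qed

text \<open>Normalise the segment from x to e: it remains in the open half-space, and its height
  runs from below s to 1.\<close>

lemma cap_boundary_point:
  fixes e x v :: "'a::real_inner"
  assumes e: "norm e = 1" and s: "x \<bullet> e < s" "s \<le> 1" and x: "norm x = 1" and v: "0 < x \<bullet> v" "0 < v \<bullet> e"
  obtains p where "norm p = 1" "p \<bullet> e = s" "0 < p \<bullet> v"
proof -
  define h where "h t = (1 - t) *\<^sub>R x + t *\<^sub>R e" for t :: real
  have hv: "0 < h t \<bullet> v" if "0 \<le> t" "t \<le> 1" for t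
  proof (cases "t = 0")
    case False
    then have "0 < t * (e \<bullet> v)" using v that by (simp add: inner_commute)
    moreover have "0 \<le> (1 - t) * (x \<bullet> v)" using v that by simp
    ultimately show ?thesis by (simp add: h_def inner_add_left)
  qed (use v in \<open>simp add: h_def\<close>)
  have h0: "h t \<noteq> 0" if "0 \<le> t" "t \<le> 1" for t using hv[OF that] by auto
  have "\<exists>t\<ge>0. t \<le> 1 \<and> (h t \<bullet> e) / norm (h t) = s"
  proof (rule IVT')
    show "continuous_on {0..1} (\<lambda>t. (h t \<bullet> e) / norm (h t))"
      using h0 unfolding h_def by (intro continuous_intros) auto
  qed (use s e x in \<open>simp_all add: h_def dot_square_norm\<close>)
  then obtain t where t: "0 \<le> t" "t \<le> 1" "(h t \<bullet> e) / norm (h t) = s" by blast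
  show ?thesis
  proof (rule that[of "h t /\<^sub>R norm (h t)"])
    show "norm (h t /\<^sub>R norm (h t)) = 1" using h0[OF t(1,2)] by simp
    show "(h t /\<^sub>R norm (h t)) \<bullet> e = s" using t(3) by (simp add: field_simps)
    show "0 < (h t /\<^sub>R norm (h t)) \<bullet> v" using hv[OF t(1,2)] h0[OF t(1,2)] by simp
  qed
qed

context obstacle_sol
begin

text \<open>Unique continuation for the difference of \<open>Pot\<close> and its mirror image. It is
  non-negative by polarization and has the mean value property off the charges and their images, so
  its zero at x spreads through a ball about x into the open half-ball, where there are no
  charges.\<close>

lemma mirror_symmetric_half_ball:
  assumes v: "norm v = 1" "0 < v \<bullet> e" and x: "norm x = 1" "0 < x \<bullet> v" "x \<noteq> e"
    and off: "x \<notin> msupp \<mu>" "reflect_in v x \<notin> msupp \<mu>" and eq: "Pot x = Pot (reflect_in v x)"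
    and z: "norm z < 1" "0 < z \<bullet> v"
  shows "Pot z = Pot (reflect_in v z)"
proof -
  let ?H = "reflect_in v"
  define U where "U = {z. 0 < z \<bullet> v} \<inter> - (msupp \<mu> \<union> ?H -` msupp \<mu> \<union> {e})"
  define W where "W z = (pr \<mu> z + c * rk z e) - (pr \<mu> (?H z) + c * rk (?H z) e)" for z
  have Hv: "?H y \<bullet> v = - (y \<bullet> v)" for y
    using v by (simp add: reflect_in_def inner_diff_left norm_eq_1) (simp add: inner_commute)
  have He: "?H y \<noteq> e" if "0 < y \<bullet> v" for y using Hv[of y] that v by (auto simp: inner_commute)
  have ne: "y \<noteq> e" "?H y \<noteq> e" if "y \<in> U" for y using that He by (auto simp: U_def)
  have W0: "W y = 0 \<longleftrightarrow> Pot y = Pot (?H y)" and Wge: "0 \<le> W y" if y: "y \<in> U" for y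
  proof -
    have P: "Pot y = ennreal (pr \<mu> y + c * rk y e)" "Pot (?H y) = ennreal (pr \<mu> (?H y) + c * rk (?H y) e)"
      using ne[OF y] by (auto intro!: Pot_real)
    have nn: "0 \<le> pr \<mu> w + c * rk w e" for w using c by simp
    show "W y = 0 \<longleftrightarrow> Pot y = Pot (?H y)" unfolding P W_def using nn by (subst ennreal_inj) auto
    have "Pot (?H y) \<le> Pot y" using y v by (intro polarization) (auto simp: U_def)
    then show "0 \<le> W y" unfolding P W_def using nn by (subst (asm) ennreal_le_iff) auto
  qed
  have cH: "continuous_on A ?H" for A
    by (intro linear_continuous_on linear_conv_bounded_linear[THEN iffD1] reflect_in_linear)
  have oU: "open U"
    unfolding U_def
    by (intro open_Int open_Compl closed_Un closed_msupp[OF sets_eq] closed_singleton closed_vimage cH open_Collect_less continuous_intros)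
  have cont_rk: "continuous_on U (\<lambda>z. c * rk z e)" "continuous_on U (\<lambda>z. c * rk (?H z) e)"
    unfolding rk_def using ne by (auto intro!: continuous_intros cH)
  have cW: "continuous_on U W"
    unfolding W_def
    by (intro continuous_intros cont_rk continuous_on_subset[OF cont_pr] continuous_on_compose2[OF cont_pr cH]) auto
  have mean: "integrable sph (\<lambda>z. W (y + \<rho> *\<^sub>R z)) \<and> (\<integral>z. W (y + \<rho> *\<^sub>R z) \<partial>sph) \<le> W y"
    if \<rho>: "0 < \<rho>" "\<rho> < r" "ball y r \<subseteq> U" for y \<rho> r
  proof -
    have far: "r \<le> norm (y - w)" if "w \<notin> U" for w
      using that \<rho>(3) by (force simp: dist_norm)
    have Hfar: "norm (?H y - w) = norm (y - ?H w)" for w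
      using norm_reflect_in_diff[OF v(1), of y "?H w"] v(1) by simp
    have 1: "\<rho> \<le> norm (y - w)" "\<rho> \<le> norm (?H y - w)" if "w \<in> msupp \<mu>" for w
      unfolding Hfar using far[of w] far[of "?H w"] that \<rho> v(1) by (auto simp: U_def)
    have 2: "\<rho> < norm (y - e)" "\<rho> < norm (?H y - e)"
      unfolding Hfar using far[of e] far[of "?H e"] \<rho> v Hv[of e] by (auto simp: U_def inner_commute)
    have rkc: "continuous_on UNIV (\<lambda>z. trunc_kernel d e z)" if "0 < d" for d
      using trunc_kernel_potential(1)[OF n that, of e] by (simp add: supermean_def)
    \<comment> \<open>On the two spheres in question the kernel agrees with its truncation at
      \<open>d\<close>, a continuous function on the whole space; this settles
      integrability.\<close>
    define d where "d = (min (norm (y - e)) (norm (?H y - e)) - \<rho>)"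
    have d: "0 < d" using 2 by (simp add: d_def)
    have near: "trunc_kernel d e (w + \<rho> *\<^sub>R z) = rk (w + \<rho> *\<^sub>R z) e"
      if "norm z = 1" "d + \<rho> \<le> norm (w - e)" for w z
    proof -
      have "norm (w - e) \<le> norm (w + \<rho> *\<^sub>R z - e) + norm (\<rho> *\<^sub>R z)"
        using norm_triangle_ineq4[of "w + \<rho> *\<^sub>R z - e" "\<rho> *\<^sub>R z"] by simp
      then have "d \<le> norm (w + \<rho> *\<^sub>R z - e)" using that \<rho>(1) by simp
      then show ?thesis by (simp add: trunc_kernel_def rk_def max_def)
    qed
    have dd: "d + \<rho> \<le> norm (y - e)" "d + \<rho> \<le> norm (?H y - e)" by (auto simp: d_def)
    have ir: "integrable sph (\<lambda>z. rk (w + \<rho> *\<^sub>R z) e)" if w: "d + \<rho> \<le> norm (w - e)" for w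
    proof (rule integrable_cong_AE_imp[OF integrable_sph_continuous[OF rkc[OF d]]])
      show "(\<lambda>z. rk (w + \<rho> *\<^sub>R z) e) \<in> borel_measurable sph" unfolding rk_def by measurable
      show "AE z in sph. trunc_kernel d e (w + \<rho> *\<^sub>R z) = rk (w + \<rho> *\<^sub>R z) e"
        using AE_sph_sphere by eventually_elim (simp add: near w)
    qed
    have Hlin: "?H (y + \<rho> *\<^sub>R z) = ?H y + \<rho> *\<^sub>R ?H z" for z
      by (simp add: linear_add linear_cmul reflect_in_linear)
    have rkm: "(\<lambda>z. rk (w + \<rho> *\<^sub>R z) e) \<in> borel_measurable borel" for w unfolding rk_def by measurable
    have irH: "integrable sph (\<lambda>z. rk (?H (y + \<rho> *\<^sub>R z)) e)"
    proof -
      have "integrable (distr sph borel ?H) (\<lambda>z. rk (?H y + \<rho> *\<^sub>R z) e)"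
        unfolding distr_sph_reflect_in[OF v(1)] by (rule ir[OF dd(2)])
      then show ?thesis
        unfolding Hlin using rkm borel_measurable_continuous_onI[OF cH] by (subst (asm) integrable_distr_eq) auto
    qed
    have mH: "(\<integral>z. rk (?H (y + \<rho> *\<^sub>R z)) e \<partial>sph) = rk (?H y) e"
      unfolding Hlin integral_sph_reflect_in[OF v(1) rkm] by (rule sphere_mean_rk[OF n2 \<rho>(1) 2(2)])
    have pH: "(\<integral>z. pr \<mu> (?H (y + \<rho> *\<^sub>R z)) \<partial>sph) = pr \<mu> (?H y)"
      unfolding sphere_mean_reflect_in[OF v(1) cont_pr] using 1 \<rho> by (intro pr_mean_off) auto
    have i1: "integrable sph (\<lambda>z. pr \<mu> (y + \<rho> *\<^sub>R z))" by (rule integrable_sph_continuous[OF cont_pr])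
    have i2: "integrable sph (\<lambda>z. pr \<mu> (?H (y + \<rho> *\<^sub>R z)))"
      by (rule integrable_sph_continuous[OF continuous_on_compose2[OF cont_pr cH]]) auto
    show ?thesis
      unfolding W_def
      using i1 i2 ir[OF dd(1)] irH mH pH sphere_mean_rk[OF n2 \<rho>(1) 2(1)] pr_mean_off[OF \<rho>(1) 1(1)] by simp
  qed
  have "x \<in> U" using x off by (auto simp: U_def)
  then obtain r where r: "0 < r" "ball x r \<subseteq> U" using oU by (meson open_contains_ball)
  define C where "C = ball x r \<union> ({z. norm z < 1} \<inter> {z. 0 < z \<bullet> v})"
  have "(max 0 (1 - r / 2)) *\<^sub>R x \<in> ball x r"
  proof -
    have "x - (max 0 (1 - r / 2)) *\<^sub>R x = (1 - max 0 (1 - r / 2)) *\<^sub>R x" by (simp add: algebra_simps)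
    then show ?thesis using x r by (simp add: dist_norm)
  qed
  have conn: "connected C"
    unfolding C_def
  proof (rule connected_Un)
    have "ball (0 :: real ^ 'n) 1 = {z. norm z < 1}" by (auto simp: dist_norm)
    then show "connected ({z. norm z < 1} \<inter> {z. 0 < z \<bullet> v})"
      using convex_halfspace_gt[of 0 v] convex_ball[of "0 :: real ^ 'n" 1]
      by (intro convex_connected convex_Int) (auto simp: inner_commute)
    define q where "q = max (1 / 2) (1 - r / 2)"
    have q: "0 < q" "q < 1" "1 - q < r" using r by (auto simp: q_def)
    have "x - q *\<^sub>R x = (1 - q) *\<^sub>R x" by (simp add: algebra_simps)
    then have "q *\<^sub>R x \<in> ball x r \<inter> ({z. norm z < 1} \<inter> {z. 0 < z \<bullet> v})"
      using q x by (auto simp: dist_norm)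
    then show "ball x r \<inter> ({z. norm z < 1} \<inter> {z. 0 < z \<bullet> v}) \<noteq> {}" by blast
  qed simp
  have in_U: "y \<in> U" if "norm y < 1" "0 < y \<bullet> v" for y
    using that v e msupp_sphere by (auto simp: U_def subset_iff)
  have "W z = 0"
    by (rule zero_propagates[OF oU cW Wge mean conn, where x=x])
      (use r W0[OF \<open>x \<in> U\<close>] eq z in_U in \<open>auto simp: C_def\<close>)
  then show ?thesis using W0[OF in_U[OF z]] by simp
qed

text \<open>Equal values at x and y make \<open>Pot\<close> symmetric in the ball about their
  bisecting hyperplane, and by continuity also at a boundary point p of the first cap on the side of
  e. But the mirror image of p lies below the cap, where \<open>Pot\<close> is smaller: finite
  against \<infinity> at e, or below R against at least R.\<close>

lemma Pot_strict:
  assumes x: "norm x = 1" "x \<bullet> e < s" "x \<notin> msupp \<mu>" and y: "norm y = 1" "y \<bullet> e < x \<bullet> e" "y \<notin> msupp \<mu>"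
    and nontriv: "0 < c \<and> s = 1 \<or> c = 0 \<and> 1 < R"
  shows "Pot x \<noteq> Pot y"
proof
  assume eq: "Pot x = Pot y"
  have ne: "x \<noteq> y" using y by auto
  define v where "v = (x - y) /\<^sub>R norm (x - y)"
  let ?H = "reflect_in v"
  have v: "norm v = 1" "0 < v \<bullet> e" using ne y by (auto simp: v_def inner_diff_left)
  have Hx: "?H x = y" unfolding v_def using x y ne by (intro reflect_in_swap) auto
  have xv: "0 < x \<bullet> v"
  proof -
    have "(norm (x - y))\<^sup>2 = 2 * ((x - y) \<bullet> x)"
      using x y unfolding power2_norm_eq_inner norm_eq_1 by (simp add: inner_diff_left inner_diff_right inner_commute)
    moreover have "0 < (norm (x - y))\<^sup>2" using ne by simp
    ultimately have "0 < (x - y) \<bullet> x" by simp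
    then show ?thesis using ne by (simp add: v_def inner_commute)
  qed
  obtain p where p: "norm p = 1" "p \<bullet> e = s" "0 < p \<bullet> v"
    using cap_boundary_point[OF e x(2) s(2) x(1) xv v(2)] by blast
  have xe: "x \<noteq> e" using x(2) s e by (auto simp: norm_eq_1)
  \<comment> \<open>The index is shifted because \<open>radii 0\<close> is 0, and the centre lies on
    the hyperplane and not in the open half-ball.\<close>
  let ?r = "\<lambda>i. radii (Suc i)"
  have r: "0 < ?r i" "?r i < 1" for i by (auto simp: radii_def field_simps)
  have mir: "Pot (?r i *\<^sub>R p) = Pot (?H (?r i *\<^sub>R p))" for i
    by (rule mirror_symmetric_half_ball[OF v x(1) xv xe]) (use r[of i] p eq Hx x(3) y(3) in simp_all)
  have lim: "(\<lambda>i. ?r i *\<^sub>R p) \<longlonglongrightarrow> p"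
    using tendsto_scaleR[OF LIMSEQ_Suc[OF radii(3)] tendsto_const, of p] by simp
  have "(\<lambda>i. Pot (?r i *\<^sub>R p)) \<longlonglongrightarrow> Pot p"
    using continuous_on_Pot lim by (rule continuous_on_tendsto_compose) auto
  moreover have "(\<lambda>i. Pot (?H (?r i *\<^sub>R p))) \<longlonglongrightarrow> Pot (?H p)"
  proof (rule continuous_on_tendsto_compose[OF continuous_on_Pot])
    show "(\<lambda>i. ?H (?r i *\<^sub>R p)) \<longlonglongrightarrow> ?H p"
      using lim unfolding reflect_in_def by (intro tendsto_intros)
  qed auto
  ultimately have Pp: "Pot p = Pot (?H p)" unfolding mir by (rule LIMSEQ_unique)
  have Hpe: "?H p \<bullet> e < s"
    using p v mult_pos_pos[OF p(3) v(2)] by (simp add: reflect_in_def inner_diff_left inner_commute[of v p])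
  show False
    using nontriv
  proof
    assume cs: "0 < c \<and> s = 1"
    then have "p = e"
    proof -
      have "(norm (p - e))\<^sup>2 = 0"
        using p e cs unfolding power2_norm_eq_inner norm_eq_1
        by (simp add: inner_diff_left inner_diff_right inner_commute)
      then show ?thesis by simp
    qed
    moreover have "?H p \<noteq> e" using Hpe cs e by (auto simp: norm_eq_1)
    then have "Pot (?H p) \<noteq> top" by (simp add: Pot_real del: ennreal_plus)
    ultimately show False using Pp Pot_center cs by simp
  next
    assume cR: "c = 0 \<and> 1 < R"
    have "ennreal R \<le> Pot p" using Pot_ge[OF p(1)] p by (simp add: obstacle_fn_def E_def)
    moreover have "Pot (?H p) < ennreal R"
    proof (cases "?H p \<in> msupp \<mu>")
      case True
      have "obstacle_fn (?H p) = 1" using Hpe by (simp add: obstacle_fn_def E_def)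
      then show ?thesis using Pot_supp[OF True] cR by simp
    next
      case False
      then have "pot \<mu> (?H p) < ennreal R" using cR p v by (intro strict_below) auto
      then show ?thesis unfolding Pot_def using cR by simp
    qed
    ultimately show False using Pp by simp
  qed
qed

end

subsection \<open>The critical parameter\<close>

text \<open>Each unit charge on the sphere has a potential with mean 1 over the sphere.\<close>

lemma (in sphere_measure) mass_eq_integral_pot:
  assumes "2 \<le> CARD('n)"
  shows "emeasure \<mu> UNIV = (\<integral>\<^sup>+z. pot \<mu> z \<partial>sph)"
proof -
  have "(\<integral>\<^sup>+z. pot \<mu> z \<partial>sph) = (\<integral>\<^sup>+y. (if norm (0 - y) \<le> 1 then ennreal (inverse 1 ^ (CARD('n) - 2)) else riesz_kernel 0 y) \<partial>\<mu>)"
    using sphere_mean_pot[OF assms zero_less_one finite_measure_axioms sets_eq, of 0] by simp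
  also have "\<dots> = (\<integral>\<^sup>+y. 1 \<partial>\<mu>)"
    using AE_sphere by (intro nn_integral_cong_AE) (auto elim: eventually_mono)
  also have "\<dots> = emeasure \<mu> UNIV" using sets_eq_imp_space_eq[OF sets_eq] by simp
  finally show ?thesis by simp
qed

lemma (in sphere_measure) pot_0: "pot \<mu> 0 = emeasure \<mu> UNIV"
proof -
  have "pot \<mu> 0 = (\<integral>\<^sup>+y. 1 \<partial>\<mu>)"
    unfolding pot_def using AE_sphere by (intro nn_integral_cong_AE) (auto elim!: eventually_mono simp: riesz_kernel_def)
  then show ?thesis using sets_eq_imp_space_eq[OF sets_eq] by simp
qed

lemma sphere_slice:
  fixes e :: "real ^ 'n"
  assumes n: "2 \<le> CARD('n)" and e: "norm e = 1" and t: "-1 \<le> t" "t \<le> 1"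
  obtains x where "norm x = 1" "x \<bullet> e = t"
proof -
  have "connected ((\<lambda>x. x \<bullet> e) ` sphere 0 1)"
    using n by (intro connected_continuous_image connected_sphere continuous_intros) auto
  moreover have "-1 \<in> (\<lambda>x. x \<bullet> e) ` sphere 0 1"
    using e by (intro image_eqI[of _ _ "- e"]) (auto simp: dot_square_norm)
  moreover have "1 \<in> (\<lambda>x. x \<bullet> e) ` sphere 0 1"
    using e by (intro image_eqI[of _ _ e]) (auto simp: dot_square_norm)
  ultimately have "t \<in> (\<lambda>x. x \<bullet> e) ` sphere 0 1"
    using t unfolding connected_iff_interval by blast
  then show thesis using that by auto
qed

text \<open>The numbers s and t are the cosines of the two angles: the first cap is x.e \<ge> s and
  the second is x.e \<le> t.\<close>

locale caps =
  fixes e :: "real ^ 'n" and s t :: real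
  assumes n: "3 \<le> CARD('n)" and e: "norm e = 1" and st: "-1 \<le> t" "t < s" "s \<le> 1"
begin

text \<open>If \<open>s = 1\<close> the cap is a point, which carries no measure of finite energy; the parameter is then the mass of
  a point charge instead of the height of the obstacle above \<open>1\<close>.\<close>

definition charge :: "real \<Rightarrow> real" where "charge \<tau> = (if s = 1 then \<tau> else 0)"

definition height :: "real \<Rightarrow> real" where "height \<tau> = (if s = 1 then 1 else 1 + \<tau>)"

definition sol :: "real \<Rightarrow> (real ^ 'n) measure" where
  "sol \<tau> = (SOME \<mu>. obstacle_sol e s (charge \<tau>) (height \<tau>) \<mu>)"

definition PP :: "real \<Rightarrow> real ^ 'n \<Rightarrow> ennreal" where
  "PP \<tau> x = pot (sol \<tau>) x + ennreal (charge \<tau>) * riesz_kernel x e"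

lemma n2: "2 \<le> CARD('n)"
  using n by simp

lemma obstacle: "0 \<le> \<tau> \<Longrightarrow> obstacle e s (charge \<tau>) (height \<tau>)"
  unfolding charge_def height_def using n e st by unfold_locales (auto split: if_splits)

lemma sol: "0 \<le> \<tau> \<Longrightarrow> obstacle_sol e s (charge \<tau>) (height \<tau>) (sol \<tau>)"
  unfolding sol_def by (rule someI_ex[OF obstacle.obstacle_sol_exists[OF obstacle]])

lemma PP_Pot: "0 \<le> \<tau> \<Longrightarrow> PP \<tau> = obstacle_sol.Pot e (charge \<tau>) (sol \<tau>)"
  by (intro ext) (simp add: PP_def obstacle_sol.Pot_def[OF sol])

lemma sphere_measure_sol: "0 \<le> \<tau> \<Longrightarrow> sphere_measure (sol \<tau>)"
  using sol obstacle_sol.axioms by blast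

lemma cont_sol: "0 \<le> \<tau> \<Longrightarrow> continuous_on UNIV (pot (sol \<tau>))"
  and fin_sol: "0 \<le> \<tau> \<Longrightarrow> pot (sol \<tau>) x < \<infinity>"
  using obstacle_sol.cont_pot[OF sol] obstacle_sol.fin_pot[OF sol] by auto

lemma obstacle_fn_eq:
  assumes "norm x = 1" "0 \<le> \<tau>"
  shows "obstacle.obstacle_fn e s (height \<tau>) x = (if s \<le> x \<bullet> e then height \<tau> else 1)"
  using assms obstacle[OF assms(2)] by (simp add: obstacle.obstacle_fn_def[where c="charge \<tau>"] obstacle.E_def[where c="charge \<tau>" and R="height \<tau>"])

lemma PP_ge: "0 \<le> \<tau> \<Longrightarrow> norm x = 1 \<Longrightarrow> ennreal (if s \<le> x \<bullet> e then height \<tau> else 1) \<le> PP \<tau> x"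
  using obstacle_sol.Pot_ge[OF sol] obstacle_fn_eq by (simp add: PP_Pot)

lemma height_ge_1: "0 \<le> \<tau> \<Longrightarrow> 1 \<le> height \<tau>"
  by (simp add: height_def)

lemma PP_ge_1: "0 \<le> \<tau> \<Longrightarrow> norm x = 1 \<Longrightarrow> 1 \<le> PP \<tau> x"
proof -
  assume a: "0 \<le> \<tau>" "norm x = 1"
  have "ennreal 1 \<le> ennreal (if s \<le> x \<bullet> e then height \<tau> else 1)"
    using height_ge_1[OF a(1)] by (intro ennreal_leI) simp
  also note PP_ge[OF a]
  finally show ?thesis by simp
qed

lemma PP_supp:
  assumes "0 \<le> \<tau>" "x \<in> msupp (sol \<tau>)"
  shows "PP \<tau> x = ennreal (if s \<le> x \<bullet> e then height \<tau> else 1)"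
proof -
  interpret obstacle_sol e s "charge \<tau>" "height \<tau>" "sol \<tau>" by (rule sol[OF assms(1)])
  have "norm x = 1" using msupp_sphere assms by auto
  then show ?thesis using Pot_supp[OF assms(2)] obstacle_fn_eq assms by (simp add: PP_Pot)
qed

lemma PP_mono:
  assumes "0 \<le> \<tau>" "\<tau> \<le> \<tau>'"
  shows "pot (sol \<tau>) x \<le> pot (sol \<tau>') x + ennreal (charge \<tau>' - charge \<tau>) * riesz_kernel x e" "PP \<tau> x \<le> PP \<tau>' x"
proof -
  have l': "0 \<le> \<tau>'" using assms by simp
  have ch: "0 \<le> charge \<tau>" "charge \<tau> \<le> charge \<tau>'" "height \<tau> \<le> height \<tau>'" using assms by (auto simp: charge_def height_def)
  show le: "pot (sol \<tau>) x \<le> pot (sol \<tau>') x + ennreal (charge \<tau>' - charge \<tau>) * riesz_kernel x e"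
  proof (rule obstacle_sol.comparison[OF sol[OF assms(1)] sphere_measure_sol[OF l'] cont_sol[OF l'] fin_sol[OF l']])
    show "0 \<le> charge \<tau>' - charge \<tau>" using ch by simp
    fix x :: "real ^ 'n" assume x: "norm x = 1"
    have "ennreal (obstacle.obstacle_fn e s (height \<tau>) x) \<le> ennreal (if s \<le> x \<bullet> e then height \<tau>' else 1)"
      using x assms ch by (auto simp: obstacle_fn_eq intro!: ennreal_leI)
    also note PP_ge[OF l' x]
    finally show "ennreal (obstacle.obstacle_fn e s (height \<tau>) x)
        \<le> pot (sol \<tau>') x + ennreal (charge \<tau> + (charge \<tau>' - charge \<tau>)) * riesz_kernel x e"
      by (simp add: PP_def)
  qed
  have "PP \<tau> x \<le> pot (sol \<tau>') x + (ennreal (charge \<tau>' - charge \<tau>) * riesz_kernel x e + ennreal (charge \<tau>) * riesz_kernel x e)"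
    using add_right_mono[OF le, of "ennreal (charge \<tau>) * riesz_kernel x e"] by (simp add: PP_def add.assoc)
  also have "\<dots> = PP \<tau>' x"
    using ch by (simp add: PP_def distrib_right[symmetric] ennreal_plus[symmetric] del: ennreal_plus)
  finally show "PP \<tau> x \<le> PP \<tau>' x" .
qed

text \<open>The smaller solution multiplied by the ratio of heights is admissible for the larger
  parameter; if s = 1 the ratio is 1 and the larger charge only helps. Together with
  \<open>PP_mono\<close> this is the continuity in \<tau> that is used later.\<close>

lemma sol_upper:
  assumes "0 \<le> \<tau>" "\<tau> \<le> \<tau>'"
  shows "pot (sol \<tau>') x \<le> ennreal (height \<tau>' / height \<tau>) * pot (sol \<tau>) x"
proof -
  have l': "0 \<le> \<tau>'" using assms by simp
  have h: "1 \<le> height \<tau>" "height \<tau> \<le> height \<tau>'" using assms by (auto simp: height_def)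
  let ?a = "height \<tau>' / height \<tau>"
  have a: "1 \<le> ?a" using h by simp
  let ?\<nu> = "density (sol \<tau>) (\<lambda>_. ennreal ?a)"
  have sm: "sphere_measure (sol \<tau>)" by (rule sphere_measure_sol[OF assms(1)])
  have pot: "pot ?\<nu> x = ennreal ?a * pot (sol \<tau>) x" for x
    by (rule pot_density_const) (use sm in \<open>simp add: sphere_measure_def sphere_measure_axioms_def\<close>)
  have "pot (sol \<tau>') x \<le> pot ?\<nu> x + ennreal 0 * riesz_kernel x e"
  proof (rule obstacle_sol.comparison[OF sol[OF l'] sphere_measure_scale[OF sm]])
    show "continuous_on UNIV (pot ?\<nu>)"
      unfolding pot[abs_def] by (intro ennreal_continuous_on_cmult cont_sol assms) simp
    show "pot ?\<nu> x < \<infinity>" for x using fin_sol[OF assms(1), of x] by (simp add: pot ennreal_mult_less_top)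
    fix x :: "real ^ 'n" assume x: "norm x = 1"
    show "ennreal (obstacle.obstacle_fn e s (height \<tau>') x) \<le> pot ?\<nu> x + ennreal (charge \<tau>' + 0) * riesz_kernel x e"
    proof (cases "s = 1")
      case True
      then have "?a = 1" "charge \<tau> \<le> charge \<tau>'" "0 \<le> charge \<tau>" unfolding height_def charge_def using assms by auto
      moreover have "ennreal (obstacle.obstacle_fn e s (height \<tau>') x) = 1"
        unfolding obstacle_fn_eq[OF x l'] by (simp add: height_def True[THEN eqTrueI])
      moreover have "pot (sol \<tau>) x + ennreal (charge \<tau>) * riesz_kernel x e \<le> pot (sol \<tau>) x + ennreal (charge \<tau>') * riesz_kernel x e"
        using \<open>charge \<tau> \<le> charge \<tau>'\<close> by (intro add_left_mono mult_right_mono ennreal_leI) auto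
      ultimately show ?thesis
        using order_trans[OF PP_ge_1[OF assms(1) x]] unfolding pot by (simp add: PP_def)
    next
      case False
      then have c: "charge \<tau> = 0" "charge \<tau>' = 0" by (auto simp: charge_def)
      have "obstacle.obstacle_fn e s (height \<tau>') x \<le> ?a * (if s \<le> x \<bullet> e then height \<tau> else 1)"
        using x l' a h by (simp add: obstacle_fn_eq)
      then have "ennreal (obstacle.obstacle_fn e s (height \<tau>') x) \<le> ennreal ?a * ennreal (if s \<le> x \<bullet> e then height \<tau> else 1)"
        using a h by (subst ennreal_mult[symmetric]) (auto split: if_splits intro!: ennreal_leI)
      also have "\<dots> \<le> ennreal ?a * PP \<tau> x" by (intro mult_left_mono PP_ge assms x) simp
      finally show ?thesis by (simp add: pot PP_def c)
    qed
  qed simp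
  then show ?thesis by (simp add: pot)
qed

text \<open>The mass grows at least linearly with \<tau>: it is at least the charge, or at least
  \<tau> times the measure of a ball inside the first cap. The value at \<open>q\<close> is at least
  2^(2-n) times the mass, so it cannot stay equal to 1.\<close>

lemma mass_sol_bounded:
  assumes q: "norm q = 1"
  obtains B where "\<And>\<tau>. 0 \<le> \<tau> \<Longrightarrow> PP \<tau> q = 1 \<Longrightarrow> \<tau> \<le> B"
proof -
  let ?h = "(1/2) ^ (CARD('n) - 2) :: real"
  have h: "0 < ?h" by simp
  show thesis
  proof (cases "s = 1")
    case True
    show ?thesis
    proof (rule that[of "1 / ?h"])
      fix \<tau> :: real assume l: "0 \<le> \<tau>" "PP \<tau> q = 1"
      have sm: "sphere_measure (point_charge e \<tau>)" by (rule sphere_measure_point_charge[OF e l(1)])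
      have "emeasure (point_charge e \<tau>) UNIV = ennreal \<tau>"
        by (simp add: point_charge_def emeasure_density nn_integral_return)
      then have "ennreal ?h * ennreal \<tau> \<le> ennreal \<tau> * riesz_kernel q e"
        using pot_ge_mass[OF sm, of q] q by (simp add: pot_point_charge)
      also have "\<dots> \<le> PP \<tau> q" unfolding PP_def charge_def using True by simp
      finally have "ennreal (?h * \<tau>) \<le> ennreal 1" using l h by (simp add: ennreal_mult)
      then have "?h * \<tau> \<le> 1" by (subst (asm) ennreal_le_iff) auto
      then show "\<tau> \<le> 1 / ?h" using h by (simp add: field_simps)
    qed
  next
    case False
    then have s1: "s < 1" using st by simp
    have "open {z. s < z \<bullet> e}" by (intro open_Collect_less continuous_intros)
    moreover have "e \<in> {z. s < z \<bullet> e}" using s1 e by (simp add: dot_square_norm)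
    ultimately obtain r where r: "0 < r" "ball e r \<subseteq> {z. s < z \<bullet> e}" by (meson open_contains_ball)
    have pos: "0 < emeasure sph (ball e r)" using emeasure_sph_ball_pos[OF e r(1)] .
    define a where "a = measure sph (ball e r)"
    have ea: "emeasure sph (ball e r) = ennreal a" by (simp add: a_def sph.emeasure_eq_measure)
    have a: "0 < a" using pos by (simp add: ea)
    show ?thesis
    proof (rule that[of "1 / (?h * a)"])
      fix \<tau> :: real assume l: "0 \<le> \<tau>" "PP \<tau> q = 1"
      interpret sphere_measure "sol \<tau>" by (rule sphere_measure_sol[OF l(1)])
      have c0: "charge \<tau> = 0" using False by (simp add: charge_def)
      have "ennreal \<tau> * ennreal a = (\<integral>\<^sup>+z. ennreal \<tau> * indicator (ball e r) z \<partial>sph)"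
        by (simp add: nn_integral_cmult_indicator ea)
      also have "\<dots> \<le> (\<integral>\<^sup>+z. pot (sol \<tau>) z \<partial>sph)"
      proof (rule nn_integral_mono_AE)
        show "AE z in sph. ennreal \<tau> * indicator (ball e r) z \<le> pot (sol \<tau>) z"
          using AE_sph_sphere
        proof eventually_elim
          case (elim z)
          show ?case
          proof (cases "z \<in> ball e r")
            case True
            then have "s \<le> z \<bullet> e" using r by auto
            moreover have "ennreal \<tau> \<le> ennreal (height \<tau>)" using False by (intro ennreal_leI) (simp add: height_def)
            ultimately have "ennreal \<tau> \<le> PP \<tau> z" using order_trans PP_ge[OF l(1) elim] by auto
            then show ?thesis using True by (simp add: PP_def c0)
          qed simp
        qed
      qed
      also have "\<dots> = emeasure (sol \<tau>) UNIV" by (rule mass_eq_integral_pot[OF n2, symmetric])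
      finally have "ennreal ?h * (ennreal \<tau> * ennreal a) \<le> ennreal ?h * emeasure (sol \<tau>) UNIV" by (rule mult_left_mono) simp
      also have "\<dots> \<le> pot (sol \<tau>) q" using q by (intro pot_ge_mass sphere_measure_sol l) simp
      also have "\<dots> = ennreal 1" using l(2) by (simp add: PP_def c0)
      finally have "ennreal (?h * (\<tau> * a)) \<le> ennreal 1" using l h a by (simp add: ennreal_mult)
      then have "?h * (\<tau> * a) \<le> 1" by (subst (asm) ennreal_le_iff) auto
      then show "\<tau> \<le> 1 / (?h * a)" using h a by (simp add: field_simps)
    qed
  qed
qed

text \<open>At a support point in the zone the potential would be 1, yet by monotonicity along the
  sphere it is at least the value at \<open>q\<close>.\<close>

lemma zone_off_supp:
  assumes l: "0 \<le> \<tau>" and q: "norm q = 1" "q \<bullet> e = t" "1 < PP \<tau> q" and x: "norm x = 1" "t < x \<bullet> e" "x \<bullet> e < s"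
  shows "x \<notin> msupp (sol \<tau>)"
proof
  assume "x \<in> msupp (sol \<tau>)"
  then have "PP \<tau> x = 1" using PP_supp[OF l] x by simp
  moreover have "PP \<tau> q \<le> PP \<tau> x"
    unfolding PP_Pot[OF l] using q x by (intro obstacle_sol.Pot_decreasing[OF sol[OF l]]) auto
  ultimately show False using q by simp
qed

text \<open>For every larger parameter the mean value equality holds at x with one radius r, because
  a fixed ball about x avoids all those supports. The two-sided dependence on \<tau> carries the
  equality over to \<tau> as the inequality needed for \<open>not_supp_of_mean_ge\<close>.\<close>

lemma zone_off_supp_limit:
  assumes l: "0 \<le> \<tau>" and off: "\<And>\<tau>' x. \<tau> < \<tau>' \<Longrightarrow> norm x = 1 \<Longrightarrow> t < x \<bullet> e \<Longrightarrow> x \<bullet> e < s \<Longrightarrow> x \<notin> msupp (sol \<tau>')"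
    and x: "norm x = 1" "t < x \<bullet> e" "x \<bullet> e < s"
  shows "x \<notin> msupp (sol \<tau>)"
proof -
  interpret sphere_measure "sol \<tau>" by (rule sphere_measure_sol[OF l])
  have "open {z. t < z \<bullet> e \<and> z \<bullet> e < s}" by (intro open_Collect_conj open_Collect_less continuous_intros)
  then obtain r where r: "0 < r" "ball x r \<subseteq> {z. t < z \<bullet> e \<and> z \<bullet> e < s}"
    using x openE[of "{z. t < z \<bullet> e \<and> z \<bullet> e < s}" x] by auto
  let ?m = "\<lambda>\<tau>. \<integral>\<^sup>+z. pot (sol \<tau>) (x + r *\<^sub>R z) \<partial>sph"
  have mle: "?m \<tau> \<le> pot (sol \<tau>) x" by (rule sphere_mean_pot_le[OF n2 r(1) finite_measure_axioms sets_eq])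
  have fin: "pot (sol \<tau>) x < \<infinity>" by (rule fin_sol[OF l])
  have xe: "x \<noteq> e" using x st e by (auto simp: dot_square_norm)
  have mfin: "?m \<tau> < \<infinity>" using mle fin by (rule le_less_trans)
  obtain a where a: "pot (sol \<tau>) x = ennreal a" "0 \<le> a" using fin by (cases "pot (sol \<tau>) x") auto
  obtain m where m: "?m \<tau> = ennreal m" "0 \<le> m" using mfin by (cases "?m \<tau>") auto
  note am = a m
  define K where "K = rk x e"
  have K: "riesz_kernel x e = ennreal K" "0 \<le> K" using riesz_kernel_rk[OF xe] by (auto simp: K_def)
  have key: "a \<le> (1 + \<delta>) * m + \<delta> * K" if d: "0 < \<delta>" for \<delta>
  proof -
    let ?l = "\<tau> + \<delta>"
    have l': "0 \<le> ?l" using l d by simp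
    interpret s': sphere_measure "sol ?l" by (rule sphere_measure_sol[OF l'])
    have "AE y in sol ?l. r \<le> norm (x - y)"
      using s'.AE_carrier s'.AE_sphere
    proof eventually_elim
      case (elim y)
      then have "y \<notin> ball x r" using off[of ?l y] d r by auto
      then show ?case by (simp add: dist_norm)
    qed
    then have mean: "?m ?l = pot (sol ?l) x"
      by (intro sphere_mean_pot_eq[OF n2 r(1)] s'.finite_measure_axioms s'.sets_eq)
    have ch: "charge ?l - charge \<tau> \<le> \<delta>" "height ?l / height \<tau> \<le> 1 + \<delta>"
      using l d by (auto simp: charge_def height_def field_simps)
    have "ennreal a \<le> pot (sol ?l) x + ennreal (charge ?l - charge \<tau>) * ennreal K"
      using PP_mono(1)[OF l, of ?l x] d am K by simp
    also have "\<dots> \<le> ?m ?l + ennreal \<delta> * ennreal K"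
      unfolding mean using ch by (intro add_left_mono mult_right_mono ennreal_leI) auto
    also have "?m ?l \<le> (\<integral>\<^sup>+z. ennreal (1 + \<delta>) * pot (sol \<tau>) (x + r *\<^sub>R z) \<partial>sph)"
    proof (rule nn_integral_mono)
      fix z
      have "pot (sol ?l) (x + r *\<^sub>R z) \<le> ennreal (height ?l / height \<tau>) * pot (sol \<tau>) (x + r *\<^sub>R z)"
        using d by (intro sol_upper l) simp
      also have "\<dots> \<le> ennreal (1 + \<delta>) * pot (sol \<tau>) (x + r *\<^sub>R z)"
        using ch by (intro mult_right_mono ennreal_leI) auto
      finally show "pot (sol ?l) (x + r *\<^sub>R z) \<le> ennreal (1 + \<delta>) * pot (sol \<tau>) (x + r *\<^sub>R z)" .
    qed
    also have "\<dots> = ennreal (1 + \<delta>) * ennreal m"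
    proof -
      have [measurable]: "pot (sol \<tau>) \<in> borel_measurable borel"
        by (auto intro!: borel_measurable_pot simp: sets_eq finite_measure_axioms)
      show ?thesis unfolding am(3)[symmetric] by (rule nn_integral_cmult) measurable
    qed
    finally have "ennreal a \<le> ennreal ((1 + \<delta>) * m + \<delta> * K)"
      using d am K by (simp add: ennreal_mult[symmetric] ennreal_plus[symmetric] del: ennreal_plus)
    then show ?thesis using d am K by (subst (asm) ennreal_le_iff) auto
  qed
  have "a \<le> m"
  proof (rule field_le_epsilon)
    fix \<epsilon> :: real assume ep: "0 < \<epsilon>"
    define \<delta> where "\<delta> = \<epsilon> / (m + K + 1)"
    have d: "0 < \<delta>" "\<delta> * (m + K + 1) = \<epsilon>" using ep am K by (auto simp: \<delta>_def)
    show "a \<le> m + \<epsilon>" using key[OF d(1)] d by (simp add: algebra_simps)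
  qed
  then have "pot (sol \<tau>) x \<le> ?m \<tau>" using am by (simp add: ennreal_leI)
  from not_supp_of_mean_ge[OF n fin r(1) this] show ?thesis .
qed

text \<open>The parameter is pushed to the largest value for which the potential still touches the level \<open>1\<close> at the
  circle bounding the second cap; beyond it the support has left the zone between the caps.\<close>

lemma critical_parameter:
  obtains \<tau> where "0 < \<tau>" "\<And>x. norm x = 1 \<Longrightarrow> x \<bullet> e \<le> t \<Longrightarrow> PP \<tau> x = 1"
    "\<And>x. x \<in> msupp (sol \<tau>) \<Longrightarrow> s \<le> x \<bullet> e \<or> x \<bullet> e \<le> t"
proof -
  obtain q where q: "norm q = 1" "q \<bullet> e = t" using sphere_slice[OF n2 e, of t] st by auto
  have qe: "q \<noteq> e" using q st e by (auto simp: dot_square_norm)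
  define K where "K = rk q e"
  have K: "riesz_kernel q e = ennreal K" "0 \<le> K" using riesz_kernel_rk[OF qe] by (auto simp: K_def)
  define L where "L = {\<tau>. 0 \<le> \<tau> \<and> PP \<tau> q = 1}"
  have c0: "charge 0 = 0" "height 0 = 1" by (auto simp: charge_def height_def)
  \<comment> \<open>At \<tau> = 0 the obstacle is 1 everywhere and there is no charge, so the
    potential is at most 1.\<close>
  have L0: "0 \<in> L"
  proof -
    have "pot (sol 0) q \<le> ennreal (height 0)" by (rule obstacle_sol.pot_le_R[OF sol]) (simp_all add: c0)
    then have "PP 0 q \<le> 1" by (simp add: PP_def c0)
    then have "PP 0 q = 1" using PP_ge_1[OF order_refl q(1)] by (rule antisym)
    then show ?thesis by (simp add: L_def)
  qed
  obtain B where B: "\<And>\<tau>. 0 \<le> \<tau> \<Longrightarrow> PP \<tau> q = 1 \<Longrightarrow> \<tau> \<le> B" using mass_sol_bounded[OF q(1)] by blast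
  have bdd: "bdd_above L" using B by (auto simp: L_def bdd_above_def)
  define \<tau> where "\<tau> = Sup L"
  have l: "0 \<le> \<tau>" unfolding \<tau>_def by (rule cSup_upper[OF L0 bdd])
  have fin: "pot (sol \<tau>) q = ennreal (pr (sol \<tau>) q)" using fin_sol[OF l, of q] by (simp add: less_top)
  \<comment> \<open>The supremum is attained: take \<kappa> in \<open>L\<close> less than \<delta>
    below it. \<open>sol_upper\<close> lets the value at \<open>q\<close> grow from \<kappa> to
    \<tau> by at most \<delta> (K + 1), where K accounts for the additional point charge.\<close>
  have "pr (sol \<tau>) q + charge \<tau> * K \<le> 1"
  proof (rule field_le_epsilon)
    fix \<epsilon> :: real assume ep: "0 < \<epsilon>"
    define \<delta> where "\<delta> = \<epsilon> / (K + 1)"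
    have d: "0 < \<delta>" "\<delta> * (K + 1) = \<epsilon>" using ep K by (auto simp: \<delta>_def)
    obtain \<kappa> where k: "\<kappa> \<in> L" "\<tau> - \<delta> < \<kappa>"
      using less_cSup_iff[of L "\<tau> - \<delta>"] L0 bdd d unfolding \<tau>_def by (metis diff_less_eq empty_iff less_add_same_cancel1)
    have kl: "\<kappa> \<le> \<tau>" unfolding \<tau>_def by (rule cSup_upper[OF k(1) bdd])
    have k0: "0 \<le> \<kappa>" "PP \<kappa> q = 1" using k by (auto simp: L_def)
    define p where "p = pr (sol \<kappa>) q"
    have p: "pot (sol \<kappa>) q = ennreal p" "0 \<le> p" using fin_sol[OF k0(1), of q] by (simp_all add: p_def less_top)
    have ck: "0 \<le> charge \<kappa>" using k0 by (simp add: charge_def)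
    have "ennreal (p + charge \<kappa> * K) = ennreal 1"
      using k0(2) p K ck by (simp add: PP_def ennreal_mult)
    then have p1: "p + charge \<kappa> * K = 1" using p K ck by (subst (asm) ennreal_inj) auto
    have hr: "0 \<le> height \<tau> / height \<kappa>" using l k0 by (simp add: height_def)
    have "ennreal (pr (sol \<tau>) q) \<le> ennreal (height \<tau> / height \<kappa> * p)"
      unfolding fin[symmetric] ennreal_mult[OF hr p(2)] using sol_upper[OF k0(1) kl, of q] unfolding p(1) .
    then have "pr (sol \<tau>) q \<le> height \<tau> / height \<kappa> * p" using mult_nonneg_nonneg[OF hr p(2)] by (subst (asm) ennreal_le_iff)
    moreover have "height \<tau> / height \<kappa> * p + charge \<tau> * K \<le> 1 + \<delta> * (K + 1)"
    proof (cases "s = 1")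
      case True
      have "(\<tau> - \<kappa>) * K \<le> \<delta> * K" using k K by (intro mult_right_mono) auto
      then show ?thesis using p1 d True unfolding height_def charge_def by (simp add: algebra_simps)
    next
      case False
      have "(1 + \<tau>) / (1 + \<kappa>) \<le> 1 + \<delta>"
      proof -
        have "1 + \<tau> \<le> (1 + \<delta>) * (1 + \<kappa>)" using k(2) mult_nonneg_nonneg[OF less_imp_le[OF d(1)] k0(1)] by (simp add: algebra_simps)
        then show ?thesis using k0 by (simp add: pos_divide_le_eq)
      qed
      moreover have "0 \<le> \<delta> * K" using d K by simp
      ultimately show ?thesis using False p1 by (simp add: height_def charge_def algebra_simps)
    qed
    ultimately show "pr (sol \<tau>) q + charge \<tau> * K \<le> 1 + \<epsilon>" using d by simp
  qed
  then have "ennreal (pr (sol \<tau>) q + charge \<tau> * K) \<le> 1" by simp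
  moreover have "PP \<tau> q = ennreal (pr (sol \<tau>) q + charge \<tau> * K)"
    unfolding PP_def K(1) using l K by (subst ennreal_plus) (auto simp: charge_def fin[symmetric] ennreal_mult)
  ultimately have Pq: "PP \<tau> q \<le> 1" by simp
  have zone: "x \<notin> msupp (sol \<tau>)" if "norm x = 1" "t < x \<bullet> e" "x \<bullet> e < s" for x
  proof (rule zone_off_supp_limit[OF l _ that])
    fix \<tau>' x assume l': "\<tau> < \<tau>'" and x: "norm x = 1" "t < x \<bullet> e" "x \<bullet> e < s"
    have "\<tau>' \<notin> L" using cSup_upper[OF _ bdd, of \<tau>'] l' by (auto simp: \<tau>_def)
    then have "1 < PP \<tau>' q" using PP_ge_1[of \<tau>' q] q l l' by (simp add: L_def less_le)
    then show "x \<notin> msupp (sol \<tau>')" using l l' q x by (intro zone_off_supp) auto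
  qed
  show thesis
  proof (rule that)
    show "0 < \<tau>"
    proof (rule ccontr)
      assume "\<not> 0 < \<tau>"
      \<comment> \<open>With the constant obstacle 1 no open part of the sphere can be free of
        support: off the support the potential is strictly below 1.\<close>
      then have l0: "\<tau> = 0" using l by simp
      obtain x where x: "norm x = 1" "x \<bullet> e = (s + t) / 2" using sphere_slice[OF n2 e, of "(s + t) / 2"] st by auto
      have "x \<notin> msupp (sol 0)" using zone[of x] x st l0 by simp
      then have "pot (sol 0) x < ennreal (height 0)" by (intro obstacle_sol.strict_below[OF sol]) (auto simp: c0 x)
      then show False using PP_ge_1[of 0 x] x c0 by (simp add: PP_def)
    qed
    show "PP \<tau> x = 1" if "norm x = 1" "x \<bullet> e \<le> t" for x
    proof -
      have "PP \<tau> x \<le> PP \<tau> q"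
        unfolding PP_Pot[OF l] using that q by (intro obstacle_sol.Pot_decreasing[OF sol[OF l]]) auto
      then show ?thesis using Pq PP_ge_1[OF l that(1)] by (auto intro: antisym)
    qed
    show "s \<le> x \<bullet> e \<or> x \<bullet> e \<le> t" if "x \<in> msupp (sol \<tau>)" for x
    proof -
      have "norm x = 1" using sphere_measure.msupp_sphere[OF sphere_measure_sol[OF l]] that by auto
      then show ?thesis using zone[of x] that by (meson not_le)
    qed
  qed
qed

end

subsection \<open>Existence and uniqueness\<close>

text \<open>The outcome of the construction without the parameter \<tau>. Uniqueness is proved for
  any data of this form, whichever minimizer they came from.\<close>

locale two_caps = obstacle_sol e s c R \<mu>
  for e :: "real ^ 'n" and s t c R :: real and \<mu> +
  assumes t: "-1 \<le> t" "t < s"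
    and nontriv: "0 < c \<and> s = 1 \<and> R = 1 \<or> c = 0 \<and> s < 1 \<and> 1 < R"
    and Pot_low: "\<And>x. norm x = 1 \<Longrightarrow> x \<bullet> e \<le> t \<Longrightarrow> Pot x = 1"
    and supp_caps: "\<And>x. x \<in> msupp \<mu> \<Longrightarrow> s \<le> x \<bullet> e \<or> x \<bullet> e \<le> t"

lemma (in caps) two_caps_exists: "\<exists>c R \<mu>. two_caps e s t c R \<mu>"
proof -
  obtain \<tau> where \<tau>: "0 < \<tau>" "\<And>x. norm x = 1 \<Longrightarrow> x \<bullet> e \<le> t \<Longrightarrow> PP \<tau> x = 1"
    "\<And>x. x \<in> msupp (sol \<tau>) \<Longrightarrow> s \<le> x \<bullet> e \<or> x \<bullet> e \<le> t"
    using critical_parameter by blast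
  have l: "0 \<le> \<tau>" using \<tau>(1) by simp
  have "0 < charge \<tau> \<and> s = 1 \<and> height \<tau> = 1 \<or> charge \<tau> = 0 \<and> s < 1 \<and> 1 < height \<tau>"
    unfolding charge_def height_def using \<tau>(1) st by auto
  then have "two_caps e s t (charge \<tau>) (height \<tau>) (sol \<tau>)"
    using sol[OF l] st(1,2) \<tau>(2,3) by (intro two_caps.intro two_caps_axioms.intro) (simp_all add: PP_Pot[OF l])
  then show ?thesis by blast
qed

context two_caps
begin

definition Total :: "(real ^ 'n) measure" where
  "Total = add_measure \<mu> (point_charge e c)"

definition mass :: real where
  "mass = measure Total UNIV"

text \<open>This is the M of the theorem, as 1 / \<open>mass\<close> is its d.\<close>

definition top_value :: ennreal where
  "top_value = (if 0 < c then \<infinity> else ennreal (R / mass))"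

definition Caps :: "(real ^ 'n) set" where
  "Caps = {x. norm x = 1 \<and> (s \<le> x \<bullet> e \<or> x \<bullet> e \<le> t)}"

lemma sphere_measure_Total: "sphere_measure Total"
  unfolding Total_def by (intro sphere_measure_add sphere_measure_axioms sphere_measure_point_charge e c)

lemma pot_Total: "pot Total x = Pot x"
  unfolding Total_def Pot_def by (subst pot_add_measure) (auto simp: sets_eq pot_point_charge)

lemma sets_Total: "sets Total = sets borel"
  using sphere_measure_Total by (rule sphere_measure.sets_eq)

lemma emeasure_Total: "emeasure Total UNIV = ennreal mass"
  using sphere_measure_Total by (simp add: mass_def sphere_measure_def finite_measure.emeasure_eq_measure)

lemma closed_Caps: "closed Caps"
  unfolding Caps_def
  by (intro closed_Collect_conj closed_Collect_disj closed_Collect_eq closed_Collect_le continuous_intros)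

lemma carried_Total: "carried_measure Total Caps"
proof -
  have B: "- Caps \<in> sets borel" using closed_Caps by (simp add: borel_closed)
  have "emeasure \<mu> (- Caps) \<le> emeasure \<mu> (- msupp \<mu>)"
    using supp_caps msupp_sphere closed_msupp[OF sets_eq]
    by (intro emeasure_mono) (auto simp: Caps_def sets_eq borel_closed)
  also have "\<dots> = 0" by (rule null_off_msupp[OF sets_eq])
  finally have 1: "emeasure \<mu> (- Caps) = 0" by simp
  have "e \<in> Caps" using e s by (simp add: Caps_def dot_square_norm)
  then have "emeasure (point_charge e c) (- Caps) = 0"
    using B by (simp add: point_charge_def emeasure_density nn_integral_return)
  with 1 have "emeasure Total (- Caps) = 0"
    using B unfolding Total_def by (subst emeasure_add_measure) (simp_all add: sets_eq)
  then show ?thesis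
    using sphere_measure_Total closed_Caps
    by (intro carried_measure.intro carried_measure_axioms.intro) (simp_all add: sphere_measure_def sets_Total)
qed

lemma mass_integral: "ennreal mass = (\<integral>\<^sup>+z. Pot z \<partial>sph)"
  using sphere_measure.mass_eq_integral_pot[OF sphere_measure_Total n2] by (simp add: emeasure_Total pot_Total)

lemma Pot_measurable [measurable]: "Pot \<in> borel_measurable borel"
  by (rule borel_measurable_continuous_onI[OF continuous_on_Pot])

lemma Pot_ge_1: "norm x = 1 \<Longrightarrow> 1 \<le> Pot x"
  using order_trans[OF ennreal_leI[OF obstacle_fn_bounds(1)] Pot_ge] by simp

text \<open>The point opposite e lies in every second cap, even if that cap is a single point. It is
  the standard witness for the value 1.\<close>

lemma pole: "norm (- e) = 1" "Pot (- e) = 1"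
  using e t by (auto intro!: Pot_low simp: dot_square_norm)

lemma not_AE_at:
  assumes "norm x = 1" "Q x" "open {x. Q x}"
  shows "\<not> (AE z in sph. \<not> Q z)"
proof
  assume AE: "AE z in sph. \<not> Q z"
  obtain r where "0 < r" "ball x r \<subseteq> {x. Q x}" using assms by (metis mem_Collect_eq open_contains_ball)
  with AE_sph_obtain[OF AE assms(1)] show False by blast
qed

lemma mass_gt_1: "1 < mass"
proof (rule ccontr)
  assume "\<not> 1 < mass"
  then have le: "(\<integral>\<^sup>+z. Pot z \<partial>sph) \<le> 1" unfolding mass_integral[symmetric] using ennreal_leI[of mass 1] by simp
  have "(\<integral>\<^sup>+z. Pot z - 1 \<partial>sph) = (\<integral>\<^sup>+z. Pot z \<partial>sph) - (\<integral>\<^sup>+z. 1 \<partial>(sph :: (real ^ 'n) measure))"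
  proof (rule nn_integral_diff)
    show "AE z in sph. 1 \<le> Pot z" using AE_sph_sphere by eventually_elim (rule Pot_ge_1)
  qed auto
  also have "\<dots> = 0"
    using le mass_integral[symmetric] by (simp add: diff_eq_0_iff_ennreal emeasure_sph_UNIV)
  finally have "AE z in sph. Pot z - 1 = 0" by (subst (asm) nn_integral_0_iff_AE) auto
  then have "AE z in sph. \<not> 1 < Pot z" by eventually_elim (auto simp: diff_eq_0_iff_ennreal)
  moreover have "1 < Pot e"
  proof (cases "0 < c")
    case False
    have "ennreal R \<le> Pot e" using Pot_ge[OF e] e_in_E by (simp add: obstacle_fn_def)
    moreover have "1 < ennreal R" using False nontriv by simp
    ultimately show ?thesis by (rule less_le_trans[rotated])
  qed (simp add: Pot_center)
  moreover have "open {z. 1 < Pot z}" by (intro open_Collect_less continuous_on_const continuous_on_Pot)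
  ultimately show False using not_AE_at[OF e, of "\<lambda>z. 1 < Pot z"] by blast
qed

lemma Pot_0: "Pot 0 = ennreal mass"
  using sphere_measure.pot_0[OF sphere_measure_Total] by (simp add: pot_Total emeasure_Total)

lemma mass_lt_R:
  assumes c0: "c = 0"
  shows "mass < R"
proof (rule ccontr)
  assume "\<not> mass < R"
  then have ge: "ennreal R \<le> (\<integral>\<^sup>+z. Pot z \<partial>sph)" unfolding mass_integral[symmetric] using ennreal_leI[of R mass] by simp
  have le: "Pot z \<le> ennreal R" for z unfolding Pot_def using pot_le_R[OF c0, of z] c0 by simp
  have "(\<integral>\<^sup>+z. ennreal R - Pot z \<partial>sph) = (\<integral>\<^sup>+z. ennreal R \<partial>(sph :: (real ^ 'n) measure)) - (\<integral>\<^sup>+z. Pot z \<partial>sph)"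
    unfolding mass_integral[symmetric]
    by (subst nn_integral_diff) (auto simp: le mass_integral[symmetric])
  also have "\<dots> = 0" using ge by (simp add: diff_eq_0_iff_ennreal emeasure_sph_UNIV)
  finally have "AE z in sph. ennreal R - Pot z = 0" by (subst (asm) nn_integral_0_iff_AE) auto
  then have "AE z in sph. \<not> Pot z < ennreal R" by eventually_elim (auto simp: diff_eq_0_iff_ennreal)
  moreover have "Pot (- e) < ennreal R" unfolding pole(2) using nontriv c0 by simp
  moreover have "open {z. Pot z < ennreal R}" by (intro open_Collect_less continuous_on_const continuous_on_Pot)
  ultimately show False using not_AE_at[OF pole(1), of "\<lambda>z. Pot z < ennreal R"] by blast
qed

lemma mass_bound: "(1/2) ^ (CARD('n) - 2) * mass \<le> 1"
proof -
  have "ennreal ((1/2) ^ (CARD('n) - 2)) * ennreal mass \<le> Pot (- e)"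
    using pot_ge_mass[OF sphere_measure_Total, of "- e"] e by (simp add: emeasure_Total pot_Total)
  then have "ennreal ((1/2) ^ (CARD('n) - 2) * mass) \<le> ennreal 1"
    using mass_gt_1 by (simp add: pole ennreal_mult)
  then show ?thesis by (subst (asm) ennreal_le_iff) auto
qed

text \<open>The Poisson formula holds in the extended reals, so the infinite value at the point
  charge requires no separate treatment.\<close>

lemma Pot_ge_1_ball:
  assumes "norm x \<le> 1"
  shows "1 \<le> Pot x"
proof (cases "norm x = 1")
  case False
  then have x: "norm x < 1" using assms by simp
  interpret P: prob_space "poisson_measure x" by (rule prob_space_poisson_measure[OF n x])
  have "1 = (\<integral>\<^sup>+z. 1 \<partial>poisson_measure x)" using P.emeasure_space_1 by simp
  also have "\<dots> \<le> (\<integral>\<^sup>+z. Pot z \<partial>poisson_measure x)"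
  proof (rule nn_integral_mono_AE)
    show "AE z in poisson_measure x. 1 \<le> Pot z"
      using AE_poisson_sphere by eventually_elim (rule Pot_ge_1)
  qed
  also have "\<dots> = Pot x"
    using sphere_measure.poisson_formula_pot[OF sphere_measure_Total n x] by (simp add: pot_Total)
  finally show ?thesis .
qed (rule Pot_ge_1)

lemma Pot_high:
  assumes "norm x = 1" "s \<le> x \<bullet> e"
  shows "Pot x = (if 0 < c then \<infinity> else ennreal R)"
proof (cases "0 < c")
  case True
  then have "s = 1" using nontriv by auto
  have "(norm (x - e))\<^sup>2 = 2 - 2 * (x \<bullet> e)"
    using assms e unfolding power2_norm_eq_inner norm_eq_1
    by (simp add: inner_diff_left inner_diff_right inner_commute)
  also have "\<dots> \<le> 0" using assms \<open>s = 1\<close> by simp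
  finally have "x = e" by simp
  then show ?thesis using True by (simp add: Pot_center)
next
  case False
  then have c0: "c = 0" using c by simp
  have "ennreal R \<le> Pot x" using Pot_ge[OF assms(1)] assms by (simp add: obstacle_fn_def E_def)
  moreover have "Pot x \<le> ennreal R" unfolding Pot_def using pot_le_R[OF c0, of x] c0 by simp
  ultimately show ?thesis using False by simp
qed

text \<open>Besides the division by the mass, the measure is transferred to the sigma-algebra of the
  sphere, as \<open>sphere_potentials\<close> demands; nothing is lost because the complement of the
  sphere is null.\<close>

lemma normalised_potential:
  obtains P where "P \<in> sphere_potentials" "\<And>x. P x = Pot x / ennreal mass"
proof -
  let ?m = "ennreal (1 / mass)"
  define D where "D = density Total (\<lambda>_. ?m)"
  define N where "N = restrict_space D (sphere 0 1)"
  have sm: "sphere_measure D" unfolding D_def by (rule sphere_measure_scale[OF sphere_measure_Total])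
  interpret D: sphere_measure D by (rule sm)
  have S: "sphere 0 1 \<inter> space D \<in> sets D" using sets_eq_imp_space_eq[OF D.sets_eq] D.sets_eq by (simp add: borel_closed)
  have "sets N = sets (restrict_space borel (sphere 0 1))"
    unfolding N_def by (rule sets_restrict_space_cong[OF D.sets_eq])
  moreover have "emeasure N (sphere 0 1) = 1"
  proof -
    have "emeasure N (sphere 0 1) = emeasure D (sphere 0 1)"
      unfolding N_def by (rule emeasure_restrict_space[OF S]) simp
    also have "\<dots> = emeasure D UNIV"
      using D.AE_sphere by (intro emeasure_eq_AE) (auto simp: D.sets_eq borel_closed)
    also have "\<dots> = ?m * ennreal mass"
      unfolding D_def by (subst emeasure_scale[OF sphere_measure_Total]) (simp_all add: emeasure_Total)
    also have "\<dots> = 1" using mass_gt_1 by (simp add: ennreal_mult[symmetric])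
    finally show ?thesis .
  qed
  moreover have "(\<integral>\<^sup>+y. riesz_kernel x y \<partial>N) = Pot x / ennreal mass" for x
  proof -
    have "(\<integral>\<^sup>+y. riesz_kernel x y \<partial>N) = (\<integral>\<^sup>+y. riesz_kernel x y * indicator (sphere 0 1) y \<partial>D)"
      unfolding N_def by (rule nn_integral_restrict_space[OF S])
    also have "\<dots> = pot D x"
      unfolding pot_def using D.AE_sphere by (intro nn_integral_cong_AE) (auto elim!: eventually_mono)
    also have "\<dots> = ?m * Pot x" unfolding D_def by (subst pot_density_const) (simp_all add: sets_Total pot_Total)
    also have "\<dots> = Pot x / ennreal mass"
      using mass_gt_1 by (simp add: divide_ennreal_def inverse_ennreal mult.commute inverse_eq_divide)
    finally show ?thesis .
  qed
  ultimately have "(\<lambda>x. Pot x / ennreal mass) \<in> sphere_potentials"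
    unfolding sphere_potentials_def by (intro CollectI exI[of _ N]) auto
  then show thesis by (rule that) simp
qed

lemma harmonic_scaled: "harmonic_on (\<lambda>x. enn2real (Pot x / ennreal mass)) (- Caps)"
proof -
  let ?D = "density Total (\<lambda>_. ennreal (1 / mass))"
  interpret T: carried_measure Total Caps by (rule carried_Total)
  have "pot ?D x = Pot x / ennreal mass" for x
    using mass_gt_1
    by (subst pot_density_const) (simp_all add: sets_Total pot_Total divide_ennreal_def inverse_ennreal mult.commute inverse_eq_divide)
  moreover have "carried_measure ?D Caps"
  proof (intro carried_measure.intro carried_measure_axioms.intro)
    show "finite_measure ?D"
      using sphere_measure_scale[OF sphere_measure_Total] by (rule sphere_measure.axioms)
    show "emeasure ?D (- Caps) = 0"
      using closed_Caps T.null_off_carrier by (subst emeasure_scale[OF sphere_measure_Total]) (auto simp: borel_closed)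
  qed (simp_all add: sets_Total closed_Caps)
  ultimately show ?thesis using carried_measure.harmonic_on_pot[OF _ n2, of ?D Caps] by simp
qed

lemma Pot_finite: "x \<notin> Caps \<Longrightarrow> Pot x < \<infinity>"
  using carried_measure.pot_finite[OF carried_Total] by (simp add: pot_Total)

end

text \<open>The mass is the mean of the potential over the sphere.\<close>

lemma Pot_eq_of_le:
  fixes e :: "real ^ 'n"
  assumes A: "two_caps e s t c R \<mu>" and B: "two_caps e s' t' c' R' \<mu>'"
    and mass: "two_caps.mass e c \<mu> = two_caps.mass e c' \<mu>'"
    and le: "\<And>x. obstacle_sol.Pot e c \<mu> x \<le> obstacle_sol.Pot e c' \<mu>' x"
    and x: "norm x = 1"
  shows "obstacle_sol.Pot e c \<mu> x = obstacle_sol.Pot e c' \<mu>' x"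
proof (rule ccontr)
  interpret A: two_caps e s t c R \<mu> by (rule A)
  interpret B: two_caps e s' t' c' R' \<mu>' by (rule B)
  assume "A.Pot x \<noteq> B.Pot x"
  then have lt: "A.Pot x < B.Pot x" using le[of x] by simp
  have "(\<integral>\<^sup>+z. B.Pot z - A.Pot z \<partial>sph) = (\<integral>\<^sup>+z. B.Pot z \<partial>sph) - (\<integral>\<^sup>+z. A.Pot z \<partial>sph)"
    by (rule nn_integral_diff) (auto simp: le A.mass_integral[symmetric])
  also have "\<dots> = 0" using mass by (simp add: A.mass_integral[symmetric] B.mass_integral[symmetric])
  finally have "AE z in sph. B.Pot z - A.Pot z = 0" by (subst (asm) nn_integral_0_iff_AE) auto
  then have "AE z in sph. \<not> A.Pot z < B.Pot z" by eventually_elim (auto simp: diff_eq_0_iff_ennreal)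
  moreover have "open {z. A.Pot z < B.Pot z}"
    by (intro open_Collect_less A.continuous_on_Pot B.continuous_on_Pot)
  ultimately show False using A.not_AE_at[OF x, of "\<lambda>z. A.Pot z < B.Pot z"] lt by blast
qed

text \<open>If t < t', then two points of different heights in the zone of the first solution lie in
  the second cap of the other. Both have potential 1, against \<open>Pot_strict\<close>.\<close>

lemma low_caps_le:
  fixes e :: "real ^ 'n"
  assumes A: "two_caps e s t c R \<mu>" and B: "two_caps e s t' c' R' \<mu>'"
    and eq: "\<And>x. norm x = 1 \<Longrightarrow> obstacle_sol.Pot e c \<mu> x = obstacle_sol.Pot e c' \<mu>' x"
  shows "t' \<le> t"
proof (rule ccontr)
  interpret A: two_caps e s t c R \<mu> by (rule A)
  interpret B: two_caps e s t' c' R' \<mu>' by (rule B)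
  assume "\<not> t' \<le> t"
  then have tt: "t < t'" by simp
  obtain x where x: "norm x = 1" "x \<bullet> e = t'" using sphere_slice[OF A.n2 A.e, of t'] B.t A.s by auto
  obtain y where y: "norm y = 1" "y \<bullet> e = (t + t') / 2"
    using sphere_slice[OF A.n2 A.e, of "(t + t') / 2"] A.t B.t A.s tt by auto
  have "A.Pot x = 1" "A.Pot y = 1" using B.Pot_low[of x] B.Pot_low[of y] x y tt eq by auto
  moreover have "A.Pot x \<noteq> A.Pot y"
    using x y tt B.t A.supp_caps[of x] A.supp_caps[of y] A.nontriv by (intro A.Pot_strict) auto
  ultimately show False by simp
qed

text \<open>If s' < s, a point of the zone of the first solution lies in the first cap of the other,
  where the potential is R; but off its support the first solution stays strictly below R. The
  height is taken between max s' t and s so that the point really lies in that zone.\<close>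

lemma high_caps_le:
  fixes e :: "real ^ 'n"
  assumes A: "two_caps e s t 0 R \<mu>" and B: "two_caps e s' t' 0 R \<mu>'"
    and eq: "\<And>x. norm x = 1 \<Longrightarrow> obstacle_sol.Pot e 0 \<mu> x = obstacle_sol.Pot e 0 \<mu>' x"
  shows "s \<le> s'"
proof (rule ccontr)
  interpret A: two_caps e s t 0 R \<mu> by (rule A)
  interpret B: two_caps e s' t' 0 R \<mu>' by (rule B)
  assume "\<not> s \<le> s'"
  then have u: "max s' t < s" using A.t by simp
  obtain x where x: "norm x = 1" "x \<bullet> e = (max s' t + s) / 2"
  proof (rule sphere_slice[OF A.n2 A.e])
    show "- 1 \<le> (max s' t + s) / 2" "(max s' t + s) / 2 \<le> 1" using A.t A.s u by (simp_all add: max_def split: if_splits)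
  qed
  have "s' \<le> x \<bullet> e" "t < x \<bullet> e" "x \<bullet> e < s" using x(2) u by auto
  then have "A.Pot x = ennreal R" "x \<notin> msupp \<mu>"
    using B.Pot_high[OF x(1)] eq[OF x(1)] A.supp_caps[of x] by auto
  then show False using A.strict_below[OF _ x(1)] by (simp add: A.Pot_def)
qed

lemma Pot_le:
  fixes e :: "real ^ 'n"
  assumes A: "two_caps e s t c R \<mu>" and B: "two_caps e s' t' c' R \<mu>'" and le: "c \<le> c'" "s' \<le> s"
  shows "obstacle_sol.Pot e c \<mu> x \<le> obstacle_sol.Pot e c' \<mu>' x"
proof -
  interpret A: two_caps e s t c R \<mu> by (rule A)
  interpret B: two_caps e s' t' c' R \<mu>' by (rule B)
  have "pot \<mu> x \<le> pot \<mu>' x + ennreal (c' - c) * riesz_kernel x e"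
  proof (rule A.comparison[OF B.sphere_measure_axioms B.cont_pot B.fin_pot])
    fix y :: "real ^ 'n" assume y: "norm y = 1"
    have "ennreal (A.obstacle_fn y) \<le> ennreal (B.obstacle_fn y)"
      using le A.R by (intro ennreal_leI) (auto simp: A.obstacle_fn_def B.obstacle_fn_def A.E_def B.E_def)
    also note B.Pot_ge[OF y]
    finally show "ennreal (A.obstacle_fn y) \<le> pot \<mu>' y + ennreal (c + (c' - c)) * riesz_kernel y e"
      by (simp add: B.Pot_def)
  qed (use le in simp)
  then have "A.Pot x \<le> pot \<mu>' x + (ennreal (c' - c) * riesz_kernel x e + ennreal c * riesz_kernel x e)"
    using add_right_mono[of "pot \<mu> x" _ "ennreal c * riesz_kernel x e"] by (simp add: A.Pot_def add.assoc)
  also have "\<dots> = B.Pot x"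
    using le A.c by (simp add: B.Pot_def distrib_right[symmetric] ennreal_plus[symmetric] del: ennreal_plus)
  finally show ?thesis .
qed

lemma two_caps_unique:
  fixes e :: "real ^ 'n"
  assumes A: "two_caps e s t c R \<mu>" and B: "two_caps e s' t' c' R' \<mu>'"
    and mass: "two_caps.mass e c \<mu> = two_caps.mass e c' \<mu>'"
    and top: "two_caps.top_value e c R \<mu> = two_caps.top_value e c' R' \<mu>'"
  shows "s = s'" "t = t'"
proof -
  interpret A: two_caps e s t c R \<mu> by (rule A)
  interpret B: two_caps e s' t' c' R' \<mu>' by (rule B)
  \<comment> \<open>M is infinite exactly in the presence of a point charge, so both solutions are
    of the same kind.\<close>
  have iff: "0 < c \<longleftrightarrow> 0 < c'" using top by (auto simp: A.top_value_def B.top_value_def split: if_splits)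
  have RR: "R = R'"
  proof (cases "0 < c")
    case True
    then show ?thesis using iff A.nontriv B.nontriv by auto
  next
    case False
    then have "ennreal (R / A.mass) = ennreal (R' / A.mass)"
      using iff top mass by (simp add: A.top_value_def B.top_value_def)
    then have "R / A.mass = R' / A.mass" using A.R B.R A.mass_gt_1 by (subst (asm) ennreal_inj) auto
    then show ?thesis using A.mass_gt_1 by simp
  qed
  have B': "two_caps e s' t' c' R \<mu>'" using B RR by simp
  \<comment> \<open>With charges, both first caps are the point e and only the charges are compared;
    without charges, the first caps are nested. In either case one of the two solutions is the
    smaller one.\<close>
  have "(c \<le> c' \<and> s' \<le> s) \<or> (c' \<le> c \<and> s \<le> s')"
    using iff A.nontriv B.nontriv by auto
  then have eq: "A.Pot x = B.Pot x" if "norm x = 1" for x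
  proof
    assume "c \<le> c' \<and> s' \<le> s"
    then show ?thesis using that by (intro Pot_eq_of_le[OF A B mass] Pot_le[OF A B']) auto
  next
    assume "c' \<le> c \<and> s \<le> s'"
    then show ?thesis using that by (intro Pot_eq_of_le[OF B A mass[symmetric], symmetric] Pot_le[OF B' A]) auto
  qed
  show ss: "s = s'"
  proof (cases "0 < c")
    case True
    then show ?thesis using iff A.nontriv B.nontriv by auto
  next
    case False
    then have c0: "c = 0" "c' = 0" using iff A.c B.c by auto
    show ?thesis
      using high_caps_le[of e s t R \<mu> s' t' \<mu>'] high_caps_le[of e s' t' R \<mu>' s t \<mu>] A B' eq unfolding c0 by (auto intro!: antisym)
  qed
  show "t = t'"
    using low_caps_le[OF A, of t' c' R' \<mu>'] low_caps_le[OF B, of t c R \<mu>] A B eq unfolding ss by (auto intro!: antisym)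
qed

theorem theorem1p1:
  fixes k :: "'n::finite"
  assumes "CARD('n) \<ge> 3"
  shows "\<exists>\<Phi> :: real \<times> real \<Rightarrow> real \<times> ennreal.
    inj_on \<Phi> {(\<xi>1, \<xi>2). 0 \<le> \<xi>1 \<and> \<xi>1 < \<xi>2 \<and> \<xi>2 \<le> pi} \<and>
    \<Phi> ` {(\<xi>1, \<xi>2). 0 \<le> \<xi>1 \<and> \<xi>1 < \<xi>2 \<and> \<xi>2 \<le> pi}
      \<subseteq> {(d, M). 2 powr (2 - real CARD('n)) \<le> d \<and> d < 1 \<and> 1 < M \<and> M \<le> \<infinity>} \<and>
    (\<forall>\<xi>1 \<xi>2 d M. 0 \<le> \<xi>1 \<and> \<xi>1 < \<xi>2 \<and> \<xi>2 \<le> pi \<and> \<Phi> (\<xi>1, \<xi>2) = (d, M) \<longrightarrow>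
      (\<exists>P \<in> (sphere_potentials :: (real ^ 'n \<Rightarrow> ennreal) set).
        (\<forall>x \<in> cap1 k \<xi>1. P x = M) \<and>
        (\<forall>x \<in> cap2 k \<xi>2. P x = ennreal d) \<and>
        (\<forall>x \<in> cball 0 1. ennreal d \<le> P x) \<and>
        (\<forall>x. P x \<le> M) \<and>
        P 0 = 1 \<and>
        (\<forall>x \<in> - (cap1 k \<xi>1 \<union> cap2 k \<xi>2). P x < \<infinity>) \<and>
        harmonic_on (\<lambda>x. enn2real (P x)) (- (cap1 k \<xi>1 \<union> cap2 k \<xi>2))))"
proof -
  define e :: "real ^ 'n" where "e = axis k 1"
  have e: "norm e = 1" by (simp add: e_def)
  have xe: "x \<bullet> e = x $ k" for x :: "real ^ 'n" by (simp add: e_def inner_axis)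
  have coord: "- 1 \<le> x $ k" "x $ k \<le> 1" if "norm x = 1" for x :: "real ^ 'n"
    using component_le_norm_cart[of x k] that by auto
  let ?D = "{(\<xi>1, \<xi>2). 0 \<le> \<xi>1 \<and> \<xi>1 < \<xi>2 \<and> \<xi>2 \<le> pi}"
  have caps: "caps e (cos \<xi>1) (cos \<xi>2)" if "(\<xi>1, \<xi>2) \<in> ?D" for \<xi>1 \<xi>2
    using that assms e cos_monotone_0_pi[of \<xi>1 \<xi>2] by unfold_locales auto
  have "\<forall>\<xi>\<in>?D. \<exists>c R \<mu>. two_caps e (cos (fst \<xi>)) (cos (snd \<xi>)) c R \<mu>"
    using caps.two_caps_exists[OF caps] by auto
  from bchoice[OF this] obtain c where "\<forall>\<xi>\<in>?D. \<exists>R \<mu>. two_caps e (cos (fst \<xi>)) (cos (snd \<xi>)) (c \<xi>) R \<mu>" ..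
  from bchoice[OF this] obtain R where "\<forall>\<xi>\<in>?D. \<exists>\<mu>. two_caps e (cos (fst \<xi>)) (cos (snd \<xi>)) (c \<xi>) (R \<xi>) \<mu>" ..
  from bchoice[OF this] obtain \<mu> where "\<forall>\<xi>\<in>?D. two_caps e (cos (fst \<xi>)) (cos (snd \<xi>)) (c \<xi>) (R \<xi>) (\<mu> \<xi>)" ..
  then have tc: "two_caps e (cos (fst \<xi>)) (cos (snd \<xi>)) (c \<xi>) (R \<xi>) (\<mu> \<xi>)" if "\<xi> \<in> ?D" for \<xi>
    using that by (rule bspec)
  \<comment> \<open>The data were chosen once for each pair in \<open>?D\<close>, so this is a
    function of the angles. Before normalisation the level on the second cap is 1, which becomes 1 /
    \<open>mass\<close>.\<close>
  define \<Phi> where "\<Phi> \<xi> = (1 / two_caps.mass e (c \<xi>) (\<mu> \<xi>), two_caps.top_value e (c \<xi>) (R \<xi>) (\<mu> \<xi>))" for \<xi>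
  show ?thesis
  proof (intro exI[of _ \<Phi>] conjI allI impI)
    show "inj_on \<Phi> ?D"
    proof (rule inj_onI)
      fix \<xi> \<eta> assume D: "\<xi> \<in> ?D" "\<eta> \<in> ?D" and eq: "\<Phi> \<xi> = \<Phi> \<eta>"
      have "cos (fst \<xi>) = cos (fst \<eta>)" "cos (snd \<xi>) = cos (snd \<eta>)"
        using two_caps_unique[OF tc[OF D(1)] tc[OF D(2)]] eq by (simp_all add: \<Phi>_def)
      then have "fst \<xi> = fst \<eta>" "snd \<xi> = snd \<eta>" using D by (auto intro: cos_inj_pi)
      then show "\<xi> = \<eta>" by (rule prod_eqI)
    qed
    show "\<Phi> ` ?D \<subseteq> {(d, M). 2 powr (2 - real CARD('n)) \<le> d \<and> d < 1 \<and> 1 < M \<and> M \<le> \<infinity>}"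
    proof (rule image_subsetI)
      fix \<xi> assume "\<xi> \<in> ?D"
      then interpret two_caps e "cos (fst \<xi>)" "cos (snd \<xi>)" "c \<xi>" "R \<xi>" "\<mu> \<xi>" by (rule tc)
      have "2 powr (2 - real CARD('n)) = (1/2) ^ (CARD('n) - 2)"
      proof -
        have "2 - real CARD('n) = - real (CARD('n) - 2)" using assms by (simp add: of_nat_diff)
        then have "2 powr (2 - real CARD('n)) = inverse (2 ^ (CARD('n) - 2))" by (simp only: powr_minus powr_realpow zero_less_numeral)
        then show ?thesis by (simp add: power_one_over inverse_eq_divide)
      qed
      then have "2 powr (2 - real CARD('n)) \<le> 1 / mass"
        using mass_bound mass_gt_1 by (simp only: pos_le_divide_eq)
      moreover have "1 / mass < 1" using mass_gt_1 by simp
      moreover have "1 < top_value"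
      proof (cases "0 < c \<xi>")
        case False
        then have "mass < R \<xi>" using c by (intro mass_lt_R) simp
        then have "1 < R \<xi> / mass" using mass_gt_1 by simp
        then show ?thesis using False by (simp add: top_value_def)
      qed (simp add: top_value_def)
      ultimately show "\<Phi> \<xi> \<in> {(d, M). 2 powr (2 - real CARD('n)) \<le> d \<and> d < 1 \<and> 1 < M \<and> M \<le> \<infinity>}"
        by (simp add: \<Phi>_def)
    qed
  next
    fix \<xi>1 \<xi>2 d M assume a: "0 \<le> \<xi>1 \<and> \<xi>1 < \<xi>2 \<and> \<xi>2 \<le> pi \<and> \<Phi> (\<xi>1, \<xi>2) = (d, M)"
    let ?x = "(\<xi>1, \<xi>2)"
    have "?x \<in> ?D" using a by simp
    then interpret two_caps e "cos \<xi>1" "cos \<xi>2" "c ?x" "R ?x" "\<mu> ?x" using tc[of ?x] by simp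
    have dM: "d = 1 / mass" "M = top_value" using a by (auto simp: \<Phi>_def)
    have Un: "cap1 k \<xi>1 \<union> cap2 k \<xi>2 = Caps"
      using coord by (auto simp: cap1_def cap2_def Caps_def xe)
    obtain P where P: "P \<in> sphere_potentials" "\<And>x. P x = Pot x / ennreal mass"
      using normalised_potential by blast
    have m: "0 < mass" using mass_gt_1 by simp
    have dd: "1 / ennreal mass = ennreal d" unfolding dM using m by (simp add: divide_ennreal[of 1 mass, simplified])
    have divm: "a / ennreal mass \<le> b / ennreal mass" if "a \<le> b" for a b :: ennreal
      using that by (rule divide_right_mono_ennreal)
    have topM: "(if 0 < c ?x then \<infinity> else ennreal (R ?x)) / ennreal mass = M"
      unfolding dM top_value_def using m R by (auto simp: divide_ennreal ennreal_top_divide)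
    show "\<exists>P\<in>sphere_potentials. (\<forall>x\<in>cap1 k \<xi>1. P x = M) \<and> (\<forall>x\<in>cap2 k \<xi>2. P x = ennreal d) \<and>
        (\<forall>x\<in>cball 0 1. ennreal d \<le> P x) \<and> (\<forall>x. P x \<le> M) \<and> P 0 = 1 \<and>
        (\<forall>x\<in>- (cap1 k \<xi>1 \<union> cap2 k \<xi>2). P x < \<infinity>) \<and>
        harmonic_on (\<lambda>x. enn2real (P x)) (- (cap1 k \<xi>1 \<union> cap2 k \<xi>2))"
    proof (intro bexI[OF _ P(1)] conjI ballI allI)
      show "P x = M" if "x \<in> cap1 k \<xi>1" for x
        using Pot_high[of x] that by (simp add: cap1_def xe P topM)
      show "P x = ennreal d" if "x \<in> cap2 k \<xi>2" for x
        using Pot_low[of x] that by (simp add: cap2_def xe P dd)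
      show "ennreal d \<le> P x" if "x \<in> cball 0 1" for x
        unfolding P dd[symmetric] using that by (intro divm Pot_ge_1_ball) simp
      show "P x \<le> M" for x
      proof -
        have "Pot x \<le> (if 0 < c ?x then \<infinity> else ennreal (R ?x))"
          unfolding Pot_def using pot_le_R[of x] c by auto
        then show ?thesis unfolding P topM[symmetric] by (rule divm)
      qed
      show "P 0 = 1" unfolding P Pot_0 using m by (simp add: ennreal_divide_self)
      show "P x < \<infinity>" if "x \<in> - (cap1 k \<xi>1 \<union> cap2 k \<xi>2)" for x
        using Pot_finite[of x] that m unfolding P Un by (simp add: ennreal_divide_eq_top_iff less_top[symmetric])
      show "harmonic_on (\<lambda>x. enn2real (P x)) (- (cap1 k \<xi>1 \<union> cap2 k \<xi>2))"
        unfolding P Un by (rule harmonic_scaled)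
    qed
  qed
qed

end
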